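(* Let $g\ge 3$ and $0<\eta<\theta<\pi/g$. Then the Riemann surface $S_{\eta,\theta}$ is not hyperelliptic. Consequently its canonical map $\phi_S:S\to\mathbf{CP}^{g-1}$, $z\mapsto[\omega_1(z):\dots:\omega_g(z)]$, is an embedding.
   Context: Fix $g\ge2$ and $0<\eta<\theta<\pi/g$. Let $\mathsf C_1$ be the circle orthogonal to the unit circle through $e^{i\eta}$ and $e^{i\theta}$; $\sigma_1(z)=\bar z$, $\sigma_3$ the inversion in $\mathsf C_1$, $r(z)=e^{2\pi i/g}z$, $f_k=r^k\sigma_1\sigma_3r^{-k}$ for $k=0,\dots,g-1$, $G=\langle f_0,\dots,f_{g-1}\rangle$ (a Schottky group pairing the circles $r^{k}(\mathsf C_1)$ and $r^k(\overline{\mathsf C_1})$), $\Omega$ its domain of discontinuity, and $S=S_{\eta,\theta}=\Omega/G$, a compact Riemann surface of genus $g$. $\omega_1,\dots,\omega_g$ denotes any basis of holomorphic differentials on $S$. A compact Riemann surface is hyperelliptic if it admits a degree-2 branched cover of $\mathbf{CP}^1$. *)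

theory Defs
  imports "HOL-Complex_Analysis.Complex_Analysis"
begin

type_synonym mat2 = "complex \<times> complex \<times> complex \<times> complex"

fun mmul :: "mat2 \<Rightarrow> mat2 \<Rightarrow> mat2" where
  "mmul (a,b,c,d) (a',b',c',d') = (a*a'+b*c', a*b'+b*d', c*a'+d*c', c*b'+d*d')"

text \<open>adjugate = inverse up to a scalar factor (same Moebius map)\<close>
fun madj :: "mat2 \<Rightarrow> mat2" where
  "madj (a,b,c,d) = (d, -b, -c, a)"

fun mden :: "mat2 \<Rightarrow> complex \<Rightarrow> complex" where
  "mden (a,b,c,d) z = c*z+d"

fun mapp :: "mat2 \<Rightarrow> complex \<Rightarrow> complex" where
  "mapp (a,b,c,d) z = (a*z+b)/(c*z+d)"

fun mderiv :: "mat2 \<Rightarrow> complex \<Rightarrow> complex" where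
  "mderiv (a,b,c,d) z = (a*d-b*c)/(c*z+d)^2"

text \<open>the Moebius map as a partial map on C (None = sent to infinity); independent of scalar\<close>
definition mob :: "mat2 \<Rightarrow> complex \<Rightarrow> complex option" where
  "mob M z = (if mden M z = 0 then None else Some (mapp M z))"

text \<open>C_1: circle orthogonal to the unit circle through e^{i eta}, e^{i theta}:
  centre e^{i(eta+theta)/2}/cos((theta-eta)/2), radius tan((theta-eta)/2).\<close>
definition C1_centre :: "real \<Rightarrow> real \<Rightarrow> complex" where
  "C1_centre \<eta> \<theta> = cis ((\<eta>+\<theta>)/2) / complex_of_real (cos ((\<theta>-\<eta>)/2))"

definition C1_radius :: "real \<Rightarrow> real \<Rightarrow> real" where
  "C1_radius \<eta> \<theta> = tan ((\<theta>-\<eta>)/2)"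

text \<open>sigma_3(z) = c + rho^2 / conj(z - c) (inversion in C_1), sigma_1 = conj, so
  f_0 = sigma_1 sigma_3 : z |-> conj c + rho^2/(z - c) = (conj c z + (rho^2 - |c|^2))/(z - c).\<close>
definition f0_mat :: "real \<Rightarrow> real \<Rightarrow> mat2" where
  "f0_mat \<eta> \<theta> = (let c = C1_centre \<eta> \<theta>; \<rho> = complex_of_real (C1_radius \<eta> \<theta>)
     in (cnj c, \<rho>^2 - cnj c * c, 1, - c))"

definition rot_mat :: "nat \<Rightarrow> int \<Rightarrow> mat2" where
  "rot_mat g k = (cis (2 * pi * real_of_int k / real g), 0, 0, 1)"

definition gen_mat :: "nat \<Rightarrow> real \<Rightarrow> real \<Rightarrow> nat \<Rightarrow> mat2" where
  "gen_mat g \<eta> \<theta> k = mmul (rot_mat g (int k)) (mmul (f0_mat \<eta> \<theta>) (rot_mat g (- int k)))"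

inductive_set schottky_group :: "nat \<Rightarrow> real \<Rightarrow> real \<Rightarrow> mat2 set" for g \<eta> \<theta> where
  one: "(1,0,0,1) \<in> schottky_group g \<eta> \<theta>"
| gen: "\<gamma> \<in> schottky_group g \<eta> \<theta> \<Longrightarrow> k < g \<Longrightarrow> mmul (gen_mat g \<eta> \<theta> k) \<gamma> \<in> schottky_group g \<eta> \<theta>"
| geninv: "\<gamma> \<in> schottky_group g \<eta> \<theta> \<Longrightarrow> k < g \<Longrightarrow> mmul (madj (gen_mat g \<eta> \<theta> k)) \<gamma> \<in> schottky_group g \<eta> \<theta>"

text \<open>Finite part of the domain of discontinuity Omega: points having a neighbourhood U
  with gamma(U) \<inter> U \<noteq> {} for only finitely many (distinct) transformations gamma in G.\<close>
definition disc_domain :: "mat2 set \<Rightarrow> complex set" where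
  "disc_domain G = {z. \<exists>e>0. finite (mob ` {\<gamma>\<in>G. \<exists>w\<in>ball z e. mden \<gamma> w \<noteq> 0 \<and> mapp \<gamma> w \<in> ball z e})}"

definition G_equiv :: "mat2 set \<Rightarrow> complex \<Rightarrow> complex \<Rightarrow> bool" where
  "G_equiv G z w \<longleftrightarrow> (\<exists>\<gamma>\<in>G. mden \<gamma> z \<noteq> 0 \<and> mapp \<gamma> z = w)"

text \<open>Meromorphic functions on S = G-invariant meromorphic functions on Omega \<inter> C
  (meromorphy at infinity follows from invariance since infinity is G-equivalent to a finite point).\<close>
definition invariant_meromorphic :: "mat2 set \<Rightarrow> (complex \<Rightarrow> complex) \<Rightarrow> bool" where
  "invariant_meromorphic G F \<longleftrightarrow> F meromorphic_on disc_domain G \<and>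
     (\<forall>\<gamma>\<in>G. \<forall>z\<in>disc_domain G. mden \<gamma> z \<noteq> 0 \<longrightarrow> (\<forall>\<^sub>F w in at z. F (mapp \<gamma> w) = F w))"

text \<open>degree of the induced map S -> CP^1: total pole order, summed over the poles on S
  (i.e. over G-orbits of poles in Omega)\<close>
definition merom_degree :: "mat2 set \<Rightarrow> (complex \<Rightarrow> complex) \<Rightarrow> nat" where
  "merom_degree G F =
     (let P = {p\<in>disc_domain G. is_pole F p}
      in \<Sum>Orb\<in>P // {(p,q). p\<in>P \<and> q\<in>P \<and> G_equiv G p q}. nat (- zorder F (SOME p. p\<in>Orb)))"

text \<open>S hyperelliptic: there is a degree-2 branched cover S -> CP^1, i.e. a meromorphic
  function of degree 2\<close>
definition hyperelliptic_quot :: "mat2 set \<Rightarrow> bool" where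
  "hyperelliptic_quot G \<longleftrightarrow> (\<exists>F. invariant_meromorphic G F \<and> merom_degree G F = 2)"

text \<open>holomorphic differentials h(z)dz on S: holomorphic h on Omega \<inter> C with
  h(gamma z) gamma'(z) = h(z) (holomorphy at infinity again follows from invariance)\<close>
definition hol_differential :: "mat2 set \<Rightarrow> (complex \<Rightarrow> complex) \<Rightarrow> bool" where
  "hol_differential G h \<longleftrightarrow> h holomorphic_on disc_domain G \<and>
     (\<forall>\<gamma>\<in>G. \<forall>z\<in>disc_domain G. mden \<gamma> z \<noteq> 0 \<longrightarrow> h (mapp \<gamma> z) * mderiv \<gamma> z = h z)"

definition hol_diff_basis :: "mat2 set \<Rightarrow> nat \<Rightarrow> (nat \<Rightarrow> complex \<Rightarrow> complex) \<Rightarrow> bool" where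
  "hol_diff_basis G n \<omega> \<longleftrightarrow>
     (\<forall>i<n. hol_differential G (\<omega> i)) \<and>
     (\<forall>a::nat\<Rightarrow>complex. (\<forall>z\<in>disc_domain G. (\<Sum>i<n. a i * \<omega> i z) = 0) \<longrightarrow> (\<forall>i<n. a i = 0)) \<and>
     (\<forall>h. hol_differential G h \<longrightarrow> (\<exists>a::nat\<Rightarrow>complex. \<forall>z\<in>disc_domain G. h z = (\<Sum>i<n. a i * \<omega> i z)))"

text \<open>The canonical map S -> CP^{n-1}, [z] |-> [omega_1(z):...:omega_n(z)], is an embedding:
  it is everywhere defined, injective on S, and an immersion (checked in an affine chart).
  For compact S an injective immersion is an embedding.\<close>
definition canonical_map_embedding :: "mat2 set \<Rightarrow> nat \<Rightarrow> (nat \<Rightarrow> complex \<Rightarrow> complex) \<Rightarrow> bool" where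
  "canonical_map_embedding G n \<omega> \<longleftrightarrow>
     (\<forall>z\<in>disc_domain G. \<exists>i<n. \<omega> i z \<noteq> 0) \<and>
     (\<forall>z\<in>disc_domain G. \<forall>w\<in>disc_domain G.
        (\<exists>t. \<forall>i<n. \<omega> i w = t * \<omega> i z) \<longrightarrow> G_equiv G z w) \<and>
     (\<forall>z\<in>disc_domain G. \<exists>j<n. \<omega> j z \<noteq> 0 \<and>
        (\<exists>i<n. deriv (\<lambda>w. \<omega> i w / \<omega> j w) z \<noteq> 0))"

end

theory Submission
  imports Defs
begin

text \<open>The group consists of matrices in \<open>SU(1,1)\<close>, and the images of an arc of the unit circle are disjoint,
  which makes Poincare series of weight two converge. The kernel \<open>K p z w\<close> obtained in this way is, as a
  function of \<open>z\<close>, an Abelian integral whose only pole is simple and lies at the orbit of \<open>p\<close>. Its additive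
  periods are holomorphic differentials as functions of \<open>p\<close>.

  The sum of the periods along the \<open>g\<close> generators is a nonzero differential that is invariant under rotation by
  \<open>2 * pi / g\<close>. It therefore vanishes to order at least \<open>g - 1\<close> at \<open>0\<close> and at \<open>\<infinity>\<close>, and these are all its
  \<open>2 * g - 2\<close> zeros. If \<open>F\<close> has degree two and a pole at \<open>0\<close> or \<open>\<infinity>\<close>, the residue theorem for the product of \<open>F\<close>
  and this differential shows that all poles of \<open>F\<close> lie in these two orbits. Rotating and inverting, one
  arrives at a function \<open>X\<close> with divisor \<open>n (0) - n (\<infinity>)\<close> and \<open>n \<le> 2\<close>. By reflection, \<open>X\<close> has constant modulus on the
  unit circle, and by the Schwarz lemma it winds in the positive direction there. The \<open>g\<close> arcs of the unit circle
  between adjacent paired circles become closed curves on the surface, so each of them covers the whole image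
  circle, and some value is attained at least three times, which is impossible.

  If all differentials vanish at a point, or take proportional values at two points, or have proportional values
  and derivatives at a point, then the same holds for the periods of the kernel. Hence a combination of \<open>K\<close> and its
  derivative in \<open>p\<close> is invariant, and it or its square has degree two.\<close>

section \<open>Matrices in \<open>SU(1,1)\<close> and the group\<close>

text \<open>Infinity belongs to the surface but is not a value of type \<open>complex\<close>. As
  \<open>lm (0,True)\<close> sends \<open>c\<close> to infinity, orders, poles and residues at
  infinity are all taken at \<open>c\<close>, and formulas that have to pass through infinity are
  kept in homogeneous form (\<open>num\<close>, \<open>den\<close>, \<open>D\<close>). Conjugation
  and the inversion in a circle orthogonal to the unit circle both preserve the unit disc, which is
  why \<open>SU(1,1)\<close> suffices. The group is then Fuchsian with free arcs on the circle; for
  a general Schottky group the series of weight two can diverge. In place of Riemann-Roch, degrees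
  are compared by the residue theorem on a fundamental domain. Its boundary circles depend on a
  parameter, so that they can be moved off the poles and zeros at hand. Genus two has to be
  excluded, since every surface of genus two is hyperelliptic. The bound \<open>g \<ge> 3\<close>
  enters decisively at two places: \<open>\<zeta>^2 \<noteq> 1\<close> when a function has poles at
  both \<open>0\<close> and infinity, and three arcs against a degree of at most two.\<close>

text \<open>A pair \<^term>\<open>(a, b)\<close> stands for the matrix with rows \<open>a, b\<close> and \<open>cnj b, cnj a\<close>.\<close>

type_synonym su = "complex \<times> complex"

fun pmul :: "su \<Rightarrow> su \<Rightarrow> su" where
  "pmul (a,b) (a',b') = (a*a' + b*cnj b', a*b' + b*cnj a')"

fun pinv :: "su \<Rightarrow> su" where
  "pinv (a,b) = (cnj a, -b)"

fun num :: "su \<Rightarrow> complex \<Rightarrow> complex" where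
  "num (a,b) z = a*z + b"

fun den :: "su \<Rightarrow> complex \<Rightarrow> complex" where
  "den (a,b) z = cnj b*z + cnj a"

definition act :: "su \<Rightarrow> complex \<Rightarrow> complex" where
  "act M z = num M z / den M z"

fun su11 :: "su \<Rightarrow> bool" where
  "su11 (a,b) \<longleftrightarrow> a * cnj a - b * cnj b = 1"

fun emb :: "su \<Rightarrow> mat2" where
  "emb (a,b) = (a, b, cnj b, cnj a)"

text \<open>The given group consists of matrices that are not normalised. Each is
  \<open>smat t (emb M)\<close> with \<open>M\<close> of determinant one; a nonzero scalar cancels
  in \<open>mapp\<close> and \<open>mderiv\<close>, keeps the zeros of \<open>mden\<close>, and is
  invisible to \<open>mob\<close>.\<close>

fun smat :: "complex \<Rightarrow> mat2 \<Rightarrow> mat2" where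
  "smat t (a,b,c,d) = (t*a, t*b, t*c, t*d)"

lemma pmul_assoc: "pmul (pmul A B) C = pmul A (pmul B C)"
  by (cases A; cases B; cases C) (simp add: algebra_simps)

lemma pmul_one [simp]: "pmul (1,0) M = M" "pmul M (1,0) = M"
  by (cases M; simp)+

lemma su11_pmul: "su11 M \<Longrightarrow> su11 N \<Longrightarrow> su11 (pmul M N)"
proof (cases M; cases N)
  fix a b a' b' assume "su11 M" "su11 N" and [simp]: "M = (a,b)" "N = (a',b')"
  hence "(a * cnj a - b * cnj b) * (a' * cnj a' - b' * cnj b') = 1" by simp
  thus ?thesis by (simp add: algebra_simps)
qed

lemma su11_pinv: "su11 M \<Longrightarrow> su11 (pinv M)"
  by (cases M) (simp add: algebra_simps)

lemma pinv_left: "su11 M \<Longrightarrow> pmul (pinv M) M = (1,0)"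
  by (cases M) (simp add: algebra_simps)

lemma pinv_right: "su11 M \<Longrightarrow> pmul M (pinv M) = (1,0)"
  by (cases M) (simp add: algebra_simps)

lemma pinv_pinv [simp]: "pinv (pinv M) = M"
  by (cases M) simp

text \<open>The action on homogeneous coordinates. In contrast to \<open>num_pmul\<close> and
  \<open>den_pmul\<close>, the intermediate image may be infinite, so a point can be followed
  through infinity.\<close>

lemma num_pmul': "num (pmul N M) z = fst N * num M z + snd N * den M z"
  by (cases M; cases N) (simp add: algebra_simps)

lemma den_pmul': "den (pmul N M) z = cnj (snd N) * num M z + cnj (fst N) * den M z"
  by (cases M; cases N) (simp add: algebra_simps)

lemma den_pmul: "den M z \<noteq> 0 \<Longrightarrow> den (pmul N M) z = den N (act M z) * den M z"
  by (cases M; cases N) (simp add: act_def field_simps)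

lemma num_pmul: "den M z \<noteq> 0 \<Longrightarrow> num (pmul N M) z = num N (act M z) * den M z"
  by (cases M; cases N) (simp add: act_def field_simps)

lemma act_pmul: "den M z \<noteq> 0 \<Longrightarrow> act (pmul N M) z = act N (act M z)"
  unfolding act_def[of "pmul N M"] act_def[of N] by (simp add: den_pmul num_pmul)

lemma act_one [simp]: "act (1,0) z = z" "den (1,0) z = 1"
  by (simp_all add: act_def)

lemma den_pinv_act:
  assumes "su11 M" "den M z \<noteq> 0"
  shows "den (pinv M) (act M z) = 1 / den M z"
proof -
  have "den (pmul (pinv M) M) z = den (pinv M) (act M z) * den M z"
    using assms by (simp add: den_pmul)
  thus ?thesis using assms pinv_left[of M] by (simp add: field_simps)
qed

lemma act_pinv_act:
  assumes "su11 M" "den M z \<noteq> 0"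
  shows "act (pinv M) (act M z) = z"
  using act_pmul[of M z "pinv M"] assms pinv_left[of M] by simp

lemma num_den_zero: 
  assumes "su11 M" "den M z = 0" shows "num M z \<noteq> 0"
proof (cases M)
  case (Pair a b)
  have *: "a * den M z - cnj b * num M z = 1"
    using assms(1) Pair by (simp add: algebra_simps)
  thus ?thesis using assms(2) by auto
qed

lemma act_deriv:
  assumes "su11 M" "den M z \<noteq> 0"
  shows "(act M has_field_derivative 1 / (den M z)^2) (at z)"
proof (cases M)
  case (Pair a b)
  have e: "a * cnj a - b * cnj b = 1" using assms Pair by simp
  have "((\<lambda>z. (a*z+b)/(cnj b*z+cnj a)) has_field_derivative 
      (a*(cnj b*z+cnj a) - (a*z+b)*cnj b)/((cnj b*z+cnj a)*(cnj b*z+cnj a))) (at z)"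
    using assms Pair by (auto intro!: derivative_eq_intros)
  moreover have "a*(cnj b*z+cnj a) - (a*z+b)*cnj b = 1" using e by (simp add: algebra_simps)
  moreover have "act M = (\<lambda>z. (a*z+b)/(cnj b*z+cnj a))" by (auto simp: act_def Pair)
  ultimately show ?thesis using Pair by (simp add: power2_eq_square)
qed

lemma su11_norm:
  assumes "su11 (a,b)" shows "(norm a)\<^sup>2 = 1 + (norm b)\<^sup>2"
proof -
  have "complex_of_real ((norm a)\<^sup>2) = of_real (1 + (norm b)\<^sup>2)"
    using assms unfolding of_real_add complex_norm_square by (simp add: algebra_simps)
  thus ?thesis using of_real_eq_iff by blast
qed

lemma num_cnj_den: "norm z = 1 \<Longrightarrow> norm (num M z) = norm (den M z)"
proof (cases M)
  case (Pair a b)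
  assume z: "norm z = 1"
  hence zz: "z * cnj z = 1" by (simp add: complex_norm_square[symmetric])
  have "norm (num M z) = norm (cnj (num M z)) " by (simp only: complex_mod_cnj)
  also have "\<dots> = norm z * norm (cnj (num M z))" using z by simp
  also have "\<dots> = norm (z * cnj (num M z))" by (simp add: norm_mult)
  also have "z * cnj (num M z) = den M z" using Pair zz by (simp add: algebra_simps)
  finally show ?thesis .
qed

text \<open>\<open>SU(1,1)\<close> preserves the Hermitian form \<open>|den|^2 - |num|^2\<close>.
  The invariance of the disc and of the circle and the absence of poles in the closed disc all come
  from this identity.\<close>

lemma norm_num_den:
  assumes "su11 M"
  shows "(norm (den M z))\<^sup>2 - (norm (num M z))\<^sup>2 = 1 - (norm z)\<^sup>2"
proof (cases M)
  case (Pair a b)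
  have e: "a * cnj a - b * cnj b = 1" using assms Pair by simp
  have "den M z * cnj (den M z) - num M z * cnj (num M z) = (a * cnj a - b * cnj b) * (1 - z * cnj z)"
    using Pair by (simp add: algebra_simps)
  hence "complex_of_real ((norm (den M z))\<^sup>2 - (norm (num M z))\<^sup>2) = of_real (1 - (norm z)\<^sup>2)"
    using e unfolding of_real_diff complex_norm_square by simp
  thus ?thesis using of_real_eq_iff by blast
qed

lemma den_nonzero: 
  assumes "su11 M" "norm z \<le> 1" shows "den M z \<noteq> 0"
proof
  assume d: "den M z = 0"
  have "num M z \<noteq> 0" using num_den_zero assms d by blast
  hence "(norm (num M z))\<^sup>2 > 0" by simp
  moreover have "(norm z)\<^sup>2 \<le> 1" using assms(2) by (simp add: power_le_one)
  moreover have "(norm (num M z))\<^sup>2 = (norm z)\<^sup>2 - 1" using norm_num_den[OF assms(1), of z] d by simp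
  ultimately show False by linarith
qed

lemma act_unit:
  assumes "su11 M" "norm z = 1" shows "norm (act M z) = 1"
  using num_cnj_den[OF assms(2), of M] den_nonzero[OF assms(1), of z] assms(2)
  by (simp add: act_def norm_divide)

lemma act_disc:
  assumes "su11 M" "norm z < 1" shows "norm (act M z) < 1"
proof -
  have d: "den M z \<noteq> 0" using den_nonzero assms by auto
  have "(norm z)\<^sup>2 < 1" using assms(2) by (simp add: power_less_one_iff abs_square_less_1)
  hence "(norm (num M z))\<^sup>2 < (norm (den M z))\<^sup>2" using norm_num_den[OF assms(1), of z] by simp
  hence "norm (num M z) < norm (den M z)" using power_less_imp_less_base norm_ge_zero by blast
  thus ?thesis using d by (simp add: act_def norm_divide)
qed

text \<open>The symmetric formula behind the invariance of cross ratios: each of the two points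
  contributes one factor \<open>den\<close>.\<close>

lemma act_diff:
  assumes "su11 M" "den M z \<noteq> 0" "den M w \<noteq> 0"
  shows "act M z - act M w = (z - w) / (den M z * den M w)"
proof (cases M)
  case (Pair a b)
  have e: "a * cnj a - b * cnj b = 1" using assms Pair by simp
  have "num M z * den M w - num M w * den M z = (a * cnj a - b * cnj b) * (z - w)"
    using Pair by (simp add: algebra_simps)
  thus ?thesis using e assms by (simp add: act_def divide_simps)
qed

lemma smat_mmul: "mmul (smat s A) (smat t B) = smat (s*t) (mmul A B)"
  by (cases A; cases B) (simp add: algebra_simps)

lemma emb_pmul: "emb (pmul A B) = mmul (emb A) (emb B)"
  by (cases A; cases B) (simp add: algebra_simps)

lemma mden_smat_emb: "mden (smat t (emb M)) z = t * den M z"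
  by (cases M) (simp add: algebra_simps)

lemma mapp_smat_emb: "t \<noteq> 0 \<Longrightarrow> mapp (smat t (emb M)) z = act M z"
  by (cases M) (auto simp: act_def divide_simps ring_distribs[symmetric] mult.assoc; simp add: algebra_simps)

lemma mderiv_smat_emb: "t \<noteq> 0 \<Longrightarrow> su11 M \<Longrightarrow> mderiv (smat t (emb M)) z = 1/(den M z)^2"
proof (cases M)
  case (Pair a b)
  assume "t \<noteq> 0" "su11 M"
  hence e: "a * cnj a - b * cnj b = 1" using Pair by simp
  have "t*a*(t*cnj a) - t*b*(t*cnj b) = t^2 * (a * cnj a - b * cnj b)" 
    by (simp add: algebra_simps power2_eq_square)
  moreover have "t * cnj b * z + t * cnj a = t * den M z" using Pair by (simp add: algebra_simps)
  ultimately show ?thesis using Pair e \<open>t \<noteq> 0\<close> by (simp add: power_mult_distrib)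
qed

lemma mob_smat_emb: "t \<noteq> 0 \<Longrightarrow> mob (smat t (emb M)) z = (if den M z = 0 then None else Some (act M z))"
  unfolding mob_def by (simp add: mden_smat_emb mapp_smat_emb)

lemma abs_sin_gt:
  assumes "0 < d" "d < pi/2" "d < \<bar>x\<bar>" "\<bar>x\<bar> < pi - d"
  shows "\<bar>sin x\<bar> > sin (d::real)"
proof -
  have "sin \<bar>x\<bar> > sin d"
  proof (cases "\<bar>x\<bar> \<le> pi/2")
    case True thus ?thesis using assms by (intro sin_monotone_2pi) auto
  next
    case False
    have "sin (pi - \<bar>x\<bar>) > sin d" using False assms by (intro sin_monotone_2pi) auto
    thus ?thesis by simp
  qed
  moreover have "sin \<bar>x\<bar> \<le> \<bar>sin x\<bar>" by (simp add: abs_if)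
  ultimately show ?thesis by linarith
qed

lemma norm_cis_diff: "norm (cis x - cis y) = 2 * \<bar>sin ((x-y)/2)\<bar>"
proof -
  have "(norm (cis x - cis y))\<^sup>2 = (cos x - cos y)\<^sup>2 + (sin x - sin y)\<^sup>2"
    by (simp add: cmod_power2)
  also have "\<dots> = 2 - 2 * cos (x - y)" 
    using sin_cos_squared_add[of x] sin_cos_squared_add[of y]
    unfolding cos_diff power2_diff by (simp add: algebra_simps)
  also have "cos (x-y) = 1 - 2 * (sin ((x-y)/2))\<^sup>2"
  proof -
    have "x - y = 2 * ((x-y)/2)" by simp
    thus ?thesis using cos_double_sin[of "(x-y)/2"] by metis
  qed
  finally have "(norm (cis x - cis y))\<^sup>2 = (2 * \<bar>sin ((x-y)/2)\<bar>)\<^sup>2" 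
    by (simp add: power_mult_distrib)
  thus ?thesis by (subst (asm) power2_eq_iff_nonneg) auto
qed

section \<open>The generators, their circles and the fundamental domains\<close>

type_synonym letter = "nat \<times> bool"

fun linv :: "letter \<Rightarrow> letter" where "linv (k,b) = (k, \<not> b)"

lemma linv_linv [simp]: "linv (linv l) = l" by (cases l) simp

locale schottky_curve =
  fixes g :: nat and \<eta> \<theta> :: real
  assumes g_ge: "g \<ge> 3" and eta_pos: "0 < \<eta>" and eta_less: "\<eta> < \<theta>" and theta_less: "\<theta> < pi / real g"
begin

text \<open>\<open>\<mu>\<close> is the argument of the centre \<open>c\<close>, and
  \<open>2 * \<delta>\<close> is the length of the arc of the unit circle inside \<open>C_1\<close>;
  thus \<open>c = cis \<mu> / cos \<delta>\<close> and \<open>\<rho> = tan \<delta>\<close>.\<close>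

definition \<delta> where "\<delta> = (\<theta> - \<eta>)/2"
definition \<mu> where "\<mu> = (\<eta> + \<theta>)/2"
definition \<zeta> where "\<zeta> = cis (2*pi/real g)"
definition c where "c = C1_centre \<eta> \<theta>"
definition \<rho> where "\<rho> = C1_radius \<eta> \<theta>"

definition Ls :: "letter set" where "Ls = {..<g} \<times> UNIV"

lemma in_Ls [simp]: "(k,b) \<in> Ls \<longleftrightarrow> k < g"
  by (simp add: Ls_def)

lemma finite_Ls [simp]: "finite Ls" by (simp add: Ls_def)

fun cen :: "letter \<Rightarrow> complex" where
  "cen (k,b) = \<zeta>^k * (if b then c else cnj c)"

text \<open>\<open>lm (k,True)\<close> is the generator \<open>f\<^sub>k\<close>, normalised to determinant one, \<open>lm (k,False)\<close> is its inverse, and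
  \<open>cen l\<close> is the point that \<open>lm l\<close> sends to infinity.\<close>

fun lm :: "letter \<Rightarrow> su" where
  "lm (k,True) = (-\<i> * cnj c / of_real \<rho>, \<i> * \<zeta>^k / of_real \<rho>)"
| "lm (k,False) = (\<i> * c / of_real \<rho>, -\<i> * \<zeta>^k / of_real \<rho>)"

text \<open>For every \<open>s\<close>, \<open>lm l\<close> maps the circle of radius \<open>rad s l\<close> about \<open>cen l\<close> to the corresponding one for the inverse
  letter; varying \<open>s\<close> moves the boundary of the fundamental domain.\<close>

fun rad :: "real \<Rightarrow> letter \<Rightarrow> real" where
  "rad s (k,b) = (if b then s * \<rho> else \<rho> / s)"

text \<open>The open and the closed fundamental domain with boundary parameter \<open>s\<close>,
  without the point at infinity.\<close>

definition outside where "outside s = {z. \<forall>l\<in>Ls. rad s l < norm (z - cen l)}"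
definition coutside where "coutside s = {z. \<forall>l\<in>Ls. rad s l \<le> norm (z - cen l)}"

inductive_set GG :: "su set" where
  one: "(1,0) \<in> GG"
| step: "M \<in> GG \<Longrightarrow> l \<in> Ls \<Longrightarrow> pmul (lm l) M \<in> GG"

lemma g_pos: "real g > 0" "g > 0" using g_ge by auto

lemma theta_lt: "\<theta> < pi/3" 
proof -
  have "pi / real g \<le> pi/3" using g_ge by (intro divide_left_mono) auto
  thus ?thesis using theta_less by linarith
qed

lemma delta: "0 < \<delta>" "\<delta> < pi/2" "\<delta> < \<mu>" "\<mu> + \<delta> = \<theta>" "\<mu> - \<delta> = \<eta>" "\<mu> < pi/3"
  using eta_pos eta_less theta_lt pi_gt_zero unfolding \<delta>_def \<mu>_def by (simp_all add: field_simps)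

lemma cos_delta: "cos \<delta> > 0" "sin \<delta> > 0" "cos \<delta> < 1"
proof -
  show "cos \<delta> > 0" using delta by (intro cos_gt_zero) auto
  show "sin \<delta> > 0" using delta by (intro sin_gt_zero) auto
  show "cos \<delta> < 1" using cos_monotone_0_pi[of 0 \<delta>] delta by simp
qed

lemma c_eq: "c = cis \<mu> / of_real (cos \<delta>)"
  by (simp add: c_def C1_centre_def \<mu>_def \<delta>_def)

lemma rho_eq: "\<rho> = sin \<delta> / cos \<delta>"
  by (simp add: \<rho>_def C1_radius_def \<delta>_def tan_def)

lemma rho_pos: "\<rho> > 0" using cos_delta by (simp add: rho_eq)

lemma norm_c: "norm c = 1 / cos \<delta>"
  using cos_delta by (simp add: c_eq norm_divide)

text \<open>This is the orthogonality of \<open>C_1\<close> to the unit circle. Through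
  \<open>c_cnj\<close> it gives the letters determinant one.\<close>

lemma c_rho: "(norm c)\<^sup>2 = 1 + \<rho>\<^sup>2"
  using cos_delta sin_cos_squared_add2[of \<delta>] by (simp add: norm_c rho_eq field_simps)

lemma c_cnj: "c * cnj c = 1 + of_real (\<rho>\<^sup>2)"
  using c_rho complex_norm_square[of c] by (metis of_real_1 of_real_add)

lemma zeta_norm [simp]: "norm \<zeta> = 1" "\<zeta> \<noteq> 0" "norm (\<zeta>^k) = 1"
  by (auto simp: \<zeta>_def norm_power)

lemma zeta_cnj: "\<zeta>^k * cnj (\<zeta>^k) = 1"
  using complex_norm_square[of "\<zeta>^k"] by simp

lemma zeta_power: "\<zeta>^k = cis (2*pi*k/g)"
  unfolding \<zeta>_def Complex.DeMoivre by (simp only: times_divide_eq_right mult_ac)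

lemma zeta_g: "\<zeta>^g = 1"
  using g_pos by (simp add: zeta_power)

lemma zeta_power_eq_1_iff: "\<zeta>^k = 1 \<longleftrightarrow> g dvd k"
proof
  assume "\<zeta>^k = 1"
  hence "cos (2*pi*k/g) = 1" by (simp add: zeta_power complex_eq_iff)
  then obtain n::int where n: "2*pi*real k/real g = of_int n * 2 * pi" using cos_one_2pi_int by blast
  hence "real k = of_int n * real g" using g_pos by (simp add: field_simps)
  hence "int k = n * int g" by (metis of_int_eq_iff of_int_mult of_int_of_nat_eq)
  thus "g dvd k" by (metis dvd_triv_right int_dvd_int_iff)
next
  assume "g dvd k" thus "\<zeta>^k = 1" using zeta_g by (auto simp: power_mult)
qed

lemma lm_su: "su11 (lm l)"
proof (cases l)
  case (Pair k b)
  have z: "\<zeta>^k * cnj (\<zeta>^k) = 1" by (rule zeta_cnj)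
  have r: "of_real (\<rho>\<^sup>2) \<noteq> (0::complex)" using rho_pos by simp
  show ?thesis
  proof (cases b)
    case True
    have "(-\<i> * cnj c / of_real \<rho>) * cnj (-\<i> * cnj c / of_real \<rho>) - 
       (\<i> * \<zeta>^k / of_real \<rho>) * cnj (\<i> * \<zeta>^k / of_real \<rho>) = (c * cnj c - \<zeta>^k * cnj (\<zeta>^k)) / of_real (\<rho>\<^sup>2)"
      using rho_pos by (simp add: field_simps power2_eq_square)
    thus ?thesis using Pair True r unfolding z c_cnj by simp
  next
    case False
    have "(\<i> * c / of_real \<rho>) * cnj (\<i> * c / of_real \<rho>) - 
       (- \<i> * \<zeta>^k / of_real \<rho>) * cnj (- \<i> * \<zeta>^k / of_real \<rho>) = (c * cnj c - \<zeta>^k * cnj (\<zeta>^k)) / of_real (\<rho>\<^sup>2)"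
      using rho_pos by (simp add: field_simps power2_eq_square)
    thus ?thesis using Pair False r unfolding z c_cnj by simp
  qed
qed

lemma lm_linv: "lm (linv l) = pinv (lm l)"
  by (cases l; cases "snd l") auto

lemma linv_in: "l \<in> Ls \<Longrightarrow> linv l \<in> Ls" by (cases l) auto

lemma den_lm: "den (lm (k,b)) z = (if b then -1 else 1) * \<i> * cnj (\<zeta>^k) / of_real \<rho> * (z - cen (k,b))"
proof -
  have z: "cnj (\<zeta>^k) * \<zeta>^k = 1" using zeta_cnj[of k] by (simp add: mult.commute)
  have *: "cnj (\<zeta>^k) * (z - \<zeta>^k * w) = cnj (\<zeta>^k) * z - w" for w
    unfolding right_diff_distrib mult.assoc[symmetric] z by simp
  have **: "x * \<i> * cnj (\<zeta>^k) / of_real \<rho> * (z - \<zeta>^k * w) = x * \<i> / of_real \<rho> * (cnj (\<zeta>^k) * z - w)" for w x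
    unfolding *[symmetric] by simp
  show ?thesis
    using rho_pos
    by (cases b) (simp_all only: cen.simps if_True if_False ** lm.simps den.simps, simp_all add: field_simps)
qed

lemma den_lm_eq_0_iff: "den (lm l) z = 0 \<longleftrightarrow> z = cen l"
  using rho_pos by (cases l) (auto simp add: den_lm simp del: cen.simps)

text \<open>Measured from its pole \<open>cen l\<close> and from the image
  \<open>cen (linv l)\<close> of infinity, a generator is a constant divided by the variable. Hence
  circles about \<open>cen l\<close> go to circles about \<open>cen (linv l)\<close>.\<close>

lemma act_lm:
  assumes "z \<noteq> cen (k,b)"
  shows "act (lm (k,b)) z = cen (linv (k,b)) + \<zeta>^(2*k) * of_real (\<rho>\<^sup>2) / (z - cen (k,b))"
proof -
  define u where "u = \<zeta>^k"
  have u: "u * cnj u = 1" unfolding u_def by (rule zeta_cnj)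
  have uz: "\<zeta>^(2*k) = u^2" unfolding u_def by (simp add: power_mult mult.commute)
  have r: "of_real \<rho> \<noteq> (0::complex)" using rho_pos by simp
  have cc: "of_real \<rho> * of_real \<rho> = c * cnj c - 1" using c_cnj by (simp add: power2_eq_square)
  have d: "den (lm (k,b)) z \<noteq> 0" using assms by (simp add: den_lm_eq_0_iff)
  have nz: "z - cen (k,b) \<noteq> 0" using assms by simp
  have eq: "\<i> / of_real \<rho> * P * Q = X * (-\<i> / of_real \<rho> * Y)" 
    "-\<i> / of_real \<rho> * P * Q = X * (\<i> / of_real \<rho> * Y)" if "P * Q = - X * Y" for P Q X Y
  proof -
    have "\<i> / of_real \<rho> * P * Q = \<i> / of_real \<rho> * (- X * Y)"  by (simp only: mult.assoc that)
    thus "\<i> / of_real \<rho> * P * Q = X * (-\<i> / of_real \<rho> * Y)" by (simp add: mult_ac)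
    have "-\<i> / of_real \<rho> * P * Q = -\<i> / of_real \<rho> * (- X * Y)"  by (simp only: mult.assoc that)
    thus "-\<i> / of_real \<rho> * P * Q = X * (\<i> / of_real \<rho> * Y)" by (simp add: mult_ac)
  qed
  have cr: "complex_of_real (\<rho>\<^sup>2) = c * cnj c - 1" using c_cnj by simp
  have "num (lm (k,b)) z * (z - cen (k,b)) = (cen (linv (k,b)) * (z - cen (k,b)) + u^2 * of_real (\<rho>\<^sup>2)) * den (lm (k,b)) z"
  proof (cases b)
    case True
    have 1: "den (lm (k,b)) z = -\<i> / of_real \<rho> * (cnj u * z - c)" using True r by (simp add: u_def field_simps)
    have 2: "num (lm (k,b)) z = \<i> / of_real \<rho> * (u - cnj c * z)" using True r by (simp add: u_def field_simps)
    have "(u - cnj c * z) * (z - u*c) = - (u * cnj c * (z - u*c) + u^2 * (c * cnj c - 1)) * (cnj u * z - c)"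
      using u by algebra
    from eq(1)[OF this] show ?thesis using True unfolding 1 2 cr by (simp add: u_def[symmetric])
  next
    case False
    have 1: "den (lm (k,b)) z = \<i> / of_real \<rho> * (cnj u * z - cnj c)" using False r by (simp add: u_def field_simps)
    have 2: "num (lm (k,b)) z = -\<i> / of_real \<rho> * (u - c * z)" using False r by (simp add: u_def field_simps)
    have "(u - c * z) * (z - u*cnj c) = - (u * c * (z - u*cnj c) + u^2 * (c * cnj c - 1)) * (cnj u * z - cnj c)"
      using u by algebra
    from eq(2)[OF this] show ?thesis using False unfolding 1 2 cr by (simp add: u_def[symmetric])
  qed
  thus ?thesis using d nz unfolding act_def uz by (simp add: divide_simps del: cen.simps lm.simps) 
qed

lemma dist_act_lm:
  assumes "z \<noteq> cen l"
  shows "norm (act (lm l) z - cen (linv l)) = \<rho>\<^sup>2 / norm (z - cen l)"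
  using act_lm[of z "fst l" "snd l"] assms
  by (simp add: norm_divide norm_mult norm_power del: cen.simps linv.simps)

lemma cen_cis: "cen (k,b) = cis (2*pi*k/g + (if b then \<mu> else -\<mu>)) / of_real (cos \<delta>)"
proof -
  have 1: "cnj c = cis (-\<mu>) / of_real (cos \<delta>)" by (simp add: c_eq cis_cnj)
  show ?thesis by (cases b) (simp_all only: cen.simps if_True if_False 1, 
    simp_all only: zeta_power c_eq times_divide_eq_right cis_mult)
qed

text \<open>All centres have modulus \<open>1 / cos \<delta>\<close>, and two of them are seen from
  the origin under the angle \<open>2 * x\<close> with \<open>x = pi * m / g + e\<close>, where
  \<open>m\<close> is the difference of the indices and \<open>e\<close> is \<open>0\<close>,
  \<open>\<mu>\<close> or \<open>-\<mu>\<close>. As \<open>0 < \<delta> < \<mu>\<close> and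
  \<open>\<mu> + \<delta> = \<theta> < pi / g\<close>, the number \<open>x\<close> is more than
  \<open>\<delta>\<close> away from \<open>0\<close>, \<open>pi\<close> and
  \<open>-pi\<close>.\<close>

lemma cen_dist:
  assumes "l \<in> Ls" "l' \<in> Ls" "l \<noteq> l'"
  shows "2*\<rho> < norm (cen l - cen l')"
proof -
  obtain k b where l: "l = (k,b)" by (cases l)
  obtain k' b' where l': "l' = (k',b')" by (cases l')
  have kg: "k < g" "k' < g" using assms l l' by auto
  define m where "m = real k - real k'"
  define e where "e = (if b = b' then 0 else if b then \<mu> else -\<mu>)"
  define x where "x = pi*m/g + e"
  have xe: "((2*pi*k/g + (if b then \<mu> else -\<mu>)) - (2*pi*k'/g + (if b' then \<mu> else -\<mu>)))/2 = x"
    unfolding x_def e_def m_def by (auto simp: add_divide_distrib diff_divide_distrib right_diff_distrib)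
  have m: "m = 0 \<or> (1 \<le> m \<and> m \<le> real g - 1) \<or> (m \<le> -1 \<and> m \<ge> 1 - real g)"
    unfolding m_def using kg by (simp add: algebra_simps) linarith
  have pm: "pi/g \<le> pi*m/g \<and> pi*m/g \<le> pi - pi/g" if "1 \<le> m" "m \<le> real g - 1"
  proof -
    have "pi * 1 \<le> pi*m" "pi*m \<le> pi * (real g - 1)" using that by (intro mult_left_mono; simp)+
    hence "pi*1/g \<le> pi*m/g" "pi*m/g \<le> pi*(real g - 1)/g" using g_pos by (simp_all add: divide_right_mono)
    thus ?thesis using g_pos by (simp add: field_simps)
  qed
  have pm': "pi*m/g \<le> -(pi/g) \<and> -(pi - pi/g) \<le> pi*m/g" if "m \<le> -1" "m \<ge> 1 - real g"
  proof -
    have "pi * m \<le> pi*(-1)" "pi*(1 - real g) \<le> pi * m" using that by (intro mult_left_mono; simp)+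
    hence "pi*m/g \<le> pi*(-1)/g" "pi*(1 - real g)/g \<le> pi*m/g" using g_pos by (intro divide_right_mono; simp)+
    thus ?thesis using g_pos by (simp add: field_simps)
  qed
  have tp: "\<mu> + \<delta> < pi/g" "0 < \<delta>" "\<delta> < \<mu>" using delta theta_less by auto
  have pg: "pi/g \<le> pi/3" using g_ge by (intro divide_left_mono) auto
  have m0: "e \<noteq> 0" if "m = 0" using that assms(3) l l' tp unfolding m_def e_def by auto
  have ee: "e = 0 \<or> e = \<mu> \<or> e = -\<mu>" unfolding e_def by auto
  have "\<delta> < \<bar>x\<bar> \<and> \<bar>x\<bar> < pi - \<delta>"
    using m
  proof (elim disjE conjE)
    assume "m = 0" 
    hence "x = e" "e = \<mu> \<or> e = -\<mu>" using m0 ee unfolding x_def by auto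
    moreover have "\<mu> + \<delta> < pi" using tp pg pi_gt_zero by linarith
    ultimately show ?thesis using tp by (auto simp: abs_if)
  next
    assume "1 \<le> m" "m \<le> real g - 1"
    thus ?thesis using pm ee tp pg unfolding x_def by (smt (verit))
  next
    assume "m \<le> -1" "1 - real g \<le> m"
    thus ?thesis using pm' ee tp pg unfolding x_def by (smt (verit))
  qed
  hence s: "sin \<delta> < \<bar>sin x\<bar>" using abs_sin_gt delta by blast
  have "norm (cen l - cen l') = 2 * \<bar>sin x\<bar> / cos \<delta>"
    unfolding l l' cen_cis diff_divide_distrib[symmetric] norm_divide norm_cis_diff xe using cos_delta by simp
  also have "\<dots> > 2 * sin \<delta> / cos \<delta>" using s cos_delta by (intro divide_strict_right_mono) auto
  finally show ?thesis by (simp add: rho_eq)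
qed


text \<open>Finitely many strict inequalities leave a common margin. It is the room in which the
  boundary circles are later moved off given poles and zeros.\<close>

lemma ex_s1: "\<exists>s1>1. \<forall>l\<in>Ls. \<forall>l'\<in>Ls. l \<noteq> l' \<longrightarrow> 2 * s1 * \<rho> < norm (cen l - cen l')"
proof -
  define T where "T = {x\<in>Ls\<times>Ls. fst x \<noteq> snd x}"
  define f where "f = (\<lambda>x. norm (cen (fst x) - cen (snd x)))"
  have fin: "finite (f ` T)" unfolding T_def by auto
  have mem: "((0,True),(0,False)) \<in> T" using g_pos unfolding T_def by auto
  hence ne: "f ` T \<noteq> {}" by blast
  define m where "m = Min (f ` T)"
  have "m \<in> f ` T" unfolding m_def using fin ne by (rule Min_in)
  then obtain x where x: "x \<in> T" "m = f x" by blast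
  have m: "m > 2*\<rho>" using x(1) cen_dist[of "fst x" "snd x"] unfolding T_def x(2) f_def mem_Collect_eq mem_Times_iff by blast
  define s1 where "s1 = (m/(2*\<rho>) + 1)/2"
  have 1: "m/(2*\<rho>) > 1" using m rho_pos by simp
  define q where "q = m/(2*\<rho>)"
  have s1: "s1 > 1" "s1 < m/(2*\<rho>)" using 1 unfolding s1_def q_def[symmetric] by simp_all
  have s1m: "2 * s1 * \<rho> < m" using s1(2) rho_pos by (simp add: pos_less_divide_eq mult_ac)
  have "2 * s1 * \<rho> < norm (cen l - cen l')" if "l\<in>Ls" "l'\<in>Ls" "l\<noteq>l'" for l l'
  proof -
    have "(l,l') \<in> T" using that unfolding T_def by simp
    hence "m \<le> f (l,l')" unfolding m_def using fin by (intro Min_le imageI)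
    thus ?thesis using s1m by (simp add: f_def del: cen.simps)
  qed
  thus ?thesis using s1(1) by (intro exI[of _ s1] conjI ballI impI) simp_all
qed

definition s1 where "s1 = (SOME s1. s1 > 1 \<and> (\<forall>l\<in>Ls. \<forall>l'\<in>Ls. l \<noteq> l' \<longrightarrow> 2 * s1 * \<rho> < norm (cen l - cen l')))"

lemma s1: "s1 > 1" "\<And>l l'. l\<in>Ls \<Longrightarrow> l'\<in>Ls \<Longrightarrow> l \<noteq> l' \<Longrightarrow> 2 * s1 * \<rho> < norm (cen l - cen l')"
proof -
  have *: "s1 > 1 \<and> (\<forall>l\<in>Ls. \<forall>l'\<in>Ls. l \<noteq> l' \<longrightarrow> 2 * s1 * \<rho> < norm (cen l - cen l'))"
    unfolding s1_def by (rule someI_ex[OF ex_s1])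
  show "s1 > 1" using * by (rule conjunct1)
  show "2 * s1 * \<rho> < norm (cen l - cen l')" if "l\<in>Ls" "l'\<in>Ls" "l \<noteq> l'" for l l'
    by (rule conjunct2[OF *, rule_format, OF that])
qed

lemma rad_pos: "s \<ge> 1 \<Longrightarrow> rad s l > 0" using rho_pos by (cases l) auto

lemma rad_le: "s \<ge> 1 \<Longrightarrow> s \<le> s1 \<Longrightarrow> rad s l \<le> s1 * \<rho>"
proof (cases l)
  case (Pair k b)
  assume s: "s \<ge> 1" "s \<le> s1"
  have "\<rho> / s \<le> \<rho> / 1" using s rho_pos by (intro divide_left_mono) auto
  also have "\<dots> \<le> s1 * \<rho>" using s1(1) rho_pos by simp
  finally show ?thesis using Pair s rho_pos by (cases b) simp_all
qed

lemma rad_linv: "s \<ge> 1 \<Longrightarrow> rad s (linv l) = \<rho>\<^sup>2 / rad s l"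
  using rho_pos by (cases l) (auto simp: field_simps power2_eq_square)

lemma disc_sep:
  assumes "1 \<le> s" "s \<le> s1" "l\<in>Ls" "l'\<in>Ls" "l \<noteq> l'" "norm (z - cen l) \<le> s1 * \<rho>"
  shows "rad s l' < norm (z - cen l')"
proof -
  have "2 * s1 * \<rho> < norm (cen l - cen l')" using s1 assms by blast
  also have "\<dots> \<le> norm (z - cen l') + norm (z - cen l)" 
    using norm_triangle_ineq4[of "z - cen l'" "z - cen l"] by (simp add: algebra_simps)
  finally show ?thesis using assms rad_le[of s l'] by linarith
qed

section \<open>Reduced words and ping-pong\<close>

inductive reduced :: "letter \<Rightarrow> su \<Rightarrow> bool" where
  base: "l \<in> Ls \<Longrightarrow> reduced l (lm l)"
| step: "reduced l M \<Longrightarrow> l' \<in> Ls \<Longrightarrow> l' \<noteq> linv l \<Longrightarrow> reduced l' (pmul (lm l') M)"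

lemma reduced_Ls: "reduced l M \<Longrightarrow> l \<in> Ls" by (induction rule: reduced.induct) auto

text \<open>In \<open>reduced l M\<close> the letter \<open>l\<close> is the leftmost one, so a new
  letter on the left either prolongs the reduced word or cancels exactly \<open>l\<close>.\<close>

lemma GG_reduced: "M \<in> GG \<Longrightarrow> M = (1,0) \<or> (\<exists>l. reduced l M)"
proof (induction rule: GG.induct)
  case (step M l)
  from step.IH show ?case
  proof
    assume "M = (1,0)" thus ?thesis using base[OF step.hyps(2)] by (metis pmul_one(2))
  next
    assume "\<exists>l. reduced l M"
    then obtain l' where l': "reduced l' M" by blast
    show ?thesis
    proof (cases "l = linv l'")
      case False thus ?thesis using l' step reduced.step by blast
    next
      case True
      have inv: "pmul (lm l) (lm l') = (1,0)" using True lm_linv lm_su pinv_left by simp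
      from l' show ?thesis
      proof cases
        case base thus ?thesis using inv by simp
      next
        case (step l'' M')
        thus ?thesis using inv by (metis pmul_assoc pmul_one(1))
      qed
    qed
  qed
qed simp

lemma GG_su: "M \<in> GG \<Longrightarrow> su11 M"
  by (induction rule: GG.induct) (auto intro: su11_pmul lm_su simp del: lm.simps)

lemma GG_mul: "M \<in> GG \<Longrightarrow> N \<in> GG \<Longrightarrow> pmul M N \<in> GG"
proof (induction rule: GG.induct)
  case (step M l)
  thus ?case unfolding pmul_assoc by (intro GG.step) auto
qed simp

lemma lm_GG: "l \<in> Ls \<Longrightarrow> lm l \<in> GG"
  using GG.step[OF GG.one, of l] by simp

lemma pinv_pmul: "pinv (pmul A B) = pmul (pinv B) (pinv A)"
  by (cases A; cases B) (simp add: algebra_simps)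

lemma GG_inv: "M \<in> GG \<Longrightarrow> pinv M \<in> GG"
proof (induction rule: GG.induct)
  case (step M l)
  have "lm (linv l) \<in> GG" using lm_GG[OF linv_in] step by blast
  thus ?case unfolding pinv_pmul lm_linv[symmetric] using step GG_mul by blast
qed (simp add: GG.one)

text \<open>Ping-pong: a letter maps the exterior of its own disc into the disc of its inverse. The
  next letter is not that inverse, so by disjointness the image lies again outside the disc of the
  next letter.\<close>

lemma reduced_act:
  assumes "reduced l M" "1 \<le> s" "s \<le> s1" "z \<in> coutside s"
  shows "den M z \<noteq> 0 \<and> norm (act M z - cen (linv l)) \<le> rad s (linv l)
     \<and> (z \<in> outside s \<longrightarrow> norm (act M z - cen (linv l)) < rad s (linv l))"
  using assms(1)
proof (induction rule: reduced.induct)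
  case (base l)
  have r: "rad s l > 0" using rad_pos assms by auto
  have z: "rad s l \<le> norm (z - cen l)" using assms base by (auto simp: coutside_def)
  have z': "z \<in> outside s \<Longrightarrow> rad s l < norm (z - cen l)" using assms base by (auto simp: outside_def)
  have ne: "z \<noteq> cen l" using r z by auto
  show ?case using ne r z z' assms rho_pos
    by (auto simp: den_lm_eq_0_iff dist_act_lm rad_linv intro!: divide_left_mono divide_strict_left_mono mult_pos_pos
       simp del: cen.simps lm.simps rad.simps)
next
  case (step l M l')
  define w where "w = act M z"
  have w: "den M z \<noteq> 0" "norm (w - cen (linv l)) \<le> rad s (linv l)" using step w_def by auto
  have l: "linv l \<in> Ls" using step reduced_Ls linv_in by blast
  have far: "rad s l' < norm (w - cen l')"
    using disc_sep[of s "linv l" l' w] w l step assms rad_le[of s "linv l"] by auto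
  have r: "rad s l' > 0" using rad_pos assms by auto
  have ne: "w \<noteq> cen l'" using r far by auto
  have d: "den (lm l') w \<noteq> 0" using ne by (simp add: den_lm_eq_0_iff)
  have "norm (act (lm l') w - cen (linv l')) < rad s (linv l')"
    using ne r far rho_pos assms
    by (auto simp: dist_act_lm rad_linv intro!: divide_strict_left_mono mult_pos_pos simp del: cen.simps lm.simps rad.simps)
  thus ?case using w d by (simp add: den_pmul act_pmul w_def del: cen.simps lm.simps rad.simps)
qed

text \<open>The same ping-pong started at infinity, whose image under \<open>M\<close> is
  \<open>fst M / cnj (snd M)\<close>.\<close>

lemma reduced_infinity:
  assumes "reduced l M" "1 \<le> s" "s \<le> s1"
  shows "snd M \<noteq> 0 \<and> norm (fst M / cnj (snd M) - cen (linv l)) < rad s (linv l)"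
  using assms(1)
proof (induction rule: reduced.induct)
  case (base l)
  obtain k b where l: "l = (k,b)" by (cases l)
  have r: "of_real \<rho> \<noteq> (0::complex)" using rho_pos by simp
  have "cnj (\<zeta>^k) = 1/\<zeta>^k" using zeta_cnj[of k] by (simp add: field_simps)
  hence "snd (lm l) \<noteq> 0 \<and> fst (lm l) / cnj (snd (lm l)) = cen (linv l)"
    using l r by (cases b) (auto simp: field_simps)
  thus ?case using rad_pos[of s "linv l"] assms by (simp del: cen.simps lm.simps rad.simps)
next
  case (step l M l')
  define w where "w = fst M / cnj (snd M)"
  have w: "snd M \<noteq> 0" "norm (w - cen (linv l)) \<le> rad s (linv l)" using step w_def by auto
  have l: "linv l \<in> Ls" using step reduced_Ls linv_in by blast
  have far: "rad s l' < norm (w - cen l')"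
    using disc_sep[of s "linv l" l' w] w l step assms rad_le[of s "linv l"] by auto
  have r: "rad s l' > 0" using rad_pos assms by auto
  have ne: "w \<noteq> cen l'" using r far by auto
  have d: "den (lm l') w \<noteq> 0" using ne by (simp add: den_lm_eq_0_iff)
  have "norm (act (lm l') w - cen (linv l')) < rad s (linv l')"
    using ne r far rho_pos assms
    by (auto simp: dist_act_lm rad_linv intro!: divide_strict_left_mono mult_pos_pos simp del: cen.simps lm.simps rad.simps)
  moreover have "cnj (snd (pmul (lm l') M)) = den (lm l') w * cnj (snd M)"
    using w by (cases M; cases "lm l'") (simp add: w_def field_simps)
  moreover have "fst (pmul (lm l') M) = num (lm l') w * cnj (snd M)"
    using w by (cases M; cases "lm l'") (simp add: w_def field_simps)
  ultimately show ?case using w d 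
    by (simp add: act_def del: cen.simps lm.simps rad.simps) (metis complex_cnj_zero_iff mult_eq_0_iff)
qed

lemma schottky_GG:
  shows schottky_imp_GG: "M \<in> schottky_group g \<eta> \<theta> \<Longrightarrow> \<exists>t N. t \<noteq> 0 \<and> N \<in> GG \<and> M = smat t (emb N)"
    and GG_imp_schottky: "N \<in> GG \<Longrightarrow> \<exists>t. t \<noteq> 0 \<and> smat t (emb N) \<in> schottky_group g \<eta> \<theta>"
proof -
  \<comment> \<open>\<open>gen_mat\<close> has determinant
    \<open>1 - c * cnj c = - \<rho>^2\<close>; dividing it by the square root
    \<open>\<i> * \<rho>\<close> of this number gives \<open>lm (k,True)\<close>.\<close>
  define ir where "ir = \<i> * of_real \<rho>"
  have ir: "ir \<noteq> 0" using rho_pos by (auto simp: ir_def)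
  have cis: "cis (- (2 * pi * real k / real g)) = cnj (\<zeta>^k)" for k
    by (simp add: zeta_power cis_cnj)
  have gm: "gen_mat g \<eta> \<theta> k = (cnj c, -(\<zeta>^k), cnj (\<zeta>^k), -c)" if "k < g" for k
  proof -
    have 1: "of_real \<rho>^2 - cnj c * c = (-1::complex)" using c_cnj by (simp add: mult.commute)
    have 2: "cis (2 * pi * real k / real g) = \<zeta>^k" by (simp add: zeta_power)
    have 3: "rot_mat g (int k) = (\<zeta>^k,0,0,1)" "rot_mat g (- int k) = (cnj (\<zeta>^k),0,0,1)"
      unfolding rot_mat_def using 2 cis by simp_all
    have 4: "f0_mat \<eta> \<theta> = (cnj c, -1, 1, -c)" 
      unfolding f0_mat_def Let_def c_def[symmetric] \<rho>_def[symmetric] 1 by simp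
    show ?thesis unfolding gen_mat_def 3 4 using zeta_cnj[of k] by (simp add: algebra_simps)
  qed
  have gT: "gen_mat g \<eta> \<theta> k = smat ir (emb (lm (k,True)))" if "k < g" for k
    using that rho_pos by (simp add: gm ir_def)
  have gF: "madj (gen_mat g \<eta> \<theta> k) = smat ir (emb (lm (k,False)))" if "k < g" for k
    using that rho_pos by (simp add: gm ir_def)
  show "\<exists>t N. t \<noteq> 0 \<and> N \<in> GG \<and> M = smat t (emb N)" if "M \<in> schottky_group g \<eta> \<theta>"
    using that
    proof (induction rule: schottky_group.induct)
      case one
      show ?case by (intro exI[of _ 1] exI[of _ "(1,0)"]) (auto intro: GG.one)
    next
      case (gen M k)
      then obtain t N where "t \<noteq> 0" "N \<in> GG" "M = smat t (emb N)" by blast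
      thus ?case using gen ir by (intro exI[of _ "ir * t"] exI[of _ "pmul (lm (k,True)) N"])
         (auto simp: gT smat_mmul emb_pmul intro: GG.step simp del: lm.simps)
    next
      case (geninv M k)
      then obtain t N where "t \<noteq> 0" "N \<in> GG" "M = smat t (emb N)" by blast
      thus ?case using geninv ir by (intro exI[of _ "ir * t"] exI[of _ "pmul (lm (k,False)) N"])
         (auto simp: gF smat_mmul emb_pmul intro: GG.step simp del: lm.simps)
    qed
  show "\<exists>t. t \<noteq> 0 \<and> smat t (emb N) \<in> schottky_group g \<eta> \<theta>" if "N \<in> GG"
      using that
    proof (induction rule: GG.induct)
      case one
      show ?case using schottky_group.one by (intro exI[of _ 1]) auto
    next
      case (step N l)
      then obtain t where t: "t \<noteq> 0" "smat t (emb N) \<in> schottky_group g \<eta> \<theta>" by blast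
      obtain k b where l: "l = (k,b)" "k < g" using step by (cases l) auto
      have "mmul (smat ir (emb (lm l))) (smat t (emb N)) \<in> schottky_group g \<eta> \<theta>"
        using schottky_group.gen[OF t(2) l(2)] schottky_group.geninv[OF t(2) l(2)] l gT gF by (cases b) auto
      thus ?case using ir t by (intro exI[of _ "ir*t"]) (auto simp: smat_mmul emb_pmul simp del: lm.simps)
    qed
qed

end

section \<open>Convergence\<close>

lemma summable_on_finite_ge:
  fixes f :: "'a \<Rightarrow> real"
  assumes "f summable_on A" "\<And>x. x \<in> A \<Longrightarrow> f x \<ge> 0" "e > 0"
  shows "finite {x\<in>A. f x \<ge> e}"
proof (rule ccontr)
  assume inf: "infinite {x\<in>A. f x \<ge> e}"
  define B where "B = infsum f A"
  obtain n :: nat where n: "real n * e > B" using reals_Archimedean3[OF assms(3)] by blast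
  obtain F where F: "finite F" "card F = n" "F \<subseteq> {x\<in>A. f x \<ge> e}"
    using infinite_arbitrarily_large[OF inf] by blast
  have "real n * e = (\<Sum>x\<in>F. e)" using F by simp
  also have "\<dots> \<le> sum f F" using F by (intro sum_mono) auto
  also have "\<dots> \<le> B" unfolding B_def using F assms by (intro finite_sum_le_infsum) auto
  finally show False using n by simp
qed

lemma sum_disjoint_intervals_le:
  fixes l u :: "'a \<Rightarrow> real"
  assumes "finite F" "\<And>i. i \<in> F \<Longrightarrow> l i \<le> u i" "\<And>i. i \<in> F \<Longrightarrow> {l i..u i} \<subseteq> {-C..C}"
    "\<And>i j. i \<in> F \<Longrightarrow> j \<in> F \<Longrightarrow> i \<noteq> j \<Longrightarrow> {l i..u i} \<inter> {l j..u j} = {}" "C \<ge> 0"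
  shows "(\<Sum>i\<in>F. u i - l i) \<le> 2 * C"
proof -
  have "(\<Sum>i\<in>F. u i - l i) = (\<Sum>i\<in>F. measure lborel {l i..u i})"
    using assms by (intro sum.cong) auto
  also have "\<dots> = measure lborel (\<Union>i\<in>F. {l i..u i})"
    using assms by (intro measure_finite_Union[symmetric]) (auto simp: disjoint_family_on_def)
  also have "\<dots> \<le> measure lborel {-C..C}"
    using assms(1,3) by (intro measure_mono_fmeasurable UN_least sets.finite_UN) (auto simp: fmeasurable_def emeasure_lborel_Icc_eq)
  also have "\<dots> = 2 * C" using assms by simp
  finally show ?thesis .
qed

context schottky_curve
begin

section \<open>Gaps on the unit circle and poles of group elements\<close>

definition pole :: "su \<Rightarrow> complex" where
  "pole M = - cnj (fst M) / cnj (snd M)"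

abbreviation "GG' \<equiv> GG - {(1,0)}"

abbreviation \<Omega> where "\<Omega> \<equiv> disc_domain (schottky_group g \<eta> \<theta>)"

lemma norm_cis_cen:
  "(norm (cis t - cen (k,b)))\<^sup>2 = \<rho>\<^sup>2 + 2 - 2 * cos (t - (2*pi*k/g + (if b then \<mu> else -\<mu>))) / cos \<delta>"
proof -
  define a where "a = 2*pi*k/g + (if b then \<mu> else -\<mu>)"
  have "norm (cis t - cen (k,b)) ^ 2 = (cos t - cos a / cos \<delta>)^2 + (sin t - sin a / cos \<delta>)^2"
    unfolding cen_cis a_def[symmetric] by (simp add: cmod_power2)
  also have "\<dots> = ((cos t)^2 + (sin t)^2) + ((cos a)^2 + (sin a)^2) / (cos \<delta>)^2 - 2 * (cos t * cos a + sin t * sin a) / cos \<delta>"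
  proof -
    have "(p - q/d)^2 + (r - u/d)^2 = (p^2 + r^2) + (q^2 + u^2)/d^2 - 2*(p * q + r * u)/d" if "d \<noteq> 0" for p q r u d :: real
      using that by (simp add: power2_eq_square field_simps)
    thus ?thesis using cos_delta by simp
  qed
  also have "\<dots> = 1 + 1/(cos \<delta>)^2 - 2 * cos (t - a) / cos \<delta>" by (simp add: cos_diff)
  also have "1/(cos \<delta>)^2 = 1 + \<rho>^2" using c_rho unfolding norm_c by (simp add: power_divide)
  finally show ?thesis unfolding a_def by simp
qed

lemma cos_le:
  assumes "\<delta> \<le> x" "x \<le> 2*pi - \<delta>" 
  shows "cos x \<le> cos \<delta>" "\<delta> < x \<Longrightarrow> x < 2*pi - \<delta> \<Longrightarrow> cos x < cos \<delta>"
proof -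
  have *: "cos x = cos (2*pi - x)" by (simp add: cos_diff)
  show "cos x \<le> cos \<delta>"
  proof (cases "x \<le> pi")
    case True thus ?thesis using assms delta by (intro cos_monotone_0_pi_le) auto
  next
    case False thus ?thesis unfolding * using assms delta by (intro cos_monotone_0_pi_le) auto
  qed
  show "cos x < cos \<delta>" if "\<delta> < x" "x < 2*pi - \<delta>"
  proof (cases "x \<le> pi")
    case True thus ?thesis using that delta by (intro cos_monotone_0_pi) auto
  next
    case False thus ?thesis unfolding * using that delta by (intro cos_monotone_0_pi) auto
  qed
qed

text \<open>The circles with index \<open>k\<close> cut out the angles from \<open>\<eta>\<close> to
  \<open>\<theta>\<close> on either side of \<open>2 * pi * k / g\<close>. Two kinds of gaps remain
  on the unit circle: the one around \<open>1\<close> ends at \<open>cis (- \<eta>)\<close> and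
  \<open>cis \<eta>\<close>, and \<open>cis (pi / g)\<close> is the midpoint of one of the other
  kind. An angular distance above \<open>\<delta>\<close> from a centre means lying outside its
  disc.\<close>

lemma letter_angle:
  fixes k :: nat and b :: bool
  assumes "k < g" "(-\<eta> \<le> t \<and> t \<le> \<eta>) \<or> t = pi/g"
  defines "x \<equiv> \<bar>t - (2*pi*k/g + (if b then \<mu> else -\<mu>))\<bar>"
  shows "\<delta> \<le> x" "x \<le> 2*pi - \<delta>" "(-\<eta> < t \<and> t < \<eta>) \<or> t = pi/g \<Longrightarrow> \<delta> < x \<and> x < 2*pi - \<delta>"
proof -
  define P where "P = pi/g"
  have P1: "P \<le> pi/3" using g_ge unfolding P_def by (intro divide_left_mono) auto
  have P: "\<mu> + \<delta> < P" "P \<le> pi/3" using delta theta_less P1 unfolding P_def by auto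
  define q where "q = 2*pi*k/g"
  have q: "q = 0 \<or> (2*P \<le> q \<and> q \<le> 2*pi - 2*P)"
  proof (cases "k = 0")
    case False
    have "2*pi*1 \<le> 2*pi*k" using False by (intro mult_left_mono) auto
    hence "2*pi*1/g \<le> 2*pi*k/g" using g_pos by (intro divide_right_mono) auto
    moreover have "2*pi*k \<le> 2*pi*(real g - 1)" using assms(1) by (intro mult_left_mono) auto
    hence "2*pi*k/g \<le> 2*pi*(real g - 1)/g" using g_pos by (intro divide_right_mono) auto
    ultimately show ?thesis using g_pos unfolding q_def P_def by (simp add: field_simps)
  qed (simp add: q_def)
  have d: "0 < \<delta>" "\<delta> < \<mu>" "\<eta> = \<mu> - \<delta>" "pi > 0" using delta by auto
  have x: "x = \<bar>t - (q + (if b then \<mu> else -\<mu>))\<bar>" unfolding x_def q_def by simp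
  have t: "(-\<eta> \<le> t \<and> t \<le> \<eta>) \<or> t = P" using assms(2) P_def by simp
  show "\<delta> \<le> x" "x \<le> 2*pi - \<delta>" using t q P d unfolding x by (cases b; auto simp: abs_if; linarith)+
  assume "(-\<eta> < t \<and> t < \<eta>) \<or> t = pi/g"
  hence t: "(-\<eta> < t \<and> t < \<eta>) \<or> t = P" using P_def by simp
  show "\<delta> < x \<and> x < 2*pi - \<delta>" using t q P d unfolding x by (cases b; auto simp: abs_if; linarith)
qed

lemma cis_coutside:
  assumes "-\<eta> \<le> t" "t \<le> \<eta>" shows "cis t \<in> coutside 1"
proof -
  have "\<rho> \<le> norm (cis t - cen (k,b))" if "k < g" for k b
  proof -
    define x where "x = t - (2*pi*k/g + (if b then \<mu> else -\<mu>))"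
    have "cos x \<le> cos \<delta>" using cos_le(1)[of "\<bar>x\<bar>"] letter_angle(1,2)[OF that, of t b] assms unfolding x_def by simp
    hence "2 * cos x / cos \<delta> \<le> 2" using cos_delta by (simp add: field_simps)
    hence "\<rho>\<^sup>2 \<le> (norm (cis t - cen (k,b)))\<^sup>2" unfolding norm_cis_cen x_def by simp
    thus ?thesis by (rule power2_le_imp_le) simp
  qed
  thus ?thesis unfolding coutside_def by (auto simp del: cen.simps)
qed

lemma cis_outside:
  assumes "(-\<eta> < t \<and> t < \<eta>) \<or> t = pi/g" shows "cis t \<in> outside 1"
proof -
  have "\<rho> < norm (cis t - cen (k,b))" if "k < g" for k b
  proof -
    define x where "x = t - (2*pi*k/g + (if b then \<mu> else -\<mu>))"
    have a: "(-\<eta> \<le> t \<and> t \<le> \<eta>) \<or> t = pi/g" using assms by auto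
    have "cos x < cos \<delta>" using cos_le(2)[of "\<bar>x\<bar>"] letter_angle[OF that a, of b] assms unfolding x_def by simp
    hence "2 * cos x / cos \<delta> < 2" using cos_delta by (simp add: field_simps)
    hence "\<rho>\<^sup>2 < (norm (cis t - cen (k,b)))\<^sup>2" unfolding norm_cis_cen x_def by simp
    thus ?thesis by (rule power2_less_imp_less) simp
  qed
  thus ?thesis unfolding outside_def by (auto simp del: cen.simps)
qed

lemma norm_cen: "norm (cen l) = norm c"
  by (cases l) (simp add: norm_mult)

lemma norm_c_gt: "norm c > 1"
  using cos_delta by (simp add: norm_c)

lemma norm_c_s1: "norm c > s1 * \<rho>"
proof -
  have "2 * s1 * \<rho> < norm (cen (0,True) - cen (0,False))" using g_pos by (intro s1) auto
  also have "\<dots> \<le> norm (cen (0,True)) + norm (cen (0,False))" by (rule norm_triangle_ineq4)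
  finally show ?thesis unfolding norm_cen by simp
qed

lemma zero_outside: "1 \<le> s \<Longrightarrow> s \<le> s1 \<Longrightarrow> 0 \<in> outside s"
  unfolding outside_def using rad_le[of s] norm_c_s1 by (auto simp: norm_cen simp del: cen.simps rad.simps intro: le_less_trans)

lemma outside_sub: "outside s \<subseteq> coutside s"
  by (auto simp: outside_def coutside_def simp del: cen.simps rad.simps intro: less_imp_le)

lemma GG'_act:
  assumes "M \<in> GG'" "1 \<le> s" "s \<le> s1" "z \<in> coutside s"
  shows "den M z \<noteq> 0" "\<exists>l\<in>Ls. norm (act M z - cen l) \<le> rad s l \<and> (z \<in> outside s \<longrightarrow> norm (act M z - cen l) < rad s l)"
proof -
  obtain l where l: "reduced l M" using GG_reduced assms by blast
  show "den M z \<noteq> 0" using reduced_act[OF l assms(2-4)] by simp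
  show "\<exists>l\<in>Ls. norm (act M z - cen l) \<le> rad s l \<and> (z \<in> outside s \<longrightarrow> norm (act M z - cen l) < rad s l)"
    using reduced_act[OF l assms(2-4)] linv_in[OF reduced_Ls[OF l]] by blast
qed

text \<open>A nontrivial element pushes the closed domain into the closed discs, which the open
  domain avoids.\<close>

lemma outside_inequiv:
  assumes "M \<in> GG" "1 \<le> s" "s \<le> s1" "z \<in> coutside s" "act M z \<in> outside s"
  shows "M = (1,0)"
  using GG'_act(2)[of M s z] assms unfolding outside_def by force

text \<open>The point \<open>0\<close> lies in the open domain and so has trivial stabiliser; its
  orbit therefore faithfully records the group elements.\<close>

lemma act_zero_inj:
  assumes "M \<in> GG" "N \<in> GG" "act M 0 = act N 0" shows "M = N"
proof -
  have d: "den M 0 \<noteq> 0" "den N 0 \<noteq> 0" using den_nonzero GG_su assms by auto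
  have "act (pmul (pinv N) M) 0 = 0"
    using d assms by (simp add: act_pmul act_pinv_act GG_su)
  hence "pmul (pinv N) M = (1,0)"
    using outside_inequiv[of "pmul (pinv N) M" 1 0] zero_outside[of 1] outside_sub s1(1) assms GG_mul GG_inv by auto
  hence "pmul N (pmul (pinv N) M) = N" by simp
  thus ?thesis using assms by (simp add: pmul_assoc[symmetric] pinv_right GG_su)
qed

lemma GG'_infinity:
  assumes "M \<in> GG'" "1 \<le> s" "s \<le> s1"
  shows "snd M \<noteq> 0" "\<exists>l\<in>Ls. norm (fst M / cnj (snd M) - cen l) < rad s l"
proof -
  obtain l where l: "reduced l M" using GG_reduced assms by blast
  show "snd M \<noteq> 0" using reduced_infinity[OF l assms(2-)] by simp
  show "\<exists>l\<in>Ls. norm (fst M / cnj (snd M) - cen l) < rad s l"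
    using reduced_infinity[OF l assms(2-)] linv_in[OF reduced_Ls[OF l]] by blast
qed

text \<open>\<open>pole M\<close> is the preimage of infinity under \<open>M\<close>, hence
  \<open>pole (pinv M)\<close> is the image of infinity.\<close>

lemma pole_pinv: "pole (pinv M) = fst M / cnj (snd M)" "pole M = fst (pinv M) / cnj (snd (pinv M))"
  by (cases M; simp add: pole_def)+

lemma pinv_GG': "M \<in> GG' \<Longrightarrow> pinv M \<in> GG'"
  using GG_inv by (cases M) auto

lemma pole_GG':
  assumes "M \<in> GG'" "1 \<le> s" "s \<le> s1" shows "\<exists>l\<in>Ls. norm (pole M - cen l) < rad s l"
  using GG'_infinity(2)[OF pinv_GG'[OF assms(1)] assms(2-)] pole_pinv(2) by simp

lemma den_pole: "snd M \<noteq> 0 \<Longrightarrow> den M z = cnj (snd M) * (z - pole M)"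
  by (cases M) (simp add: pole_def field_simps)

lemma snd_GG': "M \<in> GG' \<Longrightarrow> snd M \<noteq> 0"
  using GG'_infinity(1)[of M 1] s1(1) by simp

definition Rmax where "Rmax = norm c + s1 * \<rho>"

lemma pole_bound: "M \<in> GG' \<Longrightarrow> norm (pole M) \<le> Rmax"
proof -
  assume M: "M \<in> GG'"
  obtain l where l: "norm (pole M - cen l) < rad 1 l" using pole_GG'[OF M, of 1] s1(1) by auto
  have "norm (pole M) \<le> norm (pole M - cen l) + norm (cen l)" using norm_triangle_ineq[of "pole M - cen l" "cen l"] by simp
  thus ?thesis using l rad_le[of 1 l] s1(1) unfolding Rmax_def norm_cen by linarith
qed

lemma Rmax_pos: "Rmax > 0" unfolding Rmax_def using norm_c_gt rho_pos s1(1) by (intro add_pos_pos) auto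

lemma fst_le_snd: "M \<in> GG' \<Longrightarrow> norm (fst M) \<le> Rmax * norm (snd M)"
  using pole_bound[of M] snd_GG'[of M] by (simp add: pole_def norm_divide field_simps)

text \<open>The image of a fixed arc under \<open>M\<close> has length at least a constant times
  \<open>1 / |snd M|^2\<close>. After a Cayley transform with its pole in another gap, the images
  contain disjoint intervals in a bounded part of the real line, whose total length is
  bounded.\<close>

lemma summable_GG': "(\<lambda>M. 1 / (norm (snd M))\<^sup>2) summable_on GG'"
proof (rule nonneg_bdd_above_summable_on)
  \<comment> \<open>This point lies in a gap, whereas nontrivial elements send the arc into the
    discs; so all these images keep a distance \<open>d\<close> from it.\<close>
  define x0 where "x0 = cis (pi/g)"
  have x0: "norm x0 = 1" "x0 \<in> outside 1" unfolding x0_def using cis_outside by auto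
  obtain d where d: "d > 0" "\<And>l z. l \<in> Ls \<Longrightarrow> norm (z - cen l) < rad 1 l \<Longrightarrow> norm (x0 - z) \<ge> d"
  proof
    define S where "S = (\<lambda>l. norm (x0 - cen l) - rad 1 l) ` Ls"
    have S: "finite S" "S \<noteq> {}" unfolding S_def using g_pos by (auto simp: Ls_def simp del: cen.simps rad.simps)
    show "Min S > 0" using S x0 by (auto simp: S_def outside_def simp del: cen.simps rad.simps)
    fix l z assume l: "l \<in> Ls" "norm (z - cen l) < rad 1 l"
    have "Min S \<le> norm (x0 - cen l) - rad 1 l" using S l by (intro Min_le) (auto simp: S_def)
    also have "\<dots> \<le> norm (x0 - z)" using l norm_triangle_ineq[of "x0 - z" "z - cen l"] by simp
    finally show "norm (x0 - z) \<ge> Min S" .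
  qed
  \<comment> \<open>The Cayley transform with pole \<open>x0\<close>, which is real on the rest of
    the unit circle.\<close>
  define T where "T = (\<lambda>y. \<i> * (x0 + y) / (x0 - y))"
  have T_diff: "T y - T z = \<i> * (2 * x0 * (y - z) / ((x0 - y) * (x0 - z)))" if "y \<noteq> x0" "z \<noteq> x0" for y z
    using that by (simp add: T_def divide_simps) (simp add: algebra_simps)
  have T_real: "T y \<in> \<real>" if "norm y = 1" "y \<noteq> x0" for y
  proof -
    have 1: "cnj x0 = 1/x0" "cnj y = 1/y" "x0 \<noteq> 0" "y \<noteq> 0" 
      using that x0 complex_norm_square[of x0] complex_norm_square[of y] 
      by (auto simp: eq_divide_eq mult.commute)
    have "cnj (T y) = T y" unfolding T_def using that 1 by (simp add: field_simps)
    thus ?thesis by (simp add: Reals_cnj_iff)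
  qed
  define C where "C = 2 / d"
  have T_bound: "norm (T y) \<le> C" if "norm y = 1" "norm (x0 - y) \<ge> d" for y
  proof -
    have "norm (x0 + y) \<le> 2" using norm_triangle_ineq[of x0 y] that x0 by simp
    thus ?thesis using that d(1) x0 unfolding T_def C_def norm_divide norm_mult by (simp add: frac_le)
  qed
  \<comment> \<open>\<open>h < \<eta>\<close> keeps the closed arc in the open domain, where
    distinct points are inequivalent; this makes the images under distinct elements
    disjoint.\<close>
  define h where "h = \<eta>/2"
  have h: "0 < h" "h < \<eta>" unfolding h_def using eta_pos by auto
  define f where "f = (\<lambda>M t. Re (T (act M (cis t))))"
  define e where "e = norm (cis 0 - cis h)"
  have e: "e > 0"
  proof -
    have "sin (h/2) > 0" using h delta theta_lt pi_gt_zero eta_less by (intro sin_gt_zero) linarith+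
    thus ?thesis unfolding e_def norm_cis_diff by (auto simp: abs_if)
  qed
  have arc: "cis t \<in> outside 1" if "t \<in> {0..h}" for t using that h by (intro cis_outside) auto
  have img: "norm (act M (cis t)) = 1" "norm (x0 - act M (cis t)) \<ge> d" "act M (cis t) \<noteq> x0"
    if "M \<in> GG'" "t \<in> {0..h}" for M t
  proof -
    show "norm (act M (cis t)) = 1" using that GG_su act_unit by auto
    show "norm (x0 - act M (cis t)) \<ge> d"
      using GG'_act(2)[of M 1 "cis t"] that arc[OF that(2)] outside_sub s1(1) d(2) by (meson less_imp_le order_refl subsetD)
    thus "act M (cis t) \<noteq> x0" using d by auto
  qed
  have f_eq: "of_real (f M t) = T (act M (cis t))" if "M \<in> GG'" "t \<in> {0..h}" for M t
    using T_real[OF img(1,3)[OF that]] unfolding f_def by (simp add: of_real_Re)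
  have f_C: "\<bar>f M t\<bar> \<le> C" if "M \<in> GG'" "t \<in> {0..h}" for M t
    using T_bound[OF img(1,2)[OF that]] abs_Re_le_cmod order_trans unfolding f_def by blast
  have inj: "M = N" if "M \<in> GG'" "t \<in> {0..h}" "N \<in> GG'" "u \<in> {0..h}" "f M t = f N u" for M N t u
  proof -
    have "T (act M (cis t)) - T (act N (cis u)) = 0" using that f_eq[of M t] f_eq[of N u] by simp
    hence eq: "act M (cis t) = act N (cis u)" unfolding T_diff[OF img(3)[OF that(1,2)] img(3)[OF that(3,4)]]
      using img(3)[OF that(1,2)] img(3)[OF that(3,4)] x0 by auto
    have d: "den M (cis t) \<noteq> 0" "den N (cis u) \<noteq> 0" using that GG_su den_nonzero by auto
    have "act (pmul (pinv N) M) (cis t) = cis u"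
      using d that by (simp add: act_pmul eq act_pinv_act GG_su)
    hence "pmul (pinv N) M = (1,0)"
      using outside_inequiv[of "pmul (pinv N) M" 1 "cis t"] arc[OF that(2)] arc[OF that(4)] outside_sub s1(1) that GG_mul GG_inv by auto
    hence "pmul N (pmul (pinv N) M) = N" by simp
    thus ?thesis using that by (simp add: pmul_assoc[symmetric] pinv_right GG_su)
  qed
  have cont: "continuous_on {0..h} (f M)" if "M \<in> GG'" for M
  proof -
    have [continuous_intros]: "continuous_on {0..h} (\<lambda>t. act M (cis t))"
      using that GG_su den_nonzero unfolding act_def by (cases M) (auto intro!: continuous_intros)
    have "x0 - act M (cis t) \<noteq> 0" if "t \<in> {0..h}" for t
      using img(3)[OF \<open>M \<in> GG'\<close> that] by simp
    hence *: "\<forall>t\<in>{0..h}. x0 - act M (cis t) \<noteq> 0" by (rule ballI)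
    have "continuous_on {0..h} (\<lambda>t. \<i> * (x0 + act M (cis t)) / (x0 - act M (cis t)))"
      by (rule continuous_on_divide[OF _ _ *]) (intro continuous_intros)+
    thus ?thesis unfolding f_def T_def by (rule continuous_on_Re)
  qed
  define lo where "lo = (\<lambda>M. min (f M 0) (f M h))"
  define hi where "hi = (\<lambda>M. max (f M 0) (f M h))"
  have sub: "{lo M..hi M} \<subseteq> f M ` {0..h}" if "M \<in> GG'" for M
  proof -
    have "connected (f M ` {0..h})" by (rule connected_continuous_image[OF cont[OF that] connected_Icc])
    moreover have "f M 0 \<in> f M ` {0..h}" "f M h \<in> f M ` {0..h}" using h by auto
    hence "lo M \<in> f M ` {0..h}" "hi M \<in> f M ` {0..h}" unfolding lo_def hi_def min_def max_def by simp_all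
    ultimately show ?thesis by (rule connected_contains_Icc)
  qed
  have C0: "C \<ge> 0" unfolding C_def using d by simp
  have key: "(\<Sum>M\<in>F. hi M - lo M) \<le> 2*C" if F: "finite F" "F \<subseteq> GG'" for F
  proof (rule sum_disjoint_intervals_le)
    show "lo M \<le> hi M" for M unfolding lo_def hi_def by auto
    show "{lo M..hi M} \<subseteq> {-C..C}" if "M \<in> F" for M
    proof -
      have M: "M \<in> GG'" using that F(2) by (auto simp only: subset_iff)
      have "f M ` {0..h} \<subseteq> {-C..C}"
      proof (rule image_subsetI)
        fix t assume "t \<in> {0..h}"
        from f_C[OF M this] show "f M t \<in> {-C..C}" by (simp add: abs_le_iff)
      qed
      thus ?thesis using sub[OF M] by (rule subset_trans[rotated])
    qed
    show "{lo M..hi M} \<inter> {lo N..hi N} = {}" if "M \<in> F" "N \<in> F" "M \<noteq> N" for M N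
    proof (rule ccontr)
      assume "\<not> ?thesis"
      hence "{lo M..hi M} \<inter> {lo N..hi N} \<noteq> {}" .
      from this[unfolded ex_in_conv[symmetric]] obtain y where y: "y \<in> {lo M..hi M}" "y \<in> {lo N..hi N}" by (elim exE IntE)
      have MN: "M \<in> GG'" "N \<in> GG'" using that F(2) by (auto simp only: subset_iff)
      obtain t where t: "t \<in> {0..h}" "y = f M t" using subsetD[OF sub[OF MN(1)] y(1)] by (rule imageE)
      obtain u where u: "u \<in> {0..h}" "y = f N u" using subsetD[OF sub[OF MN(2)] y(2)] by (rule imageE)
      show False using inj[OF MN(1) t(1) MN(2) u(1)] t u that(3) by simp
    qed
  qed (use F C0 in auto)
  \<comment> \<open>On the unit circle \<open>|den M|\<close> is at most
    \<open>(Rmax + 1) * |snd M|\<close>, which bounds the chord between the images of the two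
    endpoints from below.\<close>
  have low: "(1/(norm (snd M))\<^sup>2) * (e / (2 * (Rmax+1)^2)) \<le> hi M - lo M" if M: "M \<in> GG'" for M
  proof -
    define y z where "y = act M (cis 0)" and "z = act M (cis h)"
    have mem: "0 \<in> {0..h}" "h \<in> {0..h}" using h by auto
    have su: "su11 M" using M GG_su by auto
    have dn: "den M (cis 0) \<noteq> 0" "den M (cis h) \<noteq> 0" using den_nonzero su by auto
    have db: "norm (den M w) \<le> (Rmax+1) * norm (snd M)" if "norm w = 1" for w
    proof (cases M)
      case (Pair a b)
      have "norm (den M w) \<le> norm b + norm a" using Pair norm_triangle_ineq[of "cnj b * w" "cnj a"] that by (simp add: norm_mult)
      thus ?thesis using fst_le_snd[OF M] Pair by (simp add: algebra_simps)
    qed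
    have yz: "y \<noteq> x0" "z \<noteq> x0" "norm (x0 - y) \<le> 2" "norm (x0 - z) \<le> 2" "norm (x0 - y) > 0" "norm (x0 - z) > 0"
      using img[OF M mem(1)] img[OF M mem(2)] x0 norm_triangle_ineq4[of x0 y] norm_triangle_ineq4[of x0 z] 
      unfolding y_def z_def by auto
    have "hi M - lo M = \<bar>f M 0 - f M h\<bar>" unfolding hi_def lo_def by auto
    also have "\<dots> = norm (of_real (f M 0) - complex_of_real (f M h))" by (metis norm_of_real of_real_diff real_norm_def)
    also have "\<dots> = norm (T y - T z)" using f_eq[OF M mem(1)] f_eq[OF M mem(2)] unfolding y_def z_def by simp
    also have "\<dots> = 2 * norm (y - z) / (norm (x0 - y) * norm (x0 - z))"
      unfolding T_diff[OF yz(1,2)] using x0 by (simp add: norm_mult norm_divide)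
    also have "\<dots> \<ge> 2 * norm (y - z) / (2 * 2)"
      using yz by (intro divide_left_mono mult_mono mult_pos_pos) auto
    finally have 1: "norm (y - z) / 2 \<le> hi M - lo M" by simp
    have "norm (y - z) = e / (norm (den M (cis 0)) * norm (den M (cis h)))"
      unfolding y_def z_def act_diff[OF su dn] e_def by (simp add: norm_divide norm_mult)
    also have "\<dots> \<ge> e / (((Rmax+1) * norm (snd M)) * ((Rmax+1) * norm (snd M)))"
      using e dn db Rmax_pos snd_GG'[OF M] by (intro divide_left_mono mult_mono mult_pos_pos) auto
    finally have "norm (y - z) / 2 \<ge> e / (((Rmax+1) * norm (snd M)) * ((Rmax+1) * norm (snd M))) / 2"
      by (rule divide_right_mono) simp
    moreover have "e / (((Rmax+1) * norm (snd M)) * ((Rmax+1) * norm (snd M))) / 2 = (1/(norm (snd M))\<^sup>2) * (e / (2 * (Rmax+1)^2))"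
      by (simp add: power2_eq_square mult_ac)
    ultimately show ?thesis using 1 by linarith
  qed
  define q where "q = e / (2 * (Rmax+1)^2)"
  have q: "q > 0" unfolding q_def using e Rmax_pos by (intro divide_pos_pos) auto
  show "bdd_above (sum (\<lambda>M. 1 / (norm (snd M))\<^sup>2) ` {F. F \<subseteq> GG' \<and> finite F})"
  proof (rule bdd_aboveI2)
    fix F assume F: "F \<in> {F. F \<subseteq> GG' \<and> finite F}"
    have "(\<Sum>M\<in>F. 1 / (norm (snd M))\<^sup>2) * q = (\<Sum>M\<in>F. 1 / (norm (snd M))\<^sup>2 * q)" by (rule sum_distrib_right)
    also have "\<dots> \<le> (\<Sum>M\<in>F. hi M - lo M)" unfolding q_def using low F by (intro sum_mono) auto
    also have "\<dots> \<le> 2*C" using key F by auto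
    finally show "(\<Sum>M\<in>F. 1 / (norm (snd M))\<^sup>2) \<le> 2*C/q" using q by (simp add: field_simps)
  qed
qed simp

lemma finite_snd_le: "finite {M\<in>GG'. norm (snd M) \<le> r}"
proof (cases "r > 0")
  case True
  have "finite {M\<in>GG'. 1/(norm (snd M))\<^sup>2 \<ge> 1/r\<^sup>2}" 
    using summable_GG' True by (intro summable_on_finite_ge) auto
  moreover have "1/(norm (snd M))\<^sup>2 \<ge> 1/r\<^sup>2" if "M \<in> GG'" "norm (snd M) \<le> r" for M
    using True snd_GG'[OF that(1)] that(2) by (intro divide_left_mono power_mono mult_pos_pos) auto
  hence "{M\<in>GG'. norm (snd M) \<le> r} \<subseteq> {M\<in>GG'. 1/(norm (snd M))\<^sup>2 \<ge> 1/r\<^sup>2}" by blast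
  ultimately show ?thesis by (rule finite_subset[rotated])
next
  case False
  hence "\<not> norm (snd M) \<le> r" if "M \<in> GG'" for M 
    using order_le_less_trans[of r 0 "norm (snd M)"] snd_GG'[OF that] False by (simp add: not_le not_less)
  hence e: "{M\<in>GG'. norm (snd M) \<le> r} = {}" by blast
  show ?thesis unfolding e by (rule finite.emptyI)
qed


section \<open>The domain of discontinuity\<close>

lemma act_infinity_diff:
  assumes "su11 M" "snd M \<noteq> 0" "den M w \<noteq> 0"
  shows "act M w - pole (pinv M) = - 1 / (cnj (snd M) * den M w)"
proof (cases M)
  case (Pair a b)
  have "a * cnj a - b * cnj b = 1" using assms Pair by simp
  hence "num M w * cnj b - a * den M w = -1" using Pair by (simp add: algebra_simps) 
  thus ?thesis using assms Pair unfolding act_def pole_pinv by (simp add: divide_simps)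
qed

lemma GG_imp_schottky_mob:
  assumes "M \<in> GG"
  shows "\<exists>\<gamma>\<in>schottky_group g \<eta> \<theta>. (\<forall>z. mden \<gamma> z = 0 \<longleftrightarrow> den M z = 0) \<and> (\<forall>z. mapp \<gamma> z = act M z) \<and> 
    (\<forall>z. mderiv \<gamma> z = 1/(den M z)^2) \<and> (\<forall>z. mob \<gamma> z = (if den M z = 0 then None else Some (act M z)))"
proof -
  obtain t where "t \<noteq> 0" "smat t (emb M) \<in> schottky_group g \<eta> \<theta>" using GG_imp_schottky[OF assms] by blast
  thus ?thesis using GG_su[OF assms]
    by (intro bexI[of _ "smat t (emb M)"]) (simp_all add: mden_smat_emb mapp_smat_emb mderiv_smat_emb mob_smat_emb)
qed

lemma schottky_imp_GG_mob:
  assumes "\<gamma> \<in> schottky_group g \<eta> \<theta>"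
  shows "\<exists>M\<in>GG. (\<forall>z. mden \<gamma> z = 0 \<longleftrightarrow> den M z = 0) \<and> (\<forall>z. mapp \<gamma> z = act M z) \<and> 
    (\<forall>z. mderiv \<gamma> z = 1/(den M z)^2) \<and> (\<forall>z. mob \<gamma> z = (if den M z = 0 then None else Some (act M z)))"
proof -
  obtain t M where "t \<noteq> 0" "M \<in> GG" "\<gamma> = smat t (emb M)" using schottky_imp_GG[OF assms] by blast
  thus ?thesis using GG_su[of M]
    by (intro bexI[of _ M]) (simp_all add: mden_smat_emb mapp_smat_emb mderiv_smat_emb mob_smat_emb)
qed

lemma mob_GG_inj:
  assumes "M \<in> GG" "N \<in> GG" 
    "\<And>z. (if den M z = 0 then None else Some (act M z)) = (if den N z = 0 then None else Some (act N z))"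
  shows "M = N"
proof (rule act_zero_inj)
  have "den M 0 \<noteq> 0" "den N 0 \<noteq> 0" using den_nonzero GG_su assms by auto
  thus "act M 0 = act N 0" using assms(3)[of 0] by simp
qed (use assms in auto)

text \<open>Limit points of the group are the accumulation points of the poles, i.e. of the orbit of infinity.\<close>

lemma Omega_iff: "z \<in> \<Omega> \<longleftrightarrow> (\<exists>e>0. finite {M\<in>GG'. pole M \<in> ball z e})"
proof
  assume "z \<in> \<Omega>"
  then obtain e where e: "e > 0" 
    "finite (mob ` {\<gamma>\<in>schottky_group g \<eta> \<theta>. \<exists>w\<in>ball z e. mden \<gamma> w \<noteq> 0 \<and> mapp \<gamma> w \<in> ball z e})" (is "finite (mob ` ?S)")
    unfolding disc_domain_def mem_Collect_eq by (elim exE conjE)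
  define X where "X = {M\<in>GG'. pole M \<in> ball z e}"
  have "finite X"
  proof (cases "X = {}")
    case False
    \<comment> \<open>With one element \<open>M0\<close> of \<open>X\<close> fixed, each
      \<open>pmul (pinv M0) M\<close> sends the point \<open>pole M\<close> of the ball to the point
      \<open>pole M0\<close> of the ball; this turns finiteness of return elements into finiteness
      of \<open>X\<close>.\<close>
    then obtain M0 where M0: "M0 \<in> X" by blast
    define f where "f = (\<lambda>M z. if den (pmul (pinv M0) M) z = 0 then None else Some (act (pmul (pinv M0) M) z))"
    have "f M \<in> mob ` ?S" if "M \<in> X" for M
    proof -
      have GG: "pmul (pinv M0) M \<in> GG" using that M0 GG_mul GG_inv unfolding X_def by blast
      obtain \<gamma> where \<gamma>: "\<gamma>\<in>schottky_group g \<eta> \<theta>" "\<And>z. mden \<gamma> z = 0 \<longleftrightarrow> den (pmul (pinv M0) M) z = 0"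
         "\<And>z. mapp \<gamma> z = act (pmul (pinv M0) M) z" "\<And>w. mob \<gamma> w = f M w"
        using GG_imp_schottky_mob[OF GG] unfolding f_def by metis
      have MG: "M \<in> GG'" "M0 \<in> GG'" using that M0 unfolding X_def by blast+
      have d0: "den M (pole M) = 0" using den_pole[OF snd_GG'[OF MG(1)]] by simp
      have n: "num M (pole M) \<noteq> 0" using num_den_zero d0 GG_su MG by blast
      have b0: "snd (pinv M0) \<noteq> 0" using snd_GG'[OF MG(2)] by (cases M0) simp
      have "den (pmul (pinv M0) M) (pole M) \<noteq> 0" "act (pmul (pinv M0) M) (pole M) = pole M0"
        using n b0 unfolding act_def den_pmul' num_pmul' d0 pole_pinv(2)[of M0] by auto
      moreover have "pole M \<in> ball z e" "pole M0 \<in> ball z e" using that M0 unfolding X_def by blast+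
      ultimately have "\<gamma> \<in> ?S" using \<gamma>(1-3) by (intro CollectI conjI bexI[of _ "pole M"]) simp_all
      moreover have "f M = mob \<gamma>" using \<gamma>(4) by (intro ext) simp
      ultimately show ?thesis by (rule image_eqI[rotated])
    qed
    hence "f ` X \<subseteq> mob ` ?S" by (rule image_subsetI)
    hence fin: "finite (f ` X)" using e(2) by (rule finite_subset)
    have "inj_on f X"
    proof (rule inj_onI)
      fix M N assume MN: "M \<in> X" "N \<in> X" "f M = f N"
      have "pmul (pinv M0) M = pmul (pinv M0) N"
      proof (rule mob_GG_inj)
        show "pmul (pinv M0) M \<in> GG" "pmul (pinv M0) N \<in> GG" using MN(1,2) M0 unfolding X_def by (auto intro: GG_mul GG_inv)
      qed (use fun_cong[OF MN(3)] in \<open>simp only: f_def\<close>)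
      hence "pmul M0 (pmul (pinv M0) M) = pmul M0 (pmul (pinv M0) N)" by simp
      thus "M = N" using M0 unfolding X_def by (simp add: pmul_assoc[symmetric] pinv_right GG_su)
    qed
    with fin show ?thesis by (rule finite_imageD)
  qed simp
  thus "\<exists>e>0. finite {M\<in>GG'. pole M \<in> ball z e}" using e(1) unfolding X_def by (intro exI[of _ e] conjI)
next
  assume "\<exists>e>0. finite {M\<in>GG'. pole M \<in> ball z e}"
  then obtain e where e: "e > 0" "finite {M\<in>GG'. pole M \<in> ball z e}" by blast
  define r where "r = e/2"
  have r: "r > 0" using e r_def by simp
  \<comment> \<open>Off this finite set both \<open>pole M\<close> and the image of infinity are far
    from \<open>z\<close> and \<open>snd M\<close> is large. The image of the small ball is then
    concentrated near the image of infinity and misses the ball.\<close>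
  define Y where "Y = {M\<in>GG'. pole M \<in> ball z e} \<union> pinv ` {M\<in>GG'. pole M \<in> ball z e} \<union> {M\<in>GG'. norm (snd M) \<le> 1/r} \<union> {(1,0)}"
  have "finite Y" unfolding Y_def using e finite_snd_le by auto
  have Y: "M \<in> Y" if M: "M \<in> GG" "den M w \<noteq> 0" "w \<in> ball z r" "act M w \<in> ball z r" for M w
  proof (rule ccontr)
    assume n: "M \<notin> Y"
    hence MG: "M \<in> GG'" using M Y_def by auto
    have b: "snd M \<noteq> 0" using snd_GG' MG by blast
    have 1: "pole M \<notin> ball z e" using n MG unfolding Y_def by blast
    have "pinv M \<in> GG'" using MG pinv_GG' by blast
    hence 2: "pole (pinv M) \<notin> ball z e" using n unfolding Y_def by (metis (mono_tags, lifting) UnI1 UnI2 image_eqI mem_Collect_eq pinv_pinv)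
    have 3: "norm (snd M) > 1/r" using n MG unfolding Y_def by force
    have "dist z (pole M) \<le> dist z w + dist w (pole M)" by (rule dist_triangle)
    hence 4: "norm (w - pole M) \<ge> r" using 1 M unfolding r_def by (auto simp: dist_norm)
    have "dist z (pole (pinv M)) \<le> dist z (act M w) + dist (act M w) (pole (pinv M))" by (rule dist_triangle)
    hence "r \<le> norm (act M w - pole (pinv M))" using 2 M unfolding r_def by (auto simp: dist_norm)
    also have "\<dots> = 1 / (norm (snd M) * norm (den M w))"
      using act_infinity_diff[OF GG_su[OF M(1)] b M(2)] by (simp add: norm_divide norm_mult)
    also have "norm (den M w) = norm (snd M) * norm (w - pole M)" using den_pole[OF b] by (simp add: norm_mult)
    also have "1 / (norm (snd M) * (norm (snd M) * norm (w - pole M))) \<le> 1 / (norm (snd M) * (norm (snd M) * r))"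
      using b r 4 by (intro divide_left_mono mult_left_mono mult_pos_pos) auto
    also have "\<dots> < 1 / (1/r)"
    proof -
      have "norm (snd M) * r > 1" using 3 r by (simp add: field_simps)
      hence "norm (snd M) * 1 < norm (snd M) * (norm (snd M) * r)" using b by (intro mult_strict_left_mono) auto
      hence "1/r < norm (snd M) * (norm (snd M) * r)" using 3 by linarith
      thus ?thesis by (intro divide_strict_left_mono mult_pos_pos) (use b r in auto)
    qed
    finally show False using r by simp
  qed
  define f where "f = (\<lambda>M z. if den M z = 0 then None else Some (act M z))"
  have "mob ` {\<gamma>\<in>schottky_group g \<eta> \<theta>. \<exists>w\<in>ball z r. mden \<gamma> w \<noteq> 0 \<and> mapp \<gamma> w \<in> ball z r} \<subseteq> f ` Y"
  proof (rule image_subsetI)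
    fix \<gamma> assume "\<gamma> \<in> {\<gamma>\<in>schottky_group g \<eta> \<theta>. \<exists>w\<in>ball z r. mden \<gamma> w \<noteq> 0 \<and> mapp \<gamma> w \<in> ball z r}"
    then obtain w where \<gamma>: "\<gamma> \<in> schottky_group g \<eta> \<theta>" "w \<in> ball z r" "mden \<gamma> w \<noteq> 0" "mapp \<gamma> w \<in> ball z r" 
      unfolding mem_Collect_eq by (elim bexE conjE)
    obtain M where M: "M \<in> GG" "\<And>z. mden \<gamma> z = 0 \<longleftrightarrow> den M z = 0" "\<And>z. mapp \<gamma> z = act M z" "\<And>z. mob \<gamma> z = f M z"
      using schottky_imp_GG_mob[OF \<gamma>(1)] unfolding f_def by metis
    have "M \<in> Y" using Y[of M w] M \<gamma> by simp
    moreover have "mob \<gamma> = f M" using M(4) by (intro ext) simp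
    ultimately show "mob \<gamma> \<in> f ` Y" by (rule image_eqI[rotated])
  qed
  hence "finite (mob ` {\<gamma>\<in>schottky_group g \<eta> \<theta>. \<exists>w\<in>ball z r. mden \<gamma> w \<noteq> 0 \<and> mapp \<gamma> w \<in> ball z r})"
    using finite_imageI[OF \<open>finite Y\<close>] by (rule finite_subset)
  thus "z \<in> \<Omega>" unfolding disc_domain_def mem_Collect_eq using r by (intro exI[of _ r] conjI)
qed

lemma open_Omega: "open \<Omega>"
proof (rule openI)
  fix z assume "z \<in> \<Omega>"
  then obtain e where e: "e > 0" "finite {M\<in>GG'. pole M \<in> ball z e}" unfolding Omega_iff by blast
  have "w \<in> \<Omega>" if "w \<in> ball z (e/2)" for w
  proof -
    have "ball w (e/2) \<subseteq> ball z e"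
    proof
      fix x assume "x \<in> ball w (e/2)"
      thus "x \<in> ball z e" using that dist_triangle[of z x w] by auto
    qed
    hence "{M\<in>GG'. pole M \<in> ball w (e/2)} \<subseteq> {M\<in>GG'. pole M \<in> ball z e}" by blast
    hence "finite {M\<in>GG'. pole M \<in> ball w (e/2)}" using e(2) finite_subset by blast
    thus ?thesis unfolding Omega_iff using e(1) by (intro exI[of _ "e/2"]) auto
  qed
  thus "\<exists>e>0. ball z e \<subseteq> \<Omega>" using e(1) by (intro exI[of _ "e/2"]) auto
qed

lemma norm_pole:
  assumes "M \<in> GG'" shows "(norm (pole M))\<^sup>2 = 1 + 1/(norm (snd M))\<^sup>2"
proof -
  have "(norm (fst M))\<^sup>2 = 1 + (norm (snd M))\<^sup>2" using su11_norm[of "fst M" "snd M"] GG_su assms by simp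
  thus ?thesis using snd_GG'[OF assms] by (simp add: pole_def norm_divide power_divide field_simps)
qed

text \<open>By \<open>norm_pole\<close>, poles whose modulus stays away from \<open>1\<close> have
  bounded \<open>snd M\<close>, which leaves finitely many elements. So limit points lie on the unit
  circle.\<close>

lemma norm_neq_1_Omega:
  assumes "norm z \<noteq> 1" shows "z \<in> \<Omega>"
proof -
  define e where "e = \<bar>norm z - 1\<bar> / 2"
  have e: "e > 0" using assms e_def by simp
  have "norm (snd M) \<le> 1/e" if M: "M \<in> GG'" "pole M \<in> ball z e" for M
  proof -
    define p where "p = norm (pole M)"
    have b: "norm (snd M) > 0" using snd_GG'[OF M(1)] by simp
    have p2: "p^2 = 1 + 1/(norm (snd M))\<^sup>2" using norm_pole[OF M(1)] p_def by simp
    have "p \<ge> 1" using p2 power2_le_imp_le[of 1 p] unfolding p_def by simp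
    have "\<bar>norm z - p\<bar> < e" using M(2) norm_triangle_ineq3[of z "pole M"] unfolding p_def by (simp add: dist_norm)
    hence "\<bar>p - 1\<bar> > e" unfolding e_def using assms by (auto simp: abs_if split: if_splits)
    hence "p > 1 + e" using \<open>p \<ge> 1\<close> by auto
    hence "p^2 > (1+e)^2" using e by (intro power_strict_mono) auto
    hence "1/(norm (snd M))\<^sup>2 > e^2" unfolding p2 using e by (simp add: power2_sum)
    hence "(norm (snd M))\<^sup>2 < (1/e)\<^sup>2" using b e by (simp add: field_simps)
    thus ?thesis by (intro less_imp_le power2_less_imp_less[of "norm (snd M)"]) (use e in auto)
  qed
  hence "{M\<in>GG'. pole M \<in> ball z e} \<subseteq> {M\<in>GG'. norm (snd M) \<le> 1/e}" by auto
  thus ?thesis unfolding Omega_iff using e finite_snd_le finite_subset by blast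
qed

lemma Omega_act:
  assumes "z \<in> \<Omega>" "M \<in> GG" "den M z \<noteq> 0"
  shows "act M z \<in> \<Omega>"
proof -
  obtain e where e: "e > 0" "finite {M\<in>GG'. pole M \<in> ball z e}" using assms(1) unfolding Omega_iff by blast
  define M' where "M' = pinv M"
  have su: "su11 M" "su11 M'" using GG_su assms(2) GG_inv unfolding M'_def by auto
  define w where "w = act M z"
  have dw: "den M' w \<noteq> 0" unfolding w_def M'_def using den_pinv_act[OF su(1) assms(3)] assms(3) by simp
  have zw: "act M' w = z" unfolding w_def M'_def using act_pinv_act su assms by simp
  have "isCont (act M') w" using act_deriv[OF su(2) dw] by (rule DERIV_isCont)
  then obtain d1 where d1: "d1 > 0" "\<And>x. dist x w < d1 \<Longrightarrow> dist (act M' x) z < e"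
    unfolding continuous_at_eps_delta zw using e(1) by meson
  have "den M' = (\<lambda>z. cnj (snd M') * z + cnj (fst M'))" by (cases M') auto
  hence "isCont (den M') w" by simp
  then obtain d2 where d2: "d2 > 0" "\<And>x. dist x w < d2 \<Longrightarrow> dist (den M' x) (den M' w) < norm (den M' w)"
    unfolding continuous_at_eps_delta using dw zero_less_norm_iff by meson
  define d where "d = min d1 d2"
  have d: "d > 0" "\<And>x. dist x w < d \<Longrightarrow> act M' x \<in> ball z e \<and> den M' x \<noteq> 0"
    using d1 d2 unfolding d_def by (auto simp: dist_commute) (metis dist_0_norm less_irrefl)
  define X where "X = {N\<in>GG'. pole N \<in> ball w d}"
  \<comment> \<open>The pole of \<open>pmul N M\<close> is the preimage of \<open>pole N\<close>
    under \<open>M\<close>. Apart from the identity, poles near \<open>act M z\<close> thus inject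
    into poles near \<open>z\<close>.\<close>
  have "(\<lambda>N. pmul N M) ` X \<subseteq> insert (1,0) {M\<in>GG'. pole M \<in> ball z e}"
  proof (rule image_subsetI)
    fix N assume N: "N \<in> X"
    have p: "act M' (pole N) \<in> ball z e" "den M' (pole N) \<noteq> 0" using d(2) N unfolding X_def by (auto simp: dist_commute)
    have NG: "N \<in> GG'" "snd N \<noteq> 0" using N snd_GG' unfolding X_def by blast+
    have dM: "den M (act M' (pole N)) \<noteq> 0" using den_pinv_act[OF su(2) p(2)] p(2) unfolding M'_def by simp
    have aM: "act M (act M' (pole N)) = pole N" using act_pinv_act[OF su(2) p(2)] unfolding M'_def by simp
    have "den (pmul N M) (act M' (pole N)) = 0" using dM aM by (simp add: den_pmul den_pole[OF NG(2)])
    moreover have GGm: "pmul N M \<in> GG" using NG assms GG_mul by blast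
    ultimately show "pmul N M \<in> insert (1,0) {M\<in>GG'. pole M \<in> ball z e}"
      using p(1) snd_GG'[of "pmul N M"] den_pole[of "pmul N M"] by fastforce
  qed
  hence fin: "finite ((\<lambda>N. pmul N M) ` X)" using e(2) finite_subset by blast
  have "inj_on (\<lambda>N. pmul N M) X"
  proof (rule inj_onI)
    fix A B assume "pmul A M = pmul B M"
    hence "pmul (pmul A M) (pinv M) = pmul (pmul B M) (pinv M)" by simp
    thus "A = B" using su by (simp add: pmul_assoc pinv_right)
  qed
  hence "finite X" using fin finite_imageD by blast
  thus ?thesis unfolding Omega_iff X_def w_def[symmetric] using d(1) by blast
qed

lemma outside_Omega:
  assumes "1 \<le> s" "s \<le> s1" "z \<in> outside s" shows "z \<in> \<Omega>"
proof -
  define S where "S = (\<lambda>l. norm (z - cen l) - rad s l) ` Ls"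
  have S: "finite S" "S \<noteq> {}" unfolding S_def using g_pos by (auto simp: Ls_def simp del: cen.simps rad.simps)
  have pos: "Min S > 0" using S assms(3) by (auto simp: S_def outside_def simp del: cen.simps rad.simps)
  have "pole M \<notin> ball z (Min S)" if M: "M \<in> GG'" for M
  proof -
    obtain l where l: "l \<in> Ls" "norm (pole M - cen l) < rad s l" using pole_GG'[OF M assms(1,2)] by blast
    have "Min S \<le> norm (z - cen l) - rad s l" using S l by (intro Min_le) (auto simp: S_def)
    also have "\<dots> \<le> norm (z - pole M)" using l norm_triangle_ineq[of "z - pole M" "pole M - cen l"] by simp
    finally show ?thesis by (simp add: dist_norm)
  qed
  hence "{M\<in>GG'. pole M \<in> ball z (Min S)} = {}" by blast
  hence "finite {M\<in>GG'. pole M \<in> ball z (Min S)}" by (metis finite.emptyI)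
  thus ?thesis unfolding Omega_iff using pos by blast
qed

text \<open>For the parameter \<open>s1\<close> the circle of \<open>(k,False)\<close> has shrunk to
  radius \<open>\<rho> / s1\<close>, so the annulus around it lies in the open domain. The generator
  carries the annulus around the circle of \<open>(k,True)\<close> onto this one.\<close>

lemma annulus_Omega:
  assumes "l \<in> Ls" "\<rho>/s1 < norm (z - cen l)" "norm (z - cen l) < s1 * \<rho>" shows "z \<in> \<Omega>"
proof -
  have F: "z \<in> \<Omega>" if z: "(k,False) \<in> Ls" "\<rho>/s1 < norm (z - cen (k,False))" "norm (z - cen (k,False)) < s1 * \<rho>" for z k
  proof (rule outside_Omega)
    show "z \<in> outside s1" unfolding outside_def
    proof safe
      fix k' b' assume kb: "(k',b') \<in> Ls"
      show "rad s1 (k',b') < norm (z - cen (k',b'))"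
      proof (cases "(k',b') = (k,False)")
        case True thus ?thesis using z by simp
      next
        case False thus ?thesis using disc_sep[of s1 "(k,False)" "(k',b')" z] z kb s1(1) by (simp del: cen.simps rad.simps)
      qed
    qed
  qed (use s1(1) in auto)
  obtain k b where l: "l = (k,b)" by (cases l)
  show ?thesis
  proof (cases b)
    case False thus ?thesis using F[of k z] assms l by simp
  next
    case True
    have l: "l = (k,True)" using l True by simp
    have pos: "norm (z - cen l) > 0" using assms(2) rho_pos s1(1) by (meson divide_pos_pos less_trans zero_less_one)
    hence ne: "z \<noteq> cen l" by auto
    define w where "w = act (lm l) z"
    have nw: "norm (w - cen (k,False)) = \<rho>\<^sup>2 / norm (z - cen l)" unfolding w_def using dist_act_lm[OF ne] l by simp
    have k: "(k,False) \<in> Ls" using assms l by simp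
    have "w \<in> \<Omega>"
    proof (rule F[OF k])
      show "\<rho>/s1 < norm (w - cen (k,False))" unfolding nw using assms(3) pos rho_pos s1(1)
        by (simp add: field_simps power2_eq_square)
      show "norm (w - cen (k,False)) < s1 * \<rho>" unfolding nw using assms(2) pos rho_pos s1(1)
        by (simp add: field_simps power2_eq_square)
    qed
    moreover have d: "den (lm l) z \<noteq> 0" using ne den_lm_eq_0_iff by blast
    ultimately have "act (pinv (lm l)) w \<in> \<Omega>" 
      using GG_inv[OF lm_GG[OF assms(1)]] den_pinv_act[OF lm_su d] unfolding w_def by (intro Omega_act[of "act (lm l) z"]) auto
    thus ?thesis unfolding w_def using act_pinv_act[OF lm_su d] by simp
  qed
qed

lemma coutside_Omega:
  assumes "1 \<le> s" "s < s1" "z \<in> coutside s" shows "z \<in> \<Omega>"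
proof (cases "z \<in> outside s")
  case True thus ?thesis using outside_Omega assms by simp
next
  case False
  then obtain l where l: "l \<in> Ls" "\<not> rad s l < norm (z - cen l)" unfolding outside_def mem_Collect_eq by (simp only: Ball_def not_all not_imp) (elim exE conjE)
  moreover have "rad s l \<le> norm (z - cen l)" using assms(3) l(1) unfolding coutside_def mem_Collect_eq by (rule bspec)
  ultimately have l: "l \<in> Ls" "norm (z - cen l) = rad s l" by (simp_all only: not_less order_antisym_conv)
  have "\<rho>/s1 < \<rho>/s" using assms rho_pos by (intro divide_strict_left_mono) auto
  moreover have "\<rho>/s \<le> s * \<rho>" using assms rho_pos by (simp add: field_simps power2_eq_square[symmetric])
  moreover have "s * \<rho> < s1 * \<rho>" using assms rho_pos by simp
  ultimately have "\<rho>/s1 < rad s l" "rad s l < s1 * \<rho>" by (cases l; auto)+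
  thus ?thesis using annulus_Omega[OF l(1)] l(2) by simp
qed

text \<open>Raising the parameter from \<open>1\<close> to \<open>s\<close> takes away only annuli
  around the circles of the letters \<open>(k,True)\<close>; one application of the generator
  carries such an annulus into the part gained around the circle of
  \<open>(k,False)\<close>.\<close>

lemma coutside_reduce:
  assumes "1 \<le> s" "s < s1" "w \<in> coutside 1"
  shows "\<exists>N\<in>GG. den N w \<noteq> 0 \<and> act N w \<in> coutside s"
proof (cases "w \<in> coutside s")
  case True thus ?thesis by (intro bexI[of _ "(1,0)"]) (auto intro: GG.one)
next
  case False
  then obtain l where l: "l \<in> Ls" "norm (w - cen l) < rad s l"
    unfolding coutside_def mem_Collect_eq by (simp only: Ball_def not_all not_imp not_le) (elim exE conjE)
  have w1: "rad 1 l \<le> norm (w - cen l)" using assms(3) l(1) unfolding coutside_def mem_Collect_eq by (rule bspec)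
  hence w1: "\<rho> \<le> norm (w - cen l)" by (cases l) (simp split: if_splits)
  have ne: "w \<noteq> cen l" using w1 rho_pos by auto
  define v where "v = act (lm l) w"
  have nv: "norm (v - cen (linv l)) = \<rho>\<^sup>2 / norm (w - cen l)" unfolding v_def using dist_act_lm[OF ne] .
  have pos: "norm (w - cen l) > 0" using ne by simp
  have "\<rho>\<^sup>2 / norm (w - cen l) \<le> \<rho>" using w1 pos rho_pos by (simp add: field_simps power2_eq_square)
  also have "\<rho> \<le> s1 * \<rho>" using rho_pos s1(1) by simp
  finally have up: "norm (v - cen (linv l)) \<le> s1 * \<rho>" using nv by simp
  have "\<rho>\<^sup>2 / norm (w - cen l) \<ge> \<rho>\<^sup>2 / rad s l" using l pos rho_pos rad_pos[OF assms(1)] by (intro divide_left_mono mult_pos_pos) auto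
  hence lo: "norm (v - cen (linv l)) \<ge> rad s (linv l)" using nv rad_linv[OF assms(1)] by simp
  have "v \<in> coutside s" unfolding coutside_def
  proof (intro CollectI ballI)
    fix l' assume "l' \<in> Ls"
    thus "rad s l' \<le> norm (v - cen l')"
      using lo disc_sep[of s "linv l" l' v] up assms linv_in[OF l(1)] by (cases "l' = linv l") auto
  qed
  moreover have "den (lm l) w \<noteq> 0" using ne den_lm_eq_0_iff by blast
  ultimately show ?thesis using lm_GG[OF l(1)] unfolding v_def by blast
qed

text \<open>The circle of radius \<open>\<rho>\<close> about \<open>cen l\<close> is the isometric
  circle of \<open>lm l\<close>, the locus \<open>|den (lm l)| = 1\<close>.\<close>

lemma den_ge_1_coutside:
  assumes "\<And>l. l \<in> Ls \<Longrightarrow> norm (den (lm l) w) \<ge> 1" shows "w \<in> coutside 1"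
  unfolding coutside_def
proof safe
  fix k b assume "(k,b) \<in> Ls"
  hence "1 \<le> norm (den (lm (k,b)) w)" using assms by blast
  also have "\<dots> = norm (w - cen (k,b)) / \<rho>" unfolding den_lm using rho_pos by (simp add: norm_mult norm_divide norm_power del: cen.simps)
  finally show "rad 1 (k,b) \<le> norm (w - cen (k,b))" using rho_pos by (cases b) (simp_all add: field_simps del: cen.simps)
qed

lemma finite_den_le:
  assumes "z \<in> \<Omega>" shows "finite {M\<in>GG. norm (den M z) \<le> r}"
proof -
  obtain e where e: "e > 0" "finite {M\<in>GG'. pole M \<in> ball z e}" using assms(1) unfolding Omega_iff by blast
  have "norm (snd M) \<le> r/e" if "M \<in> GG'" "pole M \<notin> ball z e" "norm (den M z) \<le> r" for M
  proof -
    have "norm (snd M) * e \<le> norm (snd M) * norm (z - pole M)" using that e by (intro mult_left_mono) (auto simp: dist_norm)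
    also have "\<dots> = norm (den M z)" using den_pole[OF snd_GG'[OF that(1)]] by (simp add: norm_mult)
    finally show ?thesis using that(3) e by (simp add: field_simps)
  qed
  hence "{M\<in>GG. norm (den M z) \<le> r} \<subseteq> {(1,0)} \<union> {M\<in>GG'. pole M \<in> ball z e} \<union> {M\<in>GG'. norm (snd M) \<le> r/e}" by blast
  thus ?thesis by (rule finite_subset) (intro finite_UnI e(2) finite_snd_le finite.intros)
qed

text \<open>The point \<^term>\<open>c\<close> represents the orbit of infinity.\<close>

lemma Omega_reduce:
  assumes "1 \<le> s" "s < s1" "z \<in> \<Omega>"
  shows "\<exists>N\<in>GG. den N z \<noteq> 0 \<and> (act N z \<in> coutside s \<or> act N z = c)"
proof (cases "\<exists>M\<in>GG. den M z = 0")
  case True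
  then obtain M where M: "M \<in> GG" "den M z = 0" by blast
  have n: "num M z \<noteq> 0" using num_den_zero M GG_su by blast
  define N where "N = pmul (lm (0,False)) M"
  have "N \<in> GG" unfolding N_def using M g_pos by (intro GG.step) auto
  moreover have "den N z = cnj (snd (lm (0,False))) * num M z" "num N z = fst (lm (0,False)) * num M z" 
    unfolding N_def den_pmul' num_pmul' M(2) by simp_all
  hence "den N z \<noteq> 0" "act N z = c" using n rho_pos by (auto simp: act_def)
  ultimately show ?thesis by blast
next
  case False
  \<comment> \<open>Ford's argument: an element minimising \<open>|den M z|\<close> brings
    \<open>z\<close> to a point where no letter decreases the denominator further, that is outside
    all isometric circles. Only finitely many elements compete.\<close>
  define S where "S = {M\<in>GG. norm (den M z) \<le> 1}"
  have S: "finite S" "(1,0) \<in> S" unfolding S_def using finite_den_le[OF assms(3)] GG.one by auto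
  obtain M where M: "M \<in> S" "\<And>N. N \<in> S \<Longrightarrow> norm (den M z) \<le> norm (den N z)"
    using arg_min_if_finite[of S "\<lambda>M. norm (den M z)"] S by (metis empty_iff not_less)
  have MG: "M \<in> GG" "norm (den M z) \<le> 1" using M unfolding S_def by auto
  have d: "den M z \<noteq> 0" using False MG by blast
  have "act M z \<in> coutside 1"
  proof (rule den_ge_1_coutside)
    fix l assume l: "l \<in> Ls"
    have "norm (den M z) \<le> norm (den (pmul (lm l) M) z)"
      using M(2)[of "pmul (lm l) M"] MG GG.step[OF MG(1) l] unfolding S_def by (cases "norm (den (pmul (lm l) M) z) \<le> 1") auto
    also have "\<dots> = norm (den (lm l) (act M z)) * norm (den M z)" using d by (simp add: den_pmul norm_mult)
    finally show "1 \<le> norm (den (lm l) (act M z))" using d by simp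
  qed
  then obtain N where N: "N\<in>GG" "den N (act M z) \<noteq> 0" "act N (act M z) \<in> coutside s" 
    using coutside_reduce assms by blast
  thus ?thesis using d MG by (intro bexI[of _ "pmul N M"]) (auto simp: act_pmul den_pmul GG_mul)
qed

lemma zero_Omega: "0 \<in> \<Omega>" by (rule norm_neq_1_Omega) simp

lemma c_Omega: "c \<in> \<Omega>" using norm_c_gt by (intro norm_neq_1_Omega) auto

text \<open>The disc and its exterior are joined by the rays through those points of the unit circle
  that belong to the domain; all the pieces \<open>U w\<close> contain \<open>0\<close>.\<close>

lemma connected_Omega: "connected \<Omega>"
proof -
  define U where "U = (\<lambda>w. ball 0 1 \<union> {z::complex. norm z > 1} \<union> {z. \<exists>t>0. z = of_real t * w})"
  have sub: "U w \<subseteq> \<Omega>" if w: "w \<in> \<Omega>" "norm w = 1" for w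
  proof
    fix z assume z: "z \<in> U w"
    show "z \<in> \<Omega>"
    proof (cases "norm z = 1")
      case False thus ?thesis by (rule norm_neq_1_Omega)
    next
      case True
      hence "z = w" using z w unfolding U_def by (auto simp: norm_mult)
      thus ?thesis using w by simp
    qed
  qed
  have con: "connected (U w)" if w: "norm w = 1" for w
  proof -
    have e: "{z::complex. norm z > 1} = - cball 0 1" by auto
    have c1: "connected {z::complex. norm z > 1}"
      unfolding e by (rule connected_complement_bounded_convex) auto
    have c2: "connected {z. \<exists>t>0. z = complex_of_real t * w}"
    proof -
      have "{z. \<exists>t>0. z = complex_of_real t * w} = (\<lambda>t. of_real t * w) ` {0<..}" by auto
      moreover have "connected ((\<lambda>t. complex_of_real t * w) ` {0<..})"
        by (intro connected_continuous_image continuous_intros connected_Ioi)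
      ultimately show ?thesis by simp
    qed
    have h: "of_real (1/2) * w \<in> ball 0 1 \<inter> {z. \<exists>t>0. z = complex_of_real t * w}"
      using w by (auto simp: norm_mult intro!: exI[of _ "1/2"])
    have k: "of_real 2 * w \<in> {z::complex. norm z > 1} \<inter> {z. \<exists>t>0. z = complex_of_real t * w}"
      using w by (auto simp: norm_mult intro!: exI[of _ "2"])
    have "connected (ball 0 1 \<union> {z. \<exists>t>0. z = complex_of_real t * w})"
      using h by (intro connected_Un c2 connected_ball) blast
    hence "connected ((ball 0 1 \<union> {z. \<exists>t>0. z = complex_of_real t * w}) \<union> {z::complex. norm z > 1})"
    proof (rule connected_Un)
      show "(ball 0 1 \<union> {z. \<exists>t>0. z = complex_of_real t * w}) \<inter> {z::complex. norm z > 1} \<noteq> {}"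
        using k by blast
    qed (use c1 in auto)
    moreover have "U w = (ball 0 1 \<union> {z. \<exists>t>0. z = complex_of_real t * w}) \<union> {z::complex. norm z > 1}"
      unfolding U_def by blast
    ultimately show ?thesis by simp
  qed
  have one: "1 \<in> \<Omega>"
    using cis_outside[of 0] eta_pos outside_Omega[of 1 1] s1(1) by simp
  have eq: "\<Omega> = \<Union> (U ` {w\<in>\<Omega>. norm w = 1})"
  proof
    show "\<Omega> \<subseteq> \<Union> (U ` {w\<in>\<Omega>. norm w = 1})"
    proof
      fix z assume z: "z \<in> \<Omega>"
      show "z \<in> \<Union> (U ` {w\<in>\<Omega>. norm w = 1})"
      proof (cases "norm z = 1")
        case True
        have "z \<in> U z" unfolding U_def by (auto intro!: exI[of _ 1])
        thus ?thesis using z True by blast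
      next
        case False
        hence "z \<in> U 1" unfolding U_def by auto
        thus ?thesis using one by auto
      qed
    qed
  qed (use sub in blast)
  show ?thesis
  proof (subst eq, rule connected_Union)
    show "connected s" if "s \<in> U ` {w\<in>\<Omega>. norm w = 1}" for s
      using that con by blast
    have "0 \<in> \<Inter> (U ` {w\<in>\<Omega>. norm w = 1})" unfolding U_def by auto
    thus "\<Inter> (U ` {w\<in>\<Omega>. norm w = 1}) \<noteq> {}" by blast
  qed
qed

section \<open>The rotation symmetry\<close>

lemma zeta_mod: "\<zeta> ^ (n mod g) = \<zeta> ^ n"
proof -
  have "\<zeta> ^ n = \<zeta> ^ (g * (n div g) + n mod g)" by (simp only: mult_div_mod_eq)
  also have "\<dots> = \<zeta> ^ (n mod g)" by (simp only: power_add power_mult zeta_g power_one mult_1)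
  finally show ?thesis ..
qed

lemma rot_cen: "\<zeta> * cen l = cen ((fst l + 1) mod g, snd l)"
  by (cases l) (simp only: cen.simps zeta_mod, simp)

lemma rot_outside:
  assumes "z \<in> outside s" shows "\<zeta> * z \<in> outside s"
proof -
  have "rad s l < norm (\<zeta> * z - cen l)" if l: "l \<in> Ls" for l
  proof -
    define l' where "l' = ((fst l + g - 1) mod g, snd l)"
    have l': "l' \<in> Ls" using g_pos by (simp add: l'_def)
    have lg: "fst l < g" using l by (cases l) simp
    have "((fst l + g - 1) mod g + 1) mod g = fst l"
    proof -
      have "((fst l + g - 1) mod g + 1) mod g = (fst l + g - 1 + 1) mod g" by (simp add: mod_simps)
      also have "fst l + g - 1 + 1 = fst l + g" using g_pos by simp
      finally show ?thesis using lg by simp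
    qed
    hence "\<zeta> * cen l' = cen l" using rot_cen[of l'] by (simp add: l'_def)
    hence "norm (\<zeta> * z - cen l) = norm (\<zeta> * (z - cen l'))" by (simp add: right_diff_distrib)
    hence e: "norm (\<zeta> * z - cen l) = norm (z - cen l')" by (simp add: norm_mult)
    have "rad s l' < norm (z - cen l')" using assms l' unfolding outside_def mem_Collect_eq by (rule bspec)
    moreover have "rad s l' = rad s l" by (cases l) (simp add: l'_def)
    ultimately show ?thesis using e by simp
  qed
  thus ?thesis unfolding outside_def by blast
qed

text \<open>Conjugation of \<open>M\<close> by the rotation with factor \<open>\<zeta>\<close>; on
  the generators it is the cyclic shift of the index.\<close>

definition rotm :: "su \<Rightarrow> su" where "rotm M = (fst M, \<zeta> * snd M)"

lemma rotm_pmul: "rotm (pmul A B) = pmul (rotm A) (rotm B)"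
  using zeta_cnj[of 1] by (cases A; cases B) (simp add: rotm_def algebra_simps)

lemma rotm_lm: "rotm (lm (k,b)) = lm ((k+1) mod g, b)"
  by (cases b) (simp_all only: lm.simps zeta_mod, simp_all add: rotm_def)

lemma rotm_GG: "M \<in> GG \<Longrightarrow> rotm M \<in> GG"
proof (induction rule: GG.induct)
  case one thus ?case by (simp add: rotm_def GG.one)
next
  case (step M l)
  obtain k b where l: "l = (k,b)" by (cases l)
  show ?case unfolding rotm_pmul l rotm_lm using step g_pos by (intro GG.step) auto
qed

lemma bij_rotm: "bij_betw rotm GG GG"
proof -
  have n: "(rotm ^^ n) M = (fst M, \<zeta>^n * snd M)" for n M
    by (induction n) (simp_all add: rotm_def)
  have id: "rotm ((rotm ^^ (g-1)) M) = M" "(rotm ^^ (g-1)) (rotm M) = M" for M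
  proof -
    have z: "\<zeta> * (\<zeta>^(g-1)) = 1" using zeta_g g_pos by (metis Suc_pred' power_Suc)
    show "rotm ((rotm ^^ (g-1)) M) = M" "(rotm ^^ (g-1)) (rotm M) = M" 
      using z unfolding n by (simp_all add: rotm_def mult.assoc[symmetric]) (simp add: mult.commute)
  qed
  have "(rotm ^^ n) M \<in> GG" if "M \<in> GG" for n M using that by (induction n) (auto intro: rotm_GG)
  thus ?thesis using id rotm_GG by (intro bij_betw_byWitness[where f' = "rotm ^^ (g-1)"]) auto
qed

lemma den_rotm: "den (rotm M) (\<zeta> * z) = den M z"
  using zeta_cnj[of 1] by (cases M) (simp add: rotm_def algebra_simps)

lemma num_rotm: "num (rotm M) (\<zeta> * z) = \<zeta> * num M z"
  by (cases M) (simp add: rotm_def algebra_simps)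

lemma act_rotm: "act (rotm M) (\<zeta> * z) = \<zeta> * act M z"
  unfolding act_def den_rotm num_rotm by simp

lemma pole_rotm: "pole (rotm M) = \<zeta> * pole M"
proof -
  have "cnj \<zeta> = 1/\<zeta>" using zeta_cnj[of 1] by (simp add: field_simps)
  thus ?thesis by (simp add: rotm_def pole_def)
qed

lemma rot_Omega: "\<zeta> * z \<in> \<Omega> \<longleftrightarrow> z \<in> \<Omega>"
proof -
  have 1: "\<zeta> * z \<in> \<Omega>" if z: "z \<in> \<Omega>" for z
  proof -
    obtain e where e: "e > 0" "finite {M\<in>GG'. pole M \<in> ball z e}" using z unfolding Omega_iff by blast
    have "{M\<in>GG'. pole M \<in> ball (\<zeta> * z) e} \<subseteq> rotm ` {M\<in>GG'. pole M \<in> ball z e}"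
    proof
      fix M assume M: "M \<in> {M\<in>GG'. pole M \<in> ball (\<zeta> * z) e}"
      hence "M \<in> rotm ` GG" using bij_rotm unfolding bij_betw_def by auto
      then obtain N where N: "N \<in> GG" "M = rotm N" by blast
      have "N \<noteq> (1,0)" using M N by (auto simp: rotm_def)
      have "norm (\<zeta> * z - \<zeta> * pole N) = norm (z - pole N)"
        unfolding right_diff_distrib[symmetric] by (simp add: norm_mult)
      moreover have "norm (\<zeta> * z - \<zeta> * pole N) < e" using M unfolding N pole_rotm[symmetric] by (simp add: dist_norm)
      ultimately have "pole N \<in> ball z e" by (simp add: dist_norm)
      thus "M \<in> rotm ` {M\<in>GG'. pole M \<in> ball z e}" using N \<open>N \<noteq> (1,0)\<close> by blast
    qed
    hence "finite {M\<in>GG'. pole M \<in> ball (\<zeta> * z) e}" using finite_imageI[OF e(2)] by (rule finite_subset)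
    thus ?thesis unfolding Omega_iff using e(1) by blast
  qed
  have "\<zeta>^n * z \<in> \<Omega>" if "z \<in> \<Omega>" for n z using that by (induction n) (auto simp: mult.assoc intro: 1)
  from this[of "\<zeta> * z" "g-1"] have "\<zeta> * z \<in> \<Omega> \<Longrightarrow> z \<in> \<Omega>"
    using zeta_g g_pos by (metis Suc_pred' mult.assoc mult_1 power_Suc2)
  thus ?thesis using 1 by blast
qed

end

section \<open>The kernel and its periods\<close>

lemma analytic_infsum_tail:
  fixes f :: "'a \<Rightarrow> complex \<Rightarrow> complex"
  assumes e: "e > 0" and bound: "\<And>M z. M \<in> A \<Longrightarrow> z \<in> ball z0 e \<Longrightarrow> norm (f M z) \<le> B M" and B: "B summable_on A"
    and hol: "\<And>M. M \<in> A \<Longrightarrow> f M holomorphic_on ball z0 e"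
  shows "(\<lambda>z. \<Sum>\<^sub>\<infinity>M\<in>A. f M z) analytic_on {z0}" 
    "((\<lambda>M. deriv (f M) z0) has_sum deriv (\<lambda>z. \<Sum>\<^sub>\<infinity>M\<in>A. f M z) z0) A"
    "\<And>z. z \<in> ball z0 e \<Longrightarrow> (\<lambda>M. f M z) summable_on A"
proof -
  define S where "S = (\<lambda>z. \<Sum>\<^sub>\<infinity>M\<in>A. f M z)"
  have ul: "uniform_limit (ball z0 e) (\<lambda>X z. \<Sum>M\<in>X. f M z) S (finite_subsets_at_top A)"
    unfolding S_def by (rule Weierstrass_m_test_general[OF bound B])
  have ev: "eventually (\<lambda>X. (\<lambda>z. \<Sum>M\<in>X. f M z) holomorphic_on ball z0 e) (finite_subsets_at_top A)"
  proof (rule eventually_finite_subsets_at_top_weakI)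
    fix X assume "finite X" "X \<subseteq> A"
    thus "(\<lambda>z. \<Sum>M\<in>X. f M z) holomorphic_on ball z0 e" by (intro holomorphic_on_sum hol) auto
  qed
  have sub: "cball z0 (e/2) \<subseteq> ball z0 e" using e by auto
  have "S holomorphic_on ball z0 (e/2)"
  proof (rule holomorphic_uniform_limit)
    show "uniform_limit (cball z0 (e/2)) (\<lambda>X z. \<Sum>M\<in>X. f M z) S (finite_subsets_at_top A)"
      by (rule uniform_limit_on_subset[OF ul sub])
    show "\<forall>\<^sub>F X in finite_subsets_at_top A. continuous_on (cball z0 (e/2)) (\<lambda>z. \<Sum>M\<in>X. f M z) \<and> 
            (\<lambda>z. \<Sum>M\<in>X. f M z) holomorphic_on ball z0 (e/2)"
      using ev
    proof eventually_elim
      case (elim X)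
      have "(\<lambda>z. \<Sum>M\<in>X. f M z) holomorphic_on cball z0 (e/2)" using elim sub by (rule holomorphic_on_subset)
      thus ?case using holomorphic_on_imp_continuous_on holomorphic_on_subset[OF _ ball_subset_cball] by blast
    qed
  qed auto
  thus "(\<lambda>z. \<Sum>\<^sub>\<infinity>M\<in>A. f M z) analytic_on {z0}" using e unfolding analytic_at_ball S_def by (intro exI[of _ "e/2"]) auto
  have "((\<lambda>X. (deriv ^^ 1) (\<lambda>z. \<Sum>M\<in>X. f M z) z0) \<longlongrightarrow> (deriv ^^ 1) S z0) (finite_subsets_at_top A)"
    by (rule higher_deriv_complex_uniform_limit[OF ul ev]) (use e in auto)
  moreover have "eventually (\<lambda>X. (deriv ^^ 1) (\<lambda>z. \<Sum>M\<in>X. f M z) z0 = (\<Sum>M\<in>X. deriv (f M) z0)) (finite_subsets_at_top A)"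
  proof (rule eventually_finite_subsets_at_top_weakI)
    fix X assume X: "finite X" "X \<subseteq> A"
    have "f M field_differentiable at z0" if "M \<in> X" for M
      using hol[of M] that X e holomorphic_on_imp_differentiable_at[of "f M" "ball z0 e" z0] by auto
    hence "((\<lambda>z. \<Sum>M\<in>X. f M z) has_field_derivative (\<Sum>M\<in>X. deriv (f M) z0)) (at z0)"
      by (intro DERIV_sum field_differentiable_derivI) auto
    thus "(deriv ^^ 1) (\<lambda>z. \<Sum>M\<in>X. f M z) z0 = (\<Sum>M\<in>X. deriv (f M) z0)" by (simp add: DERIV_imp_deriv)
  qed
  ultimately show "((\<lambda>M. deriv (f M) z0) has_sum deriv (\<lambda>z. \<Sum>\<^sub>\<infinity>M\<in>A. f M z) z0) A"
    unfolding has_sum_def S_def by (simp add: tendsto_cong)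
  show "(\<lambda>M. f M z) summable_on A" if "z \<in> ball z0 e" for z
    by (rule abs_summable_summable, rule Infinite_Sum.summable_on_comparison_test[OF B]) (use bound that in auto)
qed

text \<open>Near a given point the summable bound holds for all but finitely many group elements.
  The terms in \<open>E\<close> are only known to be analytic at the centre and are added
  separately.\<close>

lemma analytic_infsum:
  fixes f :: "'a \<Rightarrow> complex \<Rightarrow> complex"
  assumes e: "e > 0" and E: "finite E" 
    and bound: "\<And>M z. M \<in> A - E \<Longrightarrow> z \<in> ball z0 e \<Longrightarrow> norm (f M z) \<le> B M" and B: "B summable_on (A - E)"
    and hol: "\<And>M. M \<in> A - E \<Longrightarrow> f M holomorphic_on ball z0 e" and ana: "\<And>M. M \<in> A \<inter> E \<Longrightarrow> f M analytic_on {z0}"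
  shows "(\<lambda>z. \<Sum>\<^sub>\<infinity>M\<in>A. f M z) analytic_on {z0}" 
    "((\<lambda>M. deriv (f M) z0) has_sum deriv (\<lambda>z. \<Sum>\<^sub>\<infinity>M\<in>A. f M z) z0) A"
    "\<And>z. z \<in> ball z0 e \<Longrightarrow> (\<lambda>M. f M z) summable_on A"
proof -
  have tail: "(\<lambda>z. \<Sum>\<^sub>\<infinity>M\<in>A-E. f M z) analytic_on {z0}"
    "((\<lambda>M. deriv (f M) z0) has_sum deriv (\<lambda>z. \<Sum>\<^sub>\<infinity>M\<in>A-E. f M z) z0) (A-E)"
    by (rule analytic_infsum_tail[OF e _ B]; use bound hol in blast)+
  have tail3: "(\<lambda>M. f M z) summable_on A - E" if "z \<in> ball z0 e" for z
    by (rule analytic_infsum_tail(3)[OF e _ B _ that]; use bound hol in blast)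
  have A: "A = (A - E) \<union> (A \<inter> E)" "(A - E) \<inter> (A \<inter> E) = {}" "finite (A \<inter> E)" using E by auto
  show summ: "(\<lambda>M. f M z) summable_on A" if "z \<in> ball z0 e" for z
    by (subst A(1), rule summable_on_Un_disjoint[OF tail3[OF that]]) (use A in auto)
  define g where "g = (\<lambda>z. \<Sum>\<^sub>\<infinity>M\<in>A-E. f M z)"
  have eq: "(\<Sum>\<^sub>\<infinity>M\<in>A. f M z) = g z + (\<Sum>M\<in>A\<inter>E. f M z)" if "z \<in> ball z0 e" for z
    unfolding g_def by (subst A(1), subst infsum_Un_disjoint[OF tail3[OF that]]) (use A in auto)
  have ev: "eventually (\<lambda>z. (\<Sum>\<^sub>\<infinity>M\<in>A. f M z) = g z + (\<Sum>M\<in>A\<inter>E. f M z)) (nhds z0)"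
    using eventually_nhds_in_open[of "ball z0 e" z0] e by (auto elim!: eventually_mono intro: eq)
  have an: "(\<lambda>z. g z + (\<Sum>M\<in>A\<inter>E. f M z)) analytic_on {z0}"
    unfolding g_def by (intro analytic_on_add tail(1) analytic_on_sum ana)
  thus "(\<lambda>z. \<Sum>\<^sub>\<infinity>M\<in>A. f M z) analytic_on {z0}" using analytic_at_cong[OF ev refl] by simp
  have "g analytic_on {z0}" unfolding g_def by (rule tail(1))
  hence dg: "g field_differentiable at z0" using analytic_on_imp_differentiable_at by blast
  have dE: "f M field_differentiable at z0" if "M \<in> A \<inter> E" for M
    using ana[OF that] analytic_on_imp_differentiable_at by blast
  have "((\<lambda>z. g z + (\<Sum>M\<in>A\<inter>E. f M z)) has_field_derivative deriv g z0 + (\<Sum>M\<in>A\<inter>E. deriv (f M) z0)) (at z0)"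
    using dg dE by (intro DERIV_add DERIV_sum field_differentiable_derivI) auto
  hence "deriv (\<lambda>z. \<Sum>\<^sub>\<infinity>M\<in>A. f M z) z0 = deriv g z0 + (\<Sum>M\<in>A\<inter>E. deriv (f M) z0)"
    using deriv_cong_ev[OF ev refl] DERIV_imp_deriv by metis
  moreover have "((\<lambda>M. deriv (f M) z0) has_sum (deriv g z0 + (\<Sum>M\<in>A\<inter>E. deriv (f M) z0))) ((A - E) \<union> (A \<inter> E))"
    unfolding g_def by (intro has_sum_Un_disjoint tail(2) has_sum_finite A)
  ultimately show "((\<lambda>M. deriv (f M) z0) has_sum deriv (\<lambda>z. \<Sum>\<^sub>\<infinity>M\<in>A. f M z) z0) A"
    using A(1) by simp
qed

text \<open>The difference \<open>z - act M p\<close> cleared of its denominator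
  \<open>den M p\<close>.\<close>

fun D :: "su \<Rightarrow> complex \<Rightarrow> complex \<Rightarrow> complex" where
  "D M p z = z * den M p - num M p"

declare D.simps [simp del]

text \<open>This is the derivative of \<open>act M\<close> at \<open>p\<close> times \<open>1 / (z - act M p) - 1 / (w - act M p)\<close>, in a form that is
  also meaningful when \<open>act M p\<close> is infinite.\<close>

definition T :: "su \<Rightarrow> complex \<Rightarrow> complex \<Rightarrow> complex \<Rightarrow> complex" where
  "T M p z w = (w - z) / (D M p z * D M p w)"

lemma D_den: "den M p \<noteq> 0 \<Longrightarrow> D M p z = den M p * (z - act M p)"
  by (simp add: D.simps act_def field_simps)

lemma D_eq_0_iff: "su11 M \<Longrightarrow> D M p z = 0 \<longleftrightarrow> den M p \<noteq> 0 \<and> act M p = z"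
  using num_den_zero[of M p] by (cases "den M p = 0") (auto simp: D_den, auto simp: D.simps)

lemma T_cocycle:
  assumes "D M p z \<noteq> 0" "D M p w \<noteq> 0" "D M p v \<noteq> 0"
  shows "T M p z w + T M p w v = T M p z v"
proof -
  have "(w - z) * D M p v + (v - w) * D M p z = (v - z) * D M p w" by (simp add: D.simps algebra_simps)
  thus ?thesis using assms unfolding T_def by (simp add: divide_simps)
qed

lemma D_pmul: "den N p \<noteq> 0 \<Longrightarrow> D (pmul M N) p z = D M (act N p) z * den N p"
  by (simp add: D.simps den_pmul num_pmul algebra_simps)

lemma T_pmul:
  assumes "den N p \<noteq> 0"
  shows "T M (act N p) z w / (den N p)\<^sup>2 = T (pmul M N) p z w"
  using assms by (simp add: T_def D_pmul power2_eq_square mult_ac)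

lemma D_left:
  assumes "su11 N" "den N z \<noteq> 0"
  shows "D (pmul N M) p (act N z) = D M p z / den N z"
proof (cases N)
  case (Pair a b)
  have "a * cnj a - b * cnj b = 1" using assms Pair by simp
  hence "num N z * (cnj b * num M p + cnj a * den M p) - den N z * (a * num M p + b * den M p) = z * den M p - num M p"
    unfolding Pair num.simps den.simps by algebra
  thus ?thesis using assms Pair unfolding D.simps den_pmul' num_pmul' act_def by (simp add: field_simps)
qed

text \<open>By \<open>act_diff\<close> the numerator acquires the factors \<open>1 / den N z\<close>
  and \<open>1 / den N w\<close>, and the two values of \<open>D\<close> acquire the same
  ones.\<close>

lemma T_left:
  assumes "su11 N" "den N z \<noteq> 0" "den N w \<noteq> 0"
  shows "T (pmul N M) p (act N z) (act N w) = T M p z w"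
  using assms by (simp add: T_def D_left act_diff)

definition eqv :: "su set \<Rightarrow> complex \<Rightarrow> complex \<Rightarrow> bool" where
  "eqv G p z \<longleftrightarrow> (\<exists>M\<in>G. den M p \<noteq> 0 \<and> act M p = z)"

context schottky_curve
begin

abbreviation eq (infix "\<simeq>" 50) where "p \<simeq> z \<equiv> eqv GG p z"

lemma eq_refl [simp]: "p \<simeq> p" unfolding eqv_def by (intro bexI[of _ "(1,0)"]) (auto intro: GG.one)

lemma eq_sym: "p \<simeq> z \<Longrightarrow> z \<simeq> p"
  unfolding eqv_def
proof (elim bexE conjE)
  fix M assume "M \<in> GG" "den M p \<noteq> 0" "act M p = z"
  thus "\<exists>M\<in>GG. den M z \<noteq> 0 \<and> act M z = p"
    using GG_inv GG_su den_pinv_act[of M p] act_pinv_act[of M p] by (intro bexI[of _ "pinv M"]) auto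
qed

lemma eq_trans: "p \<simeq> z \<Longrightarrow> z \<simeq> w \<Longrightarrow> p \<simeq> w"
  unfolding eqv_def
proof (elim bexE conjE)
  fix M N assume "M \<in> GG" "den M p \<noteq> 0" "act M p = z" "N \<in> GG" "den N z \<noteq> 0" "act N z = w"
  thus "\<exists>M\<in>GG. den M p \<noteq> 0 \<and> act M p = w"
    using GG_mul by (intro bexI[of _ "pmul N M"]) (auto simp: den_pmul act_pmul)
qed

lemma eq_act: "M \<in> GG \<Longrightarrow> den M p \<noteq> 0 \<Longrightarrow> p \<simeq> act M p"
  unfolding eqv_def by blast

lemma eq_Omega: "p \<simeq> z \<Longrightarrow> p \<in> \<Omega> \<Longrightarrow> z \<in> \<Omega>"
  unfolding eqv_def using Omega_act by blast

lemma G_equiv_iff: "G_equiv (schottky_group g \<eta> \<theta>) z w \<longleftrightarrow> z \<simeq> w"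
proof
  assume "G_equiv (schottky_group g \<eta> \<theta>) z w"
  then obtain \<gamma> where "\<gamma> \<in> schottky_group g \<eta> \<theta>" "mden \<gamma> z \<noteq> 0" "mapp \<gamma> z = w" unfolding G_equiv_def by blast
  moreover then obtain M where "M\<in>GG" "\<forall>z. mden \<gamma> z = 0 \<longleftrightarrow> den M z = 0" "\<forall>z. mapp \<gamma> z = act M z"
    using schottky_imp_GG_mob by metis
  ultimately show "z \<simeq> w" unfolding eqv_def by (intro bexI[of _ M]) auto
next
  assume "z \<simeq> w"
  then obtain M where M: "M \<in> GG" "den M z \<noteq> 0" "act M z = w" unfolding eqv_def by blast
  moreover then obtain \<gamma> where "\<gamma>\<in>schottky_group g \<eta> \<theta>" "\<forall>z. mden \<gamma> z = 0 \<longleftrightarrow> den M z = 0" "\<forall>z. mapp \<gamma> z = act M z"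
    using GG_imp_schottky_mob[OF M(1)] by metis
  ultimately show "G_equiv (schottky_group g \<eta> \<theta>) z w" unfolding G_equiv_def by (intro bexI[of _ \<gamma>]) auto
qed

lemma D_nz: "\<not> p \<simeq> z \<Longrightarrow> M \<in> GG \<Longrightarrow> D M p z \<noteq> 0"
  using D_eq_0_iff[OF GG_su, of M p z] unfolding eqv_def by blast

lemma annulus_outside:
  assumes "(k,False) \<in> Ls" "\<rho>/s1 < norm (z - cen (k,False))" "norm (z - cen (k,False)) < s1 * \<rho>" 
  shows "z \<in> outside s1"
  unfolding outside_def mem_Collect_eq
proof (intro ballI)
  fix l assume l: "l \<in> Ls"
  show "rad s1 l < norm (z - cen l)"
  proof (cases "l = (k,False)")
    case True thus ?thesis using assms by simp
  next
    case False
    thus ?thesis using disc_sep[of s1 "(k,False)" l z] assms l s1(1) by (simp del: cen.simps rad.simps)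
  qed
qed

text \<open>A point on the circle of \<open>(k,False)\<close> becomes interior when that circle is
  shrunk, and a point on the circle of \<open>(k,True)\<close> is brought there by the generator. So
  every orbit, except possibly that of infinity, meets an open domain.\<close>

lemma Omega_reduce_outside:
  assumes "z \<in> \<Omega>"
  shows "\<exists>N\<in>GG. den N z \<noteq> 0 \<and> (act N z = c \<or> (\<exists>s. 1 \<le> s \<and> s \<le> s1 \<and> act N z \<in> outside s))"
proof -
  obtain N where N: "N \<in> GG" "den N z \<noteq> 0" "act N z \<in> coutside 1 \<or> act N z = c"
    using Omega_reduce[of 1 z] s1(1) assms by auto
  define q where "q = act N z"
  have "q \<in> coutside 1 \<or> q = c" using N(3) q_def by simp
  then consider "q = c" | "q \<in> outside 1" | "q \<in> coutside 1" "q \<notin> outside 1" by blast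
  thus ?thesis
  proof cases
    case 1
    thus ?thesis unfolding q_def by (intro bexI[OF _ N(1)] conjI N(2) disjI1)
  next
    case 2 
    thus ?thesis unfolding q_def using s1(1) by (intro bexI[OF _ N(1)] conjI N(2) disjI2 exI[of _ 1]) simp_all
  next
    case 3
    obtain l where l: "l \<in> Ls" "\<not> rad 1 l < norm (q - cen l)"
      using 3(2) unfolding outside_def mem_Collect_eq by (simp only: Ball_def not_all not_imp) (elim exE conjE)
    have "rad 1 l \<le> norm (q - cen l)" using 3(1) l(1) unfolding coutside_def mem_Collect_eq by (rule bspec)
    moreover have "rad 1 l = \<rho>" by (cases l) simp
    ultimately have nq: "norm (q - cen l) = \<rho>" using l(2) by simp
    have sr: "\<rho>/s1 < \<rho>" "\<rho> < s1 * \<rho>" using s1(1) rho_pos by (simp_all add: field_simps)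
    obtain k b where lk: "l = (k,b)" by (cases l)
    show ?thesis
    proof (cases b)
      case False
      hence "q \<in> outside s1" using annulus_outside[of k q] l nq sr lk by simp
      thus ?thesis unfolding q_def using s1(1) by (intro bexI[OF _ N(1)] conjI N(2) disjI2 exI[of _ s1]) simp_all
    next
      case True
      have ne: "q \<noteq> cen l" using nq rho_pos by auto
      have "norm (act (lm l) q - cen (k,False)) = \<rho>" using dist_act_lm[OF ne] nq lk True rho_pos by (simp add: power2_eq_square)
      hence out: "act (lm l) q \<in> outside s1" using annulus_outside[of k "act (lm l) q"] l sr lk by simp
      have "den (lm l) q \<noteq> 0" using ne den_lm_eq_0_iff by simp
      hence "den (pmul (lm l) N) z \<noteq> 0" using N(2) by (simp add: den_pmul q_def)
      moreover have "act (pmul (lm l) N) z \<in> outside s1" using out N(2) by (simp add: act_pmul q_def)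
      ultimately show ?thesis using s1(1) 
        by (intro bexI[OF _ GG.step[OF N(1) l(1)]] conjI disjI2 exI[of _ s1]) simp_all
    qed
  qed
qed

lemma GG_cancel:
  assumes "M \<in> GG" "N \<in> GG" "pmul N (pmul M (pinv N)) = (1,0)" shows "M = (1,0)"
proof -
  have "pmul (pinv N) (pmul (pmul N (pmul M (pinv N))) N) = M"
  proof -
    have "pmul (pinv N) (pmul (pmul N (pmul M (pinv N))) N) = pmul (pmul (pinv N) N) (pmul M (pmul (pinv N) N))"
      by (simp only: pmul_assoc)
    thus ?thesis by (simp only: pinv_left[OF GG_su[OF assms(2)]] pmul_one)
  qed
  thus ?thesis by (simp only: assms(3) pmul_one pinv_left[OF GG_su[OF assms(2)]])
qed

text \<open>Conjugation by a letter with pole \<open>c\<close> moves the fixed point to infinity,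
  and nontrivial elements of the group have \<open>snd M \<noteq> 0\<close>.\<close>

lemma fixed_c:
  assumes "M \<in> GG" "den M c \<noteq> 0" "act M c = c" shows "M = (1,0)"
proof -
  define l where "l = (0::nat,True)"
  have l: "l \<in> Ls" "cen l = c" using g_pos unfolding l_def by auto
  have d0: "den (lm l) c = 0" using den_lm_eq_0_iff[of l] l by simp
  have n0: "num (lm l) c \<noteq> 0" using num_den_zero lm_su d0 by blast
  define M' where "M' = pmul (lm l) (pmul M (pinv (lm l)))"
  have GGM: "M' \<in> GG" unfolding M'_def by (intro GG_mul GG_inv lm_GG l assms)
  have "pmul M' (lm l) = pmul (lm l) M" unfolding M'_def by (simp add: pmul_assoc pinv_left lm_su)
  moreover have "den (pmul (lm l) M) c = 0" using den_pmul[OF assms(2), of "lm l"] assms(3) d0 by simp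
  ultimately have "den (pmul M' (lm l)) c = 0" by simp
  hence "snd M' = 0" using n0 unfolding den_pmul' d0 by simp
  hence "M' = (1,0)" using snd_GG'[of M'] GGM by blast
  thus ?thesis using GG_cancel[OF assms(1) lm_GG[OF l(1)]] unfolding M'_def by blast
qed

text \<open>The action is free. For the kernel this means that the identity contributes the only
  term with a pole at \<open>p\<close>, so the pole there is simple.\<close>

lemma fixed_point:
  assumes "p \<in> \<Omega>" "M \<in> GG" "den M p \<noteq> 0" "act M p = p" shows "M = (1,0)"
proof -
  obtain N where N: "N\<in>GG" "den N p \<noteq> 0" "act N p = c \<or> (\<exists>s. 1 \<le> s \<and> s \<le> s1 \<and> act N p \<in> outside s)"
    using Omega_reduce_outside[OF assms(1)] by blast
  define q M' where "q = act N p" and "M' = pmul N (pmul M (pinv N))"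
  have su: "su11 N" using N GG_su by blast
  have q: "den (pinv N) q \<noteq> 0" "act (pinv N) q = p" unfolding q_def using den_pinv_act[OF su N(2)] act_pinv_act[OF su N(2)] N(2) by auto
  have M': "den M' q \<noteq> 0" "act M' q = q" unfolding M'_def using q assms N by (auto simp: den_pmul act_pmul q_def)
  have GGM: "M' \<in> GG" unfolding M'_def by (intro GG_mul GG_inv N assms)
  have "M' = (1,0)"
    using N(3)
  proof
    assume "act N p = c" thus ?thesis using fixed_c[OF GGM] M' q_def by simp
  next
    assume "\<exists>s. 1 \<le> s \<and> s \<le> s1 \<and> act N p \<in> outside s"
    then obtain s where s: "1 \<le> s" "s \<le> s1" "q \<in> outside s" unfolding q_def by blast
    thus ?thesis using outside_inequiv[OF GGM s(1,2), of q] outside_sub M' by auto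
  qed
  thus ?thesis using GG_cancel assms N unfolding M'_def by blast
qed

lemma D_self: "p \<in> \<Omega> \<Longrightarrow> M \<in> GG' \<Longrightarrow> D M p p \<noteq> 0"
  using fixed_point[of p M] D_eq_0_iff[OF GG_su, of M p p] by blast

text \<open>Off a finite set of elements, \<open>pole M\<close> stays away from \<open>p0\<close>
  and the image of infinity stays away from \<open>z0\<close>. Then \<open>|den M p|\<close> is at
  least \<open>e * |snd M|\<close>, \<open>act M p\<close> is within \<open>e\<close> of the image
  of infinity, and both factors of \<open>D M p z\<close> are bounded below.\<close>

lemma D_lower:
  assumes "p0 \<in> \<Omega>" "z0 \<in> \<Omega>"
  shows "\<exists>e>0. \<exists>E. finite E \<and> (1,0) \<in> E \<and> (\<forall>M\<in>GG-E. \<forall>p\<in>ball p0 e. \<forall>z\<in>ball z0 e. norm (D M p z) \<ge> e\<^sup>2 * norm (snd M))"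
proof -
  obtain e1 where e1: "e1 > 0" "finite {M\<in>GG'. pole M \<in> ball p0 e1}" using assms(1) unfolding Omega_iff by blast
  obtain e2 where e2: "e2 > 0" "finite {M\<in>GG'. pole M \<in> ball z0 e2}" using assms(2) unfolding Omega_iff by blast
  define e where "e = min (e1/2) (e2/3)"
  have e: "e > 0" "2 * e \<le> e1" "3 * e \<le> e2" using e1 e2 unfolding e_def by auto
  define E where "E = {M\<in>GG'. pole M \<in> ball p0 e1} \<union> pinv ` {M\<in>GG'. pole M \<in> ball z0 e2} \<union> {M\<in>GG'. norm (snd M) \<le> 1/e} \<union> {(1,0)}"
  have fin: "finite E" unfolding E_def using e1 e2 finite_snd_le by (intro finite_UnI finite_imageI) auto
  have "norm (D M p z) \<ge> e\<^sup>2 * norm (snd M)" if M: "M \<in> GG - E" "p \<in> ball p0 e" "z \<in> ball z0 e" for M p z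
  proof -
    have MG: "M \<in> GG'" using M unfolding E_def by blast
    have su: "su11 M" using MG GG_su by blast
    have b: "snd M \<noteq> 0" using snd_GG'[OF MG] .
    have 1: "pole M \<notin> ball p0 e1" using M MG unfolding E_def by blast
    have "pinv M \<in> GG'" using MG pinv_GG' by blast
    hence 2: "pole (pinv M) \<notin> ball z0 e2" using M unfolding E_def by (metis (mono_tags, lifting) DiffD2 UnI1 UnI2 image_eqI mem_Collect_eq pinv_pinv)
    have 3: "norm (snd M) > 1/e" using M MG unfolding E_def by (metis (mono_tags, lifting) DiffD2 UnI1 UnI2 mem_Collect_eq not_le)
    have "dist p0 (pole M) \<le> dist p0 p + dist p (pole M)" by (rule dist_triangle)
    hence 4: "norm (p - pole M) \<ge> e" using 1 M e by (auto simp: dist_norm)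
    have dn: "norm (den M p) = norm (snd M) * norm (p - pole M)" using den_pole[OF b] by (simp add: norm_mult)
    have be: "norm (snd M) * e \<le> norm (den M p)" unfolding dn using 4 by (intro mult_left_mono) auto
    have "norm (snd M) * e > 1" using 3 e by (simp add: field_simps)
    hence dp: "norm (den M p) > 1" using be by linarith
    hence d0: "den M p \<noteq> 0" by auto
    have "norm (act M p - pole (pinv M)) = 1 / (norm (snd M) * norm (den M p))"
      using act_infinity_diff[OF su b d0] by (simp add: norm_divide norm_mult)
    also have "\<dots> \<le> 1 / (norm (snd M) * 1)" using b dp by (intro divide_left_mono mult_left_mono mult_pos_pos) auto
    also have "\<dots> \<le> e" using 3 b e by (simp add: field_simps)
    finally have 5: "norm (act M p - pole (pinv M)) \<le> e" .
    have "dist z0 (pole (pinv M)) \<le> dist z0 z + dist z (pole (pinv M))" by (rule dist_triangle)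
    moreover have "dist z (pole (pinv M)) \<le> dist z (act M p) + dist (act M p) (pole (pinv M))" by (rule dist_triangle)
    ultimately have 6: "norm (z - act M p) \<ge> e" using 2 5 M e by (auto simp: dist_norm)
    have "norm (D M p z) = norm (den M p) * norm (z - act M p)" unfolding D_den[OF d0] by (simp add: norm_mult)
    also have "\<dots> \<ge> (norm (snd M) * e) * e" using be 6 e by (intro mult_mono) auto
    finally show ?thesis by (simp add: power2_eq_square mult_ac)
  qed
  moreover have "(1,0) \<in> E" unfolding E_def by simp
  ultimately show ?thesis using e fin by (intro exI[of _ e] conjI exI[of _ E] ballI)
qed

lemma T_bound:
  assumes "p0 \<in> \<Omega>" "z0 \<in> \<Omega>" "w0 \<in> \<Omega>"
  shows "\<exists>e>0. \<exists>E C. finite E \<and> (1,0) \<in> E \<and> (\<forall>M\<in>GG-E. \<forall>p\<in>ball p0 e. \<forall>z\<in>ball z0 e. \<forall>w\<in>ball w0 e. 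
     D M p z \<noteq> 0 \<and> D M p w \<noteq> 0 \<and> norm (T M p z w) \<le> C * (1/(norm (snd M))\<^sup>2))"
proof -
  obtain e1 E1 where 1: "e1 > 0" "finite E1" "(1,0) \<in> E1"
    "\<And>M p z. M\<in>GG-E1 \<Longrightarrow> p\<in>ball p0 e1 \<Longrightarrow> z\<in>ball z0 e1 \<Longrightarrow> norm (D M p z) \<ge> e1\<^sup>2 * norm (snd M)" 
    using D_lower[OF assms(1,2)] by meson
  obtain e2 E2 where 2: "e2 > 0" "finite E2" "(1,0) \<in> E2"
    "\<And>M p z. M\<in>GG-E2 \<Longrightarrow> p\<in>ball p0 e2 \<Longrightarrow> z\<in>ball w0 e2 \<Longrightarrow> norm (D M p z) \<ge> e2\<^sup>2 * norm (snd M)" 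
    using D_lower[OF assms(1,3)] by meson
  define e where "e = min e1 e2"
  have e: "e > 0" "e \<le> e1" "e \<le> e2" using 1 2 unfolding e_def by auto
  define C where "C = (norm (w0 - z0) + 2*e) / (e1\<^sup>2 * e2\<^sup>2)"
  have "D M p z \<noteq> 0 \<and> D M p w \<noteq> 0 \<and> norm (T M p z w) \<le> C * (1/(norm (snd M))\<^sup>2)"
    if M: "M \<in> GG - (E1 \<union> E2)" "p\<in>ball p0 e" "z\<in>ball z0 e" "w\<in>ball w0 e" for M p z w
  proof -
    have b: "snd M \<noteq> 0" using M 1 snd_GG' by blast
    have d1: "norm (D M p z) \<ge> e1\<^sup>2 * norm (snd M)" using M e by (intro 1(4)) auto
    have d2: "norm (D M p w) \<ge> e2\<^sup>2 * norm (snd M)" using M e by (intro 2(4)) auto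
    have p1: "e1\<^sup>2 * norm (snd M) > 0" "e2\<^sup>2 * norm (snd M) > 0" using b 1 2 by auto
    have nz: "D M p z \<noteq> 0" "D M p w \<noteq> 0" using d1 d2 p1 by auto
    have "w - z = (w0 - z0) + ((w - w0) - (z - z0))" by simp
    hence "norm (w - z) \<le> norm (w0 - z0) + (norm (w - w0) + norm (z - z0))"
      by (metis norm_triangle_ineq norm_triangle_ineq4 norm_triangle_mono order_refl)
    hence num: "norm (w - z) \<le> norm (w0 - z0) + 2*e" using M by (auto simp: dist_norm norm_minus_commute)
    have "norm (T M p z w) = norm (w - z) / (norm (D M p z) * norm (D M p w))"
      by (simp add: T_def norm_divide norm_mult)
    also have "\<dots> \<le> (norm (w0 - z0) + 2*e) / ((e1\<^sup>2 * norm (snd M)) * (e2\<^sup>2 * norm (snd M)))"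
      using num d1 d2 p1 nz e(1) by (intro frac_le mult_mono mult_pos_pos) auto
    also have "\<dots> = C * (1/(norm (snd M))\<^sup>2)" unfolding C_def by (simp add: power2_eq_square mult_ac)
    finally show ?thesis using nz by blast
  qed
  hence "\<forall>M\<in>GG-(E1 \<union> E2). \<forall>p\<in>ball p0 e. \<forall>z\<in>ball z0 e. \<forall>w\<in>ball w0 e. 
     D M p z \<noteq> 0 \<and> D M p w \<noteq> 0 \<and> norm (T M p z w) \<le> C * (1/(norm (snd M))\<^sup>2)" by (intro ballI)
  moreover have "finite (E1 \<union> E2)" "(1,0) \<in> E1 \<union> E2" using 1 2 by simp_all
  ultimately show ?thesis using e(1) by (intro exI[of _ e] conjI exI[of _ "E1 \<union> E2"] exI[of _ C])
qed

lemma summable_tail: 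
  assumes "(1,0) \<in> E" "A \<subseteq> GG" shows "(\<lambda>M. C * (1/(norm (snd M))\<^sup>2)) summable_on (A - E)"
proof -
  have "(\<lambda>M. C * (1/(norm (snd M))\<^sup>2)) summable_on GG'" by (rule summable_on_cmult_right[OF summable_GG'])
  thus ?thesis by (rule summable_on_subset_banach) (use assms in blast)
qed

text \<open>The index set is a parameter so that the identity term, which carries the pole at
  \<open>p\<close>, can be split off: the sum over \<open>GG'\<close> is analytic there.\<close>

definition KS :: "su set \<Rightarrow> complex \<Rightarrow> complex \<Rightarrow> complex \<Rightarrow> complex" where
  "KS A p z w = (\<Sum>\<^sub>\<infinity>M\<in>A. T M p z w)"

abbreviation "K \<equiv> KS GG"

lemma hol_D: "(\<lambda>z. D M p z) holomorphic_on S" "(\<lambda>p. D M p z) holomorphic_on S"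
  unfolding D.simps by (cases M; auto intro!: holomorphic_intros)+

lemma analytic_D: "(\<lambda>z. D M p z) analytic_on S" "(\<lambda>p. D M p z) analytic_on S"
  unfolding D.simps by (cases M; auto intro!: analytic_intros)+

lemma KS_z:
  assumes "A \<subseteq> GG" "p \<in> \<Omega>" "z0 \<in> \<Omega>" "w \<in> \<Omega>" "\<And>M. M \<in> A \<Longrightarrow> D M p z0 \<noteq> 0" "\<And>M. M \<in> A \<Longrightarrow> D M p w \<noteq> 0"
  shows "(\<lambda>z. KS A p z w) analytic_on {z0}" "eventually (\<lambda>z. (\<lambda>M. T M p z w) summable_on A) (nhds z0)"
proof -
  obtain e E C where e: "e > 0" "finite E" "(1,0) \<in> E" 
    "\<And>M p' z w'. M\<in>GG-E \<Longrightarrow> p'\<in>ball p e \<Longrightarrow> z\<in>ball z0 e \<Longrightarrow> w'\<in>ball w e \<Longrightarrow> 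
     D M p' z \<noteq> 0 \<and> D M p' w' \<noteq> 0 \<and> norm (T M p' z w') \<le> C * (1/(norm (snd M))\<^sup>2)"
    using T_bound[OF assms(2-4)] by meson
  have nz: "D M p z \<noteq> 0" "D M p w \<noteq> 0" "norm (T M p z w) \<le> C * (1/(norm (snd M))\<^sup>2)" if "M \<in> A - E" "z \<in> ball z0 e" for M z
    using e(4)[of M p z w] that assms(1) e(1) by auto
  have hol: "(\<lambda>z. T M p z w) holomorphic_on ball z0 e" if "M \<in> A - E" for M
    unfolding T_def by (intro holomorphic_intros hol_D) (use nz that in auto)
  have ana: "(\<lambda>z. T M p z w) analytic_on {z0}" if "M \<in> A \<inter> E" for M
    unfolding T_def by (intro analytic_intros analytic_D) (use assms that in auto)
  have R: "(\<lambda>z. \<Sum>\<^sub>\<infinity>M\<in>A. T M p z w) analytic_on {z0}"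
    "((\<lambda>M. deriv (\<lambda>z. T M p z w) z0) has_sum deriv (\<lambda>z. \<Sum>\<^sub>\<infinity>M\<in>A. T M p z w) z0) A"
    by (rule analytic_infsum[OF e(1,2) _ summable_tail[OF e(3) assms(1), of C]]; use nz(3) hol ana in blast)+
  have R3: "(\<lambda>M. T M p z w) summable_on A" if "z \<in> ball z0 e" for z
    by (rule analytic_infsum(3)[OF e(1,2) _ summable_tail[OF e(3) assms(1), of C] _ _ that]; use nz(3) hol ana in blast)
  show "(\<lambda>z. KS A p z w) analytic_on {z0}" unfolding KS_def by (rule R(1))
  show "eventually (\<lambda>z. (\<lambda>M. T M p z w) summable_on A) (nhds z0)"
    using eventually_nhds_in_open[of "ball z0 e" z0] e(1) by (auto elim!: eventually_mono intro: R3)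
qed

lemma KS_p:
  assumes "A \<subseteq> GG" "p0 \<in> \<Omega>" "z \<in> \<Omega>" "w \<in> \<Omega>" "\<And>M. M \<in> A \<Longrightarrow> D M p0 z \<noteq> 0" "\<And>M. M \<in> A \<Longrightarrow> D M p0 w \<noteq> 0"
  shows "(\<lambda>p. KS A p z w) analytic_on {p0}" "(\<lambda>M. T M p0 z w) summable_on A"
    "((\<lambda>M. deriv (\<lambda>p. T M p z w) p0) has_sum deriv (\<lambda>p. KS A p z w) p0) A"
proof -
  obtain e E C where e: "e > 0" "finite E" "(1,0) \<in> E" 
    "\<And>M p' z' w'. M\<in>GG-E \<Longrightarrow> p'\<in>ball p0 e \<Longrightarrow> z'\<in>ball z e \<Longrightarrow> w'\<in>ball w e \<Longrightarrow> 
     D M p' z' \<noteq> 0 \<and> D M p' w' \<noteq> 0 \<and> norm (T M p' z' w') \<le> C * (1/(norm (snd M))\<^sup>2)"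
    using T_bound[OF assms(2-4)] by meson
  have nz: "D M p z \<noteq> 0" "D M p w \<noteq> 0" "norm (T M p z w) \<le> C * (1/(norm (snd M))\<^sup>2)" if "M \<in> A - E" "p \<in> ball p0 e" for M p
    using e(4)[of M p z w] that assms(1) e(1) by auto
  have hol: "(\<lambda>p. T M p z w) holomorphic_on ball p0 e" if "M \<in> A - E" for M
    unfolding T_def by (intro holomorphic_intros hol_D) (use nz that in auto)
  have ana: "(\<lambda>p. T M p z w) analytic_on {p0}" if "M \<in> A \<inter> E" for M
    unfolding T_def by (intro analytic_intros analytic_D) (use assms that in auto)
  have R: "(\<lambda>p. \<Sum>\<^sub>\<infinity>M\<in>A. T M p z w) analytic_on {p0}"
    "((\<lambda>M. deriv (\<lambda>p. T M p z w) p0) has_sum deriv (\<lambda>p. \<Sum>\<^sub>\<infinity>M\<in>A. T M p z w) p0) A"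
    by (rule analytic_infsum[OF e(1,2) _ summable_tail[OF e(3) assms(1), of C]]; use nz(3) hol ana in blast)+
  have R3: "(\<lambda>M. T M p z w) summable_on A" if "p \<in> ball p0 e" for p
    by (rule analytic_infsum(3)[OF e(1,2) _ summable_tail[OF e(3) assms(1), of C] _ _ that]; use nz(3) hol ana in blast)
  show "(\<lambda>p. KS A p z w) analytic_on {p0}" unfolding KS_def by (rule R(1))
  show "(\<lambda>M. T M p0 z w) summable_on A" using R3[of p0] e(1) by simp
  show "((\<lambda>M. deriv (\<lambda>p. T M p z w) p0) has_sum deriv (\<lambda>p. KS A p z w) p0) A" unfolding KS_def by (rule R(2))
qed

lemma K_z: "p \<in> \<Omega> \<Longrightarrow> z0 \<in> \<Omega> \<Longrightarrow> w \<in> \<Omega> \<Longrightarrow> \<not> p \<simeq> z0 \<Longrightarrow> \<not> p \<simeq> w \<Longrightarrow> (\<lambda>z. K p z w) analytic_on {z0}"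
  by (rule KS_z(1)) (simp_all add: D_nz)

lemma K_p: "p0 \<in> \<Omega> \<Longrightarrow> z \<in> \<Omega> \<Longrightarrow> w \<in> \<Omega> \<Longrightarrow> \<not> p0 \<simeq> z \<Longrightarrow> \<not> p0 \<simeq> w \<Longrightarrow> (\<lambda>p. K p z w) analytic_on {p0}"
  by (rule KS_p(1)) (simp_all add: D_nz)

lemma K_summable: "p \<in> \<Omega> \<Longrightarrow> z \<in> \<Omega> \<Longrightarrow> w \<in> \<Omega> \<Longrightarrow> \<not> p \<simeq> z \<Longrightarrow> \<not> p \<simeq> w \<Longrightarrow> (\<lambda>M. T M p z w) summable_on GG"
  by (rule KS_p(2)) (simp_all add: D_nz)

lemma K_cocycle:
  assumes "p \<in> \<Omega>" "z \<in> \<Omega>" "w \<in> \<Omega>" "v \<in> \<Omega>" "\<not> p \<simeq> z" "\<not> p \<simeq> w" "\<not> p \<simeq> v"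
  shows "K p z w + K p w v = K p z v"
proof -
  have "K p z w + K p w v = (\<Sum>\<^sub>\<infinity>M\<in>GG. T M p z w + T M p w v)"
    unfolding KS_def by (intro infsum_add[symmetric] K_summable assms)
  also have "\<dots> = K p z v" unfolding KS_def by (intro infsum_cong T_cocycle D_nz assms)
  finally show ?thesis .
qed

lemma bij_right:
  assumes "N \<in> GG" shows "bij_betw (\<lambda>M. pmul M N) GG GG"
proof (rule bij_betw_byWitness[where f' = "\<lambda>M. pmul M (pinv N)"])
  have N: "pinv N \<in> GG" "su11 N" using assms GG_inv GG_su by simp_all
  show "\<forall>M\<in>GG. pmul (pmul M N) (pinv N) = M" "\<forall>M\<in>GG. pmul (pmul M (pinv N)) N = M"
    by (simp_all only: pmul_assoc pinv_left[OF N(2)] pinv_right[OF N(2)] pmul_one, simp_all)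
  show "(\<lambda>M. pmul M N) ` GG \<subseteq> GG" "(\<lambda>M. pmul M (pinv N)) ` GG \<subseteq> GG"
    by (rule image_subsetI, erule GG_mul, rule assms N(1))+
qed

lemma bij_left:
  assumes "N \<in> GG" shows "bij_betw (\<lambda>M. pmul N M) GG GG"
proof (rule bij_betw_byWitness[where f' = "\<lambda>M. pmul (pinv N) M"])
  have N: "pinv N \<in> GG" "su11 N" using assms GG_inv GG_su by simp_all
  show "\<forall>M\<in>GG. pmul (pinv N) (pmul N M) = M" "\<forall>M\<in>GG. pmul N (pmul (pinv N) M) = M"
    by (simp_all only: pmul_assoc[symmetric] pinv_left[OF N(2)] pinv_right[OF N(2)] pmul_one, simp_all)
  show "(\<lambda>M. pmul N M) ` GG \<subseteq> GG" "(\<lambda>M. pmul (pinv N) M) ` GG \<subseteq> GG"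
    by (rule image_subsetI, rule GG_mul, rule assms N(1), assumption)+
qed

text \<open>Translating the summation index on the right gives weight two in \<open>p\<close>;
  translating it on the left gives the invariance in the pair \<open>z\<close>, \<open>w\<close> in
  \<open>K_act_z\<close>.\<close>

lemma K_act_p:
  assumes "N \<in> GG" "den N p \<noteq> 0"
  shows "K (act N p) z w / (den N p)\<^sup>2 = K p z w"
proof -
  have "K (act N p) z w / (den N p)\<^sup>2 = (\<Sum>\<^sub>\<infinity>M\<in>GG. T M (act N p) z w / (den N p)\<^sup>2)"
    unfolding KS_def divide_inverse by (rule infsum_cmult_left'[symmetric])
  also have "\<dots> = (\<Sum>\<^sub>\<infinity>M\<in>GG. T (pmul M N) p z w)" using T_pmul[OF assms(2)] by simp
  also have "\<dots> = K p z w" unfolding KS_def by (rule infsum_reindex_bij_betw[OF bij_right[OF assms(1)]])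
  finally show ?thesis .
qed

lemma K_act_z:
  assumes "N \<in> GG" "den N z \<noteq> 0" "den N w \<noteq> 0"
  shows "K p (act N z) (act N w) = K p z w"
proof -
  have "K p (act N z) (act N w) = (\<Sum>\<^sub>\<infinity>M\<in>GG. T (pmul N M) p (act N z) (act N w))"
    unfolding KS_def by (rule infsum_reindex_bij_betw[OF bij_left[OF assms(1)], symmetric])
  also have "\<dots> = K p z w" unfolding KS_def using T_left[OF GG_su[OF assms(1)] assms(2,3)] by simp
  finally show ?thesis .
qed

lemma D_rot: "D (rotm M) (\<zeta> * p) (\<zeta> * z) = \<zeta> * D M p z"
  unfolding D.simps den_rotm num_rotm by (simp add: algebra_simps)

lemma K_rot: "K (\<zeta> * p) (\<zeta> * z) (\<zeta> * w) * \<zeta> = K p z w"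
proof -
  have "T (rotm M) (\<zeta> * p) (\<zeta> * z) (\<zeta> * w) * \<zeta> = T M p z w" for M
    unfolding T_def D_rot right_diff_distrib[symmetric] by simp
  hence "(\<Sum>\<^sub>\<infinity>M\<in>GG. T (rotm M) (\<zeta> * p) (\<zeta> * z) (\<zeta> * w) * \<zeta>) = K p z w" unfolding KS_def by simp
  moreover have "(\<Sum>\<^sub>\<infinity>M\<in>GG. T (rotm M) (\<zeta> * p) (\<zeta> * z) (\<zeta> * w) * \<zeta>) = (\<Sum>\<^sub>\<infinity>M\<in>GG. T (rotm M) (\<zeta> * p) (\<zeta> * z) (\<zeta> * w)) * \<zeta>"
    by (rule infsum_cmult_left')
  moreover have "(\<Sum>\<^sub>\<infinity>M\<in>GG. T (rotm M) (\<zeta> * p) (\<zeta> * z) (\<zeta> * w)) = K (\<zeta> * p) (\<zeta> * z) (\<zeta> * w)"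
    unfolding KS_def by (rule infsum_reindex_bij_betw[OF bij_rotm])
  ultimately show ?thesis by simp
qed

end

lemma analytic_at_transform:
  "g analytic_on {z} \<Longrightarrow> eventually (\<lambda>x. f x = g x) (nhds z) \<Longrightarrow> f analytic_on {z}"
  using analytic_at_cong[of f g z z] by simp

context schottky_curve
begin

section \<open>Periods of the kernel\<close>

lemma one_Omega: "1 \<in> \<Omega>"
  using cis_outside[of 0] eta_pos outside_Omega[of 1 1] s1(1) by simp

lemma eq_norm: "p \<simeq> z \<Longrightarrow> norm p = 1 \<Longrightarrow> norm z = 1"
  "p \<simeq> z \<Longrightarrow> norm p < 1 \<Longrightarrow> norm z < 1"
  unfolding eqv_def using act_unit act_disc GG_su by blast+

text \<open>The group preserves the open disc and the unit circle, so \<open>0\<close> and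
  \<open>1\<close> are inequivalent and one of them is always available as a base point.\<close>

lemma zero_one_ineq: "\<not> (p \<simeq> 0 \<and> p \<simeq> 1)"
proof
  assume "p \<simeq> 0 \<and> p \<simeq> 1"
  hence "0 \<simeq> 1" using eq_sym eq_trans by meson
  thus False using eq_norm(2)[of 0 1] by simp
qed

text \<open>The additive period of \<open>K p\<close> along \<open>N\<close>, as a function of \<open>p\<close>. It does not depend on the auxiliary
  point, which is only chosen off the orbit of \<open>p\<close>.\<close>

definition psi :: "su \<Rightarrow> complex \<Rightarrow> complex" where
  "psi N p = (if p \<simeq> 0 then K p (act N 1) 1 else K p (act N 0) 0)"

lemma neq_act: "N \<in> GG \<Longrightarrow> den N z \<noteq> 0 \<Longrightarrow> \<not> p \<simeq> z \<Longrightarrow> \<not> p \<simeq> act N z"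
  using eq_act eq_sym eq_trans by meson

text \<open>The cocycle rule expresses \<open>K p (act N z) w\<close> in two ways, through
  \<open>z\<close> and through \<open>act N w\<close>; the remaining parts \<open>K p z w\<close>
  and \<open>K p (act N z) (act N w)\<close> agree by invariance.\<close>

lemma K_period_indep:
  assumes "N \<in> GG" "p \<in> \<Omega>" "z \<in> \<Omega>" "w \<in> \<Omega>" "den N z \<noteq> 0" "den N w \<noteq> 0" "\<not> p \<simeq> z" "\<not> p \<simeq> w"
  shows "K p (act N z) z = K p (act N w) w"
proof -
  note O = Omega_act[OF assms(3,1,5)] Omega_act[OF assms(4,1,6)]
  note n = neq_act[OF assms(1,5,7)] neq_act[OF assms(1,6,8)]
  have "K p (act N z) z + K p z w = K p (act N z) w"
    by (intro K_cocycle assms O n)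
  moreover have "K p (act N z) (act N w) + K p (act N w) w = K p (act N z) w"
    by (intro K_cocycle assms O n)
  ultimately show ?thesis unfolding K_act_z[OF assms(1,5,6)] by (metis add.commute add_left_cancel)
qed

lemma psi_eq:
  assumes "N \<in> GG" "p \<in> \<Omega>" "z \<in> \<Omega>" "den N z \<noteq> 0" "\<not> p \<simeq> z"
  shows "psi N p = K p (act N z) z"
proof (cases "p \<simeq> 0")
  case True
  hence "\<not> p \<simeq> 1" using zero_one_ineq by blast
  thus ?thesis unfolding psi_def using True one_Omega den_nonzero[OF GG_su[OF assms(1)], of 1]
    by (simp add: K_period_indep[OF assms(1,2) one_Omega assms(3)] assms)
next
  case False
  thus ?thesis unfolding psi_def using zero_Omega den_nonzero[OF GG_su[OF assms(1)], of 0]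
    by (simp add: K_period_indep[OF assms(1,2) zero_Omega assms(3)] assms)
qed

lemma ex_base: "\<exists>z\<in>\<Omega>. norm z \<le> 1 \<and> \<not> p \<simeq> z"
proof (cases "p \<simeq> 0")
  case True
  thus ?thesis using zero_one_ineq[of p] one_Omega by (intro bexI[of _ 1]) auto
next
  case False
  thus ?thesis using zero_Omega by (intro bexI[of _ 0]) auto
qed

lemma K_quasi:
  assumes "N \<in> GG" "p \<in> \<Omega>" "z \<in> \<Omega>" "w \<in> \<Omega>" "den N z \<noteq> 0" "\<not> p \<simeq> z" "\<not> p \<simeq> w"
  shows "K p (act N z) w = K p z w + psi N p"
proof -
  have "K p (act N z) z + K p z w = K p (act N z) w"
    by (intro K_cocycle assms Omega_act neq_act)
  thus ?thesis unfolding psi_eq[OF assms(1,2,3,5,6)] by (simp only: add.commute)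
qed

lemma psi_mul:
  assumes "N \<in> GG" "M \<in> GG" "p \<in> \<Omega>"
  shows "psi (pmul N M) p = psi N p + psi M p"
proof -
  obtain z where z: "z \<in> \<Omega>" "norm z \<le> 1" "\<not> p \<simeq> z" using ex_base by blast
  define w where "w = act M z"
  have dM: "den M z \<noteq> 0" using den_nonzero GG_su assms z by blast
  have w: "norm w \<le> 1" using z act_unit[OF GG_su[OF assms(2)], of z] act_disc[OF GG_su[OF assms(2)], of z] unfolding w_def
    by (cases "norm z = 1") auto
  have dN: "den N w \<noteq> 0" using den_nonzero GG_su assms w by blast
  have wO: "w \<in> \<Omega>" "\<not> p \<simeq> w" unfolding w_def using Omega_act neq_act z assms dM by blast+
  have d: "den (pmul N M) z \<noteq> 0" using dM dN by (simp add: den_pmul w_def)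
  have "psi (pmul N M) p = K p (act N w) z" using psi_eq[OF GG_mul[OF assms(1,2)] assms(3) z(1) d z(3)] dM by (simp add: act_pmul w_def)
  also have "\<dots> = K p w z + psi N p" by (intro K_quasi assms wO z dN)
  also have "K p w z = psi M p" unfolding w_def using psi_eq[OF assms(2,3) z(1) dM z(3)] by simp
  finally show ?thesis by simp
qed

lemma psi_act:
  assumes "N \<in> GG" "M \<in> GG" "p \<in> \<Omega>" "den M p \<noteq> 0"
  shows "psi N (act M p) / (den M p)\<^sup>2 = psi N p"
proof -
  obtain z where z: "z \<in> \<Omega>" "norm z \<le> 1" "\<not> p \<simeq> z" using ex_base by blast
  have dN: "den N z \<noteq> 0" using den_nonzero GG_su assms z by blast
  have n: "\<not> act M p \<simeq> z" using eq_act[OF assms(2,4)] z eq_trans by blast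
  show ?thesis 
    unfolding psi_eq[OF assms(1) Omega_act[OF assms(3,2,4)] z(1) dN n] psi_eq[OF assms(1,3) z(1) dN z(3)]
    by (rule K_act_p[OF assms(2,4)])
qed

text \<open>Nonvanishing for infinitely many elements at once is an open condition:
  \<open>D_lower\<close> treats all but finitely many of them uniformly, continuity the
  others.\<close>

lemma D_near:
  assumes "A \<subseteq> GG" "p \<in> \<Omega>" "z \<in> \<Omega>" "\<And>M. M \<in> A \<Longrightarrow> D M p z \<noteq> 0"
  shows "eventually (\<lambda>x. x \<in> \<Omega> \<and> (\<forall>M\<in>A. D M x z \<noteq> 0)) (nhds p)" "eventually (\<lambda>x. x \<in> \<Omega> \<and> (\<forall>M\<in>A. D M p x \<noteq> 0)) (nhds z)"
proof -
  obtain e E where e: "e > 0" "finite E" "(1,0) \<in> E"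
    "\<And>M p' z'. M\<in>GG-E \<Longrightarrow> p'\<in>ball p e \<Longrightarrow> z'\<in>ball z e \<Longrightarrow> norm (D M p' z') \<ge> e\<^sup>2 * norm (snd M)" 
    using D_lower[OF assms(2,3)] by meson
  have nz: "eventually (\<lambda>x. f x \<noteq> 0) (nhds x0)" if "f x0 \<noteq> 0" "f analytic_on {x0}" for f :: "complex \<Rightarrow> complex" and x0
  proof -
    have 1: "isCont f x0" using that(2) analytic_at_imp_isCont by blast
    have 2: "0 < norm (f x0)" using that(1) by simp
    from 1[unfolded continuous_at_eps_delta, rule_format, OF 2]
    obtain d where "d > 0" "\<And>x. dist x x0 < d \<Longrightarrow> dist (f x) (f x0) < norm (f x0)" by blast
    moreover from this(2) have "f x \<noteq> 0" if "dist x x0 < d" for x using that by force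
    ultimately show ?thesis unfolding eventually_nhds_metric by blast
  qed
  have D: "D M p' z' \<noteq> 0" if "M \<in> A" "M \<notin> E" "p'\<in>ball p e" "z'\<in>ball z e" for M p' z'
  proof -
    have M: "M \<in> GG" using that assms by (auto simp only: subset_iff)
    have "snd M \<noteq> 0" using snd_GG' M that(2) e(3) by (metis Diff_iff singletonD)
    hence "e\<^sup>2 * norm (snd M) > 0" using e(1) by simp
    thus ?thesis using e(4)[of M p' z'] M that by auto
  qed
  have fin: "finite (A \<inter> E)" using e by simp
  have "eventually (\<lambda>x. \<forall>M\<in>A\<inter>E. D M x z \<noteq> 0) (nhds p)"
    by (intro eventually_ball_finite[OF fin] ballI nz[of "\<lambda>x. D _ x z"] analytic_D assms(4)) auto
  moreover have "eventually (\<lambda>x. x \<in> ball p e) (nhds p)" using eventually_nhds_in_open[of "ball p e" p] e by auto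
  moreover have "eventually (\<lambda>x. x \<in> \<Omega>) (nhds p)" using eventually_nhds_in_open[OF open_Omega assms(2)] .
  ultimately show "eventually (\<lambda>x. x \<in> \<Omega> \<and> (\<forall>M\<in>A. D M x z \<noteq> 0)) (nhds p)"
  proof eventually_elim
    case (elim x)
    have "D M x z \<noteq> 0" if "M \<in> A" for M
    proof (cases "M \<in> E")
      case True thus ?thesis using elim that by blast
    next
      case False thus ?thesis using D[OF that] elim e(1) by simp
    qed
    thus ?case using elim by blast
  qed
  have "eventually (\<lambda>x. \<forall>M\<in>A\<inter>E. D M p x \<noteq> 0) (nhds z)"
    by (intro eventually_ball_finite[OF fin] ballI nz[of "\<lambda>x. D _ p x"] analytic_D assms(4)) auto
  moreover have "eventually (\<lambda>x. x \<in> ball z e) (nhds z)" using eventually_nhds_in_open[of "ball z e" z] e by auto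
  moreover have "eventually (\<lambda>x. x \<in> \<Omega>) (nhds z)" using eventually_nhds_in_open[OF open_Omega assms(3)] .
  ultimately show "eventually (\<lambda>x. x \<in> \<Omega> \<and> (\<forall>M\<in>A. D M p x \<noteq> 0)) (nhds z)"
  proof eventually_elim
    case (elim x)
    have "D M p x \<noteq> 0" if "M \<in> A" for M
    proof (cases "M \<in> E")
      case True thus ?thesis using elim that by blast
    next
      case False thus ?thesis using D[OF that] elim e(1) by simp
    qed
    thus ?case using elim by blast
  qed
qed

lemma eq_iff_D: "p \<simeq> z \<longleftrightarrow> (\<exists>M\<in>GG. D M p z = 0)"
  unfolding eqv_def using D_eq_0_iff[OF GG_su] by blast

lemma open_neq:
  assumes "p \<in> \<Omega>" "z \<in> \<Omega>" "\<not> p \<simeq> z"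
  shows "eventually (\<lambda>x. x \<in> \<Omega> \<and> \<not> x \<simeq> z) (nhds p)" "eventually (\<lambda>x. x \<in> \<Omega> \<and> \<not> p \<simeq> x) (nhds z)"
  using D_near[OF order_refl assms(1,2)] assms(3) unfolding eq_iff_D by auto

lemma psi_analytic:
  assumes "N \<in> GG" "p \<in> \<Omega>" shows "psi N analytic_on {p}"
proof -
  obtain z where z: "z \<in> \<Omega>" "norm z \<le> 1" "\<not> p \<simeq> z" using ex_base by blast
  have dN: "den N z \<noteq> 0" using den_nonzero GG_su assms z by blast
  have ev: "eventually (\<lambda>x. psi N x = K x (act N z) z) (nhds p)"
    using open_neq(1)[OF assms(2) z(1,3)]
    by eventually_elim (auto intro: psi_eq[OF assms(1) _ z(1) dN])
  have "(\<lambda>x. K x (act N z) z) analytic_on {p}"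
    by (intro K_p assms z Omega_act neq_act dN)
  thus ?thesis using analytic_at_cong[OF ev refl] by simp
qed

lemma psi_holomorphic: "N \<in> GG \<Longrightarrow> psi N holomorphic_on \<Omega>"
  using psi_analytic analytic_imp_holomorphic analytic_on_analytic_at by blast

lemma eq_rot: "\<zeta> * p \<simeq> \<zeta> * z \<longleftrightarrow> p \<simeq> z"
proof
  assume "p \<simeq> z"
  then obtain M where M: "M \<in> GG" "den M p \<noteq> 0" "act M p = z" unfolding eqv_def by blast
  show "\<zeta> * p \<simeq> \<zeta> * z" unfolding eqv_def
    by (rule bexI[OF _ rotm_GG[OF M(1)]]) (simp add: den_rotm act_rotm M)
next
  assume "\<zeta> * p \<simeq> \<zeta> * z"
  then obtain M where M: "M \<in> GG" "den M (\<zeta> * p) \<noteq> 0" "act M (\<zeta> * p) = \<zeta> * z" unfolding eqv_def by blast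
  have "M \<in> rotm ` GG" using bij_rotm M(1) unfolding bij_betw_def by simp
  then obtain N where N: "N \<in> GG" "M = rotm N" by blast
  have "den N p \<noteq> 0" "act N p = z" using M(2,3) unfolding N by (simp_all add: den_rotm act_rotm)
  thus "p \<simeq> z" unfolding eqv_def using N(1) by blast
qed

lemma psi_rot:
  assumes "N \<in> GG" "p \<in> \<Omega>"
  shows "psi (rotm N) (\<zeta> * p) * \<zeta> = psi N p"
proof -
  obtain z where z: "z \<in> \<Omega>" "norm z \<le> 1" "\<not> p \<simeq> z" using ex_base by blast
  have dN: "den N z \<noteq> 0" using den_nonzero GG_su assms z by blast
  have 1: "\<zeta> * p \<in> \<Omega>" "\<zeta> * z \<in> \<Omega>" using rot_Omega assms z by blast+
  have "psi (rotm N) (\<zeta> * p) = K (\<zeta> * p) (act (rotm N) (\<zeta> * z)) (\<zeta> * z)"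
    using z(3) dN by (intro psi_eq rotm_GG assms 1) (simp_all add: den_rotm eq_rot)
  hence "psi (rotm N) (\<zeta> * p) * \<zeta> = K p (act N z) z" unfolding act_rotm by (simp add: K_rot)
  thus ?thesis using psi_eq[OF assms(1,2) z(1) dN z(3)] by simp
qed

lemma K_split:
  assumes "p \<in> \<Omega>" "z \<in> \<Omega>" "w \<in> \<Omega>" "\<not> p \<simeq> z" "\<not> p \<simeq> w"
  shows "K p z w = 1/(z - p) - 1/(w - p) + KS GG' p z w"
proof -
  have "z \<noteq> p" "w \<noteq> p" using assms by auto
  hence T1: "T (1,0) p z w = 1/(z - p) - 1/(w - p)" by (simp add: T_def D.simps divide_simps)
  have e: "GG = {(1,0)} \<union> GG'" "{(1,0)} \<inter> GG' = {}" using GG.one by auto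
  have "(\<lambda>M. T M p z w) summable_on GG'"
    by (rule summable_on_subset_banach[OF K_summable[OF assms]]) blast
  hence "K p z w = infsum (\<lambda>M. T M p z w) {(1,0)} + KS GG' p z w"
    unfolding KS_def by (subst e(1), intro infsum_Un_disjoint e(2)) auto
  thus ?thesis using T1 by simp
qed

lemma KS'_analytic:
  assumes "p \<in> \<Omega>" "w \<in> \<Omega>" "\<not> p \<simeq> w"
  shows "(\<lambda>z. KS GG' p z w) analytic_on {p}"
proof (rule KS_z(1))
  show "D M p p \<noteq> 0" if "M \<in> GG'" for M using D_self assms that by blast
  show "D M p w \<noteq> 0" if "M \<in> GG'" for M using D_nz assms that by blast
qed (use assms in auto)

lemma deriv_T:
  assumes "D M p z \<noteq> 0" "D M p w \<noteq> 0"
  shows "((\<lambda>p. T M p z w) has_field_derivative 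
     - (w - z) * ((z * cnj (snd M) - fst M) * D M p w + (w * cnj (snd M) - fst M) * D M p z) / (D M p z * D M p w)\<^sup>2) (at p)"
proof -
  have D': "((\<lambda>p. D M p z) has_field_derivative (z * cnj (snd M) - fst M)) (at p)" for z
    unfolding D.simps by (cases M) (auto intro!: derivative_eq_intros)
  show ?thesis unfolding T_def
    by (rule derivative_eq_intros D' refl | use assms in force)+ (use assms in \<open>simp add: power2_eq_square algebra_simps\<close>)
qed

text \<open>The derivative in \<open>p\<close> is again a locally dominated series of functions of
  \<open>z\<close>: the Cauchy inequality on a circle of radius \<open>e / 2\<close> turns the bound
  on the terms into a bound on their derivatives.\<close>

lemma deriv_KS_analytic:
  assumes "A \<subseteq> GG" "p \<in> \<Omega>" "z0 \<in> \<Omega>" "w \<in> \<Omega>" "\<And>M. M \<in> A \<Longrightarrow> D M p z0 \<noteq> 0" "\<And>M. M \<in> A \<Longrightarrow> D M p w \<noteq> 0"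
  shows "(\<lambda>z. deriv (\<lambda>q. KS A q z w) p) analytic_on {z0}"
proof -
  obtain e E C where e: "e > 0" "finite E" "(1,0) \<in> E" 
    "\<And>M p' z w'. M\<in>GG-E \<Longrightarrow> p'\<in>ball p e \<Longrightarrow> z\<in>ball z0 e \<Longrightarrow> w'\<in>ball w e \<Longrightarrow> 
     D M p' z \<noteq> 0 \<and> D M p' w' \<noteq> 0 \<and> norm (T M p' z w') \<le> C * (1/(norm (snd M))\<^sup>2)"
    using T_bound[OF assms(2-4)] by meson
  have nz: "D M p' z \<noteq> 0" "D M p' w \<noteq> 0" "norm (T M p' z w) \<le> C * (1/(norm (snd M))\<^sup>2)" 
    if "M \<in> A - E" "z \<in> ball z0 e" "p' \<in> ball p e" for M z p'
    using e(4)[of M p' z w] that assms(1) e(1) by auto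
  have near: "eventually (\<lambda>x. x \<in> \<Omega> \<and> (\<forall>M\<in>A. D M p x \<noteq> 0)) (nhds z0)"
    by (rule D_near(2)[OF assms(1-3)]) (rule assms(5))
  define dT where "dT = (\<lambda>M z. deriv (\<lambda>q. T M q z w) p)"
  have dT: "dT M z = - (w - z) * ((z * cnj (snd M) - fst M) * D M p w + (w * cnj (snd M) - fst M) * D M p z) / (D M p z * D M p w)\<^sup>2"
    if "D M p z \<noteq> 0" "D M p w \<noteq> 0" for M z
    unfolding dT_def using deriv_T[OF that] by (rule DERIV_imp_deriv)
  have bound: "norm (dT M z) \<le> (2/e * C) * (1/(norm (snd M))\<^sup>2)" if "M \<in> A - E" "z \<in> ball z0 e" for M z
  proof -
    have "norm ((deriv ^^ 1) (\<lambda>q. T M q z w) p) \<le> fact 1 * (C * (1/(norm (snd M))\<^sup>2)) / (e/2)^1"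
    proof (rule Cauchy_inequality)
      have hol: "(\<lambda>q. T M q z w) holomorphic_on ball p e"
        unfolding T_def by (intro holomorphic_intros hol_D) (use nz that in auto)
      have sub: "cball p (e/2) \<subseteq> ball p e" using e(1) by auto
      show "(\<lambda>q. T M q z w) holomorphic_on ball p (e/2)" using hol by (rule holomorphic_on_subset) (use sub ball_subset_cball in blast)
      show "continuous_on (cball p (e/2)) (\<lambda>q. T M q z w)" using holomorphic_on_imp_continuous_on[OF holomorphic_on_subset[OF hol sub]] .
      show "0 < e/2" using e by simp
      show "norm (T M x z w) \<le> C * (1/(norm (snd M))\<^sup>2)" if "norm (p - x) = e/2" for x
        using nz(3)[OF \<open>M \<in> A - E\<close> \<open>z \<in> ball z0 e\<close>, of x] that e(1) by (auto simp: dist_norm)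
    qed
    thus ?thesis unfolding dT_def by (simp add: mult_ac)
  qed
  have hol: "dT M holomorphic_on ball z0 e" if "M \<in> A - E" for M
  proof -
    have "(\<lambda>z. - (w - z) * ((z * cnj (snd M) - fst M) * D M p w + (w * cnj (snd M) - fst M) * D M p z) / (D M p z * D M p w)\<^sup>2) holomorphic_on ball z0 e"
      by (intro holomorphic_intros hol_D) (use nz that e(1) in auto)
    thus ?thesis by (rule holomorphic_transform) (use dT nz that e(1) in auto)
  qed
  have ana: "dT M analytic_on {z0}" if "M \<in> A \<inter> E" for M
  proof -
    have M: "M \<in> A" using that by simp
    have "(\<lambda>z. - (w - z) * ((z * cnj (snd M) - fst M) * D M p w + (w * cnj (snd M) - fst M) * D M p z) / (D M p z * D M p w)\<^sup>2) analytic_on {z0}"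
      by (intro analytic_intros analytic_D) (use assms M in auto)
    moreover have "eventually (\<lambda>z. dT M z = - (w - z) * ((z * cnj (snd M) - fst M) * D M p w + (w * cnj (snd M) - fst M) * D M p z) / (D M p z * D M p w)\<^sup>2) (nhds z0)"
      using near by eventually_elim (use dT M assms in auto)
    ultimately show ?thesis by (rule analytic_at_transform)
  qed
  have "(\<lambda>z. \<Sum>\<^sub>\<infinity>M\<in>A. dT M z) analytic_on {z0}"
    by (rule analytic_infsum(1)[OF e(1,2) _ summable_tail[OF e(3) assms(1), of "2/e * C"]]; use bound hol ana in blast)
  moreover have "eventually (\<lambda>z. deriv (\<lambda>q. KS A q z w) p = (\<Sum>\<^sub>\<infinity>M\<in>A. dT M z)) (nhds z0)"
    using near 
  proof eventually_elim
    case (elim z)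
    have "((\<lambda>M. deriv (\<lambda>p. T M p z w) p) has_sum deriv (\<lambda>p. KS A p z w) p) A"
      by (rule KS_p(3)) (use elim assms in auto)
    thus ?case unfolding dT_def using infsumI by metis
  qed
  ultimately show ?thesis by (rule analytic_at_transform)
qed

section \<open>The kernel with a double pole\<close>

definition dK :: "complex \<Rightarrow> complex \<Rightarrow> complex \<Rightarrow> complex" where
  "dK p z w = deriv (\<lambda>q. K q z w) p"

lemma dK_analytic: "p \<in> \<Omega> \<Longrightarrow> z0 \<in> \<Omega> \<Longrightarrow> w \<in> \<Omega> \<Longrightarrow> \<not> p \<simeq> z0 \<Longrightarrow> \<not> p \<simeq> w \<Longrightarrow> (\<lambda>z. dK p z w) analytic_on {z0}"
  unfolding dK_def by (rule deriv_KS_analytic) (simp_all add: D_nz)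

lemma dK_quasi:
  assumes "N \<in> GG" "p \<in> \<Omega>" "z \<in> \<Omega>" "w \<in> \<Omega>" "den N z \<noteq> 0" "\<not> p \<simeq> z" "\<not> p \<simeq> w"
  shows "dK p (act N z) w = dK p z w + deriv (psi N) p"
proof -
  have "eventually (\<lambda>q. K q (act N z) w = K q z w + psi N q) (nhds p)"
    using open_neq(1)[OF assms(2,3,6)] open_neq(1)[OF assms(2,4,7)]
    by eventually_elim (use assms K_quasi in blast)
  hence "dK p (act N z) w = deriv (\<lambda>q. K q z w + psi N q) p" unfolding dK_def by (rule deriv_cong_ev) simp
  also have "\<dots> = dK p z w + deriv (psi N) p"
    unfolding dK_def using K_p[OF assms(2,3,4,6,7)] psi_analytic[OF assms(1,2)]
    by (intro deriv_add analytic_on_imp_differentiable_at) auto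
  finally show ?thesis .
qed

lemma dK_split:
  assumes "p \<in> \<Omega>" "z \<in> \<Omega>" "w \<in> \<Omega>" "\<not> p \<simeq> z" "\<not> p \<simeq> w"
  shows "dK p z w = 1/(z - p)\<^sup>2 - 1/(w - p)\<^sup>2 + deriv (\<lambda>q. KS GG' q z w) p"
proof -
  have ne: "z \<noteq> p" "w \<noteq> p" using assms by auto
  have d1: "((\<lambda>q. 1/(u - q)) has_field_derivative 1/(u - p)\<^sup>2) (at p)" if "u \<noteq> p" for u
    using that by (auto intro!: derivative_eq_intros simp: power2_eq_square)
  have "eventually (\<lambda>q. K q z w = 1/(z - q) - 1/(w - q) + KS GG' q z w) (nhds p)"
    using open_neq(1)[OF assms(1,2,4)] open_neq(1)[OF assms(1,3,5)]
    by eventually_elim (intro K_split assms; simp)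
  hence "dK p z w = deriv (\<lambda>q. 1/(z - q) - 1/(w - q) + KS GG' q z w) p" unfolding dK_def by (rule deriv_cong_ev) simp
  moreover have an: "(\<lambda>q. KS GG' q z w) analytic_on {p}"
  proof (rule KS_p(1))
    show "D M p z \<noteq> 0" "D M p w \<noteq> 0" if "M \<in> GG'" for M 
      by (rule D_nz[OF assms(4)], rule DiffD1[OF that], rule D_nz[OF assms(5)], rule DiffD1[OF that])
  qed (rule Diff_subset assms)+
  have fd: "(\<lambda>q. KS GG' q z w) field_differentiable at p"
    by (rule analytic_on_imp_differentiable_at[OF an]) simp
  note DERIV_imp_deriv[OF DERIV_add[OF DERIV_diff[OF d1[OF ne(1)] d1[OF ne(2)]] field_differentiable_derivI[OF fd]]]
  ultimately show ?thesis by simp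
qed

lemma dKS'_analytic:
  assumes "p \<in> \<Omega>" "w \<in> \<Omega>" "\<not> p \<simeq> w"
  shows "(\<lambda>z. deriv (\<lambda>q. KS GG' q z w) p) analytic_on {p}"
proof (rule deriv_KS_analytic)
  show "D M p p \<noteq> 0" if "M \<in> GG'" for M using D_self assms that by blast
  show "D M p w \<noteq> 0" if "M \<in> GG'" for M using D_nz assms that by blast
qed (use assms in auto)

end

section \<open>The residue theorem on the quotient\<close>

text \<open>The set is the union of the sets \<open>S - ball a t\<close> for \<open>t\<close>
  slightly larger than \<open>r\<close>. Each is connected, and all contain one point
  \<open>q\<close> that is far enough from \<open>a\<close>.\<close>

lemma connected_open_diff_cball:
  fixes a :: complex
  assumes "open S" "connected S" "cball a r \<subseteq> S" "S - cball a r \<noteq> {}" "r > 0"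
  shows "connected (S - cball a r)"
proof -
  obtain e where e: "e > 0" "\<And>x. dist a x < r + e \<Longrightarrow> x \<in> S"
  proof (cases "S = UNIV")
    case True thus ?thesis using that[of 1] by auto
  next
    case False
    have "compact (cball a r)" "closed (- S)" "cball a r \<inter> - S = {}" using assms by auto
    then obtain d where d: "d > 0" "\<And>x y. x \<in> cball a r \<Longrightarrow> y \<in> - S \<Longrightarrow> d \<le> dist x y"
      using separate_compact_closed[of "cball a r" "- S"] by auto
    show ?thesis
    proof (rule that[OF d(1)])
      fix x assume x: "dist a x < r + d"
      show "x \<in> S"
      proof (cases "dist a x \<le> r")
        case True thus ?thesis using assms by auto
      next
        case False
        define y where "y = a + of_real (r / dist a x) * (x - a)"
        have nx: "norm (x - a) = dist a x" by (simp add: dist_norm norm_minus_commute)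
        have "y - a = of_real (r / dist a x) * (x - a)" unfolding y_def by simp
        hence "norm (y - a) = \<bar>r / dist a x\<bar> * dist a x" using nx by (metis norm_mult norm_of_real)
        have "a \<noteq> x" using False assms(5) by auto
        have "norm (y - a) = r" using assms(5) \<open>a \<noteq> x\<close> \<open>norm (y - a) = \<bar>r / dist a x\<bar> * dist a x\<close> by simp
        hence "y \<in> cball a r" by (simp add: dist_norm norm_minus_commute)
        have "x - y = of_real (1 - r / dist a x) * (x - a)" unfolding y_def by (simp add: algebra_simps)
        hence "norm (x - y) = \<bar>1 - r / dist a x\<bar> * dist a x" using nx by (metis norm_mult norm_of_real)
        moreover have "1 - r / dist a x \<ge> 0" using False assms(5) by (simp add: divide_le_eq)
        hence "\<bar>1 - r / dist a x\<bar> * dist a x = dist a x - r" using \<open>a \<noteq> x\<close> by (simp add: left_diff_distrib)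
        ultimately have dyx: "dist y x = dist a x - r" by (simp add: dist_norm norm_minus_commute)
        show ?thesis using d(2)[of y x] x dyx \<open>y \<in> cball a r\<close> by force
      qed
    qed
  qed
  obtain q where "q \<in> S - cball a r" using assms(4) by blast
  hence q: "q \<in> S" "dist a q > r" by auto
  define d where "d = min (r + e) (dist a q)"
  have d: "d > r" "d \<le> r + e" "d \<le> dist a q" using e(1) q(2) unfolding d_def by auto
  have eq: "S - cball a r = \<Union>((\<lambda>t. S - ball a t) ` {r<..<d})"
  proof (intro equalityI subsetI)
    fix x assume x: "x \<in> S - cball a r"
    define t where "t = min (dist a x) ((r + d)/2)"
    have "(r + d)/2 < d" "r < (r + d)/2" using d(1) by (simp_all add: field_simps)
    hence "t \<in> {r<..<d}" "x \<in> S - ball a t" using x unfolding t_def min_def by auto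
    thus "x \<in> \<Union>((\<lambda>t. S - ball a t) ` {r<..<d})" by blast
  qed auto
  show ?thesis
  proof (subst eq, rule connected_Union)
    show "connected X" if "X \<in> (\<lambda>t. S - ball a t) ` {r<..<d}" for X
    proof -
      from that obtain t where "X = S - ball a t" "t \<in> {r<..<d}" by (rule imageE)
      hence t: "X = S - ball a t" "r < t" "t < d" by simp_all
      have "cball a t \<subseteq> S" using t e(2) d by auto
      thus ?thesis unfolding t(1) by (intro connected_diff_ball assms) auto
    qed
    have "q \<in> \<Inter>((\<lambda>t. S - ball a t) ` {r<..<d})"
      using q d by auto
    thus "\<Inter>((\<lambda>t. S - ball a t) ` {r<..<d}) \<noteq> {}" by blast
  qed
qed

lemma connected_ball_minus_cballs:
  fixes a :: "'i \<Rightarrow> complex"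
  assumes "finite I" "\<And>i. i \<in> I \<Longrightarrow> cball (a i) r \<subseteq> ball o' R" "r > 0"
    "\<And>i j. i \<in> I \<Longrightarrow> j \<in> I \<Longrightarrow> i \<noteq> j \<Longrightarrow> cball (a i) r \<inter> cball (a j) r = {}" 
    "p \<in> ball o' R - (\<Union>i\<in>I. cball (a i) r)"
  shows "connected (ball o' R - (\<Union>i\<in>I. cball (a i) r))"
  using assms(1,2,4,5)
proof (induction I rule: finite_induct)
  case (insert i I)
  define X where "X = ball o' R - (\<Union>i\<in>I. cball (a i) r)"
  have e: "ball o' R - (\<Union>i\<in>insert i I. cball (a i) r) = X - cball (a i) r" unfolding X_def by blast
  have "connected X" unfolding X_def by (rule insert.IH) (use insert.prems in auto)
  moreover have "open X" unfolding X_def using insert.hyps by (intro open_Diff closed_UN) auto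
  moreover have "cball (a i) r \<subseteq> X"
  proof
    fix x assume x: "x \<in> cball (a i) r"
    have "x \<notin> cball (a j) r" if "j \<in> I" for j
      using insert.prems(2)[of i j] that insert.hyps x by blast
    thus "x \<in> X" unfolding X_def using insert.prems(1)[of i] x by blast
  qed
  moreover have "X - cball (a i) r \<noteq> {}" using insert.prems(3) e by blast
  ultimately show ?case unfolding e using assms(3) by (intro connected_open_diff_cball)
qed simp

text \<open>The two loops are linked by a path inside \<open>S\<close> that is traversed in both
  directions, so that its contribution cancels.\<close>

lemma join_loops:
  assumes S: "open S" "connected S"
    and 1: "valid_path \<gamma>1" "pathfinish \<gamma>1 = pathstart \<gamma>1" "path_image \<gamma>1 \<subseteq> S"
    and 2: "valid_path \<gamma>2" "pathfinish \<gamma>2 = pathstart \<gamma>2" "path_image \<gamma>2 \<subseteq> S"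
  shows "\<exists>\<gamma>. valid_path \<gamma> \<and> pathfinish \<gamma> = pathstart \<gamma> \<and> path_image \<gamma> \<subseteq> S \<and>
    (\<forall>f. f holomorphic_on S \<longrightarrow> contour_integral \<gamma> f = contour_integral \<gamma>1 f + contour_integral \<gamma>2 f)"
proof -
  have "pathstart \<gamma>1 \<in> S" "pathstart \<gamma>2 \<in> S" using 1(3) 2(3) pathstart_in_path_image by blast+
  then obtain l where l: "polynomial_function l" "path_image l \<subseteq> S" "pathstart l = pathstart \<gamma>1" "pathfinish l = pathstart \<gamma>2"
    using connected_open_polynomial_connected[OF S] by blast
  have vl: "valid_path l" using l(1) valid_path_polynomial_function by blast
  define \<gamma> where "\<gamma> = \<gamma>1 +++ (l +++ (\<gamma>2 +++ reversepath l))"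
  have vr: "valid_path (reversepath l)" using vl valid_path_imp_reverse by blast
  have v3: "valid_path (\<gamma>2 +++ reversepath l)" using vr 2 l by (intro valid_path_join) auto
  have v2: "valid_path (l +++ (\<gamma>2 +++ reversepath l))" by (rule valid_path_join[OF vl v3]) (use l in simp)
  have v: "valid_path \<gamma>" unfolding \<gamma>_def by (rule valid_path_join[OF 1(1) v2]) (use 1 l in simp)
  have "contour_integral \<gamma> f = contour_integral \<gamma>1 f + contour_integral \<gamma>2 f" if f: "f holomorphic_on S" for f
  proof -
    have int: "f contour_integrable_on p" if "valid_path p" "path_image p \<subseteq> S" for p
      using contour_integrable_holomorphic_simple[OF f S(1) that] .
    have i1: "f contour_integrable_on \<gamma>1" "f contour_integrable_on \<gamma>2" "f contour_integrable_on l" 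
      using 1 2 l vl by (auto intro: int)
    have ir: "f contour_integrable_on reversepath l" using i1(3) vl by (simp add: contour_integrable_reversepath)
    have i3: "f contour_integrable_on (\<gamma>2 +++ reversepath l)" using i1 ir 2 vr by (intro contour_integrable_joinI)
    have i2: "f contour_integrable_on (l +++ (\<gamma>2 +++ reversepath l))" by (rule contour_integrable_joinI[OF i1(3) i3 vl v3])
    show ?thesis unfolding \<gamma>_def
      using i1 i2 i3 ir 1 2 vl vr v2 v3 by (simp add: contour_integral_join contour_integral_reversepath)
  qed
  moreover have "path_image \<gamma> \<subseteq> S" "pathfinish \<gamma> = pathstart \<gamma>" unfolding \<gamma>_def using 1 2 l by (auto simp: path_image_join)
  ultimately show ?thesis using v by blast
qed

lemma joined_cycle:
  assumes "finite I" "I \<noteq> {}" and S: "open S" "connected S"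
    and "\<And>i. i \<in> I \<Longrightarrow> valid_path (\<gamma> i) \<and> pathfinish (\<gamma> i) = pathstart (\<gamma> i) \<and> path_image (\<gamma> i) \<subseteq> S"
  shows "\<exists>\<beta>. valid_path \<beta> \<and> pathfinish \<beta> = pathstart \<beta> \<and> path_image \<beta> \<subseteq> S \<and>
    (\<forall>f. f holomorphic_on S \<longrightarrow> contour_integral \<beta> f = (\<Sum>i\<in>I. contour_integral (\<gamma> i) f))"
  using assms(1,2,5)
proof (induction I rule: finite_ne_induct)
  case (singleton i)
  thus ?case by (intro exI[of _ "\<gamma> i"]) auto
next
  case (insert i I)
  then obtain \<beta> where \<beta>: "valid_path \<beta>" "pathfinish \<beta> = pathstart \<beta>" "path_image \<beta> \<subseteq> S" 
    "\<And>f. f holomorphic_on S \<Longrightarrow> contour_integral \<beta> f = (\<Sum>i\<in>I. contour_integral (\<gamma> i) f)" by blast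
  have i: "valid_path (\<gamma> i)" "pathfinish (\<gamma> i) = pathstart (\<gamma> i)" "path_image (\<gamma> i) \<subseteq> S" using insert.prems by auto
  from join_loops[OF S i \<beta>(1-3)] show ?case using \<beta>(4) insert.hyps by (elim ex_forward) auto
qed

text \<open>The loops are joined to one closed path in the complement of the singularities. What has
  to vanish outside \<open>S\<close> is the sum of the winding numbers, not each of them; this is
  the form needed for the boundary of a multiply connected domain.\<close>

theorem Residue_theorem_cycle:
  fixes S pts :: "complex set"
  assumes S: "open S" "connected S" "finite pts" and holo: "f holomorphic_on S - pts" and I: "finite I" "I \<noteq> {}"
    and \<gamma>: "\<And>i. i \<in> I \<Longrightarrow> valid_path (\<gamma> i) \<and> pathfinish (\<gamma> i) = pathstart (\<gamma> i) \<and> path_image (\<gamma> i) \<subseteq> S - pts"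
    and homo: "\<And>z. z \<notin> S \<Longrightarrow> (\<Sum>i\<in>I. winding_number (\<gamma> i) z) = 0"
  shows "(\<Sum>i\<in>I. contour_integral (\<gamma> i) f) = 2 * pi * \<i> * (\<Sum>p\<in>pts. (\<Sum>i\<in>I. winding_number (\<gamma> i) p) * residue f p)"
proof -
  have o: "open (S - pts)" "connected (S - pts)" 
    using S by (auto intro: finite_imp_closed connected_open_delete_finite)
  have "\<exists>\<beta>. valid_path \<beta> \<and> pathfinish \<beta> = pathstart \<beta> \<and> path_image \<beta> \<subseteq> S - pts \<and>
    (\<forall>f. f holomorphic_on S - pts \<longrightarrow> contour_integral \<beta> f = (\<Sum>i\<in>I. contour_integral (\<gamma> i) f))"
    by (rule joined_cycle[OF I o \<gamma>])
  then obtain \<beta> where \<beta>: "valid_path \<beta>" "pathfinish \<beta> = pathstart \<beta>" "path_image \<beta> \<subseteq> S - pts" 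
    "\<And>f. f holomorphic_on (S - pts) \<Longrightarrow> contour_integral \<beta> f = (\<Sum>i\<in>I. contour_integral (\<gamma> i) f)"
    by (elim exE conjE) simp
  have w: "winding_number \<beta> z = (\<Sum>i\<in>I. winding_number (\<gamma> i) z)" if z: "z \<notin> S - pts" for z
  proof -
    have "(\<lambda>w. 1/(w - z)) holomorphic_on (S - pts)" using z by (auto intro!: holomorphic_intros)
    moreover have "winding_number \<beta> z = 1/(2*pi*\<i>) * contour_integral \<beta> (\<lambda>w. 1/(w - z))"
      using \<beta> z by (intro winding_number_valid_path) auto
    moreover have "winding_number (\<gamma> i) z = 1/(2*pi*\<i>) * contour_integral (\<gamma> i) (\<lambda>w. 1/(w - z))" if "i \<in> I" for i
      using \<gamma>[OF that] z by (intro winding_number_valid_path) auto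
    ultimately show ?thesis using \<beta>(4) by (simp add: sum_distrib_left sum_divide_distrib)
  qed
  have "contour_integral \<beta> f = 2 * pi * \<i> * (\<Sum>p\<in>pts. winding_number \<beta> p * residue f p)"
  proof (rule Residue_theorem[OF S holo \<beta>(1-3)])
    show "\<forall>z. z \<notin> S \<longrightarrow> winding_number \<beta> z = 0" using w homo by auto
  qed
  also have "(\<Sum>p\<in>pts. winding_number \<beta> p * residue f p) = (\<Sum>p\<in>pts. (\<Sum>i\<in>I. winding_number (\<gamma> i) p) * residue f p)"
    using w by (intro sum.cong) auto
  finally show ?thesis using \<beta>(4)[OF holo] by simp
qed

text \<open>A generator with index \<open>k\<close> turns the starting point of its circle by the
  angle of \<open>\<zeta>^(2*k)\<close>; shifting the parameter shows that the integral is the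
  same.\<close>

lemma contour_integral_rotated_circle:
  assumes "norm u = 1"
  shows "contour_integral (\<lambda>t. z + u * of_real r * exp (2 * of_real pi * \<i> * of_real t)) f = contour_integral (circlepath z r) f"
    and "valid_path (\<lambda>t. z + u * of_real r * exp (2 * of_real pi * \<i> * of_real t))"
proof -
  obtain x where x: "0 \<le> x" "x < 2*pi" "u = cis x" 
    using assms by (metis Arg2pi_ge_0 Arg2pi_lt_2pi complex_norm_eq_1_exp cis_conv_exp mult.commute)
  define a where "a = x / (2*pi)"
  have a: "a \<in> {0..1}" using x unfolding a_def by auto
  have u: "u = exp (2 * of_real pi * \<i> * of_real a)" unfolding x(3) a_def cis_conv_exp by (simp add: mult_ac)
  have eq: "(\<lambda>t. z + u * of_real r * exp (2 * of_real pi * \<i> * of_real t)) = shiftpath a (circlepath z r)"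
  proof
    fix t :: real
    have 1: "circlepath z r (a + t) = z + u * of_real r * exp (2 * of_real pi * \<i> * of_real t)"
      unfolding circlepath u by (simp add: exp_add[symmetric] algebra_simps)
    have 2: "circlepath z r (a + t - 1) = circlepath z r (a + t)"
      unfolding circlepath by (simp add: algebra_simps exp_diff exp_add)
    show "z + u * of_real r * exp (2 * of_real pi * \<i> * of_real t) = shiftpath a (circlepath z r) t"
      unfolding shiftpath_def using 1 2 by simp
  qed
  show "contour_integral (\<lambda>t. z + u * of_real r * exp (2 * of_real pi * \<i> * of_real t)) f = contour_integral (circlepath z r) f"
    unfolding eq by (rule contour_integral_shiftpath) (use a in auto)
  show "valid_path (\<lambda>t. z + u * of_real r * exp (2 * of_real pi * \<i> * of_real t))"
    unfolding eq by (rule valid_path_shiftpath) (use a in auto)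
qed

context schottky_curve
begin

text \<open>On a circle about its pole a generator behaves like the reciprocal of the variable, so
  the image circle is traversed backwards. This is the origin of the sign.\<close>

lemma contour_integral_act_circle:
  assumes "l \<in> Ls" "r > 0"
  shows "contour_integral (circlepath (cen (linv l)) (\<rho>\<^sup>2/r)) h = 
    - contour_integral (circlepath (cen l) r) (\<lambda>w. h (act (lm l) w) / (den (lm l) w)\<^sup>2)"
proof -
  obtain k b where l: "l = (k,b)" by (cases l)
  define u where "u = \<zeta>^(2*k)"
  have u: "norm u = 1" unfolding u_def by simp
  define \<gamma> where "\<gamma> = (\<lambda>t. cen (linv l) + u * of_real (\<rho>\<^sup>2/r) * exp (2 * of_real pi * \<i> * of_real t))"
  have ne: "w \<noteq> cen l" if "w \<in> sphere (cen l) r" for w using that assms by auto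
  have d0: "den (lm l) w \<noteq> 0" if "w \<in> sphere (cen l) r" for w using ne[OF that] den_lm_eq_0_iff by simp
  have an: "act (lm l) analytic_on sphere (cen l) r"
    unfolding act_def using d0 by (cases "lm l") (auto intro!: analytic_intros)
  have eq: "act (lm l) \<circ> circlepath (cen l) r = reversepath \<gamma>"
  proof
    fix t :: real
    define e where "e = exp (2 * of_real pi * \<i> * of_real t)"
    have e: "e \<noteq> 0" unfolding e_def by simp
    have ci: "circlepath (cen l) r t = cen l + of_real r * e" unfolding circlepath e_def by simp
    have "act (lm l) (circlepath (cen l) r t) = cen (linv l) + u * of_real (\<rho>\<^sup>2) / (of_real r * e)"
    proof -
      have nz: "cen l + of_real r * e \<noteq> cen (k,b)" using assms e l by (simp del: cen.simps)
      show ?thesis unfolding ci using act_lm[OF nz] unfolding l u_def by (simp del: cen.simps linv.simps)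
    qed
    also have "\<dots> = cen (linv l) + u * of_real (\<rho>\<^sup>2/r) * inverse e" using assms e by (simp add: field_simps)
    also have "inverse e = exp (2 * of_real pi * \<i> * of_real (1 - t))"
      unfolding e_def by (simp add: right_diff_distrib exp_diff inverse_eq_divide)
    finally show "(act (lm l) \<circ> circlepath (cen l) r) t = reversepath \<gamma> t" by (simp add: reversepath_def \<gamma>_def)
  qed
  have "contour_integral (act (lm l) \<circ> circlepath (cen l) r) h = 
     contour_integral (circlepath (cen l) r) (\<lambda>w. deriv (act (lm l)) w * h (act (lm l) w))"
    by (rule contour_integral_comp_analyticW[OF an]) (use assms in auto)
  also have "\<dots> = contour_integral (circlepath (cen l) r) (\<lambda>w. h (act (lm l) w) / (den (lm l) w)\<^sup>2)"
  proof (rule contour_integral_cong)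
    fix w assume "w \<in> path_image (circlepath (cen l) r)"
    hence "den (lm l) w \<noteq> 0" using d0 assms by simp
    from DERIV_imp_deriv[OF act_deriv[OF lm_su this]]
    show "deriv (act (lm l)) w * h (act (lm l) w) = h (act (lm l) w) / (den (lm l) w)\<^sup>2" by simp
  qed simp
  also have "contour_integral (act (lm l) \<circ> circlepath (cen l) r) h = - contour_integral \<gamma> h"
    unfolding eq \<gamma>_def by (rule contour_integral_reversepath) (rule contour_integral_rotated_circle(2)[OF u])
  also have "contour_integral \<gamma> h = contour_integral (circlepath (cen (linv l)) (\<rho>\<^sup>2/r)) h"
    unfolding \<gamma>_def by (rule contour_integral_rotated_circle(1)[OF u])
  finally have "- (- contour_integral (circlepath (cen (linv l)) (\<rho>\<^sup>2/r)) h) = 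
      - contour_integral (circlepath (cen l) r) (\<lambda>w. h (act (lm l) w) / (den (lm l) w)\<^sup>2)"
    by (rule arg_cong)
  thus ?thesis by (simp only: minus_minus)
qed

text \<open>The factor \<open>m\<close> is \<open>0\<close> for a differential and \<open>1\<close> for the
  logarithmic derivative of the coefficient of a differential; the point \<^term>\<open>c\<close> stands for infinity.\<close>

lemma residue_sum:
  assumes s: "1 \<le> s" "s < s1" 
    and hol: "h holomorphic_on \<Omega> - Q" and Q: "Q \<subseteq> \<Omega>" "\<And>z. z \<in> \<Omega> \<Longrightarrow> \<not> z islimpt Q"
    and circ: "\<And>l z. l \<in> Ls \<Longrightarrow> norm (z - cen l) = rad s l \<Longrightarrow> z \<notin> Q"
    and inv: "\<And>k w. k < g \<Longrightarrow> w \<in> \<Omega> - Q \<Longrightarrow> w \<noteq> cen (k,True) \<Longrightarrow> act (lm (k,True)) w \<notin> Q \<and> 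
       h (act (lm (k,True)) w) / (den (lm (k,True)) w)\<^sup>2 = h w + m * (2 / (w - cen (k,True)))"
  shows "finite (Q \<inter> outside s)" "(\<Sum>p\<in>Q \<inter> outside s. residue h p) + residue h c = m * (2 * of_nat g - 2)"
proof -
  define l0 where "l0 = (0::nat,True)"
  have l0: "l0 \<in> Ls" "cen l0 = c" "linv l0 \<in> Ls" using g_pos unfolding l0_def by auto
  define o' where "o' = cen (linv l0)"
  obtain e0 where e0: "e0 > 0" "ball c e0 \<subseteq> \<Omega>" using open_Omega c_Omega open_contains_ball by blast
  obtain e1 where e1: "e1 > 0" "\<And>w. w \<in> Q \<Longrightarrow> w \<noteq> c \<Longrightarrow> dist w c < e1 \<Longrightarrow> False"
    using Q(2)[OF c_Omega] unfolding islimpt_approachable by (metis dist_commute)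
  \<comment> \<open>From this radius on, a circle about \<open>o'\<close> encloses all the circles
    of the letters, since every centre has modulus \<open>norm c\<close>.\<close>
  define B where "B = 2 * norm c + s1 * \<rho> + 1"
  have B: "B > 0" unfolding B_def using norm_c_gt rho_pos s1(1) by (intro add_pos_pos add_nonneg_pos) auto
  define e where "e = min (min (e0/2) (e1/2)) (\<rho>\<^sup>2 / B)"
  have e: "e > 0" "e < e0" "e < e1" "e \<le> \<rho>\<^sup>2/B" using e0 e1 B rho_pos unfolding e_def by auto
  \<comment> \<open>The outer circle of the cycle is the image under \<open>lm l0\<close> of the
    circle of radius \<open>e\<close> about \<open>c\<close>, that is a small circle around
    infinity.\<close>
  define Ro where "Ro = \<rho>\<^sup>2/e"
  have Ro: "Ro \<ge> B" "Ro > 0" unfolding Ro_def using e B rho_pos by (simp_all add: field_simps)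
  \<comment> \<open>Below every boundary radius, but above \<open>\<rho> / s1\<close> so that the
    annuli stay in the domain of discontinuity. With it, \<open>S\<close> is a neighbourhood of the
    truncated fundamental domain.\<close>
  define r2 where "r2 = (\<rho>/s1 + \<rho>/s)/2"
  have "\<rho>/s1 < \<rho>/s" using s rho_pos by (intro divide_strict_left_mono) auto
  moreover have "A < B \<Longrightarrow> A < (A + B)/2 \<and> (A + B)/2 < B" for A B :: real by auto
  ultimately have r2: "\<rho>/s1 < r2" "r2 < \<rho>/s" unfolding r2_def by blast+
  have r2p: "r2 > 0" using r2 rho_pos s1(1) by (meson divide_pos_pos less_trans zero_less_one)
  have rads: "r2 < rad s l" "rad s l < s1 * \<rho>" for l
  proof -
    have 1: "\<rho>/s \<le> s * \<rho>" using s rho_pos by (simp add: field_simps power2_eq_square[symmetric])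
    have 2: "s * \<rho> < s1 * \<rho>" using s rho_pos by simp
    show "r2 < rad s l" "rad s l < s1 * \<rho>" using 1 2 r2 by (cases l; simp)+
  qed
  define R2 where "R2 = Ro + 1"
  define S where "S = ball o' R2 - (\<Union>l\<in>Ls. cball (cen l) r2)"
  define L where "L = cball o' R2 - (\<Union>l\<in>Ls. ball (cen l) r2)"
  have cin: "norm (z - o') < Ro" if "norm (z - cen l) \<le> s1 * \<rho>" for z l
  proof -
    have "norm (z - o') \<le> norm (z - cen l) + norm (cen l - o')" using norm_triangle_ineq[of "z - cen l" "cen l - o'"] by simp
    also have "norm (cen l - o') \<le> norm (cen l) + norm o'" by (rule norm_triangle_ineq4)
    finally show ?thesis using that Ro(1) unfolding B_def o'_def norm_cen by linarith
  qed
  have inO: "z \<in> \<Omega>" if z: "\<And>l. l \<in> Ls \<Longrightarrow> r2 \<le> norm (z - cen l)" for z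
  proof (cases "z \<in> coutside s")
    case True thus ?thesis using coutside_Omega s by blast
  next
    case False
    then obtain l where l: "l \<in> Ls" "norm (z - cen l) < rad s l"
      unfolding coutside_def mem_Collect_eq by (simp only: Ball_def not_all not_imp not_le) (elim exE conjE)
    show ?thesis using annulus_Omega[OF l(1)] z[OF l(1)] l(2) rads(2)[of l] r2(1) by simp
  qed
  have SL: "S \<subseteq> L" unfolding S_def L_def by (auto simp: Ball_def)
  have LO: "L \<subseteq> \<Omega>"
  proof
    fix z assume "z \<in> L"
    hence "\<And>l. l \<in> Ls \<Longrightarrow> r2 \<le> norm (z - cen l)" unfolding L_def by (auto simp: dist_norm norm_minus_commute not_less simp del: cen.simps)
    thus "z \<in> \<Omega>" by (rule inO)
  qed
  have "compact L" unfolding L_def by (intro compact_diff compact_cball open_UN ballI open_ball)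
  hence fin: "finite (L \<inter> Q)" using Q(2) LO by (intro finite_not_islimpt_in_compact) auto
  define pts where "pts = S \<inter> Q"
  have fpts: "finite pts" unfolding pts_def using fin SL by (meson finite_subset Int_mono order_refl)
  have openS: "open S" unfolding S_def by (intro open_Diff closed_UN ballI finite_Ls closed_cball open_ball)
  have zero: "0 \<in> outside s" using zero_outside s by simp
  have outs: "z \<in> S" if "z \<in> outside s" "norm (z - o') < R2" for z
  proof -
    have "z \<notin> cball (cen l) r2" if "l \<in> Ls" for l
    proof -
      have "rad s l < norm (z - cen l)" using \<open>z \<in> outside s\<close> that unfolding outside_def mem_Collect_eq by (rule bspec)
      thus ?thesis using rads(1)[of l] by (simp add: dist_norm norm_minus_commute)
    qed
    thus ?thesis using that(2) unfolding S_def by (simp add: dist_norm norm_minus_commute)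
  qed
  have nzero: "norm (0 - o') < R2" using Ro norm_c_gt rho_pos s1(1) unfolding R2_def B_def o'_def 
    by (simp add: norm_cen del: cen.simps) (smt (verit) mult_pos_pos)
  have conS: "connected S" unfolding S_def
  proof (rule connected_ball_minus_cballs)
    show "cball (cen l) r2 \<subseteq> ball o' R2" for l
    proof
      fix z assume "z \<in> cball (cen l) r2"
      hence "norm (z - cen l) \<le> s1 * \<rho>" using rads[of l] by (simp add: dist_norm norm_minus_commute)
      from cin[OF this] show "z \<in> ball o' R2" unfolding R2_def by (simp add: dist_norm norm_minus_commute)
    qed
    show "cball (cen i) r2 \<inter> cball (cen j) r2 = {}" if ij: "i \<in> Ls" "j \<in> Ls" "i \<noteq> j" for i j
    proof (rule ccontr)
      assume "cball (cen i) r2 \<inter> cball (cen j) r2 \<noteq> {}"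
      then obtain z where "z \<in> cball (cen i) r2" "z \<in> cball (cen j) r2" by blast
      hence z: "norm (z - cen i) \<le> r2" "norm (z - cen j) \<le> r2" by (simp_all add: dist_norm norm_minus_commute)
      show False using disc_sep[of s i j z] s ij z rads[of i] rads[of j] by auto
    qed
    show "0 \<in> ball o' R2 - (\<Union>l\<in>Ls. cball (cen l) r2)" using outs[OF zero nzero] unfolding S_def .
  qed (use r2p in auto)
  have hS: "h holomorphic_on S - pts"
    using hol by (rule holomorphic_on_subset) (use SL LO in \<open>auto simp: pts_def\<close>)
  define I where "I = insert None (Some ` Ls)"
  define \<gamma> where "\<gamma> = (\<lambda>x. case x of None \<Rightarrow> circlepath o' Ro | Some l \<Rightarrow> reversepath (circlepath (cen l) (rad s l)))"
  have rp: "rad s l > 0" for l using rad_pos s by simp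
  \<comment> \<open>The inverse of \<open>lm l0\<close> carries the points on and beyond the outer
    circle into the punctured disc of radius \<open>e\<close> about \<open>c\<close>, which contains
    no point of \<open>Q\<close>.\<close>
  have far: "z \<notin> Q" if z: "norm (z - o') \<ge> Ro" for z
  proof -
    have ne: "z \<noteq> cen (linv l0)" using z Ro unfolding o'_def by auto
    define w where "w = act (lm (linv l0)) z"
    have nw: "norm (w - c) = \<rho>\<^sup>2 / norm (z - o')" unfolding w_def using dist_act_lm[OF ne] l0(2) unfolding o'_def by simp
    have d: "den (lm (linv l0)) z \<noteq> 0" using ne den_lm_eq_0_iff by simp
    have pz: "norm (z - o') > 0" using z Ro by linarith
    have "\<rho>\<^sup>2 / norm (z - o') \<le> \<rho>\<^sup>2 / Ro" using z Ro pz by (intro divide_left_mono) auto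
    also have "\<rho>\<^sup>2 / Ro = e" unfolding Ro_def using e rho_pos by simp
    finally have we: "norm (w - c) \<le> e" using nw by simp
    have wc: "w \<noteq> c" using nw pz rho_pos by auto
    have wO: "w \<in> \<Omega>" using we e e0 by (intro subsetD[OF e0(2)]) (simp add: dist_norm norm_minus_commute)
    have wQ: "w \<notin> Q" using e1(2)[of w] wc we e by (auto simp: dist_norm)
    have "act (lm l0) w = z" unfolding w_def using act_pinv_act[OF lm_su d] lm_linv[of "linv l0"] by simp
    thus "z \<notin> Q" using inv[of 0 w] wO wQ wc l0(2) g_pos unfolding l0_def by auto
  qed
  have circS: "sphere (cen l) (rad s l) \<subseteq> S - pts" if l: "l \<in> Ls" for l
  proof
    fix z assume "z \<in> sphere (cen l) (rad s l)"
    hence z: "norm (z - cen l) = rad s l" by (simp add: dist_norm norm_minus_commute)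
    have zs: "norm (z - cen l) \<le> s1 * \<rho>" using z rads(2)[of l] by simp
    have "r2 < norm (z - cen l')" if "l' \<in> Ls" for l'
      using disc_sep[of s l l' z] s l that zs z rads(1)[of l] rads(1)[of l'] by (cases "l = l'") auto
    moreover have "norm (z - o') < R2" using cin[OF zs] R2_def by simp
    ultimately show "z \<in> S - pts" using circ[OF l z] unfolding S_def pts_def
      by (auto simp: dist_norm norm_minus_commute not_le simp del: cen.simps)
  qed
  have outS: "sphere o' Ro \<subseteq> S - pts"
  proof
    fix z assume "z \<in> sphere o' Ro"
    hence z: "norm (z - o') = Ro" by (simp add: dist_norm norm_minus_commute)
    have "r2 < norm (z - cen l)" for l
    proof (rule ccontr)
      assume "\<not> ?thesis"
      hence "norm (z - cen l) \<le> s1 * \<rho>" using rads[of l] by auto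
      from cin[OF this] show False using z by simp
    qed
    thus "z \<in> S - pts" using far[of z] z unfolding S_def pts_def R2_def
      by (auto simp: dist_norm norm_minus_commute not_le simp del: cen.simps)
  qed
  have sum_I: "(\<Sum>x\<in>I. f x) = f None + (\<Sum>l\<in>Ls. f (Some l))" for f :: "letter option \<Rightarrow> complex"
    unfolding I_def by (subst sum.insert) (auto simp: sum.reindex)
  have wn: "winding_number (\<gamma> (Some l)) z = (if norm (z - cen l) < rad s l then -1 else 0)" 
    if "norm (z - cen l) \<noteq> rad s l" for l z
  proof -
    have zi: "z \<notin> path_image (circlepath (cen l) (rad s l))" using that rp[of l] by (auto simp: dist_norm norm_minus_commute)
    have "winding_number (\<gamma> (Some l)) z = - winding_number (circlepath (cen l) (rad s l)) z"
      unfolding \<gamma>_def using zi by (simp add: winding_number_reversepath del: cen.simps rad.simps)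
    moreover have "winding_number (circlepath (cen l) (rad s l)) z = (if norm (z - cen l) < rad s l then 1 else 0)"
    proof (cases "norm (z - cen l) < rad s l")
      case True thus ?thesis using winding_number_circlepath[OF True] by simp
    next
      case False
      have "winding_number (circlepath (cen l) (rad s l)) z = 0"
      proof (rule winding_number_zero_outside)
        show "path (circlepath (cen l) (rad s l))" by simp
        show "convex (cball (cen l) (rad s l))" by simp
        show "z \<notin> cball (cen l) (rad s l)" using False that by (simp add: dist_norm norm_minus_commute)
        show "path_image (circlepath (cen l) (rad s l)) \<subseteq> cball (cen l) (rad s l)" using rp[of l] by auto
      qed simp
      thus ?thesis using False by simp
    qed
    ultimately show ?thesis by simp
  qed
  have wo: "winding_number (\<gamma> None) z = (if norm (z - o') < Ro then 1 else 0)" if "norm (z - o') \<noteq> Ro" for z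
  proof (cases "norm (z - o') < Ro")
    case True thus ?thesis using winding_number_circlepath[OF True] by (simp add: \<gamma>_def)
  next
    case False
    have "winding_number (circlepath o' Ro) z = 0"
    proof (rule winding_number_zero_outside)
      show "z \<notin> cball o' Ro" using False that by (simp add: dist_norm norm_minus_commute)
      show "path_image (circlepath o' Ro) \<subseteq> cball o' Ro" using Ro by auto
    qed auto
    thus ?thesis using False by (simp add: \<gamma>_def)
  qed
  have wsum: "(\<Sum>x\<in>I. winding_number (\<gamma> x) z) = (if norm (z - o') < Ro \<and> z \<in> outside s then 1 else 0)"
    if z: "norm (z - o') \<noteq> Ro" "\<And>l. l \<in> Ls \<Longrightarrow> norm (z - cen l) \<noteq> rad s l" for z
  proof (cases "\<exists>l\<in>Ls. norm (z - cen l) < rad s l")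
    case True
    then obtain l where l: "l \<in> Ls" "norm (z - cen l) < rad s l" by blast
    have zs: "norm (z - cen l) \<le> s1 * \<rho>" using l rads(2)[of l] by simp
    have "\<not> norm (z - cen l') < rad s l'" if "l' \<in> Ls" "l' \<noteq> l" for l'
      using disc_sep[of s l l' z] s l that zs by auto
    hence "(\<Sum>l'\<in>Ls. winding_number (\<gamma> (Some l')) z) = (\<Sum>l'\<in>Ls. if l' = l then -1 else 0)"
      using wn z(2) l(2) by (intro sum.cong) auto
    also have "\<dots> = -1" using l(1) by simp
    finally have "(\<Sum>x\<in>I. winding_number (\<gamma> x) z) = 0" unfolding sum_I using wo[OF z(1)] cin[OF zs] by simp
    moreover have "z \<notin> outside s" using l unfolding outside_def mem_Collect_eq by (meson less_asym)
    ultimately show ?thesis by simp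
  next
    case False
    hence "(\<Sum>l\<in>Ls. winding_number (\<gamma> (Some l)) z) = 0" using wn z(2) by (intro sum.neutral) auto
    moreover have "z \<in> outside s" using False z(2) unfolding outside_def mem_Collect_eq by (metis linorder_neqE_linordered_idom)
    ultimately show ?thesis unfolding sum_I using wo[OF z(1)] by simp
  qed
  have homo: "(\<Sum>x\<in>I. winding_number (\<gamma> x) z) = 0" if "z \<notin> S" for z
  proof -
    have c1: "norm (z - o') \<noteq> Ro" using that outS by (auto simp: dist_norm norm_minus_commute)
    have c2: "norm (z - cen l) \<noteq> rad s l" if "l \<in> Ls" for l 
      using \<open>z \<notin> S\<close> circS[OF that] by (auto simp: dist_norm norm_minus_commute)
    have "\<not> (norm (z - o') < Ro \<and> z \<in> outside s)" using that outs[of z] R2_def by auto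
    thus ?thesis using wsum[OF c1 c2] by simp
  qed
  have main: "(\<Sum>x\<in>I. contour_integral (\<gamma> x) h) = 2 * pi * \<i> * (\<Sum>p\<in>pts. (\<Sum>x\<in>I. winding_number (\<gamma> x) p) * residue h p)"
  proof (rule Residue_theorem_cycle[OF openS conS fpts hS _ _ _ homo])
    show "finite I" "I \<noteq> {}" unfolding I_def by auto
    show "valid_path (\<gamma> x) \<and> pathfinish (\<gamma> x) = pathstart (\<gamma> x) \<and> path_image (\<gamma> x) \<subseteq> S - pts" if "x \<in> I" for x
    proof (cases x)
      case None thus ?thesis using outS Ro by (simp add: \<gamma>_def)
    next
      case (Some l)
      hence "l \<in> Ls" using that unfolding I_def by auto
      from circS[OF this] show ?thesis using Some rp[of l] by (simp add: \<gamma>_def del: cen.simps rad.simps)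
    qed
  qed
  have pts_eq: "Q \<inter> outside s \<subseteq> pts"
  proof
    fix p assume p: "p \<in> Q \<inter> outside s"
    hence "norm (p - o') < Ro" using far[of p] by force
    thus "p \<in> pts" unfolding pts_def using outs[of p] p R2_def by auto
  qed
  thus finQ: "finite (Q \<inter> outside s)" using fpts finite_subset by blast
  have res: "(\<Sum>p\<in>pts. (\<Sum>x\<in>I. winding_number (\<gamma> x) p) * residue h p) = (\<Sum>p\<in>Q \<inter> outside s. residue h p)"
  proof (rule sum.mono_neutral_cong_right[OF fpts pts_eq])
    have W: "(\<Sum>x\<in>I. winding_number (\<gamma> x) p) = (if p \<in> outside s then 1 else 0)" if p: "p \<in> pts" for p
    proof -
      have "norm (p - o') < Ro" using far[of p] p unfolding pts_def by force
      moreover have "norm (p - cen l) \<noteq> rad s l" if "l \<in> Ls" for l using circ[OF that, of p] p unfolding pts_def by auto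
      ultimately show ?thesis using wsum[of p] by simp
    qed
    show "\<forall>p\<in>pts - Q \<inter> outside s. (\<Sum>x\<in>I. winding_number (\<gamma> x) p) * residue h p = 0"
      using W unfolding pts_def by auto
    show "(\<Sum>x\<in>I. winding_number (\<gamma> x) p) * residue h p = residue h p" if "p \<in> Q \<inter> outside s" for p
      using W[of p] that pts_eq by auto
  qed
  \<comment> \<open>The correction term integrates to \<open>4 * pi * \<i> * m\<close>. It enters
    once for each of the \<open>g\<close> pairs of circles and once with the opposite sign at
    infinity, which produces \<open>m * (2 * g - 2)\<close>.\<close>
  have pole_int: "contour_integral (circlepath a r) (\<lambda>w. f w + m * (2/(w - a))) = contour_integral (circlepath a r) f + 4 * pi * \<i> * m"
    if r: "r > 0" and f: "f contour_integrable_on (circlepath a r)" for f a r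
  proof -
    have "((\<lambda>w. 1/(w - a)) has_contour_integral 2 * pi * \<i>) (circlepath a r)"
      using Cauchy_integral_circlepath_simple[of "\<lambda>_. 1" a r a] r by simp
    hence "((\<lambda>w. (m*2) * (1/(w - a))) has_contour_integral (m*2) * (2 * pi * \<i>)) (circlepath a r)"
      by (rule has_contour_integral_lmul)
    from has_contour_integral_add[OF has_contour_integral_integral[OF f] this]
    show ?thesis by (simp add: contour_integral_unique mult_ac)
  qed
  have integrable: "h contour_integrable_on (circlepath a r)" if "sphere a r \<subseteq> \<Omega> - Q" "r > 0" for a r
    by (rule contour_integrable_continuous_circlepath)
       (use that hol in \<open>auto intro!: holomorphic_on_imp_continuous_on holomorphic_on_subset[OF hol]\<close>)
  have I_k: "contour_integral (circlepath (cen (k,False)) (rad s (k,False))) h = 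
      - contour_integral (circlepath (cen (k,True)) (rad s (k,True))) h - 4 * pi * \<i> * m" if k: "k < g" for k
  proof -
    have l: "(k,True) \<in> Ls" using k by simp
    have sp: "sphere (cen (k,True)) (rad s (k,True)) \<subseteq> \<Omega> - Q"
    proof
      fix z assume z: "z \<in> sphere (cen (k,True)) (rad s (k,True))"
      hence "z \<in> S - pts" using circS[OF l] by blast
      moreover have "z \<notin> Q" using circ[OF l, of z] z by (simp add: dist_norm norm_minus_commute del: cen.simps rad.simps)
      ultimately show "z \<in> \<Omega> - Q" using SL LO by blast
    qed
    have "contour_integral (circlepath (cen (linv (k,True))) (\<rho>\<^sup>2 / rad s (k,True))) h = 
        - contour_integral (circlepath (cen (k,True)) (rad s (k,True))) (\<lambda>w. h (act (lm (k,True)) w) / (den (lm (k,True)) w)\<^sup>2)"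
      by (rule contour_integral_act_circle[OF l rp])
    also have "contour_integral (circlepath (cen (k,True)) (rad s (k,True))) (\<lambda>w. h (act (lm (k,True)) w) / (den (lm (k,True)) w)\<^sup>2)
      = contour_integral (circlepath (cen (k,True)) (rad s (k,True))) (\<lambda>w. h w + m * (2/(w - cen (k,True))))"
    proof (rule contour_integral_cong[OF refl])
      fix w assume "w \<in> path_image (circlepath (cen (k,True)) (rad s (k,True)))"
      hence w: "w \<in> sphere (cen (k,True)) (rad s (k,True))" using rp[of "(k,True)"] by (simp del: cen.simps rad.simps)
      hence "w \<noteq> cen (k,True)" using rp[of "(k,True)"] by (auto simp del: cen.simps rad.simps)
      thus "h (act (lm (k,True)) w) / (den (lm (k,True)) w)\<^sup>2 = h w + m * (2/(w - cen (k,True)))"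
        using inv[OF k] sp w by blast
    qed
    also have "\<dots> = contour_integral (circlepath (cen (k,True)) (rad s (k,True))) h + 4 * pi * \<i> * m"
      by (rule pole_int[OF rp integrable[OF sp rp]])
    also have "\<rho>\<^sup>2 / rad s (k,True) = rad s (k,False)" using rad_linv[OF s(1), of "(k,True)"] by simp
    also have "linv (k,True) = (k,False)" by simp
    finally show ?thesis by simp
  qed
  have "(\<Sum>l\<in>Ls. contour_integral (\<gamma> (Some l)) h) = - (\<Sum>l\<in>Ls. contour_integral (circlepath (cen l) (rad s l)) h)"
    unfolding \<gamma>_def by (simp add: contour_integral_reversepath sum_negf del: cen.simps rad.simps)
  also have "(\<Sum>l\<in>Ls. contour_integral (circlepath (cen l) (rad s l)) h) = 
      (\<Sum>k<g. \<Sum>b\<in>UNIV. contour_integral (circlepath (cen (k,b)) (rad s (k,b))) h)"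
    unfolding Ls_def sum.cartesian_product by (simp add: split_def del: cen.simps rad.simps)
  also have "\<dots> = (\<Sum>k<g. - (4 * pi * \<i> * m))"
    using I_k by (intro sum.cong) (simp_all add: UNIV_bool del: cen.simps rad.simps)
  finally have circles: "(\<Sum>l\<in>Ls. contour_integral (\<gamma> (Some l)) h) = of_nat g * (4 * pi * \<i> * m)" by simp
  have spc: "sphere c e \<subseteq> \<Omega> - Q"
  proof
    fix z assume z: "z \<in> sphere c e"
    hence "z \<in> \<Omega>" using e e0 by auto
    moreover have "z \<notin> Q" using e1(2)[of z] z e by (auto simp: dist_commute)
    ultimately show "z \<in> \<Omega> - Q" by blast
  qed
  have outer: "contour_integral (\<gamma> None) h = - contour_integral (circlepath c e) h - 4 * pi * \<i> * m"
  proof -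
    have "contour_integral (\<gamma> None) h = 
        - contour_integral (circlepath c e) (\<lambda>w. h (act (lm l0) w) / (den (lm l0) w)\<^sup>2)"
      using contour_integral_act_circle[OF l0(1) e(1), of h] unfolding \<gamma>_def o'_def Ro_def l0(2) by simp
    also have "contour_integral (circlepath c e) (\<lambda>w. h (act (lm l0) w) / (den (lm l0) w)\<^sup>2)
      = contour_integral (circlepath c e) (\<lambda>w. h w + m * (2/(w - c)))"
    proof (rule contour_integral_cong[OF refl])
      fix w assume "w \<in> path_image (circlepath c e)"
      hence w: "w \<in> sphere c e" using e by simp
      hence "w \<noteq> c" using e by auto
      thus "h (act (lm l0) w) / (den (lm l0) w)\<^sup>2 = h w + m * (2/(w - c))"
        using inv[OF g_pos(2), of w] spc w l0(2) unfolding l0_def by (metis subsetD)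
    qed
    also have "\<dots> = contour_integral (circlepath c e) h + 4 * pi * \<i> * m"
      by (rule pole_int[OF e(1) integrable[OF spc e(1)]])
    finally show ?thesis by simp
  qed
  have resc: "contour_integral (circlepath c e) h = 2 * pi * \<i> * residue h c"
  proof -
    have "(h has_contour_integral (2 * pi * \<i> * residue h c)) (circlepath c e)"
    proof (rule base_residue)
      show "open (ball c (min e0 e1))" "c \<in> ball c (min e0 e1)" "e > 0" "cball c e \<subseteq> ball c (min e0 e1)" using e0 e1 e by auto
      show "h holomorphic_on ball c (min e0 e1) - {c}"
        using hol by (rule holomorphic_on_subset) (use e0(2) e1(2) in \<open>auto simp: dist_commute\<close>)
    qed
    thus ?thesis by (rule contour_integral_unique)
  qed
  have "2 * pi * \<i> * (\<Sum>p\<in>Q \<inter> outside s. residue h p) = 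
      - (2 * pi * \<i> * residue h c) - 4 * pi * \<i> * m + of_nat g * (4 * pi * \<i> * m)"
    using main[unfolded sum_I[of "\<lambda>x. contour_integral (\<gamma> x) h"] res outer circles resc] by simp
  hence "2 * pi * \<i> * ((\<Sum>p\<in>Q \<inter> outside s. residue h p) + residue h c) = 2 * pi * \<i> * (m * (2 * of_nat g - 2))"
    by (simp add: algebra_simps)
  thus "(\<Sum>p\<in>Q \<inter> outside s. residue h p) + residue h c = m * (2 * of_nat g - 2)" by simp
qed

end

section \<open>Meromorphic functions on the quotient\<close>

lemma filtermap_act:
  assumes "su11 M" "den M z \<noteq> 0"
  shows "filtermap (act M) (at z) = at (act M z)"
proof -
  have lim: "filterlim (act M) (at (act M z)) (at z)" if M: "su11 M" "den M z \<noteq> 0" for M z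
  proof -
    have "isCont (act M) z" using act_deriv[OF M] by (rule DERIV_isCont)
    moreover have "den M = (\<lambda>z. cnj (snd M) * z + cnj (fst M))" by (cases M) auto
    hence "isCont (den M) z" by simp
    hence "eventually (\<lambda>w. den M w \<noteq> 0) (at z)" using M(2) unfolding isCont_def by (rule tendsto_imp_eventually_ne)
    hence "eventually (\<lambda>w. den M w \<noteq> 0 \<and> w \<noteq> z) (at z)" by (auto simp: eventually_at_filter elim: eventually_mono)
    hence "eventually (\<lambda>w. act M w \<noteq> act M z) (at z)"
      by eventually_elim (metis act_pinv_act M)
    ultimately show ?thesis unfolding isCont_def filterlim_at by auto
  qed
  have d: "den (pinv M) (act M z) \<noteq> 0" using den_pinv_act[OF assms] assms by simp
  have e: "act (pinv M) (act M z) = z" by (rule act_pinv_act[OF assms])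
  show ?thesis
  proof (rule filtermap_fun_inverse)
    show "filterlim (act (pinv M)) (at z) (at (act M z))" using lim[OF su11_pinv[OF assms(1)] d] unfolding e .
    show "filterlim (act M) (at (act M z)) (at z)" by (rule lim[OF assms])
    have "den (pinv M) = (\<lambda>z. cnj (snd (pinv M)) * z + cnj (fst (pinv M)))" by (cases "pinv M") auto
    hence "isCont (den (pinv M)) (act M z)" by simp
    hence "eventually (\<lambda>w. den (pinv M) w \<noteq> 0) (at (act M z))" using d unfolding isCont_def by (rule tendsto_imp_eventually_ne)
    thus "eventually (\<lambda>w. act M (act (pinv M) w) = w) (at (act M z))"
      by eventually_elim (metis act_pinv_act su11_pinv assms(1) pinv_pinv)
  qed
qed

lemma act_analytic: "su11 M \<Longrightarrow> den M z \<noteq> 0 \<Longrightarrow> act M analytic_on {z}"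
  unfolding act_def by (cases M) (auto intro!: analytic_intros)

lemma zorder_act:
  assumes "su11 M" "den M z \<noteq> 0" "f meromorphic_on {act M z}" "eventually (\<lambda>w. f w \<noteq> 0) (at (act M z))"
  shows "zorder (\<lambda>w. f (act M w)) z = zorder f (act M z)"
proof -
  have an: "act M analytic_on {z}" using act_analytic assms by blast
  have "zorder (\<lambda>w. act M w - act M z) z = 1"
  proof (rule zorder_zero_eqI')
    show "(\<lambda>w. act M w - act M z) analytic_on {z}" by (intro analytic_intros an)
    have "((\<lambda>w. act M w - act M z) has_field_derivative 1/(den M z)\<^sup>2 - 0) (at z)"
      by (intro DERIV_diff act_deriv assms DERIV_const)
    hence "deriv (\<lambda>w. act M w - act M z) z = 1/(den M z)\<^sup>2" by (simp add: DERIV_imp_deriv)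
    thus "(deriv ^^ nat 1) (\<lambda>w. act M w - act M z) z \<noteq> 0" using assms by simp
    show "(deriv ^^ i) (\<lambda>w. act M w - act M z) z = 0" if "i < nat 1" for i using that by simp
  qed simp
  moreover have "eventually (\<lambda>w. act M w \<noteq> act M z) (at z)"
  proof -
    have "eventually (\<lambda>w. w \<noteq> act M z) (filtermap (act M) (at z))"
      unfolding filtermap_act[OF assms(1,2)] by (simp add: eventually_at_filter)
    thus ?thesis by (simp add: eventually_filtermap)
  qed
  ultimately have "zorder (f \<circ> act M) z = zorder f (act M z) * 1"
    using zorder_compose'[of f "act M" z] assms an meromorphic_at_iff by metis
  thus ?thesis by (simp add: o_def)
qed

lemma residue_logderiv:
  assumes "f meromorphic_on {z}" "eventually (\<lambda>w. f w \<noteq> 0) (at z)"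
  shows "residue (\<lambda>w. deriv f w / f w) z = of_int (zorder f z)"
proof -
  obtain F where F: "(\<lambda>w. f (z + w)) has_laurent_expansion F"
    using assms(1) by (auto simp: meromorphic_on_def)
  have F0: "F \<noteq> 0" using has_laurent_expansion_eventually_nonzero_iff[OF F] assms(2) by blast
  have "deriv (\<lambda>w. f (z + w)) = (\<lambda>w. deriv f (z + w))"
    unfolding deriv_def using DERIV_shift[of f _ _ z] by (simp add: add.commute)
  hence "(\<lambda>w. deriv f (z + w)) has_laurent_expansion fls_deriv F"
    using has_laurent_expansion_deriv[OF F] by simp
  hence "(\<lambda>w. deriv f (z + w) / f (z + w)) has_laurent_expansion fls_deriv F / F"
    using F by (rule has_laurent_expansion_divide)
  hence "residue (\<lambda>w. deriv f w / f w) z = fls_residue (fls_deriv F / F)"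
    by (rule has_laurent_expansion_residue)
  also have "fls_deriv F / F = fls_deriv F * fls_right_inverse F (inverse (fls_nth F (fls_subdegree F)))"
    unfolding divide_inverse fls_inverse_def' ..
  also have "fls_residue \<dots> = of_int (fls_subdegree F)"
    using F0 by (intro fls_residue_deriv_times_lr_inverse_eq_subdegree(1)) auto
  also have "fls_subdegree F = zorder f z" using has_laurent_expansion_zorder[OF F F0] by simp
  finally show ?thesis .
qed

context schottky_curve
begin

abbreviation "G \<equiv> schottky_group g \<eta> \<theta>"

definition INV :: "(complex \<Rightarrow> complex) \<Rightarrow> bool" where
  "INV F \<longleftrightarrow> F meromorphic_on \<Omega> \<and> (\<forall>M\<in>GG. \<forall>z\<in>\<Omega>. den M z \<noteq> 0 \<longrightarrow> (\<forall>\<^sub>F w in at z. F (act M w) = F w))"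

lemma invariant_meromorphic_iff: "invariant_meromorphic G F \<longleftrightarrow> INV F"
proof
  assume F: "invariant_meromorphic G F"
  have "\<forall>\<^sub>F w in at z. F (act M w) = F w" if M: "M \<in> GG" "z \<in> \<Omega>" "den M z \<noteq> 0" for M z
  proof -
    obtain \<gamma> where "\<gamma> \<in> G" "mden \<gamma> z \<noteq> 0" "\<And>w. mapp \<gamma> w = act M w" using GG_imp_schottky_mob[OF M(1)] M(3) by metis
    thus ?thesis using F M(2) unfolding invariant_meromorphic_def by force
  qed
  thus "INV F" using F unfolding INV_def invariant_meromorphic_def by blast
next
  assume F: "INV F"
  have "\<forall>\<^sub>F w in at z. F (mapp \<gamma> w) = F w" if M: "\<gamma> \<in> G" "z \<in> \<Omega>" "mden \<gamma> z \<noteq> 0" for \<gamma> z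
  proof -
    obtain M where "M \<in> GG" "den M z \<noteq> 0" "\<And>w. mapp \<gamma> w = act M w" using schottky_imp_GG_mob[OF M(1)] M(3) by metis
    thus ?thesis using F M(2) unfolding INV_def by force
  qed
  thus "invariant_meromorphic G F" using F unfolding INV_def invariant_meromorphic_def by blast
qed

lemma INV_mer: "INV F \<Longrightarrow> z \<in> \<Omega> \<Longrightarrow> F meromorphic_on {z}"
  unfolding INV_def using meromorphic_on_subset by blast

lemma INV_D: "INV F \<Longrightarrow> M \<in> GG \<Longrightarrow> z \<in> \<Omega> \<Longrightarrow> den M z \<noteq> 0 \<Longrightarrow> \<forall>\<^sub>F w in at z. F (act M w) = F w"
  unfolding INV_def by blast

lemma INV_inverse: "INV F \<Longrightarrow> INV (\<lambda>w. inverse (F w - v))"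
  unfolding INV_def by (intro conjI ballI impI meromorphic_intros) (auto elim!: eventually_mono)

lemma INV_pole:
  assumes "INV F" "M \<in> GG" "z \<in> \<Omega>" "den M z \<noteq> 0"
  shows "is_pole F (act M z) \<longleftrightarrow> is_pole F z"
proof -
  have "is_pole F (act M z) \<longleftrightarrow> is_pole (F \<circ> act M) z"
    by (rule is_pole_compose_iff[symmetric]) (intro filtermap_act GG_su assms)
  also have "\<dots> \<longleftrightarrow> is_pole F z"
    by (rule is_pole_cong) (use INV_D[OF assms] in \<open>auto simp: o_def\<close>)
  finally show ?thesis .
qed

lemma INV_pole_eq: "INV F \<Longrightarrow> z \<in> \<Omega> \<Longrightarrow> z \<simeq> w \<Longrightarrow> is_pole F w \<longleftrightarrow> is_pole F z"
  unfolding eqv_def using INV_pole by blast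

text \<open>A pole excludes the constant case of the identity theorem on the connected set
  \<open>\<Omega>\<close>.\<close>

lemma nonconst:
  assumes "F meromorphic_on \<Omega>" "p \<in> \<Omega>" "is_pole F p" "z \<in> \<Omega>"
  shows "eventually (\<lambda>w. F w \<noteq> v) (at z)"
proof -
  consider "eventually (\<lambda>z. F z = v) (cosparse \<Omega>)" | "eventually (\<lambda>z. F z \<noteq> v) (cosparse \<Omega>)"
    using meromorphic_imp_constant_or_avoid[OF assms(1) open_Omega connected_Omega] by blast
  thus ?thesis
  proof cases
    case 1
    hence "eventually (\<lambda>z. F z = v) (at p)" using assms(2) eventually_cosparse_imp_eventually_at by blast
    hence "is_pole (\<lambda>_. v) p" using assms(3) is_pole_cong[of F "\<lambda>_. v" p p] by simp
    thus ?thesis by simp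
  next
    case 2 thus ?thesis using assms(4) eventually_cosparse_imp_eventually_at by blast
  qed
qed

lemma INV_zorder:
  assumes "INV F" "p \<in> \<Omega>" "is_pole F p" "z \<in> \<Omega>" "z \<simeq> w"
  shows "zorder F w = zorder F z"
proof -
  obtain M where M: "M \<in> GG" "den M z \<noteq> 0" "act M z = w" using assms(5) unfolding eqv_def by blast
  have w: "w \<in> \<Omega>" using M Omega_act assms by blast
  have "zorder (\<lambda>x. F (act M x)) z = zorder F (act M z)"
    by (rule zorder_act) (use M w GG_su INV_mer assms nonconst[of F p w 0] in \<open>auto simp: INV_def\<close>)
  moreover have "zorder (\<lambda>x. F (act M x)) z = zorder F z"
    by (rule zorder_cong) (use INV_D[OF assms(1) M(1) assms(4) M(2)] in auto)
  ultimately show ?thesis using M by simp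
qed

lemma pole_zorder: "INV F \<Longrightarrow> z \<in> \<Omega> \<Longrightarrow> is_pole F z \<Longrightarrow> zorder F z < 0"
  using isolated_pole_imp_neg_zorder INV_mer meromorphic_at_iff by blast

abbreviation "poles F \<equiv> {p\<in>\<Omega>. is_pole F p}"

abbreviation "deg F \<equiv> merom_degree G F"

text \<open>The degree is defined through an arbitrary choice in each orbit. Since pole orders are
  constant along orbits, any transversal of the poles computes it.\<close>

lemma merom_degree_transversal:
  assumes F: "INV F" and R: "finite R" "R \<subseteq> poles F" "\<And>r r'. r \<in> R \<Longrightarrow> r' \<in> R \<Longrightarrow> r \<simeq> r' \<Longrightarrow> r = r'"
    "\<And>p. p \<in> poles F \<Longrightarrow> \<exists>r\<in>R. r \<simeq> p"
  shows "deg F = (\<Sum>r\<in>R. nat (- zorder F r))"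
proof -
  define rel where "rel = {(p,q). p\<in>poles F \<and> q\<in>poles F \<and> G_equiv G p q}"
  have rel: "rel = {(p,q). p\<in>poles F \<and> q\<in>poles F \<and> p \<simeq> q}" unfolding rel_def G_equiv_iff ..
  define O' where "O' = (\<lambda>r. rel `` {r})"
  have O': "O' r = {q\<in>poles F. r \<simeq> q}" if "r \<in> R" for r unfolding O'_def rel using that R(2) by auto
  have quot: "poles F // rel = O' ` R"
  proof (intro equalityI subsetI)
    fix X assume "X \<in> poles F // rel"
    then obtain p where p: "p \<in> poles F" "X = rel `` {p}" unfolding quotient_def by blast
    obtain r where r: "r \<in> R" "r \<simeq> p" using R(4)[OF p(1)] by blast
    have "X = O' r" unfolding O'[OF r(1)] p(2) rel using p(1) r eq_trans eq_sym by blast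
    thus "X \<in> O' ` R" using r by blast
  next
    fix X assume "X \<in> O' ` R"
    then obtain r where r: "r \<in> R" "X = rel `` {r}" unfolding O'_def by blast
    thus "X \<in> poles F // rel" unfolding quotient_def using R(2) by blast
  qed
  have inj: "inj_on O' R"
  proof (rule inj_onI)
    fix x y assume xy: "x \<in> R" "y \<in> R" "O' x = O' y"
    have "y \<in> O' y" using O'[OF xy(2)] R(2) xy by auto
    hence "x \<simeq> y" using O'[OF xy(1)] xy(3) by auto
    thus "x = y" using R(3) xy by blast
  qed
  have "deg F = (\<Sum>Orb\<in>poles F // rel. nat (- zorder F (SOME p. p\<in>Orb)))"
    unfolding merom_degree_def Let_def rel_def ..
  also have "\<dots> = (\<Sum>r\<in>R. nat (- zorder F (SOME p. p \<in> O' r)))"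
    unfolding quot by (rule sum.reindex_cong[OF inj refl refl])
  also have "\<dots> = (\<Sum>r\<in>R. nat (- zorder F r))"
  proof (rule sum.cong[OF refl])
    fix r assume r: "r \<in> R"
    define p where "p = (SOME p. p \<in> O' r)"
    have rP: "r \<in> \<Omega>" "is_pole F r" using R(2) r by blast+
    hence "r \<in> O' r" unfolding O'[OF r] using eq_refl by blast
    hence "p \<in> O' r" unfolding p_def by (rule someI)
    hence "r \<simeq> p" unfolding O'[OF r] by blast
    from INV_zorder[OF F rP rP(1) this] have "zorder F p = zorder F r" .
    thus "nat (- zorder F (SOME p. p \<in> O' r)) = nat (- zorder F r)" unfolding p_def by simp
  qed
  finally show ?thesis .
qed

text \<open>The compact annuli swept by the moving circles contain finitely many points of
  \<open>Q\<close>, and each of these rules out at most two parameters per letter, one for either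
  kind of circle.\<close>

lemma ex_radius:
  assumes "Q \<subseteq> \<Omega>" "\<And>z. z \<in> \<Omega> \<Longrightarrow> \<not> z islimpt Q"
  shows "\<exists>s. 1 \<le> s \<and> s < s1 \<and> (\<forall>l\<in>Ls. \<forall>z. norm (z - cen l) = rad s l \<longrightarrow> z \<notin> Q)"
proof -
  define s2 where "s2 = (1 + s1)/2"
  have s2: "1 < s2" "s2 < s1" using s1(1) unfolding s2_def by (simp_all add: field_simps)
  define A where "A = (\<lambda>l. cball (cen l) (s2 * \<rho>) - ball (cen l) (\<rho>/s2))"
  have AO: "A l \<subseteq> \<Omega>" if "l \<in> Ls" for l
  proof
    fix z assume "z \<in> A l"
    hence z: "norm (z - cen l) \<le> s2 * \<rho>" "\<rho>/s2 \<le> norm (z - cen l)" unfolding A_def by (auto simp: dist_norm norm_minus_commute)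
    have "\<rho>/s1 < \<rho>/s2" using s2 rho_pos by (intro divide_strict_left_mono) auto
    moreover have "s2 * \<rho> < s1 * \<rho>" using s2 rho_pos by simp
    ultimately show "z \<in> \<Omega>" using annulus_Omega[OF that, of z] z by simp
  qed
  have fin: "finite (A l \<inter> Q)" if "l \<in> Ls" for l
    by (rule finite_not_islimpt_in_compact) (use AO[OF that] assms(2) in \<open>auto simp: A_def intro!: compact_diff\<close>)
  define bad where "bad = (\<Union>l\<in>Ls. (\<lambda>q. norm (q - cen l) / \<rho>) ` (A l \<inter> Q) \<union> (\<lambda>q. \<rho> / norm (q - cen l)) ` (A l \<inter> Q))"
  have "finite bad" unfolding bad_def using fin by (intro finite_UN_I finite_Ls finite_UnI finite_imageI)
  moreover have "infinite {1<..<s2}" using s2 by (simp add: infinite_Ioo)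
  ultimately have "infinite ({1<..<s2} - bad)" by simp
  then obtain s where s: "s \<in> {1<..<s2}" "s \<notin> bad" by (metis Diff_iff all_not_in_conv finite.emptyI)
  have "z \<notin> Q" if l: "l \<in> Ls" "norm (z - cen l) = rad s l" for l z
  proof
    assume zQ: "z \<in> Q"
    obtain k b where kb: "l = (k,b)" by (cases l)
    have ss: "1 < s" "s < s2" using s by auto
    have a: "\<rho>/s2 \<le> \<rho>/s" using ss rho_pos by (intro divide_left_mono) auto
    have "\<rho>/s \<le> \<rho>" "\<rho> \<le> s * \<rho>" using ss rho_pos by (simp_all add: pos_divide_le_eq)
    hence b: "\<rho>/s \<le> s * \<rho>" by (rule order_trans)
    have c: "s * \<rho> \<le> s2 * \<rho>" using ss rho_pos by simp
    have r: "\<rho>/s2 \<le> rad s l" "rad s l \<le> s2 * \<rho>" using a b c kb by (cases b; simp)+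
    hence zA: "z \<in> A l \<inter> Q" using l(2) zQ unfolding A_def by (simp add: dist_norm norm_minus_commute)
    have "s = norm (z - cen l) / \<rho> \<or> s = \<rho> / norm (z - cen l)"
      unfolding l(2) using kb rho_pos ss by (cases b) simp_all
    hence "s \<in> bad" unfolding bad_def using zA l(1) by blast
    thus False using s by blast
  qed
  thus ?thesis using s s2 by (intro exI[of _ s]) auto
qed

section \<open>Representatives of orbits and normal forms of functions\<close>

definition reps :: "real \<Rightarrow> complex set" where "reps s = outside s \<union> {c}"

text \<open>For two points of the open domain this is \<open>outside_inequiv\<close>. A point of the
  open domain equivalent to \<open>c\<close> would be sent to infinity by some element, whereas all
  elements are finite on the domain.\<close>

lemma reps_unique:
  assumes "1 \<le> s" "s \<le> s1" "z \<in> reps s" "w \<in> reps s" "z \<simeq> w" shows "z = w"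
proof -
  have A: "z = w" if zw: "z \<in> outside s" "w \<in> outside s" "z \<simeq> w" for z w
  proof -
    obtain M where M: "M \<in> GG" "act M z = w" using zw(3) unfolding eqv_def by blast
    have "M = (1,0)" using outside_inequiv[OF M(1) assms(1,2), of z] zw(1,2) outside_sub M(2) by (meson subsetD)
    thus ?thesis using M by simp
  qed
  have B: False if z: "z \<in> outside s" "z \<simeq> c" for z
  proof -
    obtain M where M: "M \<in> GG" "den M z \<noteq> 0" "act M z = c" using z unfolding eqv_def by blast
    define N where "N = pmul (lm (0,True)) M"
    have l: "(0,True) \<in> Ls" "cen (0,True) = c" using g_pos by auto
    have "den N z = 0" unfolding N_def den_pmul[OF M(2)] M(3) using den_lm_eq_0_iff[of "(0,True)" c] l(2) by (simp del: lm.simps cen.simps)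
    moreover have "N \<in> GG" unfolding N_def using M l GG.step by blast
    moreover have "N \<noteq> (1,0)" using calculation(1) by auto
    ultimately show False using GG'_act(1)[of N s z] assms(1,2) z(1) outside_sub by auto
  qed
  show ?thesis using assms(3-5) A B eq_sym unfolding reps_def by blast
qed

lemma reps_exist:
  assumes "1 \<le> s" "s < s1" "q \<in> \<Omega>" "q \<in> Q" "\<And>z w. z \<in> Q \<Longrightarrow> z \<simeq> w \<Longrightarrow> w \<in> Q"
    "\<And>l z. l \<in> Ls \<Longrightarrow> norm (z - cen l) = rad s l \<Longrightarrow> z \<notin> Q"
  shows "\<exists>r\<in>Q \<inter> reps s. r \<simeq> q"
proof -
  obtain N where N: "N\<in>GG" "den N q \<noteq> 0" "act N q \<in> coutside s \<or> act N q = c"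
    using Omega_reduce[OF assms(1-3)] by blast
  define r where "r = act N q"
  have qr: "q \<simeq> r" unfolding r_def using eq_act N by blast
  hence rQ: "r \<in> Q" using assms(4,5) by blast
  have "r \<in> reps s"
  proof (cases "r = c")
    case False
    hence "r \<in> coutside s" using N(3) r_def by blast
    moreover have "norm (r - cen l) \<noteq> rad s l" if "l \<in> Ls" for l using assms(6)[OF that] rQ by blast
    ultimately have "r \<in> outside s" unfolding outside_def coutside_def mem_Collect_eq by (metis less_le)
    thus ?thesis unfolding reps_def by blast
  qed (simp add: reps_def)
  thus ?thesis using rQ qr eq_sym by blast
qed

lemma c_not_outside: "1 \<le> s \<Longrightarrow> c \<notin> outside s"
proof
  assume s: "1 \<le> s" "c \<in> outside s"
  have "(0,True) \<in> Ls" using g_pos by simp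
  hence "rad s (0,True) < norm (c - cen (0,True))" using s(2) unfolding outside_def mem_Collect_eq by (rule bspec[rotated])
  thus False using rad_pos[OF s(1), of "(0,True)"] by simp
qed

text \<open>The normal form of an invariant function: removable singularities are filled in, so that
  invariance holds at every point, and the value at a pole is \<open>0\<close> by convention. A zero
  must therefore always be stated together with the absence of a pole.\<close>

definition nice :: "(complex \<Rightarrow> complex) \<Rightarrow> bool" where
  "nice F \<longleftrightarrow> F nicely_meromorphic_on \<Omega> \<and> (\<forall>M\<in>GG. \<forall>z\<in>\<Omega>. den M z \<noteq> 0 \<longrightarrow> F (act M z) = F z)"

lemma nice_remove_sings:
  assumes "INV F" shows "nice (remove_sings F)"
proof -
  have "remove_sings F (act M z) = remove_sings F z" if M: "M \<in> GG" "z \<in> \<Omega>" "den M z \<noteq> 0" for M z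
  proof -
    have "remove_sings F (act M z) = remove_sings (F \<circ> act M) z"
      by (rule remove_sings_compose[symmetric]) (intro filtermap_act GG_su M)
    also have "\<dots> = remove_sings F z"
      by (rule remove_sings_cong) (use INV_D[OF assms M] in \<open>auto simp: o_def\<close>)
    finally show ?thesis .
  qed
  thus ?thesis unfolding nice_def using remove_sings_nicely_meromorphic assms unfolding INV_def by blast
qed

lemma nice_INV: 
  assumes "nice F" shows "INV F"
proof -
  have "\<forall>\<^sub>F w in at z. F (act M w) = F w" if M: "M \<in> GG" "z \<in> \<Omega>" "den M z \<noteq> 0" for M z
  proof -
    have "den M = (\<lambda>z. cnj (snd M) * z + cnj (fst M))" by (cases M) auto
    hence "isCont (den M) z" by simp
    hence "eventually (\<lambda>w. den M w \<noteq> 0) (at z)" using M(3) unfolding isCont_def by (rule tendsto_imp_eventually_ne)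
    moreover have "eventually (\<lambda>w. w \<in> \<Omega>) (at z)" using open_Omega M(2) eventually_at_in_open' by blast
    ultimately show ?thesis by eventually_elim (use assms M(1) in \<open>auto simp: nice_def\<close>)
  qed
  thus ?thesis using assms unfolding INV_def nice_def nicely_meromorphic_on_def by blast
qed

lemma nice_analytic: "nice F \<Longrightarrow> z \<in> \<Omega> \<Longrightarrow> \<not> is_pole F z \<Longrightarrow> F analytic_on {z}"
  unfolding nice_def using nicely_meromorphic_on_imp_analytic_at by blast

lemma nice_act: "nice F \<Longrightarrow> M \<in> GG \<Longrightarrow> z \<in> \<Omega> \<Longrightarrow> den M z \<noteq> 0 \<Longrightarrow> F (act M z) = F z"
  unfolding nice_def by blast

lemma nice_eq: "nice F \<Longrightarrow> z \<in> \<Omega> \<Longrightarrow> z \<simeq> w \<Longrightarrow> F w = F z"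
  unfolding eqv_def using nice_act by blast

lemma remove_sings_pole:
  assumes "F meromorphic_on {z}" 
  shows "is_pole (remove_sings F) z \<longleftrightarrow> is_pole F z" "zorder (remove_sings F) z = zorder F z"
  using eventually_remove_sings_eq_at[of F z] assms meromorphic_at_iff 
  by (auto intro!: is_pole_cong zorder_cong)

lemma deg_cong:
  assumes "\<And>z. z \<in> \<Omega> \<Longrightarrow> eventually (\<lambda>w. F w = H w) (at z)"
  shows "deg F = deg H"
proof -
  have 1: "poles F = poles H" using is_pole_cong[OF assms refl] by blast
  have "(\<Sum>Orb\<in>poles F // rel. nat (- zorder F (SOME p. p\<in>Orb))) = (\<Sum>Orb\<in>poles F // rel. nat (- zorder H (SOME p. p\<in>Orb)))"
    if rel: "rel = {(p,q). p\<in>poles F \<and> q\<in>poles F \<and> G_equiv G p q}" for rel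
  proof (rule sum.cong[OF refl])
    fix X assume "X \<in> poles F // rel"
    then obtain p where p: "p \<in> poles F" "X = rel `` {p}" unfolding quotient_def by blast
    hence "p \<in> X" unfolding rel by (auto simp: G_equiv_iff)
    hence "(SOME p. p \<in> X) \<in> X" by (rule someI)
    hence "(SOME p. p \<in> X) \<in> \<Omega>" unfolding p(2) rel by auto
    from zorder_cong[OF assms[OF this] refl] show "nat (- zorder F (SOME p. p \<in> X)) = nat (- zorder H (SOME p. p \<in> X))" by simp
  qed
  thus ?thesis unfolding merom_degree_def Let_def 1 by simp
qed

lemma poles_islimpt: 
  assumes "F meromorphic_on \<Omega>" "z \<in> \<Omega>" shows "\<not> z islimpt poles F"
proof
  assume "z islimpt poles F"
  moreover have "poles F \<subseteq> {w. \<not> F analytic_on {w}}" using analytic_at_imp_no_pole by blast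
  ultimately have "z islimpt {w. \<not> F analytic_on {w}}" by (rule islimpt_subset)
  thus False using meromorphic_on_imp_not_islimpt_singularities assms by blast
qed

lemma values_islimpt:
  assumes "eventually (\<lambda>w. F w \<noteq> v) (at z)" shows "\<not> z islimpt {w\<in>\<Omega>. F w = v}"
proof
  assume "z islimpt {w\<in>\<Omega>. F w = v}"
  hence "frequently (\<lambda>w. w \<in> {w\<in>\<Omega>. F w = v}) (at z)" by (simp add: islimpt_conv_frequently_at)
  hence "frequently (\<lambda>w. F w = v) (at z)" by (rule frequently_elim1) simp
  thus False using assms unfolding frequently_def by simp
qed

lemma deriv_invariant:
  assumes "M \<in> GG" "den M w \<noteq> 0" "F field_differentiable at (act M w)" "eventually (\<lambda>x. F (act M x) = F x) (nhds w)"
  shows "deriv F (act M w) / (den M w)\<^sup>2 = deriv F w"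
proof -
  have "(F \<circ> act M has_field_derivative deriv F (act M w) * (1/(den M w)\<^sup>2)) (at w)"
    by (rule DERIV_chain) (use assms in \<open>auto intro: field_differentiable_derivI act_deriv GG_su\<close>)
  hence "deriv (F \<circ> act M) w = deriv F (act M w) / (den M w)\<^sup>2" by (simp add: DERIV_imp_deriv)
  moreover have "deriv (F \<circ> act M) w = deriv F w" by (rule deriv_cong_ev) (use assms in \<open>auto simp: o_def\<close>)
  ultimately show ?thesis by simp
qed

text \<open>The argument principle on the quotient, from \<open>residue_sum\<close> with
  \<open>m = 0\<close> and the logarithmic derivative of \<open>F - v\<close>. The representative
  \<open>c\<close> takes part because infinity may be a pole or a \<open>v\<close>-point.\<close>

lemma order_sum:
  assumes F: "nice F" and p: "p \<in> \<Omega>" "is_pole F p" and s: "1 \<le> s" "s < s1"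
    and Q: "Q = {z\<in>\<Omega>. is_pole F z \<or> F z = v}"
    and circ: "\<And>l z. l \<in> Ls \<Longrightarrow> norm (z - cen l) = rad s l \<Longrightarrow> z \<notin> Q"
  shows "finite (Q \<inter> reps s)" "(\<Sum>p\<in>Q \<inter> reps s. zorder (\<lambda>w. F w - v) p) = 0"
proof -
  define f where "f = (\<lambda>w. F w - v)"
  have INV: "INV F" using nice_INV F .
  have mF: "F meromorphic_on \<Omega>" using INV INV_def by blast
  have mf: "f meromorphic_on \<Omega>" unfolding f_def by (intro meromorphic_intros mF)
  have nz: "eventually (\<lambda>w. F w \<noteq> v) (at z)" if "z \<in> \<Omega>" for z using nonconst[OF mF p that] .
  have QQ: "Q = poles F \<union> {w\<in>\<Omega>. F w = v}" unfolding Q by auto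
  have lim: "\<not> z islimpt Q" if "z \<in> \<Omega>" for z
    unfolding QQ islimpt_Un using poles_islimpt[OF mF that] values_islimpt[OF nz[OF that]] by blast
  define h where "h = (\<lambda>w. deriv f w / f w)"
  have an: "f analytic_on {z}" "f z \<noteq> 0" if "z \<in> \<Omega> - Q" for z
    unfolding f_def using nice_analytic[OF F, of z] that unfolding Q by (auto intro!: analytic_intros)
  have anh: "h analytic_on {z}" if "z \<in> \<Omega> - Q" for z
    unfolding h_def using an[OF that] by (intro analytic_intros) auto
  have hol: "h holomorphic_on \<Omega> - Q" using anh analytic_imp_holomorphic analytic_on_analytic_at by blast
  have inv: "act (lm (k,True)) w \<notin> Q \<and> h (act (lm (k,True)) w) / (den (lm (k,True)) w)\<^sup>2 = h w + 0 * (2 / (w - cen (k,True)))"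
    if k: "k < g" "w \<in> \<Omega> - Q" "w \<noteq> cen (k,True)" for k w
  proof -
    define M where "M = lm (k,True)"
    have M: "M \<in> GG" "den M w \<noteq> 0" unfolding M_def using lm_GG[of "(k,True)"] k den_lm_eq_0_iff by (auto simp del: lm.simps cen.simps)
    define y where "y = act M w"
    have wO: "w \<in> \<Omega>" "w \<notin> Q" using k by auto
    have yO: "y \<in> \<Omega>" unfolding y_def using Omega_act wO M by blast
    have Fy: "F y = F w" unfolding y_def using nice_act[OF F M(1) wO(1) M(2)] .
    have yQ: "y \<notin> Q" using INV_pole[OF INV M(1) wO(1) M(2)] Fy wO yO unfolding Q y_def by auto
    have "eventually (\<lambda>x. x \<in> \<Omega> - {cen (k,True)}) (nhds w)"
      using open_delete[OF open_Omega] by (rule eventually_nhds_in_open) (use wO k(3) in simp)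
    hence ev: "eventually (\<lambda>x. f (act M x) = f x) (nhds w)"
    proof eventually_elim
      case (elim x)
      hence "den M x \<noteq> 0" unfolding M_def using den_lm_eq_0_iff by blast
      thus ?case unfolding f_def using nice_act[OF F M(1), of x] elim by simp
    qed
    have "f field_differentiable at y" using an(1)[of y] yO yQ analytic_on_imp_differentiable_at by blast
    hence "deriv f y / (den M w)\<^sup>2 = deriv f w" unfolding y_def using deriv_invariant[OF M _ ev] by blast
    moreover have "f y = f w" unfolding f_def Fy ..
    moreover have "h y / (den M w)\<^sup>2 = (deriv f y / (den M w)\<^sup>2) / f y" unfolding h_def by simp
    ultimately have "h y / (den M w)\<^sup>2 = h w" unfolding h_def by simp
    thus ?thesis using yQ unfolding M_def[symmetric] y_def[symmetric] by simp
  qed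
  have QO: "Q \<subseteq> \<Omega>" unfolding Q by blast
  have fin: "finite (Q \<inter> outside s)"
    by (rule residue_sum(1)[where m = 0, OF s hol QO lim circ inv])
  show "finite (Q \<inter> reps s)" unfolding reps_def Int_Un_distrib using fin by simp
  have res: "residue h z = of_int (zorder f z)" if "z \<in> \<Omega>" for z
    unfolding h_def
  proof (rule residue_logderiv)
    show "f meromorphic_on {z}" using mf that meromorphic_on_subset by blast
    show "eventually (\<lambda>w. f w \<noteq> 0) (at z)" using nz[OF that] by (simp add: f_def)
  qed
  have "(\<Sum>p\<in>Q \<inter> outside s. residue h p) + residue h c = 0 * (2 * of_nat g - 2)"
    by (rule residue_sum(2)[where m = 0, OF s hol QO lim circ inv])
  hence "(\<Sum>z\<in>Q \<inter> outside s. residue h z) + residue h c = 0" by simp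
  moreover have "(\<Sum>z\<in>Q \<inter> outside s. residue h z) = (\<Sum>z\<in>Q \<inter> outside s. of_int (zorder f z))"
    using res QO by (intro sum.cong) auto
  ultimately have "of_int ((\<Sum>z\<in>Q \<inter> outside s. zorder f z) + zorder f c) = (of_int 0 :: complex)"
    using res[OF c_Omega] by simp
  hence 0: "(\<Sum>z\<in>Q \<inter> outside s. zorder f z) + zorder f c = 0" by (simp only: of_int_eq_iff)
  have "(\<Sum>z\<in>Q \<inter> reps s. zorder f z) = 0"
  proof (cases "c \<in> Q")
    case True
    have "Q \<inter> reps s = insert c (Q \<inter> outside s)" unfolding reps_def using True by blast
    thus ?thesis using 0 fin c_not_outside[OF s(1)] by simp
  next
    case False
    have "Q \<inter> reps s = Q \<inter> outside s" unfolding reps_def using False by blast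
    moreover have "zorder f c = 0"
    proof -
      have "h analytic_on {c}" using anh[of c] False c_Omega by simp
      then obtain S where "open S" "c \<in> S" "h holomorphic_on S" unfolding analytic_at by blast
      hence "residue h c = 0" by (rule residue_holo)
      thus ?thesis using res[OF c_Omega] by simp
    qed
    ultimately show ?thesis using 0 by simp
  qed
  thus "(\<Sum>p\<in>Q \<inter> reps s. zorder (\<lambda>w. F w - v) p) = 0" unfolding f_def .
qed

end

lemma zorder_factor:
  assumes "f meromorphic_on {z}" "eventually (\<lambda>w. f w \<noteq> 0) (at z)"
  obtains P where "P z \<noteq> 0" "isCont P z" "eventually (\<lambda>w. f w = P w * (w - z) powi zorder f z) (at z)"
proof -
  have fr: "\<exists>\<^sub>F w in at z. f w \<noteq> 0" using assms(2) by (rule eventually_frequently[rotated]) simp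
  have iso: "isolated_singularity_at f z" "not_essential f z" using assms(1) meromorphic_at_iff by auto
  define P where "P = zor_poly f z"
  obtain r where r: "r > 0" "P z \<noteq> 0" "P holomorphic_on cball z r"
    "\<And>w. w \<in> cball z r - {z} \<Longrightarrow> f w = P w * (w - z) powi (zorder f z)"
    using zorder_exist[OF iso fr] unfolding P_def by blast
  have "continuous_on (ball z r) P"
    using holomorphic_on_imp_continuous_on[OF r(3)] continuous_on_subset ball_subset_cball by blast
  hence Pc: "isCont P z" using r(1) by (simp add: continuous_on_eq_continuous_at)
  have "eventually (\<lambda>w. w \<in> ball z r - {z}) (at z)" using r(1) by (intro eventually_at_in_open) auto
  hence "eventually (\<lambda>w. f w = P w * (w - z) powi zorder f z) (at z)" by eventually_elim (use r(4) in auto)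
  thus ?thesis using that r(2) Pc by blast
qed

lemma simple_pole_limit:
  assumes "f meromorphic_on {z}" "eventually (\<lambda>w. f w \<noteq> 0) (at z)" "zorder f z = -1"
  shows "\<exists>a. a \<noteq> 0 \<and> ((\<lambda>w. f w * (w - z)) \<longlongrightarrow> a) (at z)"
proof -
  obtain P where P: "P z \<noteq> 0" "isCont P z" "eventually (\<lambda>w. f w = P w * (w - z) powi zorder f z) (at z)"
    using zorder_factor[OF assms(1,2)] .
  have "(P \<longlongrightarrow> P z) (at z)" using P(2) by (simp add: isCont_def)
  moreover have "eventually (\<lambda>w. P w = f w * (w - z)) (at z)" using P(3) eventually_neq_at_within[of z z UNIV]
    by eventually_elim (simp add: assms(3) power_int_minus)
  ultimately have "((\<lambda>w. f w * (w - z)) \<longlongrightarrow> P z) (at z)" by (rule Lim_transform_eventually)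
  thus ?thesis using P(1) by blast
qed

lemma zorder_limit_power:
  assumes f: "f meromorphic_on {z}" and L: "((\<lambda>w. f w * (w - z) ^ k) \<longlongrightarrow> L) (at z)" "L \<noteq> 0"
  shows "zorder f z = - int k" "eventually (\<lambda>w. f w \<noteq> 0) (at z)"
proof -
  have "eventually (\<lambda>w. f w * (w - z) ^ k \<noteq> 0) (at z)" using L by (rule tendsto_imp_eventually_ne)
  thus nz: "eventually (\<lambda>w. f w \<noteq> 0) (at z)" by eventually_elim simp
  obtain P where P: "P z \<noteq> 0" "isCont P z" "eventually (\<lambda>w. f w = P w * (w - z) powi zorder f z) (at z)"
    using zorder_factor[OF f nz] .
  have PL: "(P \<longlongrightarrow> P z) (at z)" using P(2) by (simp add: isCont_def)
  have pw: "((\<lambda>w. (w - z) ^ Suc n) \<longlongrightarrow> 0) (at z)" for n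
  proof -
    have "((\<lambda>w. (w - z) ^ Suc n) \<longlongrightarrow> (z - z) ^ Suc n) (at z)" by (intro tendsto_intros)
    thus ?thesis by simp
  qed
  have ne: "eventually (\<lambda>w. w \<noteq> z) (at z)" by (rule eventually_neq_at_within)
  define m where "m = zorder f z + int k"
  have ev: "eventually (\<lambda>w. f w * (w - z) ^ k = P w * (w - z) powi m) (at z)" using P(3) ne
    by eventually_elim (simp add: m_def power_int_add)
  consider n where "m = int (Suc n)" | n where "m = - int (Suc n)" | "m = 0"
    by (metis int_cases nat.exhaust of_nat_0)
  hence "m = 0"
  proof cases
    case (1 n)
    have "((\<lambda>w. P w * (w - z) ^ Suc n) \<longlongrightarrow> P z * 0) (at z)" by (intro tendsto_mult PL pw)
    moreover have "eventually (\<lambda>w. P w * (w - z) ^ Suc n = f w * (w - z) ^ k) (at z)" using ev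
      unfolding 1 power_int_of_nat by eventually_elim (rule sym)
    ultimately have "((\<lambda>w. f w * (w - z) ^ k) \<longlongrightarrow> P z * 0) (at z)" by (rule Lim_transform_eventually)
    hence "L = P z * 0" using L(1) LIM_unique by blast
    thus ?thesis using L(2) by simp
  next
    case (2 n)
    have "((\<lambda>w. f w * (w - z) ^ k * (w - z) ^ Suc n) \<longlongrightarrow> L * 0) (at z)" by (intro tendsto_mult L pw)
    moreover have "eventually (\<lambda>w. f w * (w - z) ^ k * (w - z) ^ Suc n = P w) (at z)" using ev ne
    proof eventually_elim
      case (elim w)
      have "inverse ((w - z) ^ Suc n) * (w - z) ^ Suc n = 1" by (rule left_inverse) (use elim(2) in simp)
      thus ?case unfolding elim(1) 2 power_int_minus power_int_of_nat by (simp only: mult.assoc mult_1_right)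
    qed
    ultimately have "(P \<longlongrightarrow> L * 0) (at z)" by (rule Lim_transform_eventually)
    hence "P z = L * 0" using PL LIM_unique by blast
    thus ?thesis using P(1) by simp
  qed
  thus "zorder f z = - int k" unfolding m_def by simp
qed

lemma zorder_nonneg_limit:
  assumes f: "f meromorphic_on {z}" "eventually (\<lambda>w. f w \<noteq> 0) (at z)" and L: "((\<lambda>w. f w * (w - z)) \<longlongrightarrow> 0) (at z)"
  shows "zorder f z \<ge> 0"
proof (rule ccontr)
  assume "\<not> zorder f z \<ge> 0"
  then obtain n where n: "zorder f z = - int (Suc n)" using int_cases[of "zorder f z"] by force
  obtain P where P: "P z \<noteq> 0" "isCont P z" "eventually (\<lambda>w. f w = P w * (w - z) powi zorder f z) (at z)"
    using zorder_factor[OF f] .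
  have "((\<lambda>w. f w * (w - z) * (w - z) ^ n) \<longlongrightarrow> 0 * (z - z) ^ n) (at z)" by (intro tendsto_intros L)
  moreover have "eventually (\<lambda>w. f w * (w - z) * (w - z) ^ n = P w) (at z)" using P(3) eventually_neq_at_within[of z z UNIV]
  proof eventually_elim
    case (elim w)
    have "inverse ((w - z) ^ Suc n) * ((w - z) * (w - z) ^ n) = 1"
      unfolding power_Suc by (rule left_inverse) (use elim(2) in simp)
    thus ?case unfolding elim(1) n power_int_minus power_int_of_nat by (simp only: mult.assoc mult_1_right)
  qed
  ultimately have "(P \<longlongrightarrow> 0 * (z - z) ^ n) (at z)" by (rule Lim_transform_eventually)
  moreover have "(P \<longlongrightarrow> P z) (at z)" using P(2) by (simp add: isCont_def)
  ultimately have "P z = 0 * (z - z) ^ n" using LIM_unique by blast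
  thus False using P(1) by simp
qed

context schottky_curve
begin

lemma pole_rs:
  assumes "INV F" "z \<in> \<Omega>"
  shows "is_pole (remove_sings F) z \<longleftrightarrow> is_pole F z" "zorder (remove_sings F) z = zorder F z"
    "eventually (\<lambda>w. remove_sings F w = F w) (at z)"
  using remove_sings_pole[of F z] INV_mer[OF assms] eventually_remove_sings_eq_at[of F z] meromorphic_at_iff by blast+

lemma deg_rs: "INV F \<Longrightarrow> deg (remove_sings F) = deg F"
  by (rule deg_cong) (rule pole_rs(3))

lemma poles_rs: "INV F \<Longrightarrow> poles (remove_sings F) = poles F"
  using pole_rs(1) by blast

text \<open>The \<open>v\<close>-points are carried along because finiteness comes from
  \<open>order_sum\<close>, which treats them together with the poles.\<close>

lemma finite_transversal:
  assumes F: "INV F" and s: "1 \<le> s" "s < s1" 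
    and circ: "\<And>l z. l \<in> Ls \<Longrightarrow> norm (z - cen l) = rad s l \<Longrightarrow> z \<notin> poles F \<union> {z\<in>\<Omega>. remove_sings F z = v}"
  shows "finite (poles F \<inter> reps s)" "deg F = (\<Sum>r\<in>poles F \<inter> reps s. nat (- zorder F r))"
    "\<And>p. p \<in> poles F \<Longrightarrow> \<exists>r\<in>poles F \<inter> reps s. r \<simeq> p"
proof -
  define F' where "F' = remove_sings F"
  have F': "nice F'" unfolding F'_def by (rule nice_remove_sings[OF F])
  define Q where "Q = {z\<in>\<Omega>. is_pole F' z \<or> F' z = v}"
  have Q: "Q = poles F \<union> {z\<in>\<Omega>. remove_sings F z = v}" unfolding Q_def F'_def using poles_rs[OF F] by blast
  show fin: "finite (poles F \<inter> reps s)"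
  proof (cases "poles F = {}")
    case False
    then obtain p where p: "p \<in> poles F'" using poles_rs[OF F] unfolding F'_def by blast
    have "finite (Q \<inter> reps s)"
      by (rule order_sum(1)[OF F' _ _ s Q_def]) (use p circ Q in auto)
    thus ?thesis by (rule finite_subset[rotated]) (use Q in blast)
  next
    case True thus ?thesis by (metis Int_empty_left finite.emptyI)
  qed
  show ex: "\<exists>r\<in>poles F \<inter> reps s. r \<simeq> p" if p: "p \<in> poles F" for p
  proof (rule reps_exist[OF s _ p])
    show "p \<in> \<Omega>" using p by blast
    show "w \<in> poles F" if "z \<in> poles F" "z \<simeq> w" for z w using that INV_pole_eq[OF F] eq_Omega by blast
    show "z \<notin> poles F" if "l \<in> Ls" "norm (z - cen l) = rad s l" for l z using circ[OF that] by blast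
  qed
  show "deg F = (\<Sum>r\<in>poles F \<inter> reps s. nat (- zorder F r))"
  proof (rule merom_degree_transversal[OF F fin _ _ ex])
    show "r = r'" if "r \<in> poles F \<inter> reps s" "r' \<in> poles F \<inter> reps s" "r \<simeq> r'" for r r'
      using reps_unique[of s r r'] s that by simp
  qed auto
qed

lemma values_nice:
  assumes "INV F" "p \<in> poles F" "z \<in> \<Omega>"
  shows "eventually (\<lambda>w. remove_sings F w \<noteq> v) (at z)"
  using nonconst[of "remove_sings F" p z v] nice_INV[OF nice_remove_sings[OF assms(1)]] poles_rs[OF assms(1)] assms 
  unfolding INV_def by blast

lemma Q_islimpt:
  assumes "INV F" "p \<in> poles F" "z \<in> \<Omega>"
  shows "\<not> z islimpt poles F \<union> {z\<in>\<Omega>. remove_sings F z = v}"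
  unfolding islimpt_Un using values_islimpt[OF values_nice[OF assms]] poles_islimpt[of F z] assms unfolding INV_def by blast

lemma ex_transversal:
  assumes "INV F"
  shows "\<exists>R. finite R \<and> R \<subseteq> poles F \<and> (\<forall>p\<in>poles F. \<exists>r\<in>R. r \<simeq> p) \<and> deg F = (\<Sum>r\<in>R. nat (- zorder F r))"
proof (cases "poles F = {}")
  case True
  have "deg F = (\<Sum>r\<in>{}. nat (- zorder F r))"
    by (rule merom_degree_transversal[OF assms]) (use True in auto)
  thus ?thesis using True by (intro exI[of _ "{}"]) simp
next
  case False
  then obtain p where p: "p \<in> poles F" by blast
  obtain s where s: "1 \<le> s" "s < s1" "\<forall>l\<in>Ls. \<forall>z. norm (z - cen l) = rad s l \<longrightarrow> z \<notin> poles F \<union> {z\<in>\<Omega>. remove_sings F z = 0}"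
    using ex_radius[of "poles F \<union> {z\<in>\<Omega>. remove_sings F z = 0}"] Q_islimpt[OF assms p] by blast
  have circ: "z \<notin> poles F \<union> {z\<in>\<Omega>. remove_sings F z = 0}" if "l \<in> Ls" "norm (z - cen l) = rad s l" for l z
    using s(3) that by blast
  note R = finite_transversal[OF assms s(1,2) circ]
  have 1: "finite (poles F \<inter> reps s)" by (rule R(1))
  have 2: "deg F = (\<Sum>r\<in>poles F \<inter> reps s. nat (- zorder F r))" by (rule R(2))
  have 3: "\<forall>p\<in>poles F. \<exists>r\<in>poles F \<inter> reps s. r \<simeq> p" by (rule ballI, rule R(3))
  show ?thesis using 1 2 3 by (intro exI[of _ "poles F \<inter> reps s"] conjI) simp_all
qed

text \<open>Inequivalent poles inject into a transversal, and orders are constant along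
  orbits.\<close>

lemma orders_le:
  assumes F: "INV F" and Z: "finite Z" "Z \<subseteq> poles F" "\<And>z w. z \<in> Z \<Longrightarrow> w \<in> Z \<Longrightarrow> z \<simeq> w \<Longrightarrow> z = w"
  shows "(\<Sum>z\<in>Z. nat (- zorder F z)) \<le> deg F"
proof -
  obtain R where R: "finite R" "R \<subseteq> poles F" "\<And>p. p\<in>poles F \<Longrightarrow> \<exists>r\<in>R. r \<simeq> p" "deg F = (\<Sum>r\<in>R. nat (- zorder F r))"
    using ex_transversal[OF F] by blast
  define f where "f = (\<lambda>z. SOME r. r \<in> R \<and> r \<simeq> z)"
  have f: "f z \<in> R \<and> f z \<simeq> z" if "z \<in> Z" for z
    unfolding f_def using someI_ex[of "\<lambda>r. r \<in> R \<and> r \<simeq> z"] R(3)[of z] that Z(2) by blast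
  have inj: "inj_on f Z"
  proof (rule inj_onI)
    fix x y assume "x \<in> Z" "y \<in> Z" "f x = f y"
    thus "x = y" using f[of x] f[of y] Z(3)[of x y] eq_sym eq_trans by metis
  qed
  have "(\<Sum>z\<in>Z. nat (- zorder F z)) = (\<Sum>z\<in>Z. nat (- zorder F (f z)))"
  proof (rule sum.cong[OF refl])
    fix z assume z: "z \<in> Z"
    have fz: "f z \<in> \<Omega>" "is_pole F (f z)" "f z \<simeq> z" using f[OF z] R(2) by blast+
    show "nat (- zorder F z) = nat (- zorder F (f z))" using INV_zorder[OF F fz(1,2,1,3)] by simp
  qed
  also have "\<dots> = (\<Sum>r\<in>f ` Z. nat (- zorder F r))" by (rule sum.reindex[OF inj, symmetric, unfolded o_def])
  also have "\<dots> \<le> (\<Sum>r\<in>R. nat (- zorder F r))" by (rule sum_mono2) (use R(1) f in auto)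
  finally show ?thesis using R(4) by simp
qed

lemma card_le_deg:
  assumes F: "INV F" and Z: "finite Z" "Z \<subseteq> poles F" "\<And>z w. z \<in> Z \<Longrightarrow> w \<in> Z \<Longrightarrow> z \<simeq> w \<Longrightarrow> z = w"
  shows "card Z \<le> deg F"
proof -
  have "card Z = (\<Sum>z\<in>Z. 1)" by simp
  also have "\<dots> \<le> (\<Sum>z\<in>Z. nat (- zorder F z))"
  proof (rule sum_mono)
    fix z assume "z \<in> Z"
    hence "zorder F z < 0" using pole_zorder[OF F] Z(2) by blast
    thus "1 \<le> nat (- zorder F z)" by simp
  qed
  also have "\<dots> \<le> deg F" by (rule orders_le[OF F Z])
  finally show ?thesis .
qed

lemma poles_inverse_iff:
  assumes F: "nice F" and p: "p \<in> poles F" and z: "z \<in> \<Omega>"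
  shows "is_pole (\<lambda>w. inverse (F w - v)) z \<longleftrightarrow> \<not> is_pole F z \<and> F z = v"
proof -
  have ev: "eventually (\<lambda>w. F w \<noteq> v) (at z)"
    using nonconst[of F p z v] nice_INV[OF F] p z unfolding INV_def by blast
  show ?thesis unfolding is_pole_inverse_iff isolated_zero_def
  proof safe
    assume lim: "(\<lambda>w. F w - v) \<midarrow>z\<rightarrow> 0"
    hence lim': "F \<midarrow>z\<rightarrow> v" by (simp add: Lim_null[of F v])
    show np: False if "is_pole F z"
      using that lim' not_tendsto_and_filterlim_at_infinity[of "at z" F v] unfolding is_pole_def by simp
    have "F analytic_on {z}" using nice_analytic[OF F z] np by blast
    hence "F \<midarrow>z\<rightarrow> F z" using analytic_at_imp_isCont isCont_def by blast
    thus "F z = v" using lim' LIM_unique by blast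
  next
    assume "\<not> is_pole F z" "v = F z"
    hence "F analytic_on {z}" using nice_analytic[OF F z] by blast
    hence "F \<midarrow>z\<rightarrow> F z" using analytic_at_imp_isCont isCont_def by blast
    thus "(\<lambda>w. F w - F z) \<midarrow>z\<rightarrow> 0" by (simp add: Lim_null[symmetric])
  next
    assume "\<not> is_pole F z" "v = F z"
    thus "\<forall>\<^sub>F w in at z. F w - F z \<noteq> 0" using ev by simp
  qed
qed

text \<open>Every value is taken as often as infinity: the poles of \<open>1 / (F - v)\<close> are
  the \<open>v\<close>-points of \<open>F\<close>, whose orders \<open>order_sum\<close> balances
  against those of the poles of \<open>F\<close>.\<close>

lemma deg_inverse_nice:
  assumes F: "nice F" and p: "p \<in> poles F"
  shows "deg (\<lambda>w. inverse (F w - v)) = deg F"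
proof -
  define f where "f = (\<lambda>w. F w - v)"
  define H where "H = (\<lambda>w. inverse (F w - v))"
  have INV: "INV F" "INV H" unfolding H_def using nice_INV[OF F] INV_inverse by blast+
  have mF: "F meromorphic_on \<Omega>" using INV INV_def by blast
  have nz: "eventually (\<lambda>w. F w \<noteq> v) (at z)" if "z \<in> \<Omega>" for z v using nonconst[OF mF _ _ that, of p] p by blast
  define Q where "Q = {z\<in>\<Omega>. is_pole F z \<or> F z = v}"
  have QQ: "Q = poles F \<union> {w\<in>\<Omega>. F w = v}" unfolding Q_def by auto
  have lim: "\<not> z islimpt Q" if "z \<in> \<Omega>" for z
    unfolding QQ islimpt_Un using poles_islimpt[OF mF that] values_islimpt[OF nz[OF that]] by blast
  obtain s where s: "1 \<le> s" "s < s1" "\<forall>l\<in>Ls. \<forall>z. norm (z - cen l) = rad s l \<longrightarrow> z \<notin> Q"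
    using ex_radius[of Q] lim unfolding Q_def by blast
  have circ: "z \<notin> Q" if "l \<in> Ls" "norm (z - cen l) = rad s l" for l z using s(3) that by blast
  have pF: "p \<in> \<Omega>" "is_pole F p" using p by blast+
  have fin: "finite (Q \<inter> reps s)" by (rule order_sum(1)[OF F pF s(1,2) Q_def circ])
  have sum0: "(\<Sum>p\<in>Q \<inter> reps s. zorder f p) = 0" unfolding f_def by (rule order_sum(2)[OF F pF s(1,2) Q_def circ])
  have PH: "poles H = {z\<in>\<Omega>. \<not> is_pole F z \<and> F z = v}" unfolding H_def using poles_inverse_iff[OF F p] by blast
  have U: "Q \<inter> reps s = (poles F \<inter> reps s) \<union> (poles H \<inter> reps s)" "(poles F \<inter> reps s) \<inter> (poles H \<inter> reps s) = {}"
    unfolding PH Q_def by blast+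
  have fins: "finite (poles F \<inter> reps s)" "finite (poles H \<inter> reps s)" using fin unfolding U(1) by blast+
  have eqQ: "w \<in> poles X" if "INV X" "z \<in> poles X" "z \<simeq> w" for X z w using that INV_pole_eq eq_Omega by blast
  have subQ: "poles F \<subseteq> Q" "poles H \<subseteq> Q" unfolding PH Q_def by blast+
  have dX: "deg X = (\<Sum>r\<in>poles X \<inter> reps s. nat (- zorder X r))" if X: "INV X" "finite (poles X \<inter> reps s)" "poles X \<subseteq> Q" for X
  proof (rule merom_degree_transversal[OF X(1,2)])
    show "r = r'" if "r \<in> poles X \<inter> reps s" "r' \<in> poles X \<inter> reps s" "r \<simeq> r'" for r r'
      using reps_unique[of s r r'] s that by simp
    show "\<exists>r\<in>poles X \<inter> reps s. r \<simeq> p" if p: "p \<in> poles X" for p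
    proof (rule reps_exist[OF s(1,2) _ p])
      show "p \<in> \<Omega>" using p by blast
      show "w \<in> poles X" if "z \<in> poles X" "z \<simeq> w" for z w using eqQ[OF X(1) that] .
      show "z \<notin> poles X" if "l \<in> Ls" "norm (z - cen l) = rad s l" for l z using circ[OF that] X(3) by blast
    qed
  qed simp
  have fm: "f meromorphic_on {z}" if "z \<in> \<Omega>" for z unfolding f_def using INV_mer[OF INV(1) that] by (intro meromorphic_intros)
  have zF: "nat (- zorder F z) = nat (- zorder f z) \<and> zorder f z < 0" if z: "z \<in> poles F" for z
  proof -
    have zO: "z \<in> \<Omega>" "is_pole F z" using z by blast+
    have pf: "is_pole f z" unfolding f_def using zO(2) is_pole_plus_const_iff[of F z "-v"] by simp
    have "zorder f z < 0" using isolated_pole_imp_neg_zorder[OF _ pf] fm[OF zO(1)] meromorphic_at_iff by blast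
    moreover have "zorder f z = zorder F z"
    proof (cases "v = 0")
      case False
      have "zorder (\<lambda>w. F w + (- v)) z = zorder F z"
      proof (rule zorder_add1)
        show "\<exists>\<^sub>F w in at z. F w \<noteq> 0" using nz[OF zO(1), of 0] by (rule eventually_frequently[rotated]) simp
        show "zorder F z < zorder (\<lambda>_. - v) z" using pole_zorder[OF INV(1) zO] False by (simp add: zorder_const)
        show "\<exists>\<^sub>F w in at z. - v \<noteq> 0" using False by simp
      qed (auto intro: INV_mer[OF INV(1) zO(1)])
      thus ?thesis by (simp add: f_def)
    qed (simp add: f_def)
    ultimately show ?thesis by simp
  qed
  have zH: "nat (- zorder H z) = nat (zorder f z) \<and> zorder f z > 0" if z: "z \<in> poles H" for z
  proof -
    have zO: "z \<in> \<Omega>" "is_pole H z" using z by blast+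
    have "\<exists>\<^sub>F w in at z. f w \<noteq> 0" using nz[OF zO(1), of v] unfolding f_def by (intro eventually_frequently) auto
    hence "zorder H z = - zorder f z" unfolding H_def f_def[symmetric]
      using zorder_inverse[of f z] fm[OF zO(1)] meromorphic_at_iff unfolding f_def by auto
    thus ?thesis using pole_zorder[OF INV(2) zO] by simp
  qed
  have "(\<Sum>z\<in>poles F \<inter> reps s. zorder f z) + (\<Sum>z\<in>poles H \<inter> reps s. zorder f z) = 0"
    using sum0 unfolding U(1) by (subst (asm) sum.union_disjoint[OF fins U(2)])
  moreover have "int (nat (- zorder F z)) = - zorder f z" if "z \<in> poles F \<inter> reps s" for z
    using zF[OF IntD1[OF that]] by simp
  hence "int (deg F) = - (\<Sum>z\<in>poles F \<inter> reps s. zorder f z)"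
    unfolding dX[OF INV(1) fins(1) subQ(1)] int_sum sum_negf[symmetric] by (rule sum.cong[OF refl])
  moreover have "int (nat (- zorder H z)) = zorder f z" if "z \<in> poles H \<inter> reps s" for z
    using zH[OF IntD1[OF that]] by simp
  hence "int (deg H) = (\<Sum>z\<in>poles H \<inter> reps s. zorder f z)"
    unfolding dX[OF INV(2) fins(2) subQ(2)] int_sum by (rule sum.cong[OF refl])
  ultimately have "int (deg H) = int (deg F)" by simp
  thus ?thesis unfolding H_def by simp
qed

section \<open>A rotation-invariant differential\<close>

definition psi_sum :: "complex \<Rightarrow> complex" where
  "psi_sum z = (\<Sum>k<g. psi (lm (k,True)) z)"

lemma lmT_GG: "k < g \<Longrightarrow> lm (k,True) \<in> GG" by (rule lm_GG) simp

lemma psi_sum_analytic: "z \<in> \<Omega> \<Longrightarrow> psi_sum analytic_on {z}"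
  unfolding psi_sum_def by (intro analytic_on_sum psi_analytic lmT_GG) auto

lemma psi_sum_holomorphic: "psi_sum holomorphic_on \<Omega>"
  using psi_sum_analytic analytic_imp_holomorphic analytic_on_analytic_at by blast

lemma psi_sum_act: "M \<in> GG \<Longrightarrow> z \<in> \<Omega> \<Longrightarrow> den M z \<noteq> 0 \<Longrightarrow> psi_sum (act M z) / (den M z)\<^sup>2 = psi_sum z"
  unfolding psi_sum_def sum_divide_distrib by (intro sum.cong refl psi_act lmT_GG) auto

text \<open>The rotation permutes the generators \<open>lm (k,True)\<close> cyclically; this is the
  reason for summing the periods over all of them.\<close>

lemma psi_sum_rot:
  assumes "z \<in> \<Omega>" shows "psi_sum (\<zeta> * z) * \<zeta> = psi_sum z"
proof -
  define f where "f = (\<lambda>k. (k + 1) mod g)"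
  have bij: "bij_betw f {..<g} {..<g}"
  proof (rule bij_betwI[where g = "\<lambda>k. (k + (g - 1)) mod g"])
    have e: "((k + a) mod g + b) mod g = k" if "a + b = g" "k < g" for k a b
    proof -
      have "((k + a) mod g + b) mod g = (k + g) mod g" using that(1) by (simp add: mod_simps add.assoc)
      thus ?thesis using that by simp
    qed
    show "(f k + (g-1)) mod g = k" if "k \<in> {..<g}" for k unfolding f_def using e[of 1 "g-1" k] that g_pos by auto
    show "f ((k + (g-1)) mod g) = k" if "k \<in> {..<g}" for k unfolding f_def using e[of "g-1" 1 k] that g_pos by auto
  qed (use g_pos in \<open>auto simp: f_def\<close>)
  have "psi_sum (\<zeta> * z) * \<zeta> = (\<Sum>k<g. psi (lm (f k,True)) (\<zeta> * z)) * \<zeta>"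
    unfolding psi_sum_def by (subst sum.reindex_bij_betw[OF bij]) simp
  also have "\<dots> = (\<Sum>k<g. psi (rotm (lm (k,True))) (\<zeta> * z) * \<zeta>)"
    unfolding sum_distrib_right rotm_lm f_def ..
  also have "\<dots> = psi_sum z" unfolding psi_sum_def by (intro sum.cong refl psi_rot lmT_GG assms) auto
  finally show ?thesis .
qed

lemma Re_less_cos_eta:
  assumes "norm y = 1" "\<not> (\<exists>t. -\<eta> \<le> t \<and> t \<le> \<eta> \<and> y = cis t)"
  shows "Re y < cos \<eta>"
proof -
  obtain t where t: "-pi < t" "t \<le> pi" "y = cis t"
    using assms(1) cis_Arg[of y] Arg_bounded[of y] by (metis norm_zero sgn_eq div_by_1 of_real_1 zero_neq_one)
  have "\<bar>t\<bar> > \<eta>"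
  proof (rule ccontr)
    assume "\<not> \<bar>t\<bar> > \<eta>"
    hence "-\<eta> \<le> t" "t \<le> \<eta>" by auto
    thus False using assms(2) t(3) by blast
  qed
  hence "cos \<bar>t\<bar> < cos \<eta>" using t eta_pos by (intro cos_monotone_0_pi) auto
  thus ?thesis using t by simp
qed

text \<open>Termwise positivity: every point of the orbit of \<open>x\<close> lies off the arc from \<open>cis (-\<eta>)\<close> to \<open>cis \<eta>\<close>.\<close>

lemma psi_positive:
  assumes x: "norm x = 1" "x \<in> outside 1" "Re x < cos \<eta>"
  shows "Im (x * psi (lm (0,True)) x) < 0"
proof -
  define l where "l = (0::nat,True)"
  define M0 where "M0 = lm l"
  \<comment> \<open>An endpoint of the gap around \<open>1\<close>. It lies on \<open>C_1\<close>,
    so the generator sends it to its conjugate and the period becomes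
    \<open>K x (cnj z) z\<close>.\<close>
  define z where "z = cis \<eta>"
  have l: "l \<in> Ls" "cen l = c" "cen (linv l) = cnj c" using g_pos unfolding l_def by auto
  have M0: "M0 \<in> GG" unfolding M0_def using lm_GG[OF l(1)] .
  have zco: "z \<in> coutside 1" unfolding z_def using eta_pos by (intro cis_coutside) auto
  have zO: "z \<in> \<Omega>" using coutside_Omega[of 1 z] zco s1(1) by simp
  have xO: "x \<in> \<Omega>" using outside_Omega[of 1 x] x(2) s1(1) by simp
  have nz: "norm z = 1" "z * cnj z = 1" unfolding z_def by (simp_all add: cis_cnj cis_mult)
  have "(norm (z - c))\<^sup>2 = \<rho>\<^sup>2"
  proof -
    have "\<eta> - \<mu> = - \<delta>" using delta by simp
    hence "cos (\<eta> - \<mu>) = cos \<delta>" by simp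
    thus ?thesis using norm_cis_cen[of \<eta> 0 True] cos_delta unfolding z_def by simp
  qed
  hence zc: "(z - c) * cnj (z - c) = of_real (\<rho>\<^sup>2)" using complex_norm_square[of "z - c"] by simp
  have zne: "z \<noteq> c" using zc rho_pos by auto
  have a0: "act M0 z = cnj z"
  proof -
    have "z \<noteq> cen (0,True)" using zne l by (simp add: l_def)
    from act_lm[OF this] have "act M0 z = cnj c + of_real (\<rho>\<^sup>2) / (z - c)" unfolding M0_def l_def by simp
    thus ?thesis unfolding zc[symmetric] using zne by simp
  qed
  have d0: "den M0 z \<noteq> 0" using den_nonzero[OF GG_su[OF M0]] nz by simp
  have xz: "\<not> x \<simeq> z"
  proof
    assume "x \<simeq> z"
    then obtain M where M: "M \<in> GG" "act M z = x" using eq_sym[of x z] unfolding eqv_def by blast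
    have "M = (1,0)" using outside_inequiv[OF M(1), of 1 z] s1(1) zco x(2) M(2) by simp
    thus False using M(2) x(3) unfolding z_def by auto
  qed
  have pe: "psi M0 x = K x (cnj z) z" using psi_eq[OF M0 xO zO d0 xz] a0 by simp
  have cz: "cnj z \<in> \<Omega>" "\<not> x \<simeq> cnj z" using Omega_act[OF zO M0 d0] neq_act[OF M0 d0 xz] a0 by simp_all
  have Re_y: "Re (act M x) < cos \<eta>" if M: "M \<in> GG" for M
  proof (cases "M = (1,0)")
    case True thus ?thesis using x(3) by simp
  next
    case False
    have "norm (act M x) = 1" using act_unit[OF GG_su[OF M] x(1)] .
    moreover have "\<not> (\<exists>t. -\<eta> \<le> t \<and> t \<le> \<eta> \<and> act M x = cis t)"
    proof
      assume "\<exists>t. -\<eta> \<le> t \<and> t \<le> \<eta> \<and> act M x = cis t"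
      hence co: "act M x \<in> coutside 1" using cis_coutside by auto
      obtain l where "l\<in>Ls" "norm (act M x - cen l) < rad 1 l"
        using GG'_act(2)[of M 1 x] M False s1(1) x(2) outside_sub by (metis DiffI order_refl less_imp_le singletonD subsetD)
      thus False using co unfolding coutside_def mem_Collect_eq by (meson not_le)
    qed
    ultimately show ?thesis by (rule Re_less_cos_eta)
  qed
  \<comment> \<open>With all points on the unit circle, \<open>x\<close> times a term of the series
    is purely imaginary, and its sign is that of \<open>Re (act M x) - cos \<eta>\<close>.\<close>
  have Tx: "x * T M x (cnj z) z = \<i> * of_real (sin \<eta> / ((norm (den M x))\<^sup>2 * (Re (act M x) - cos \<eta>)))" if M: "M \<in> GG" for M
  proof -
    define d y where "d = den M x" and "y = act M x"
    have su: "su11 M" using GG_su M by blast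
    have dn: "d \<noteq> 0" unfolding d_def using den_nonzero su x(1) by simp
    have ny: "norm y = 1" unfolding y_def using act_unit su x(1) by blast
    hence yy: "y * cnj y = 1" using complex_norm_square[of y] by simp
    have x1: "x * cnj x = 1" using complex_norm_square[of x] x(1) by simp
    have num: "num M x = x * cnj d" unfolding d_def using x1 by (cases M) (simp add: algebra_simps)
    have dy: "d * y = x * cnj d" unfolding y_def act_def using num dn d_def by simp
    have y2: "y + cnj y = of_real (2 * Re y)" by (simp add: complex_add_cnj)
    have z2: "z + cnj z = of_real (2 * cos \<eta>)" unfolding z_def by (simp add: complex_add_cnj)
    have z3: "z - cnj z = 2 * \<i> * of_real (sin \<eta>)" unfolding z_def by (simp add: complex_eq_iff)
    have "(cnj z - y) * (z - y) = z * cnj z - y * (z + cnj z) + y * y" by (simp add: algebra_simps)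
    also have "\<dots> = y * cnj y - y * (z + cnj z) + y * y" using nz yy by simp
    also have "\<dots> = y * ((y + cnj y) - (z + cnj z))" by (simp add: algebra_simps)
    also have "\<dots> = y * of_real (2 * (Re y - cos \<eta>))" unfolding y2 z2 by simp
    finally have q: "(cnj z - y) * (z - y) = y * of_real (2 * (Re y - cos \<eta>))" .
    have dd: "d * cnj d = of_real ((norm d)\<^sup>2)" by (rule complex_norm_square[symmetric])
    have "D M x (cnj z) * D M x z = d * d * ((cnj z - y) * (z - y))"
      unfolding D_den[OF dn[unfolded d_def]] d_def y_def by (simp add: algebra_simps)
    also have "\<dots> = d * (d * y) * of_real (2 * (Re y - cos \<eta>))" unfolding q by (simp add: mult_ac)
    also have "\<dots> = x * (d * cnj d) * of_real (2 * (Re y - cos \<eta>))" unfolding dy by (simp add: mult_ac)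
    finally have DD: "D M x (cnj z) * D M x z = x * of_real ((norm d)\<^sup>2 * (2 * (Re y - cos \<eta>)))" unfolding dd by simp
    have xn: "x \<noteq> 0" using x(1) by auto
    have e: "(2 * \<i> * of_real a) / of_real (n * (2 * r)) = \<i> * of_real (a / (n * r))" for a n r :: real
      by (cases "n = 0 \<or> r = 0") (auto simp: field_simps)
    have "x * T M x (cnj z) z = (2 * \<i> * of_real (sin \<eta>)) / of_real ((norm d)\<^sup>2 * (2 * (Re y - cos \<eta>)))"
      unfolding T_def DD z3 using xn by simp
    thus ?thesis unfolding e d_def y_def .
  qed
  have sn: "sin \<eta> > 0" using eta_pos eta_less theta_lt pi_gt_zero by (intro sin_gt_zero) linarith+
  define t where "t = (\<lambda>M. sin \<eta> / ((norm (den M x))\<^sup>2 * (Re (act M x) - cos \<eta>)))"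
  have tneg: "t M < 0" if M: "M \<in> GG" for M
  proof -
    have "den M x \<noteq> 0" using den_nonzero GG_su[OF M] x(1) by simp
    hence "(norm (den M x))\<^sup>2 * (Re (act M x) - cos \<eta>) < 0" using Re_y[OF M] by (intro mult_pos_neg) auto
    thus ?thesis unfolding t_def using sn by (intro divide_pos_neg)
  qed
  have "((\<lambda>M. T M x (cnj z) z) has_sum K x (cnj z) z) GG"
    unfolding KS_def by (rule has_sum_infsum) (rule K_summable[OF xO cz(1) zO cz(2) xz])
  hence "((\<lambda>M. x * T M x (cnj z) z) has_sum x * K x (cnj z) z) GG" by (rule has_sum_cmult_right)
  hence S0: "((\<lambda>M. Im (x * T M x (cnj z) z)) has_sum Im (x * K x (cnj z) z)) GG" by (rule has_sum_Im)
  define v where "v = Im (x * K x (cnj z) z)"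
  have "((\<lambda>M. Im (x * T M x (cnj z) z)) has_sum v) GG \<longleftrightarrow> (t has_sum v) GG"
    by (rule has_sum_cong) (unfold t_def Tx, simp)
  moreover have "((\<lambda>M. Im (x * T M x (cnj z) z)) has_sum v) GG" unfolding v_def by (rule S0)
  ultimately have S: "(t has_sum v) GG" by blast
  have h: "((\<lambda>M. - t M) has_sum - v) GG" using S by (simp add: has_sum_uminus)
  have "- t (1,0) \<le> - v"
  proof -
    have "(\<Sum>M\<in>{(1,0)}. - t M) \<le> (\<Sum>\<^sub>\<infinity>M\<in>GG. - t M)"
    proof (rule finite_sum_le_infsum)
      show "(\<lambda>M. - t M) summable_on GG" using h has_sum_imp_summable by blast
      show "0 \<le> - t M" if "M \<in> GG - {(1,0)}" for M using tneg[of M] that by simp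
    qed (use GG.one in auto)
    thus ?thesis using infsumI[OF h] by simp
  qed
  thus ?thesis using tneg[OF GG.one] pe unfolding M0_def l_def v_def by simp
qed

text \<open>At \<open>cis (pi / g)\<close> rotation turns each summand into the one with index
  \<open>0\<close>, taken at another point that \<open>psi_positive\<close> covers. All summands
  thus have the same sign and cannot cancel.\<close>

lemma psi_sum_nonzero: "psi_sum (cis (pi/g)) \<noteq> 0"
proof -
  define x0 where "x0 = cis (pi/g)"
  have x0: "norm x0 = 1" "x0 \<in> outside 1" unfolding x0_def using cis_outside by auto
  have xO: "x0 \<in> \<Omega>" using outside_Omega[of 1 x0] x0 s1(1) by simp
  have neg: "Im (x0 * psi (lm (k,True)) x0) < 0" if k: "k < g" for k
  proof -
    define x where "x = \<zeta>^(g-k) * x0"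
    have kk: "\<zeta>^k * x = x0" 
    proof -
      have "\<zeta>^k * x = \<zeta>^(k + (g - k)) * x0" unfolding x_def by (simp add: power_add mult.assoc)
      thus ?thesis using k zeta_g by simp
    qed
    have nx: "norm x = 1" unfolding x_def using x0 by (simp add: norm_mult)
    have out: "\<zeta>^n * x0 \<in> outside 1" for n using rot_outside x0(2) by (induction n) (auto simp: mult.assoc)
    have "Re x < cos \<eta>"
    proof (rule Re_less_cos_eta[OF nx], rule notI)
      assume "\<exists>t. -\<eta> \<le> t \<and> t \<le> \<eta> \<and> x = cis t"
      then obtain t where t: "-\<eta> \<le> t" "t \<le> \<eta>" "x = cis t" by blast
      have "x = cis (pi/g - 2*pi*k/g)"
      proof -
        have "x = x0 / \<zeta>^k" using kk by (simp add: field_simps)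
        thus ?thesis unfolding x0_def zeta_power cis_divide .
      qed
      hence "cis t = cis (pi/g - 2*pi*k/g)" using t(3) by simp
      hence "cis (t - (pi/g - 2*pi*k/g)) = 1" by (simp add: cis_divide[symmetric])
      hence "cos (t - (pi/g - 2*pi*k/g)) = 1" by (simp add: complex_eq_iff)
      then obtain n::int where n: "t - (pi/g - 2*pi*k/g) = of_int n * 2 * pi" using cos_one_2pi_int by blast
      have tg: "\<bar>t\<bar> < pi/g" using t theta_less eta_less by linarith
      define N where "N = 2 * n * int g + 1 - 2 * int k"
      have "t = pi / g * of_int N" using n g_pos unfolding N_def by (simp add: field_simps)
      hence "pi/g * \<bar>of_int N\<bar> < pi/g * 1" using tg g_pos by (simp add: abs_mult)
      hence "\<bar>of_int N\<bar> < (1::real)" using g_pos by (simp add: divide_less_cancel)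
      hence "N = 0" by linarith
      moreover have "odd N" unfolding N_def by simp
      ultimately show False by simp
    qed
    moreover have xout: "x \<in> outside 1" unfolding x_def by (rule out)
    ultimately have 1: "Im (x * psi (lm (0,True)) x) < 0" using psi_positive[OF nx] by blast
    have rot: "psi (lm (j,True)) (\<zeta>^j * x) * \<zeta>^j = psi (lm (0,True)) x \<and> \<zeta>^j * x \<in> \<Omega>" if "j < g" for j
      using that
    proof (induction j)
      case 0 thus ?case using outside_Omega[of 1 x] xout s1(1) by simp
    next
      case (Suc j)
      have IH: "psi (lm (j,True)) (\<zeta>^j * x) * \<zeta>^j = psi (lm (0,True)) x" "\<zeta>^j * x \<in> \<Omega>" using Suc by auto
      have "rotm (lm (j,True)) = lm (Suc j, True)" unfolding rotm_lm using Suc.prems by simp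
      hence "psi (lm (Suc j,True)) (\<zeta> * (\<zeta>^j * x)) * \<zeta> = psi (lm (j,True)) (\<zeta>^j * x)"
        using psi_rot[OF lmT_GG[of j] IH(2)] Suc.prems by simp
      moreover have "psi (lm (Suc j,True)) (\<zeta>^Suc j * x) * \<zeta>^Suc j = (psi (lm (Suc j,True)) (\<zeta> * (\<zeta>^j * x)) * \<zeta>) * \<zeta>^j"
        by (simp only: power_Suc mult_ac)
      moreover have "\<zeta>^Suc j * x \<in> \<Omega>" using IH rot_Omega[of "\<zeta>^j * x"] by (simp only: power_Suc mult.assoc)
      ultimately show ?case using IH by (simp only:)
    qed
    have "psi (lm (0,True)) x = psi (lm (k,True)) x0 * \<zeta>^k" using rot[OF k] by (simp only: kk)
    hence "x * psi (lm (0,True)) x = (\<zeta>^k * x) * psi (lm (k,True)) x0" by (simp add: mult_ac)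
    thus ?thesis using 1 kk by simp
  qed
  have "Im (x0 * psi_sum x0) = (\<Sum>k<g. Im (x0 * psi (lm (k,True)) x0))"
    unfolding psi_sum_def sum_distrib_left Im_sum ..
  also have "\<dots> < 0" using neg g_pos by (intro sum_strict_mono[where g = "\<lambda>_. 0::real", simplified]) auto
  finally have "Im (x0 * psi_sum x0) < 0" .
  thus ?thesis unfolding x0_def by auto
qed

end

text \<open>The leading coefficients of both sides of the functional equation are compared. The
  factors may depend on \<open>w\<close>, since at \<open>c\<close> the rotation is linear only to
  first order.\<close>

lemma rotation_order:
  fixes f :: "complex \<Rightarrow> complex"
  assumes f: "f analytic_on {a}" "eventually (\<lambda>w. f w \<noteq> 0) (at a)"
    and \<tau>: "(\<tau> \<longlongrightarrow> \<tau>0) (at a)" and \<kappa>: "(\<kappa> \<longlongrightarrow> \<kappa>0) (at a)" "\<kappa>0 \<noteq> 0"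
    and eq: "eventually (\<lambda>w. f w = \<tau> w * f (a + (w - a) * \<kappa> w)) (at a)"
  shows "\<exists>n. zorder f a = int n \<and> \<tau>0 * \<kappa>0 ^ n = 1"
proof -
  have fr: "\<exists>\<^sub>F w in at a. f w \<noteq> 0" using f(2) by (rule eventually_frequently[rotated]) simp
  have mf: "f meromorphic_on {a}" using f(1) by (rule analytic_on_imp_meromorphic_on)
  obtain P where P: "P a \<noteq> 0" "isCont P a" "eventually (\<lambda>w. f w = P w * (w - a) powi zorder f a) (at a)"
    using zorder_factor[OF mf f(2)] .
  obtain n where n: "zorder f a = int n" using zorder_ge_0[OF f(1) fr] nonneg_int_cases by blast
  have fP: "eventually (\<lambda>w. f w = P w * (w - a) ^ n) (at a)" using P(3) unfolding n power_int_of_nat .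
  define y where "y = (\<lambda>w. a + (w - a) * \<kappa> w)"
  have "((\<lambda>w. a + (w - a) * \<kappa> w) \<longlongrightarrow> a + (a - a) * \<kappa>0) (at a)" by (intro tendsto_intros \<kappa>)
  hence y: "(y \<longlongrightarrow> a) (at a)" unfolding y_def by simp
  have \<kappa>n: "eventually (\<lambda>w. \<kappa> w \<noteq> 0) (at a)" using \<kappa> by (rule tendsto_imp_eventually_ne)
  have ne: "eventually (\<lambda>w. w \<noteq> a) (at a)" by (rule eventually_neq_at_within)
  have "eventually (\<lambda>w. y w \<noteq> a) (at a)" using \<kappa>n ne by eventually_elim (simp add: y_def)
  hence "filterlim y (at a) (at a)" using y by (intro filterlim_atI)
  hence fPy: "eventually (\<lambda>w. f (y w) = P (y w) * (y w - a) ^ n) (at a)" using fP unfolding filterlim_iff by blast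
  have "eventually (\<lambda>w. P w = \<tau> w * \<kappa> w ^ n * P (y w)) (at a)" using eq fP fPy ne
  proof eventually_elim
    case (elim w)
    have "f (a + (w - a) * \<kappa> w) = P (y w) * ((w - a) * \<kappa> w) ^ n" using elim(3) unfolding y_def by simp
    hence "P w * (w - a) ^ n = (\<tau> w * \<kappa> w ^ n * P (y w)) * (w - a) ^ n"
      using elim(1) unfolding elim(2) by (simp only: power_mult_distrib mult_ac)
    thus ?case using elim(4) by simp
  qed
  moreover have "((\<lambda>w. \<tau> w * \<kappa> w ^ n * P (y w)) \<longlongrightarrow> \<tau>0 * \<kappa>0 ^ n * P a) (at a)"
    by (intro tendsto_intros \<tau> \<kappa> isCont_tendsto_compose[OF P(2) y])
  ultimately have "(P \<longlongrightarrow> \<tau>0 * \<kappa>0 ^ n * P a) (at a)" using tendsto_cong by fastforce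
  moreover have "(P \<longlongrightarrow> P a) (at a)" using P(2) by (simp add: isCont_def)
  ultimately have "\<tau>0 * \<kappa>0 ^ n * P a = P a" using LIM_unique by blast
  hence "\<tau>0 * \<kappa>0 ^ n = 1" using P(1) by simp
  thus ?thesis using n by blast
qed

lemma residue_mult_simple_pole:
  assumes f: "f meromorphic_on {z}" "eventually (\<lambda>w. f w \<noteq> 0) (at z)" "zorder f z = -1"
    and h: "h analytic_on {z}"
  shows "\<exists>a. a \<noteq> 0 \<and> residue (\<lambda>w. f w * h w) z = a * h z"
proof -
  obtain a where a: "a \<noteq> 0" "((\<lambda>w. f w * (w - z)) \<longlongrightarrow> a) (at z)" using simple_pole_limit[OF f] by blast
  have "isolated_singularity_at (\<lambda>w. f w * h w) z"
    using isolated_singularity_at_times[OF _ isolated_singularity_at_analytic[OF h]] f(1) meromorphic_at_iff by blast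
  then obtain r where r: "r > 0" "(\<lambda>w. f w * h w) analytic_on ball z r - {z}" unfolding isolated_singularity_at_def by blast
  have "residue (\<lambda>w. f w * h w) z = a * h z"
  proof (rule residue_simple')
    show "(\<lambda>w. f w * h w) holomorphic_on ball z r - {z}" using r(2) by (rule analytic_imp_holomorphic)
    have "(h \<longlongrightarrow> h z) (at z)" using analytic_at_imp_isCont[OF h] by (simp add: isCont_def)
    hence "((\<lambda>w. (f w * (w - z)) * h w) \<longlongrightarrow> a * h z) (at z)" using a(2) by (intro tendsto_mult)
    thus "((\<lambda>w. f w * h w * (w - z)) \<longlongrightarrow> a * h z) (at z)" by (simp only: mult_ac)
  qed (use r(1) in auto)
  thus ?thesis using a(1) by blast
qed

context schottky_curve
begin

lemma psi_sum_neq_0: "z \<in> \<Omega> \<Longrightarrow> eventually (\<lambda>w. psi_sum w \<noteq> 0) (at z)"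
proof -
  assume z: "z \<in> \<Omega>"
  have "cis (pi/g) \<in> \<Omega>" using outside_Omega[of 1 "cis (pi/g)"] cis_outside[of "pi/g"] s1(1) by simp
  from non_zero_neighbour_alt[OF psi_sum_holomorphic open_Omega connected_Omega z this psi_sum_nonzero]
  show ?thesis by (rule eventually_mono) simp
qed

lemma psi_sum_zorder_ge_0: "z \<in> \<Omega> \<Longrightarrow> zorder psi_sum z \<ge> 0"
  using zorder_ge_0[OF psi_sum_analytic] eventually_frequently[OF _ psi_sum_neq_0] by simp

lemma psi_sum_zorder_pos: "z \<in> \<Omega> \<Longrightarrow> zorder psi_sum z > 0 \<longleftrightarrow> psi_sum z = 0"
  using zorder_pos_iff[OF psi_sum_holomorphic open_Omega] eventually_frequently[OF _ psi_sum_neq_0] by simp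

text \<open>The factor by which the rotation, carried from infinity to \<open>c\<close> by
  \<open>lm (0,True)\<close>, multiplies \<open>u - c\<close>. Its limit at \<open>c\<close> is
  \<open>1 / \<zeta>\<close>, as infinity is rotated in the opposite sense.\<close>

definition \<kappa> :: "complex \<Rightarrow> complex" where
  "\<kappa> u = of_real (\<rho>\<^sup>2) / (\<zeta> * of_real (\<rho>\<^sup>2) + (\<zeta> - 1) * cnj c * (u - c))"

lemma kappa_tendsto: "(\<kappa> \<longlongrightarrow> 1 / \<zeta>) (at c)"
proof -
  have "((\<lambda>u. of_real (\<rho>\<^sup>2) / (\<zeta> * of_real (\<rho>\<^sup>2) + (\<zeta> - 1) * cnj c * (u - c))) \<longlongrightarrow>
    of_real (\<rho>\<^sup>2) / (\<zeta> * of_real (\<rho>\<^sup>2) + (\<zeta> - 1) * cnj c * (c - c))) (at c)"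
    using rho_pos by (intro tendsto_intros) auto
  thus ?thesis unfolding \<kappa>_def using rho_pos by simp
qed

text \<open>The rotation by \<open>\<zeta>\<close> about \<open>\<infinity>\<close>, transported to the equivalent point \<open>c\<close>.\<close>

lemma rotation_near_c:
  defines "M \<equiv> lm (0,True)" and "N \<equiv> lm (0,False)"
  shows "eventually (\<lambda>u. u \<in> \<Omega> \<and> den M u \<noteq> 0 \<and> den N (\<zeta> * act M u) \<noteq> 0 \<and>
    act N (\<zeta> * act M u) = c + (u - c) * \<kappa> u \<and> den M u * den N (\<zeta> * act M u) * \<kappa> u = 1) (at c)"
proof -
  define d where "d = (\<lambda>u. \<zeta> * of_real (\<rho>\<^sup>2) + (\<zeta> - 1) * cnj c * (u - c))"
  have "(d \<longlongrightarrow> \<zeta> * of_real (\<rho>\<^sup>2) + (\<zeta> - 1) * cnj c * (c - c)) (at c)" unfolding d_def by (intro tendsto_intros)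
  hence "eventually (\<lambda>u. d u \<noteq> 0) (at c)" by (rule tendsto_imp_eventually_ne) (use rho_pos in simp)
  moreover have "eventually (\<lambda>u. u \<in> \<Omega> - {c}) (at c)" using open_Omega c_Omega by (intro eventually_at_in_open) auto
  ultimately show ?thesis
  proof eventually_elim
    case (elim u)
    have cn: "cen (0,True) = c" "cen (0,False) = cnj c" "linv (0,True) = (0,False)" "linv (0,False) = (0,True)" by simp_all
    have uc: "u \<noteq> cen (0,True)" "u - c \<noteq> 0" using elim by auto
    have M: "den M u = -1 * \<i> / of_real \<rho> * (u - c)" unfolding M_def den_lm using cn by simp
    have aM: "act M u = cnj c + of_real (\<rho>\<^sup>2) / (u - c)" unfolding M_def act_lm[OF uc(1)] cn by simp
    define w where "w = \<zeta> * act M u"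
    have "(\<zeta> * (cnj c + of_real (\<rho>\<^sup>2) / (u - c)) - cnj c) * (u - c) = d u"
      using uc(2) unfolding d_def by (simp add: divide_simps) (simp add: algebra_simps)
    hence w: "w - cnj c = d u / (u - c)" unfolding w_def aM using uc(2) by (simp add: divide_simps)
    hence wc: "w \<noteq> cen (0,False)" using elim(1) uc(2) cn by auto
    have N: "den N w = \<i> / of_real \<rho> * (w - cnj c)" unfolding N_def den_lm cn by simp
    have aN: "act N w = c + of_real (\<rho>\<^sup>2) / (w - cnj c)" unfolding N_def act_lm[OF wc] cn by simp
    have k: "\<kappa> u = of_real (\<rho>\<^sup>2) / d u" unfolding \<kappa>_def d_def ..
    have "act N w = c + (u - c) * \<kappa> u" unfolding aN w k using uc elim(1) by (simp add: field_simps)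
    moreover have "den M u * den N w * \<kappa> u = 1"
      unfolding M N w k using rho_pos uc(2) elim(1) by (simp add: field_simps power2_eq_square)
    moreover have "den M u \<noteq> 0" "den N w \<noteq> 0" using calculation(2) by auto
    ultimately show ?case using elim unfolding w_def by blast
  qed
qed

lemma zeta_dvd:
  assumes "\<zeta> * \<zeta> ^ n = 1" shows "int n \<ge> int g - 1"
proof -
  have "g dvd n + 1" using assms zeta_power_eq_1_iff[of "n + 1"] by simp
  hence "g \<le> n + 1" by (rule dvd_imp_le) simp
  thus ?thesis by simp
qed

lemma psi_sum_order_0: "zorder psi_sum 0 \<ge> int g - 1"
proof -
  have "eventually (\<lambda>w. w \<in> \<Omega>) (at 0)" using open_Omega zero_Omega by (intro eventually_at_in_open') auto
  hence "eventually (\<lambda>w. psi_sum w = \<zeta> * psi_sum (0 + (w - 0) * \<zeta>)) (at 0)"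
    by eventually_elim (use psi_sum_rot in \<open>simp add: mult_ac\<close>)
  from rotation_order[OF psi_sum_analytic[OF zero_Omega] psi_sum_neq_0[OF zero_Omega] tendsto_const tendsto_const zeta_norm(2) this]
  show ?thesis using zeta_dvd by auto
qed

text \<open>Weight two contributes \<open>\<kappa>^2\<close>, so the limit of the multiplier is
  \<open>\<zeta> * (1/\<zeta>)^2\<close>. The relation between the coefficients then says that
  \<open>\<zeta>\<close> to the power \<open>n + 1\<close> is \<open>1\<close>, the same condition
  as at \<open>0\<close>.\<close>

lemma psi_sum_order_c: "zorder psi_sum c \<ge> int g - 1"
proof -
  have "eventually (\<lambda>u. psi_sum u = (\<zeta> * (\<kappa> u)\<^sup>2) * psi_sum (c + (u - c) * \<kappa> u)) (at c)"
    using rotation_near_c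
  proof eventually_elim
    case (elim u)
    define M where "M = lm (0,True)"
    define N where "N = lm (0,False)"
    define w where "w = act M u"
    have MN: "M \<in> GG" "N \<in> GG" unfolding M_def N_def using lm_GG g_pos by (simp_all del: lm.simps)
    have e: "u \<in> \<Omega>" "den M u \<noteq> 0" "den N (\<zeta> * w) \<noteq> 0" "act N (\<zeta> * w) = c + (u - c) * \<kappa> u" "den M u * den N (\<zeta> * w) * \<kappa> u = 1"
      using elim unfolding M_def N_def w_def by blast+
    have wO: "w \<in> \<Omega>" "\<zeta> * w \<in> \<Omega>" unfolding w_def using Omega_act[OF e(1) MN(1) e(2)] rot_Omega by blast+
    have 1: "psi_sum w / (den M u)\<^sup>2 = psi_sum u" unfolding w_def using psi_sum_act[OF MN(1) e(1,2)] .
    have 2: "psi_sum (c + (u - c) * \<kappa> u) / (den N (\<zeta> * w))\<^sup>2 = psi_sum (\<zeta> * w)" using psi_sum_act[OF MN(2) wO(2) e(3)] e(4) by simp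
    have 3: "psi_sum (\<zeta> * w) * \<zeta> = psi_sum w" using psi_sum_rot[OF wO(1)] .
    have k: "\<kappa> u = 1 / (den M u * den N (\<zeta> * w))" using e(2,3,5) by (simp add: field_simps)
    show ?case unfolding 1[symmetric] 3[symmetric] 2[symmetric] k by (simp add: power_divide power_mult_distrib mult_ac)
  qed
  note ev = this
  have t: "((\<lambda>u. \<zeta> * (\<kappa> u)\<^sup>2) \<longlongrightarrow> \<zeta> * (1/\<zeta>)\<^sup>2) (at c)" by (intro tendsto_intros kappa_tendsto)
  have nz: "1/\<zeta> \<noteq> 0" by simp
  obtain n where n: "zorder psi_sum c = int n" "\<zeta> * (1/\<zeta>)\<^sup>2 * (1/\<zeta>)^n = 1"
    using rotation_order[OF psi_sum_analytic[OF c_Omega] psi_sum_neq_0[OF c_Omega] t kappa_tendsto nz ev] by blast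
  have "\<zeta> * \<zeta> ^ n = 1" using n(2) by (simp add: power_divide divide_simps power2_eq_square)
  thus ?thesis using zeta_dvd n(1) by simp
qed

lemma psi_sum_zero: "psi_sum 0 = 0" "psi_sum c = 0"
  using psi_sum_order_0 psi_sum_order_c psi_sum_zorder_pos[OF zero_Omega] psi_sum_zorder_pos[OF c_Omega] g_ge by auto

lemma psi_sum_zero_act:
  assumes "M \<in> GG" "z \<in> \<Omega>" "den M z \<noteq> 0" shows "psi_sum (act M z) = 0 \<longleftrightarrow> psi_sum z = 0"
  using psi_sum_act[OF assms] assms(3) by (metis divide_eq_0_iff power_not_zero)

abbreviation "Z \<equiv> {z\<in>\<Omega>. psi_sum z = 0}"

text \<open>The factor \<open>(den M)^2\<close> in the transformation rule adds twice the
  logarithmic derivative of \<open>den M\<close>, which is \<open>2 / (w - cen l)\<close> for a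
  letter, to the logarithmic derivative. This is the case \<open>m = 1\<close> of
  \<open>residue_sum\<close>.\<close>

lemma psi_sum_zero_count:
  assumes s: "1 \<le> s" "s < s1" and circ: "\<And>l z. l \<in> Ls \<Longrightarrow> norm (z - cen l) = rad s l \<Longrightarrow> z \<notin> Z"
  shows "finite (Z \<inter> outside s)" "(\<Sum>z\<in>Z \<inter> outside s. zorder psi_sum z) + zorder psi_sum c = 2 * int g - 2"
proof -
  define h where "h = (\<lambda>w. deriv psi_sum w / psi_sum w)"
  have an: "psi_sum analytic_on {z}" if "z \<in> \<Omega>" for z using psi_sum_analytic[OF that] .
  have "h analytic_on {z}" if "z \<in> \<Omega> - Z" for z
    unfolding h_def using that by (intro analytic_intros an) auto
  hence hol: "h holomorphic_on \<Omega> - Z" using analytic_imp_holomorphic analytic_on_analytic_at by blast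
  have QO: "Z \<subseteq> \<Omega>" by blast
  have lim: "\<not> z islimpt Z" if "z \<in> \<Omega>" for z using values_islimpt[OF psi_sum_neq_0[OF that]] .
  have inv: "act (lm (k,True)) w \<notin> Z \<and> h (act (lm (k,True)) w) / (den (lm (k,True)) w)\<^sup>2 = h w + 1 * (2 / (w - cen (k,True)))"
    if k: "k < g" "w \<in> \<Omega> - Z" "w \<noteq> cen (k,True)" for k w
  proof -
    define M where "M = lm (k,True)"
    have M: "M \<in> GG" "den M w \<noteq> 0" unfolding M_def using lm_GG[of "(k,True)"] k den_lm_eq_0_iff by (auto simp del: lm.simps cen.simps)
    define y where "y = act M w"
    have wO: "w \<in> \<Omega>" "psi_sum w \<noteq> 0" using k by auto
    have yO: "y \<in> \<Omega>" unfolding y_def using Omega_act wO M by blast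
    have yQ: "psi_sum y \<noteq> 0" unfolding y_def using psi_sum_zero_act[OF M(1) wO(1) M(2)] wO(2) by simp
    have "eventually (\<lambda>x. x \<in> \<Omega> - {cen (k,True)}) (nhds w)"
      using open_delete[OF open_Omega] by (rule eventually_nhds_in_open) (use wO k(3) in simp)
    hence ev: "eventually (\<lambda>x. psi_sum (act M x) = psi_sum x * (den M x)\<^sup>2) (nhds w)"
    proof eventually_elim
      case (elim x)
      hence "den M x \<noteq> 0" unfolding M_def using den_lm_eq_0_iff by blast
      thus ?case using psi_sum_act[OF M(1), of x] elim by (simp add: field_simps)
    qed
    define b where "b = cnj (snd M)"
    have dd: "(den M has_field_derivative b) (at w)"
    proof -
      have "den M = (\<lambda>z. b * z + cnj (fst M))" unfolding b_def by (rule ext) (cases M, simp)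
      thus ?thesis by (auto intro!: derivative_eq_intros)
    qed
    have dp: "(psi_sum has_field_derivative deriv psi_sum x) (at x)" if "x \<in> \<Omega>" for x
      using an[OF that] analytic_on_imp_differentiable_at DERIV_deriv_iff_field_differentiable by blast
    have "((\<lambda>x. psi_sum (act M x)) has_field_derivative deriv psi_sum y * (1 / (den M w)\<^sup>2)) (at w)"
      unfolding y_def by (rule DERIV_chain2[OF dp act_deriv]) (use yO M GG_su in \<open>auto simp: y_def\<close>)
    moreover have "((\<lambda>x. psi_sum x * (den M x)\<^sup>2) has_field_derivative deriv psi_sum w * (den M w)\<^sup>2 + psi_sum w * (2 * den M w * b)) (at w)"
      by (auto intro!: derivative_eq_intros dp[OF wO(1)] dd)
    hence "((\<lambda>x. psi_sum (act M x)) has_field_derivative deriv psi_sum w * (den M w)\<^sup>2 + psi_sum w * (2 * den M w * b)) (at w)"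
      by (rule DERIV_cong_ev[OF refl ev refl, THEN iffD2])
    ultimately have e: "deriv psi_sum y * (1 / (den M w)\<^sup>2) = deriv psi_sum w * (den M w)\<^sup>2 + psi_sum w * (2 * den M w * b)"
      by (rule DERIV_unique)
    have py: "psi_sum y = psi_sum w * (den M w)\<^sup>2" unfolding y_def using ev eventually_nhds_x_imp_x by blast
    have bd: "den M w = b * (w - cen (k,True))"
    proof -
      have "b * cen (k,True) + cnj (fst M) = 0"
      proof -
        have "den M (cen (k,True)) = 0" unfolding M_def den_lm_eq_0_iff ..
        thus ?thesis unfolding b_def by (cases M) simp
      qed
      moreover have "den M w = b * w + cnj (fst M)" unfolding b_def by (cases M) simp
      ultimately show ?thesis by (metis add_diff_cancel_right' diff_0_right diff_add_cancel right_diff_distrib add.commute diff_diff_eq2)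
    qed
    have "h y / (den M w)\<^sup>2 = (deriv psi_sum y * (1 / (den M w)\<^sup>2)) / psi_sum y" unfolding h_def by simp
    also have "\<dots> = h w + 2 * b / den M w" unfolding e py h_def using wO(2) M(2) by (simp add: field_simps power2_eq_square)
    also have "2 * b / den M w = 2 / (w - cen (k,True))" using M(2) unfolding bd by simp
    finally show ?thesis using yQ unfolding M_def[symmetric] y_def[symmetric] by simp
  qed
  show fin: "finite (Z \<inter> outside s)" by (rule residue_sum(1)[where m = 1, OF s hol QO lim circ inv])
  have "(\<Sum>p\<in>Z \<inter> outside s. residue h p) + residue h c = 1 * (2 * of_nat g - 2)"
    by (rule residue_sum(2)[where m = 1, OF s hol QO lim circ inv])
  moreover have res: "residue h z = of_int (zorder psi_sum z)" if "z \<in> \<Omega>" for z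
    unfolding h_def by (rule residue_logderiv[OF analytic_on_imp_meromorphic_on[OF an[OF that]] psi_sum_neq_0[OF that]])
  have "(\<Sum>z\<in>Z \<inter> outside s. residue h z) = (\<Sum>z\<in>Z \<inter> outside s. of_int (zorder psi_sum z))"
    using res by (intro sum.cong) auto
  ultimately have "of_int ((\<Sum>z\<in>Z \<inter> outside s. zorder psi_sum z) + zorder psi_sum c) = (of_int (2 * int g - 2) :: complex)"
    using res[OF c_Omega] by simp
  thus "(\<Sum>z\<in>Z \<inter> outside s. zorder psi_sum z) + zorder psi_sum c = 2 * int g - 2" by (simp only: of_int_eq_iff)
qed

lemma c_neq_0: "\<not> c \<simeq> 0" "\<not> 0 \<simeq> c"
proof -
  show "\<not> c \<simeq> 0"
  proof
    assume "c \<simeq> 0"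
    hence "c = 0" using reps_unique[of 1 c 0] s1(1) zero_outside[of 1] unfolding reps_def by auto
    thus False using norm_c_gt by simp
  qed
  thus "\<not> 0 \<simeq> c" using eq_sym by blast
qed

text \<open>A function of degree two with simple poles at \<open>e\<close> and \<open>q\<close> only forces \<open>psi_sum\<close> to vanish at \<open>q\<close>,
  by the residue theorem, while \<open>psi_sum\<close> already has all its \<open>2g - 2\<close> zeros at \<open>0\<close> and \<open>c\<close>.\<close>

lemma deg2_poles:
  assumes F: "INV F" "deg F = 2" and e: "e = 0 \<or> e = c" "is_pole F e" and q: "q \<in> \<Omega>" "is_pole F q"
  shows "q \<simeq> 0 \<or> q \<simeq> c"
proof (rule ccontr)
  assume contra: "\<not> ?thesis"
  define H where "H = remove_sings F"
  have H: "nice H" "INV H" "deg H = 2" "poles H = poles F"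
    unfolding H_def using nice_remove_sings[OF F(1)] nice_INV deg_rs[OF F(1)] F(2) poles_rs[OF F(1)] by auto
  have eO: "e \<in> \<Omega>" using e zero_Omega c_Omega by blast
  have eq: "\<not> q \<simeq> e" using contra e by blast
  have pe: "e \<in> poles H" "q \<in> poles H" unfolding H(4) using eO e q by blast+
  have ne: "e \<noteq> q" using eq by auto
  have inj: "z = w" if "z \<in> {e,q}" "w \<in> {e,q}" "z \<simeq> w" for z w using that eq eq_sym by blast
  have zneg: "zorder H p < 0" if "p \<in> poles H" for p using pole_zorder[OF H(2)] that by blast
  have "(\<Sum>z\<in>{e,q}. nat (- zorder H z)) \<le> deg H" by (rule orders_le[OF H(2) _ _ inj]) (use pe in auto)
  hence "nat (- zorder H e) + nat (- zorder H q) \<le> 2" using ne H(3) by simp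
  hence ze: "zorder H e = -1" "zorder H q = -1" using zneg[OF pe(1)] zneg[OF pe(2)] by linarith+
  have other: "p \<simeq> e \<or> p \<simeq> q" if p: "p \<in> poles H" for p
  proof (rule ccontr)
    assume c: "\<not> ?thesis"
    have "card {p,e,q} \<le> deg H"
    proof (rule card_le_deg[OF H(2)])
      show "z = w" if "z \<in> {p,e,q}" "w \<in> {p,e,q}" "z \<simeq> w" for z w using that eq c eq_sym by blast
    qed (use p pe in auto)
    moreover have "p \<noteq> e" "p \<noteq> q" using c by auto
    ultimately show False using H(3) ne by simp
  qed
  define Q where "Q = poles H \<union> Z"
  have HO: "H meromorphic_on \<Omega>" using H(2) INV_def by blast
  have "\<not> z islimpt Q" if "z \<in> \<Omega>" for z
    unfolding Q_def islimpt_Un using values_islimpt[OF psi_sum_neq_0[OF that]] poles_islimpt[OF HO that] by blast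
  then obtain s where s: "1 \<le> s" "s < s1" "\<forall>l\<in>Ls. \<forall>z. norm (z - cen l) = rad s l \<longrightarrow> z \<notin> Q"
    using ex_radius[of Q] unfolding Q_def by blast
  have circZ: "z \<notin> Z" if "l \<in> Ls" "norm (z - cen l) = rad s l" for l z using s(3) that unfolding Q_def by blast
  have circP: "z \<notin> poles H" if "l \<in> Ls" "norm (z - cen l) = rad s l" for l z using s(3) that unfolding Q_def by blast
  have "\<exists>r\<in>poles H \<inter> reps s. r \<simeq> q"
  proof (rule reps_exist[OF s(1,2) q(1) pe(2) _ circP])
    show "w \<in> poles H" if "z \<in> poles H" "z \<simeq> w" for z w using that INV_pole_eq[OF H(2)] eq_Omega by blast
  qed
  then obtain q' where q': "q' \<in> poles H" "q' \<in> reps s" "q' \<simeq> q" by blast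
  have q'c: "\<not> q' \<simeq> e" "\<not> q' \<simeq> c" "\<not> q' \<simeq> 0" using q'(3) eq contra eq_sym eq_trans by blast+
  have q'O: "q' \<in> \<Omega>" "q' \<in> outside s" using q' q'c(2) unfolding reps_def by auto
  have er: "e \<in> reps s" using e(1) zero_outside s unfolding reps_def by auto
  have zq: "zorder H q' = -1"
  proof -
    have "is_pole H q" using pe(2) by blast
    from INV_zorder[OF H(2) q(1) this q'O(1) q'(3)] show ?thesis using ze(2) by simp
  qed
  have sub: "p = e \<or> p = q'" if p: "p \<in> poles H" "p \<in> reps s" for p
  proof -
    consider "p \<simeq> e" | "p \<simeq> q'" using other[OF p(1)] q'(3) eq_sym eq_trans by blast
    thus ?thesis using reps_unique[of s p e] reps_unique[of s p q'] s(1,2) p(2) er q'(2) by cases auto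
  qed
  define h where "h = (\<lambda>w. H w * psi_sum w)"
  have Han: "H analytic_on {z}" if "z \<in> \<Omega> - poles H" for z using nice_analytic[OF H(1)] that by blast
  have han: "h analytic_on {z}" if "z \<in> \<Omega> - poles H" for z
    unfolding h_def using that by (intro analytic_intros Han psi_sum_analytic) auto
  hence hol: "h holomorphic_on \<Omega> - poles H" using analytic_imp_holomorphic analytic_on_analytic_at by blast
  have inv: "act (lm (k,True)) w \<notin> poles H \<and> h (act (lm (k,True)) w) / (den (lm (k,True)) w)\<^sup>2 = h w + 0 * (2 / (w - cen (k,True)))"
    if k: "k < g" "w \<in> \<Omega> - poles H" "w \<noteq> cen (k,True)" for k w
  proof -
    define M where "M = lm (k,True)"
    have M: "M \<in> GG" "den M w \<noteq> 0" unfolding M_def using lm_GG[of "(k,True)"] k den_lm_eq_0_iff by (auto simp del: lm.simps cen.simps)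
    have w: "w \<in> \<Omega>" using k(2) by blast
    have "\<not> is_pole H (act M w)" using INV_pole[OF H(2) M(1) w M(2)] k(2) by blast
    moreover have "h (act M w) / (den M w)\<^sup>2 = h w"
      unfolding h_def nice_act[OF H(1) M(1) w M(2)] using psi_sum_act[OF M(1) w M(2)] by (metis times_divide_eq_right)
    ultimately show ?thesis unfolding M_def[symmetric] by simp
  qed
  have PO: "poles H \<subseteq> \<Omega>" by blast
  have lim: "\<not> z islimpt poles H" if "z \<in> \<Omega>" for z using poles_islimpt[OF HO that] .
  have fin: "finite (poles H \<inter> outside s)" by (rule residue_sum(1)[where m = 0, OF s(1,2) hol PO lim circP inv])
  have "(\<Sum>p\<in>poles H \<inter> outside s. residue h p) + residue h c = 0 * (2 * of_nat g - 2)"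
    by (rule residue_sum(2)[where m = 0, OF s(1,2) hol PO lim circP inv])
  hence rs: "(\<Sum>p\<in>poles H \<inter> outside s. residue h p) + residue h c = 0" by simp
  have res: "\<exists>a. a \<noteq> 0 \<and> residue h z = a * psi_sum z" if "z \<in> poles H" "zorder H z = -1" for z
    unfolding h_def
  proof (rule residue_mult_simple_pole)
    have z: "z \<in> \<Omega>" "is_pole H z" using that by blast+
    show "H meromorphic_on {z}" using INV_mer[OF H(2) z(1)] .
    show "psi_sum analytic_on {z}" using psi_sum_analytic[OF z(1)] .
    show "eventually (\<lambda>w. H w \<noteq> 0) (at z)" using nonconst[OF HO z(1,2,1)] .
  qed (rule that(2))
  \<comment> \<open>\<open>psi_sum\<close> vanishes at \<open>e\<close> and cancels the simple pole
    of \<open>H\<close> there, so the residue at \<open>q'\<close> is the only one left and must be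
    \<open>0\<close>.\<close>
  have re: "residue h e = 0" using res[OF pe(1) ze(1)] psi_sum_zero e(1) by auto
  have rc: "residue h c = 0"
  proof (cases "c \<in> poles H")
    case True
    hence "c = e \<or> c = q'" using sub[of c] unfolding reps_def by simp
    thus ?thesis using re q'c(2) by auto
  next
    case False
    have "h analytic_on {c}" using han[of c] c_Omega False by blast
    then obtain S where "open S" "c \<in> S" "h holomorphic_on S" unfolding analytic_at by blast
    thus ?thesis by (rule residue_holo)
  qed
  have "(\<Sum>p\<in>poles H \<inter> outside s. residue h p) = (\<Sum>p\<in>{q'}. residue h p)"
  proof (rule sum.mono_neutral_right[OF fin])
    show "\<forall>p\<in>poles H \<inter> outside s - {q'}. residue h p = 0"
    proof
      fix p assume p: "p \<in> poles H \<inter> outside s - {q'}"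
      have "p = e" using sub[of p] p unfolding reps_def by blast
      thus "residue h p = 0" using re by simp
    qed
  qed (use q'(1) q'O in auto)
  hence "residue h q' = 0" using rs rc by simp
  hence pq: "psi_sum q' = 0" using res[OF q'(1) zq] by auto
  have finZ: "finite (Z \<inter> outside s)" by (rule psi_sum_zero_count(1)[OF s(1,2) circZ])
  have N: "(\<Sum>z\<in>Z \<inter> outside s. zorder psi_sum z) + zorder psi_sum c = 2 * int g - 2" by (rule psi_sum_zero_count(2)[OF s(1,2) circZ])
  have "(\<Sum>z\<in>{0,q'}. zorder psi_sum z) \<le> (\<Sum>z\<in>Z \<inter> outside s. zorder psi_sum z)"
  proof (rule sum_mono2[OF finZ])
    show "{0,q'} \<subseteq> Z \<inter> outside s" using pq q'O psi_sum_zero zero_Omega zero_outside[of s] s(1,2) by auto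
    show "0 \<le> zorder psi_sum b" if "b \<in> Z \<inter> outside s - {0,q'}" for b using psi_sum_zorder_ge_0[of b] that by blast
  qed
  moreover have "zorder psi_sum q' > 0" using psi_sum_zorder_pos[OF q'O(1)] pq by simp
  moreover have "q' \<noteq> 0" using q'c by auto
  ultimately show False using N psi_sum_order_0 psi_sum_order_c by simp
qed

end

section \<open>Functions with divisor supported at zero and infinity\<close>

lemma filterlim_cnj_at: "filterlim cnj (at (cnj z)) (at z)"
proof (rule filterlim_atI)
  show "(cnj \<longlongrightarrow> cnj z) (at z)" by (intro tendsto_intros)
  show "\<forall>\<^sub>F x in at z. cnj x \<noteq> cnj z" using eventually_neq_at_within[of z z UNIV] by eventually_elim simp
qed

lemma meromorphic_cnj_cnj:
  assumes "f meromorphic_on {cnj z}" shows "(\<lambda>w. cnj (f (cnj w))) meromorphic_on {z}"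
proof -
  have iso: "isolated_singularity_at f (cnj z)" "not_essential f (cnj z)" using assms meromorphic_at_iff by auto
  obtain r where r: "r > 0" "f analytic_on ball (cnj z) r - {cnj z}" using iso(1) unfolding isolated_singularity_at_def by blast
  have "cnj ` (ball z r - {z}) \<subseteq> ball (cnj z) r - {cnj z}"
  proof (rule image_subsetI)
    fix x assume x: "x \<in> ball z r - {z}"
    have "dist (cnj z) (cnj x) = dist z x" unfolding dist_norm complex_cnj_diff[symmetric] by (rule complex_mod_cnj)
    thus "cnj x \<in> ball (cnj z) r - {cnj z}" using x by simp
  qed
  hence "f holomorphic_on cnj ` (ball z r - {z})" using analytic_imp_holomorphic[OF r(2)] holomorphic_on_subset by blast
  hence "cnj \<circ> f \<circ> cnj holomorphic_on ball z r - {z}" by (rule holomorphic_on_compose_cnj_cnj) (simp add: open_Diff)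
  hence "cnj \<circ> f \<circ> cnj analytic_on ball z r - {z}" by (subst analytic_on_open) (simp_all add: open_Diff)
  hence 1: "isolated_singularity_at (\<lambda>w. cnj (f (cnj w))) z" unfolding isolated_singularity_at_def o_def using r(1) by blast
  have "not_essential (\<lambda>w. cnj (f (cnj w))) z"
  proof (cases "is_pole f (cnj z)")
    case True
    hence "filterlim (\<lambda>w. f (cnj w)) at_infinity (at z)" unfolding is_pole_def by (rule filterlim_compose[OF _ filterlim_cnj_at])
    hence "is_pole (\<lambda>w. cnj (f (cnj w))) z" unfolding is_pole_def filterlim_at_infinity_conv_norm_at_top by simp
    thus ?thesis unfolding not_essential_def by blast
  next
    case False
    then obtain x where "(f \<longlongrightarrow> x) (at (cnj z))" using iso(2) unfolding not_essential_def by blast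
    hence "((\<lambda>w. f (cnj w)) \<longlongrightarrow> x) (at z)" by (rule filterlim_compose[OF _ filterlim_cnj_at])
    hence "((\<lambda>w. cnj (f (cnj w))) \<longlongrightarrow> cnj x) (at z)" by (rule tendsto_cnj)
    thus ?thesis unfolding not_essential_def by blast
  qed
  thus ?thesis using 1 meromorphic_at_iff by blast
qed

text \<open>A bound in terms of moduli survives composition with the antiholomorphic reflection,
  where the order itself is not directly available.\<close>

lemma zorder_bound:
  assumes "f meromorphic_on {z}" "eventually (\<lambda>w. f w \<noteq> 0) (at z)"
  shows "\<exists>B. eventually (\<lambda>w. norm (f w) \<le> B * norm (w - z) powi zorder f z) (at z)"
proof -
  obtain P where P: "P z \<noteq> 0" "isCont P z" "eventually (\<lambda>w. f w = P w * (w - z) powi zorder f z) (at z)"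
    using zorder_factor[OF assms] .
  have "((\<lambda>w. norm (P w)) \<longlongrightarrow> norm (P z)) (at z)" using P(2) unfolding isCont_def by (rule tendsto_norm)
  hence "eventually (\<lambda>w. norm (P w) < norm (P z) + 1) (at z)" by (rule order_tendstoD) simp
  hence "eventually (\<lambda>w. norm (f w) \<le> (norm (P z) + 1) * norm (w - z) powi zorder f z) (at z)" using P(3)
  proof eventually_elim
    case (elim w)
    show ?case unfolding elim(2) norm_mult norm_power_int using elim(1) by (intro mult_right_mono) auto
  qed
  thus ?thesis by blast
qed

lemma bounded_not_pole:
  fixes f :: "complex \<Rightarrow> complex"
  assumes "eventually (\<lambda>w. norm (f w) \<le> B) (at z)" shows "\<not> is_pole f z"
proof
  assume "is_pole f z"
  hence "eventually (\<lambda>w. norm (f w) > B) (at z)"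
    unfolding is_pole_def filterlim_at_infinity_conv_norm_at_top filterlim_at_top_dense by blast
  hence "eventually (\<lambda>w. False) (at z)" using assms by eventually_elim simp
  thus False using trivial_limit_def[of "at z"] at_neq_bot[of z] by blast
qed

context schottky_curve
begin

lemma den_tendsto: "den M \<midarrow>z\<rightarrow> den M z"
proof (cases M)
  case (Pair a b)
  show ?thesis unfolding Pair den.simps by (intro tendsto_intros)
qed

lemma eventually_den: "den M z \<noteq> 0 \<Longrightarrow> eventually (\<lambda>w. den M w \<noteq> 0) (at z)"
  by (rule tendsto_imp_eventually_ne[OF den_tendsto])

lemma eventually_Omega: "z \<in> \<Omega> \<Longrightarrow> eventually (\<lambda>w. w \<in> \<Omega>) (at z)"
  using open_Omega by (rule eventually_at_in_open')

lemma meromorphic_Omega: "(\<And>z. z \<in> \<Omega> \<Longrightarrow> F meromorphic_on {z}) \<Longrightarrow> F meromorphic_on \<Omega>"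
  unfolding meromorphic_on_def by blast

lemma no_poles_deg: 
  assumes "INV F" "poles F = {}" shows "deg F = 0"
proof -
  have "deg F = (\<Sum>r\<in>{}. nat (- zorder F r))" by (rule merom_degree_transversal[OF assms(1)]) (use assms(2) in auto)
  thus ?thesis by simp
qed

lemma deg_single:
  assumes "INV F" "p \<in> poles F" "\<And>q. q \<in> poles F \<Longrightarrow> p \<simeq> q" shows "deg F = nat (- zorder F p)"
proof -
  have "deg F = (\<Sum>r\<in>{p}. nat (- zorder F r))" by (rule merom_degree_transversal[OF assms(1)]) (use assms(2,3) in auto)
  thus ?thesis by simp
qed

lemma INV_diff_const: "INV F \<Longrightarrow> INV (\<lambda>w. F w - v)"
  unfolding INV_def by (auto intro!: meromorphic_intros elim: eventually_mono)

text \<open>Compactness enters through degrees: for a nonconstant \<open>Y\<close> without poles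
  some \<open>1 / (Y - v)\<close> has positive degree, but inverting it once more gives
  \<open>Y - v\<close>, which has degree \<open>0\<close>.\<close>

lemma nice_constant:
  assumes Y: "nice Y" "poles Y = {}" and z: "z0 \<in> \<Omega>" "z1 \<in> \<Omega>"
  shows "Y z0 = Y z1"
proof (rule ccontr)
  assume neq: "Y z0 \<noteq> Y z1"
  define v where "v = Y z0"
  have an: "Y analytic_on {z}" if "z \<in> \<Omega>" for z using nice_analytic[OF Y(1) that] Y(2) that by blast
  have hol: "(\<lambda>w. Y w - v) holomorphic_on \<Omega>"
    using an analytic_imp_holomorphic analytic_on_analytic_at by (intro holomorphic_intros) blast
  have INV: "INV Y" using nice_INV[OF Y(1)] .
  define H where "H = (\<lambda>w. inverse (Y w - v))"
  have H: "INV H" unfolding H_def by (rule INV_inverse[OF INV])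
  have "Y z1 - v \<noteq> 0" using neq by (simp add: v_def)
  from non_zero_neighbour_alt[OF hol open_Omega connected_Omega z this]
  have ev: "eventually (\<lambda>w. Y w - v \<noteq> 0) (at z0)" by (rule eventually_mono) simp
  have "Y \<midarrow>z0\<rightarrow> v" using analytic_at_imp_isCont[OF an[OF z(1)]] unfolding isCont_def v_def .
  hence "(\<lambda>w. Y w - v) \<midarrow>z0\<rightarrow> 0" by (simp add: Lim_null[symmetric])
  hence "is_pole H z0" unfolding H_def is_pole_inverse_iff isolated_zero_def using ev by simp
  hence pH: "z0 \<in> poles (remove_sings H)" using poles_rs[OF H] z by blast
  have "deg (\<lambda>w. inverse (remove_sings H w - 0)) = deg (remove_sings H)"
    by (rule deg_inverse_nice[OF nice_remove_sings[OF H] pH])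
  also have "\<dots> \<ge> card {z0}"
    by (rule card_le_deg[OF nice_INV[OF nice_remove_sings[OF H]]]) (use pH in auto)
  finally have d: "deg (\<lambda>w. inverse (remove_sings H w - 0)) \<ge> 1" by simp
  have "deg (\<lambda>w. inverse (remove_sings H w - 0)) = deg (\<lambda>w. Y w - v)"
  proof (rule deg_cong)
    fix z assume "z \<in> \<Omega>"
    from pole_rs(3)[OF H this] show "eventually (\<lambda>w. inverse (remove_sings H w - 0) = Y w - v) (at z)"
      by eventually_elim (simp add: H_def)
  qed
  moreover have "deg (\<lambda>w. Y w - v) = 0"
  proof (rule no_poles_deg[OF INV_diff_const[OF INV]])
    have "\<not> is_pole (\<lambda>w. Y w - v) z" if "z \<in> \<Omega>" for z
      using an[OF that] by (intro analytic_at_imp_no_pole analytic_intros)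
    thus "poles (\<lambda>w. Y w - v) = {}" by blast
  qed
  ultimately show False using d by simp
qed

text \<open>Reflection in the unit circle, which commutes with the group. The convention
  \<open>inverse 0 = 0\<close> yields \<open>refl 0 = 0\<close> instead of infinity, so the point
  \<open>0\<close> is treated separately.\<close>

definition refl :: "complex \<Rightarrow> complex" where "refl z = inverse (cnj z)"

lemma refl_refl [simp]: "refl (refl z) = z" by (simp add: refl_def)

lemma refl_eq_0 [simp]: "refl z = 0 \<longleftrightarrow> z = 0" by (simp add: refl_def)

lemma refl_act:
  assumes "z \<noteq> 0" "den M z \<noteq> 0" "act M z \<noteq> 0"
  shows "den M (refl z) \<noteq> 0" "act M (refl z) = refl (act M z)"
proof -
  have 1: "den M (refl z) = cnj (num M z) / cnj z" "num M (refl z) = cnj (den M z) / cnj z"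
    using assms(1) by (cases M; simp add: refl_def field_simps)+
  have n: "num M z \<noteq> 0" using assms(3) unfolding act_def by auto
  show "den M (refl z) \<noteq> 0" unfolding 1 using n assms(1) by simp
  have "act M (refl z) = (cnj (den M z) / cnj z) / (cnj (num M z) / cnj z)" unfolding act_def[of M "refl z"] 1 ..
  also have "\<dots> = refl (act M z)" using assms(1) n unfolding refl_def act_def by simp
  finally show "act M (refl z) = refl (act M z)" .
qed

lemma refl_eqv: "z \<simeq> w \<Longrightarrow> z \<noteq> 0 \<Longrightarrow> w \<noteq> 0 \<Longrightarrow> refl z \<simeq> refl w"
  unfolding eqv_def using refl_act by blast

lemma refl_c: "0 \<simeq> refl c"
proof -
  define N where "N = lm (0,False)"
  have N: "N \<in> GG" unfolding N_def using lm_GG g_pos by (simp del: lm.simps)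
  have c0: "c \<noteq> 0" using norm_c_gt by auto
  have "act N 0 = refl c" unfolding N_def act_def refl_def using rho_pos c0 by (simp add: field_simps)
  moreover have "den N 0 \<noteq> 0" using den_nonzero[OF GG_su[OF N]] by simp
  ultimately show ?thesis using eq_act[OF N] by fastforce
qed

text \<open>Reflection exchanges \<open>0\<close> with infinity and hence their orbits; on finite
  points this rests on \<open>refl c\<close> lying in the orbit of \<open>0\<close>.\<close>

lemma refl_orbits:
  assumes "z \<noteq> 0"
  shows "z \<simeq> c \<Longrightarrow> refl z \<simeq> 0" "z \<simeq> 0 \<Longrightarrow> refl z \<simeq> c"
proof -
  have c0: "c \<noteq> 0" using norm_c_gt by auto
  show "refl z \<simeq> 0" if "z \<simeq> c" using refl_eqv[OF that assms c0] refl_c eq_sym eq_trans by blast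
  show "refl z \<simeq> c" if "z \<simeq> 0"
  proof -
    have "z \<simeq> refl c" using that refl_c eq_trans by blast
    from refl_eqv[OF this assms] show ?thesis using c0 by simp
  qed
qed

lemma refl_Omega: "z \<in> \<Omega> \<Longrightarrow> z \<noteq> 0 \<Longrightarrow> refl z \<in> \<Omega>"
proof (cases "norm z = 1")
  case True
  assume "z \<in> \<Omega>"
  moreover have "z * cnj z = 1" using complex_norm_square[of z] True by simp
  hence "refl z = z" unfolding refl_def by (metis inverse_unique mult.commute)
  ultimately show ?thesis by simp
next
  case False
  assume "z \<noteq> 0"
  hence "norm (refl z) \<noteq> 1" using False by (simp add: refl_def norm_inverse)
  thus ?thesis by (rule norm_neq_1_Omega)
qed

lemma filterlim_refl: "z \<noteq> 0 \<Longrightarrow> filterlim refl (at (refl z)) (at z)"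
proof (rule filterlim_atI)
  assume "z \<noteq> 0"
  thus "(refl \<longlongrightarrow> refl z) (at z)" unfolding refl_def by (intro tendsto_intros) auto
  show "\<forall>\<^sub>F x in at z. refl x \<noteq> refl z" using eventually_neq_at_within[of z z UNIV]
    by eventually_elim (auto simp: refl_def)
qed

text \<open>The divisor is supported on the orbits of \<open>0\<close> and of infinity, with zeros
  on the former and poles on the latter. The orders are left open; \<open>balanced_orders\<close>
  shows them to be opposite.\<close>

definition balanced :: "(complex \<Rightarrow> complex) \<Rightarrow> bool" where
  "balanced X \<longleftrightarrow> nice X \<and> (\<forall>p\<in>\<Omega>. is_pole X p \<longleftrightarrow> p \<simeq> c) \<and> (\<forall>p\<in>\<Omega>. \<not> is_pole X p \<and> X p = 0 \<longleftrightarrow> p \<simeq> 0)"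

text \<open>The degree is computed once from the single orbit of poles and once, for the inverse
  function, from the single orbit of zeros.\<close>

lemma balanced_orders:
  assumes X: "balanced X"
  shows "zorder X 0 = - zorder X c"
proof -
  have nX: "nice X" "INV X" using X nice_INV unfolding balanced_def by blast+
  have cp: "c \<in> poles X" using X c_Omega unfolding balanced_def by simp
  have mX: "X meromorphic_on \<Omega>" using nX(2) INV_def by blast
  have ne: "eventually (\<lambda>w. X w \<noteq> 0) (at 0)" using nonconst[OF mX c_Omega _ zero_Omega] cp by blast
  have d1: "deg X = nat (- zorder X c)"
    by (rule deg_single[OF nX(2) cp]) (use X eq_sym in \<open>auto simp: balanced_def\<close>)
  define I where "I = (\<lambda>w. inverse (X w - 0))"
  have IN: "INV I" unfolding I_def by (rule INV_inverse[OF nX(2)])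
  have pI: "is_pole I z \<longleftrightarrow> z \<simeq> 0" if "z \<in> \<Omega>" for z
    unfolding I_def using poles_inverse_iff[OF nX(1) cp that, of 0] X that unfolding balanced_def by blast
  have "deg I = nat (- zorder I 0)"
    by (rule deg_single[OF IN]) (use pI zero_Omega eq_sym in auto)
  moreover have "zorder I 0 = - zorder X 0"
  proof -
    have "isolated_singularity_at X 0" "not_essential X 0" using INV_mer[OF nX(2) zero_Omega] meromorphic_at_iff by blast+
    moreover have "\<exists>\<^sub>F w in at 0. X w \<noteq> 0" using ne by (rule eventually_frequently[rotated]) simp
    ultimately show ?thesis unfolding I_def using zorder_inverse[of X 0] by simp
  qed
  moreover have "deg I = deg X" unfolding I_def by (rule deg_inverse_nice[OF nX(1) cp])
  moreover have "zorder X c < 0" using pole_zorder[OF nX(2) c_Omega] cp by blast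
  ultimately show ?thesis using d1 by simp
qed

text \<open>The reflected function has the inverse divisor of \<open>X\<close>, so the product of the two is constant.\<close>

lemma balanced_circle:
  assumes X: "balanced X" and z: "norm z = 1" "z \<in> \<Omega>"
  shows "norm (X z) = norm (X 1)"
proof -
  have nX: "nice X" "INV X" using X nice_INV unfolding balanced_def by blast+
  have cp: "is_pole X c" using X c_Omega unfolding balanced_def by simp
  have mX: "X meromorphic_on \<Omega>" using nX(2) INV_def by blast
  have ne: "eventually (\<lambda>w. X w \<noteq> 0) (at z)" if "z \<in> \<Omega>" for z using nonconst[OF mX c_Omega cp that] .
  define Y where "Y = (\<lambda>w. X w * cnj (X (refl w)))"
  \<comment> \<open>Near \<open>z\<close> the two factors are bounded by multiples of
    \<open>|w - z|\<close> to the powers \<open>zorder X z\<close> and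
    \<open>zorder X (refl z)\<close>; if the exponents have a nonnegative sum, the product is
    bounded.\<close>
  have bound: "\<not> is_pole Y z" if z: "z \<in> \<Omega>" "z \<noteq> 0" "zorder X z + zorder X (refl z) \<ge> 0" for z
  proof -
    define n m where "n = zorder X z" and "m = zorder X (refl z)"
    have rz: "refl z \<in> \<Omega>" using refl_Omega z by blast
    obtain B1 where B1: "eventually (\<lambda>w. norm (X w) \<le> B1 * norm (w - z) powi n) (at z)"
      using zorder_bound[OF INV_mer[OF nX(2) z(1)] ne[OF z(1)]] unfolding n_def by blast
    obtain B2 where B2: "eventually (\<lambda>w. norm (X w) \<le> B2 * norm (w - refl z) powi m) (at (refl z))"
      using zorder_bound[OF INV_mer[OF nX(2) rz] ne[OF rz]] unfolding m_def by blast
    have B2': "eventually (\<lambda>w. norm (X (refl w)) \<le> B2 * norm (refl w - refl z) powi m) (at z)"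
      using B2 filterlim_refl[OF z(2)] unfolding filterlim_iff by blast
    define q where "q = (\<lambda>w::complex. inverse ((norm w * norm z) powi m))"
    have "(q \<longlongrightarrow> q z) (at z)" unfolding q_def using z(2) by (intro tendsto_intros) auto
    hence "eventually (\<lambda>w. q w < q z + 1) (at z)" by (rule order_tendstoD) simp
    moreover have "eventually (\<lambda>w. w \<in> ball z 1 - {z}) (at z)" by (intro eventually_at_in_open) auto
    moreover have "eventually (\<lambda>w. w \<noteq> 0) (at z)" by (rule eventually_neq_at_within)
    ultimately have "eventually (\<lambda>w. norm (Y w) \<le> \<bar>B1\<bar> * \<bar>B2\<bar> * (q z + 1)) (at z)" using B1 B2'
    proof eventually_elim
      case (elim w)
      define d where "d = norm (w - z)"
      have d: "0 < d" "d \<le> 1" using elim(2) unfolding d_def by (auto simp: dist_norm norm_minus_commute)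
      have "refl w - refl z = - cnj (w - z) / (cnj w * cnj z)" unfolding refl_def using elim(3) z(2) by (simp add: field_simps)
      hence "norm (refl w - refl z) = d / (norm w * norm z)" unfolding d_def by (simp only: norm_divide norm_minus_cancel complex_mod_cnj norm_mult)
      hence "norm (refl w - refl z) powi m = d powi m / (norm w * norm z) powi m" by (simp only: power_int_divide_distrib)
      hence r: "norm (refl w - refl z) powi m = d powi m * q w" unfolding q_def by (simp only: divide_inverse)
      have q0: "q w \<ge> 0" unfolding q_def by simp
      have "norm (X w) \<le> \<bar>B1\<bar> * d powi n" using elim(4) d unfolding d_def[symmetric] by (smt (verit) mult_right_mono zero_le_power_int)
      moreover have "norm (X (refl w)) \<le> \<bar>B2\<bar> * (d powi m * q w)" using elim(5) d q0 unfolding r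
        by (smt (verit) mult_right_mono zero_le_power_int mult_nonneg_nonneg)
      ultimately have "norm (X w) * norm (X (refl w)) \<le> (\<bar>B1\<bar> * d powi n) * (\<bar>B2\<bar> * (d powi m * q w))"
        using d by (intro mult_mono) auto
      also have "\<dots> = \<bar>B1\<bar> * \<bar>B2\<bar> * (d powi (n + m) * q w)" using d by (simp add: power_int_add mult_ac)
      also have "\<dots> \<le> \<bar>B1\<bar> * \<bar>B2\<bar> * (1 * (q z + 1))"
      proof (intro mult_left_mono mult_mono)
        obtain j where j: "n + m = int j" using z(3) unfolding n_def m_def using nonneg_int_cases by blast
        show "d powi (n + m) \<le> 1" unfolding j power_int_of_nat using d by (intro power_le_one) auto
        show "q w \<le> q z + 1" using elim(1) by simp
      qed (use q0 in auto)
      finally show ?case unfolding Y_def by (simp add: norm_mult)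
    qed
    thus ?thesis by (rule bounded_not_pole)
  qed
  have mer: "Y meromorphic_on {z}" if z: "z \<in> \<Omega>" "z \<noteq> 0" for z
  proof -
    have "X meromorphic_on {cnj (inverse z)}" using INV_mer[OF nX(2) refl_Omega[OF z]] by (simp add: refl_def)
    hence 1: "(\<lambda>w. cnj (X (cnj w))) meromorphic_on {inverse z}" by (rule meromorphic_cnj_cnj)
    have "(\<lambda>w. cnj (X (cnj (inverse w)))) meromorphic_on {z}"
      by (rule meromorphic_on_compose[OF 1]) (use z(2) in \<open>auto intro!: analytic_intros\<close>)
    hence "(\<lambda>w. cnj (X (refl w))) meromorphic_on {z}" by (simp add: refl_def)
    thus ?thesis unfolding Y_def by (intro meromorphic_intros INV_mer[OF nX(2) z(1)])
  qed
  have inv: "eventually (\<lambda>w. Y (act M w) = Y w) (at z)" if M: "M \<in> GG" "z \<in> \<Omega>" "den M z \<noteq> 0" for M z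
  proof -
    have "eventually (\<lambda>y. y \<noteq> 0) (filtermap (act M) (at z))"
      unfolding filtermap_act[OF GG_su[OF M(1)] M(3)] by (rule eventually_neq_at_within)
    hence "eventually (\<lambda>w. act M w \<noteq> 0) (at z)" unfolding eventually_filtermap .
    moreover have "eventually (\<lambda>w. w \<noteq> 0) (at z)" by (rule eventually_neq_at_within)
    ultimately show ?thesis using eventually_den[OF M(3)] eventually_Omega[OF M(2)]
    proof eventually_elim
      case (elim w)
      note r = refl_act[OF elim(2,3,1)]
      have "X (refl (act M w)) = X (refl w)" using nice_act[OF nX(1) M(1) refl_Omega[OF elim(4,2)] r(1)] r(2) by simp
      thus ?case unfolding Y_def nice_act[OF nX(1) M(1) elim(4,3)] by simp
    qed
  qed
  \<comment> \<open>Near \<open>0\<close> the reflected argument tends to infinity. By invariance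
    the behaviour of \<open>Y\<close> there can be read off at the equivalent point
    \<open>act M0 0 = 1 / c\<close>.\<close>
  define M0 where "M0 = lm (0,True)"
  have M0: "M0 \<in> GG" unfolding M0_def using lmT_GG g_pos by blast
  have d0: "den M0 0 \<noteq> 0" using den_nonzero[OF GG_su[OF M0]] by simp
  have a0: "act M0 0 \<noteq> 0"
  proof -
    have "act M0 0 = 1 / c" unfolding M0_def act_def using rho_pos norm_c_gt by (auto simp: field_simps)
    thus ?thesis using norm_c_gt by auto
  qed
  have a0O: "act M0 0 \<in> \<Omega>" by (rule Omega_act[OF zero_Omega M0 d0])
  have mer0: "Y meromorphic_on {0}"
  proof -
    have "(\<lambda>w. Y (act M0 w)) meromorphic_on {0}"
      by (rule meromorphic_on_compose[OF mer[OF a0O a0] act_analytic[OF GG_su[OF M0] d0]]) simp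
    moreover have "(\<lambda>w. Y (act M0 w)) meromorphic_on {0} \<longleftrightarrow> Y meromorphic_on {0}"
      by (rule meromorphic_on_cong[OF _ refl]) (use inv[OF M0 zero_Omega d0] in simp)
    ultimately show ?thesis by blast
  qed
  have YI: "INV Y" unfolding INV_def using meromorphic_Omega[of Y] mer mer0 inv by (metis (no_types, lifting))
  have zle: "zorder X p \<ge> 0" if "p \<in> \<Omega>" "\<not> is_pole X p" for p
    using zorder_ge_0[OF nice_analytic[OF nX(1) that]] eventually_frequently[OF _ ne[OF that(1)]] by simp
  have zc: "zorder X p = zorder X c" if "p \<simeq> c" for p
    using INV_zorder[OF nX(2) c_Omega cp c_Omega eq_sym[OF that]] .
  have z0: "zorder X p = - zorder X c" if "p \<simeq> 0" for p
    using INV_zorder[OF nX(2) c_Omega cp zero_Omega eq_sym[OF that]] balanced_orders[OF X] by simp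
  have np: "\<not> is_pole Y z" if z: "z \<in> \<Omega>" "z \<noteq> 0" for z
  proof (rule bound[OF z])
    have rz: "refl z \<in> \<Omega>" "refl z \<noteq> 0" using refl_Omega z by simp_all
    consider "z \<simeq> c" | "refl z \<simeq> c" | "\<not> z \<simeq> c" "\<not> refl z \<simeq> c" by blast
    thus "zorder X z + zorder X (refl z) \<ge> 0"
    proof cases
      case 1 thus ?thesis using zc[OF 1] z0[OF refl_orbits(1)[OF z(2) 1]] by simp
    next
      case 2
      from refl_orbits(1)[OF rz(2) 2] have "z \<simeq> 0" by simp
      thus ?thesis using zc[OF 2] z0[of z] by simp
    next
      case 3
      hence "\<not> is_pole X z" "\<not> is_pole X (refl z)" using X z(1) rz(1) unfolding balanced_def by blast+
      thus ?thesis using zle[OF z(1)] zle[OF rz(1)] by simp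
    qed
  qed
  have np0: "\<not> is_pole Y 0" using INV_pole[OF YI M0 zero_Omega d0] np[OF a0O a0] by simp
  have "poles (remove_sings Y) = {}" unfolding poles_rs[OF YI] using np np0 by blast
  note const = nice_constant[OF nice_remove_sings[OF YI] this]
  have val: "remove_sings Y z = of_real ((norm (X z))\<^sup>2)" if z: "norm z = 1" "z \<in> \<Omega>" for z
  proof -
    have z0: "z \<noteq> 0" using z by auto
    have "z * cnj z = 1" using complex_norm_square[of z] z by simp
    hence rz: "refl z = z" unfolding refl_def by (metis inverse_unique mult.commute)
    have "\<not> z \<simeq> c" using eq_norm(1)[of z c] z norm_c_gt by auto
    hence "\<not> is_pole X z" using X z unfolding balanced_def by blast
    hence "isCont X z" using nice_analytic[OF nX(1) z(2)] analytic_at_imp_isCont by blast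
    hence Xz: "(X \<longlongrightarrow> X z) (at z)" by (simp add: isCont_def)
    have "((\<lambda>w. X (refl w)) \<longlongrightarrow> X z) (at z)" using filterlim_refl[OF z0] Xz unfolding rz by (rule filterlim_compose[rotated])
    hence "(Y \<longlongrightarrow> X z * cnj (X z)) (at z)" unfolding Y_def by (intro tendsto_intros Xz)
    hence "remove_sings Y z = X z * cnj (X z)" by (rule remove_sings_eqI)
    thus ?thesis using complex_norm_square[of "X z"] by simp
  qed
  have "(norm (X z))\<^sup>2 = (norm (X 1))\<^sup>2" using val[OF z] val[of 1] one_Omega const[OF z(2) one_Omega] by (simp only: of_real_eq_iff norm_one)
  thus ?thesis by simp
qed

lemma balanced_zero: "balanced X \<Longrightarrow> X 0 = 0" "balanced X \<Longrightarrow> \<not> is_pole X 0"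
  unfolding balanced_def using zero_Omega eq_refl by blast+

lemma balanced_analytic:
  assumes X: "balanced X" and z: "norm z < 1 \<or> norm z = 1 \<and> z \<in> \<Omega>"
  shows "z \<in> \<Omega>" "X analytic_on {z}"
proof -
  show zO: "z \<in> \<Omega>" using z norm_neq_1_Omega[of z] by auto
  have "\<not> z \<simeq> c" using eq_norm[of z c] z norm_c_gt by auto
  hence "\<not> is_pole X z" using X zO unfolding balanced_def by blast
  thus "X analytic_on {z}" using nice_analytic[of X z] X zO unfolding balanced_def by blast
qed

lemma closed_coutside: "closed (coutside s)"
proof -
  have "coutside s = (\<Inter>l\<in>Ls. {z. rad s l \<le> norm (z - cen l)})" unfolding coutside_def by blast
  moreover have "closed {z. rad s l \<le> norm (z - cen l)}" for l by (intro closed_Collect_le continuous_intros)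
  ultimately show ?thesis by auto
qed

lemma one_coutside: "1 \<in> coutside 1" using cis_coutside[of 0] eta_pos by simp

lemma balanced_one: assumes "balanced X" shows "X 1 \<noteq> 0"
proof
  assume "X 1 = 0"
  moreover have "\<not> is_pole X 1" using analytic_at_imp_no_pole balanced_analytic(2)[OF assms, of 1] one_Omega by simp
  ultimately have "1 \<simeq> 0" using assms one_Omega unfolding balanced_def by blast
  thus False using eq_norm(1)[of 1 0] by simp
qed

text \<open>Maximum principle on the quotient: the compact set \<open>A\<close> meets every orbit in
  the disc, so the modulus attains its supremum. At an inner point this would make \<open>X\<close>
  constant, equal to \<open>X 0 = 0\<close>; so it is attained on the circle, where the modulus is
  that of \<open>X 1\<close>.\<close>

lemma balanced_disc:
  assumes X: "balanced X" and z: "norm z < 1"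
  shows "norm (X z) < norm (X 1)"
proof -
  have nX: "nice X" using X unfolding balanced_def by blast
  have hol: "X holomorphic_on ball 0 1"
    using balanced_analytic(2)[OF X] analytic_imp_holomorphic analytic_on_analytic_at by (metis dist_0_norm mem_ball)
  have noconst: "norm (X y) < norm (X u)" if y: "norm y < 1" and u: "norm u < 1" "X u \<noteq> 0" "\<And>x. norm x < 1 \<Longrightarrow> norm (X x) \<le> norm (X u)" for y u
  proof -
    have "X constant_on ball 0 1"
      by (rule maximum_modulus_principle[OF hol _ _ _ _ _, of "ball 0 1" u]) (use u in auto)
    then obtain v where "\<And>x. x \<in> ball 0 1 \<Longrightarrow> X x = v" unfolding constant_on_def by blast
    hence "X u = X 0" using u(1) by simp
    thus ?thesis using u(2) balanced_zero(1)[OF X] by simp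
  qed
  define A where "A = cball 0 1 \<inter> coutside 1"
  have AO: "norm z < 1 \<or> norm z = 1 \<and> z \<in> \<Omega>" if "z \<in> A" for z
    using that coutside_Omega[of 1 z] s1(1) unfolding A_def by auto
  have "isCont X z" if "z \<in> A" for z using balanced_analytic(2)[OF X AO[OF that]] analytic_at_imp_isCont by blast
  hence "continuous_on A (\<lambda>z. norm (X z))" by (intro continuous_on_norm continuous_at_imp_continuous_on) blast
  moreover have "compact A" unfolding A_def using closed_coutside by (intro compact_Int_closed) auto
  moreover have "1 \<in> A" unfolding A_def using one_coutside by simp
  ultimately obtain u where u: "u \<in> A" "\<And>y. y \<in> A \<Longrightarrow> norm (X y) \<le> norm (X u)"
    using continuous_attains_sup[of A "\<lambda>z. norm (X z)"] by blast
  have X1: "X 1 \<noteq> 0" "norm (X 1) \<le> norm (X u)" using balanced_one[OF X] u(2)[OF \<open>1 \<in> A\<close>] by auto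
  have max: "norm (X x) \<le> norm (X u)" if x: "norm x < 1" for x
  proof -
    have xO: "x \<in> \<Omega>" using norm_neq_1_Omega[of x] x by simp
    obtain N where N: "N \<in> GG" "den N x \<noteq> 0" "act N x \<in> coutside 1 \<or> act N x = c"
      using Omega_reduce[of 1 x] s1(1) xO by auto
    have "norm (act N x) < 1" using act_disc[OF GG_su[OF N(1)] x] .
    hence "act N x \<in> A" using N(3) norm_c_gt unfolding A_def by auto
    thus ?thesis using u(2) nice_act[OF nX N(1) xO N(2)] by metis
  qed
  have "norm u = 1"
  proof (rule ccontr)
    assume "norm u \<noteq> 1"
    hence "norm u < 1" using u(1) unfolding A_def by auto
    moreover have "X u \<noteq> 0" using X1 by auto
    ultimately show False using noconst[of u u] max by blast
  qed
  hence eq: "norm (X u) = norm (X 1)" using balanced_circle[OF X, of u] AO[OF u(1)] by auto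
  show ?thesis
  proof (rule ccontr)
    assume contra: "\<not> ?thesis"
    have "norm (X x) \<le> norm (X z)" if "norm x < 1" for x using max[OF that] eq contra by simp
    moreover have "X z \<noteq> 0" using contra X1 by auto
    ultimately show False using noconst[of z z] z by blast
  qed
qed

text \<open>The Schwarz lemma makes \<open>X\<close> wind in the positive direction along the unit circle.\<close>

lemma balanced_logderiv:
  assumes X: "balanced X" and z: "norm z = 1" "z \<in> \<Omega>"
  shows "Re (z * deriv X z / X z) > 0"
proof -
  define f where "f = (\<lambda>w. X w / X 1)"
  have X1: "X 1 \<noteq> 0" by (rule balanced_one[OF X])
  have hol: "f holomorphic_on ball 0 1" unfolding f_def
    using balanced_analytic(2)[OF X] analytic_imp_holomorphic analytic_on_analytic_at X1
    by (intro holomorphic_intros) (metis dist_0_norm mem_ball)+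
  have f0: "f 0 = 0" unfolding f_def using balanced_zero(1)[OF X] by simp
  have f1: "norm (f w) < 1" if "norm w < 1" for w
    unfolding f_def norm_divide using balanced_disc[OF X that] X1 by (simp add: divide_less_eq)
  have schwarz: "norm (f w) \<le> norm w" if "norm w < 1" for w
    by (rule Schwarz_Lemma(1)[OF hol f0 f1 that])
  have nfz: "norm (f z) = 1" unfolding f_def norm_divide balanced_circle[OF X z] using X1 by simp
  define f' where "f' = deriv X z / X 1"
  have "X field_differentiable at z"
    using balanced_analytic(2)[OF X] z analytic_on_imp_differentiable_at by blast
  hence "(X has_field_derivative deriv X z) (at z)" using DERIV_deriv_iff_field_differentiable by blast
  hence df: "(f has_field_derivative f') (at z)" unfolding f_def f'_def by (rule DERIV_cdivide)
  \<comment> \<open>Along the radius the real part of \<open>q\<close> is \<open>1\<close> at the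
    end and, by the Schwarz lemma, at most the radius before it. Its derivative at the end is
    therefore at least \<open>1\<close>.\<close>
  define q where "q = (\<lambda>x. cnj (f z) * f (x * z))"
  have dl: "((\<lambda>x. x * z) has_field_derivative z) (at (of_real 1))" by (auto intro!: derivative_eq_intros)
  have df1: "(f has_field_derivative f') (at (of_real 1 * z))" using df by simp
  have "(q has_field_derivative cnj (f z) * (f' * z)) (at (of_real 1))"
    unfolding q_def by (rule DERIV_cmult[OF DERIV_chain2[OF df1 dl]])
  hence "((\<lambda>r. q (of_real r)) has_vector_derivative cnj (f z) * (f' * z)) (at 1)" by (rule has_vector_derivative_real_field)
  hence dq: "((\<lambda>r. Re (q (of_real r))) has_real_derivative Re (cnj (f z) * (f' * z))) (at 1)"
    using bounded_linear.has_vector_derivative[OF bounded_linear_Re] has_real_derivative_iff_has_vector_derivative by blast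
  have "Re (cnj (f z) * (f' * z)) \<ge> 1"
  proof (rule ccontr)
    assume lt: "\<not> ?thesis"
    have "((\<lambda>r. Re (q (of_real r)) - r) has_real_derivative Re (cnj (f z) * (f' * z)) - 1) (at 1)"
      by (intro derivative_intros dq)
    moreover have "Re (cnj (f z) * (f' * z)) - 1 < 0" using lt by simp
    ultimately obtain d where d: "d > 0" "\<forall>h>0. h < d \<longrightarrow> Re (q (of_real 1)) - 1 < Re (q (of_real (1 - h))) - (1 - h)"
      using DERIV_neg_dec_left by blast
    define h where "h = min (d/2) (1/2)"
    have h: "0 < h" "h < d" "h < 1" unfolding h_def using d(1) by auto
    have "q 1 = of_real ((norm (f z))\<^sup>2)" unfolding q_def using complex_norm_square[of "f z"] by (simp add: mult.commute)
    hence "Re (q (of_real 1)) = 1" using nfz by simp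
    moreover have "Re (q (of_real (1 - h))) \<le> 1 - h"
    proof -
      have n: "norm (of_real (1 - h) * z) = 1 - h" using z h by (simp add: norm_mult del: of_real_diff)
      have "Re (q (of_real (1 - h))) \<le> norm (q (of_real (1 - h)))" by (rule complex_Re_le_cmod)
      also have "\<dots> = norm (f (of_real (1 - h) * z))" unfolding q_def norm_mult complex_mod_cnj nfz by simp
      also have "\<dots> \<le> 1 - h" using schwarz[of "of_real (1 - h) * z"] n h by simp
      finally show ?thesis .
    qed
    ultimately show False using d(2) h by fastforce
  qed
  moreover have "cnj (f z) = 1 / f z"
  proof -
    have "f z * cnj (f z) = 1" using complex_norm_square[of "f z"] nfz by simp
    thus ?thesis by (metis divide_inverse inverse_unique mult_1)
  qed
  hence "cnj (f z) * (f' * z) = z * deriv X z / X z" unfolding f_def f'_def using X1 by simp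
  ultimately show ?thesis by simp
qed

lemma rot_power_Omega: "z \<in> \<Omega> \<Longrightarrow> \<zeta>^k * z \<in> \<Omega>"
  using rot_Omega by (induction k) (auto simp: mult.assoc)

lemma rot_power_outside: "z \<in> outside s \<Longrightarrow> \<zeta>^k * z \<in> outside s"
  using rot_outside by (induction k) (auto simp: mult.assoc)

text \<open>On its own circle the inversion is the identity, so the generator acts there as the
  reflection in the axis of index \<open>k\<close>, which exchanges the two ends of the gap.\<close>

lemma arc_endpoints:
  assumes k: "k < g"
  defines "M \<equiv> lm (k,True)"
  shows "den M (\<zeta>^k * cis \<eta>) \<noteq> 0" "act M (\<zeta>^k * cis \<eta>) = \<zeta>^k * cis (-\<eta>)"
proof -
  define u where "u = cis \<eta>"
  have cn: "cen (k,True) = \<zeta>^k * c" "cen (linv (k,True)) = \<zeta>^k * cnj c" by simp_all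
  have nu: "norm u = 1" "cnj u = cis (-\<eta>)" unfolding u_def by (simp_all add: cis_cnj)
  have uc: "u \<noteq> c" using nu(1) norm_c_gt by auto
  have ne: "\<zeta>^k * u \<noteq> cen (k,True)" unfolding cn using uc by simp
  thus "den M (\<zeta>^k * cis \<eta>) \<noteq> 0" unfolding M_def den_lm_eq_0_iff u_def .
  have "(norm (u - c))\<^sup>2 = \<rho>\<^sup>2"
  proof -
    have "\<eta> - \<mu> = - \<delta>" using delta by simp
    hence "cos (\<eta> - \<mu>) = cos \<delta>" by simp
    thus ?thesis using norm_cis_cen[of \<eta> 0 True] cos_delta unfolding u_def by simp
  qed
  hence r: "of_real (\<rho>\<^sup>2) = (u - c) * cnj (u - c)" using complex_norm_square[of "u - c"] by simp
  have "act M (\<zeta>^k * u) = \<zeta>^k * cnj c + \<zeta>^(2*k) * ((u - c) * cnj (u - c)) / (\<zeta>^k * u - \<zeta>^k * c)"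
    unfolding M_def act_lm[OF ne] cn r ..
  also have "\<zeta>^(2*k) * ((u - c) * cnj (u - c)) / (\<zeta>^k * u - \<zeta>^k * c) = \<zeta>^k * cnj (u - c)"
  proof -
    have "\<zeta>^k * u - \<zeta>^k * c = \<zeta>^k * (u - c)" by (simp add: right_diff_distrib)
    moreover have "\<zeta>^(2*k) = \<zeta>^k * \<zeta>^k" by (simp add: mult_2 power_add)
    ultimately show ?thesis using uc by simp
  qed
  finally have "act M (\<zeta>^k * u) = \<zeta>^k * cnj u" by (simp add: algebra_simps)
  thus "act M (\<zeta>^k * cis \<eta>) = \<zeta>^k * cis (-\<eta>)" unfolding u_def by (simp only: nu(2)[unfolded u_def])
qed

text \<open>Each arc between adjacent circles is closed up by the group, so it is mapped onto the whole circle;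
  otherwise a Cayley transform of \<open>X\<close> would be strictly increasing on it.\<close>

lemma balanced_arc:
  assumes X: "balanced X" and k: "k < g" and v: "norm v = norm (X 1)"
  shows "\<exists>t. -\<eta> \<le> t \<and> t \<le> \<eta> \<and> X (\<zeta>^k * cis t) = v"
proof (rule ccontr)
  assume "\<not> ?thesis"
  hence nv: "X (\<zeta>^k * cis t) \<noteq> v" if "-\<eta> \<le> t" "t \<le> \<eta>" for t using that by blast
  define u where "u = (\<lambda>t. \<zeta>^k * cis t)"
  \<comment> \<open>The Cayley transform whose pole is the omitted value \<open>v\<close>: it is
    real on the rest of the circle through \<open>v\<close> about \<open>0\<close> and increases
    with the angle.\<close>
  define Q where "Q = (\<lambda>w. \<i> * (v + X w) / (v - X w))"
  have nu: "norm (u t) = 1" for t unfolding u_def by (simp add: norm_mult)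
  have uO: "u t \<in> \<Omega>" if "-\<eta> \<le> t" "t \<le> \<eta>" for t
    unfolding u_def using coutside_Omega[of 1 "cis t"] cis_coutside[OF that] s1(1) by (intro rot_power_Omega) simp
  have inc: "\<exists>y. ((\<lambda>t. Re (Q (u t))) has_real_derivative y) (at t) \<and> y > 0" if t: "-\<eta> \<le> t" "t \<le> \<eta>" for t
  proof -
    define z where "z = u t"
    define x where "x = X z"
    define L where "L = z * deriv X z / x"
    have z: "norm z = 1" "z \<in> \<Omega>" unfolding z_def using nu uO[OF t] by auto
    have L: "Re L > 0" unfolding L_def x_def by (rule balanced_logderiv[OF X z])
    have nx: "norm x = norm v" unfolding x_def v by (rule balanced_circle[OF X z])
    have x0: "x \<noteq> 0" "v \<noteq> 0" using nx v balanced_one[OF X] by auto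
    have vx: "v - x \<noteq> 0" using nv[OF t] unfolding x_def z_def u_def by auto
    have "X field_differentiable at z"
      using balanced_analytic(2)[OF X] z analytic_on_imp_differentiable_at by blast
    hence dX: "(X has_field_derivative deriv X z) (at z)" using DERIV_deriv_iff_field_differentiable by blast
    have "((\<lambda>w. \<i> * (v + X w) / (v - X w)) has_field_derivative
      ((\<i> * (0 + deriv X z)) * (v - X z) - \<i> * (v + X z) * (0 - deriv X z)) / ((v - X z) * (v - X z))) (at z)"
      by (intro DERIV_divide DERIV_cmult DERIV_add DERIV_diff DERIV_const dX) (use vx x_def in simp)
    hence dQ: "(Q has_field_derivative 2 * \<i> * v * deriv X z / (v - x)\<^sup>2) (at z)"
      unfolding Q_def x_def by (rule DERIV_cong) (simp add: power2_eq_square algebra_simps)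
    have zt: "\<zeta>^k * exp (\<i> * of_real t) = z" unfolding z_def u_def cis_conv_exp ..
    have dU: "((\<lambda>y. \<zeta>^k * exp (\<i> * y)) has_field_derivative \<i> * z) (at (of_real t))"
      by (rule derivative_eq_intros refl | simp add: zt[symmetric])+
    have "((\<lambda>y. Q (\<zeta>^k * exp (\<i> * y))) has_field_derivative (2 * \<i> * v * deriv X z / (v - x)\<^sup>2) * (\<i> * z)) (at (of_real t))"
      by (rule DERIV_chain2[OF _ dU]) (use dQ zt in simp)
    hence "((\<lambda>t. Q (\<zeta>^k * exp (\<i> * of_real t))) has_vector_derivative (2 * \<i> * v * deriv X z / (v - x)\<^sup>2) * (\<i> * z)) (at t)"
      by (rule has_vector_derivative_real_field)
    hence "((\<lambda>t. Re (Q (\<zeta>^k * exp (\<i> * of_real t)))) has_real_derivative Re ((2 * \<i> * v * deriv X z / (v - x)\<^sup>2) * (\<i> * z))) (at t)"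
      using bounded_linear.has_vector_derivative[OF bounded_linear_Re] has_real_derivative_iff_has_vector_derivative by blast
    hence d: "((\<lambda>t. Re (Q (u t))) has_real_derivative Re ((2 * \<i> * v * deriv X z / (v - x)\<^sup>2) * (\<i> * z))) (at t)"
      unfolding u_def cis_conv_exp .
    define a where "a = (norm v)\<^sup>2"
    define b where "b = (norm (v - x))\<^sup>2"
    have ab: "a > 0" "b > 0" unfolding a_def b_def using x0 vx by auto
    have va: "v * cnj v = of_real a" "x * cnj x = of_real a" unfolding a_def using complex_norm_square[of v] complex_norm_square[of x] nx by auto
    have vb: "of_real b = (v - x) * cnj (v - x)" unfolding b_def by (rule complex_norm_square)
    \<comment> \<open>When \<open>|v| = |x|\<close>, the quotient \<open>v * x / (v - x)^2\<close>
      is the negative number \<open>- |v|^2 / |v - x|^2\<close>, so the derivative has the sign of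
      \<open>Re L\<close>.\<close>
    have "v * x * of_real b = (v - x) * ((v * cnj v) * x - v * (x * cnj x))" unfolding vb by (simp add: algebra_simps)
    also have "\<dots> = - (v - x)\<^sup>2 * of_real a" unfolding va by (simp add: power2_eq_square algebra_simps)
    finally have "v * x / (v - x)\<^sup>2 = - of_real (a / b)" using ab vx by (simp add: divide_simps)
    moreover have "(2 * \<i> * v * deriv X z / (v - x)\<^sup>2) * (\<i> * z) = - 2 * (v * x / (v - x)\<^sup>2) * L"
    proof -
      have "(2 * \<i> * v * deriv X z / (v - x)\<^sup>2) * (\<i> * z) = (\<i> * \<i>) * (2 * (v * (z * deriv X z) / (v - x)\<^sup>2))"
        by (simp only: mult_ac times_divide_eq_left times_divide_eq_right)
      hence "(2 * \<i> * v * deriv X z / (v - x)\<^sup>2) * (\<i> * z) = - 2 * (v * (z * deriv X z) / (v - x)\<^sup>2)" by simp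
      also have "z * deriv X z = x * L" unfolding L_def using x0 by simp
      finally show ?thesis by simp
    qed
    ultimately have "(2 * \<i> * v * deriv X z / (v - x)\<^sup>2) * (\<i> * z) = of_real (2 * (a / b)) * L" by simp
    moreover have "Re (of_real (2 * (a / b)) * L) = 2 * (a / b) * Re L" by simp
    ultimately have "Re ((2 * \<i> * v * deriv X z / (v - x)\<^sup>2) * (\<i> * z)) = 2 * (a / b) * Re L" by (simp only:)
    moreover have "2 * (a / b) * Re L > 0" using ab L by simp
    ultimately show ?thesis using d by auto
  qed
  have "Re (Q (u (-\<eta>))) < Re (Q (u \<eta>))"
    by (rule DERIV_pos_imp_increasing[of "-\<eta>" \<eta>]) (use eta_pos inc in auto)
  moreover have "X (u (-\<eta>)) = X (u \<eta>)"
  proof -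
    have e: "\<zeta>^k * cis \<eta> \<in> \<Omega>" using uO[of \<eta>] eta_pos unfolding u_def by simp
    have "nice X" using X unfolding balanced_def by blast
    from nice_act[OF this lmT_GG[OF k] e arc_endpoints(1)[OF k]] show ?thesis unfolding arc_endpoints(2)[OF k] u_def .
  qed
  ultimately show False unfolding Q_def by simp
qed

lemma arcs_disjoint:
  assumes "j < k" "k < 3" "-\<eta> \<le> s" "s \<le> \<eta>" "-\<eta> \<le> t" "t \<le> \<eta>"
  shows "\<zeta>^j * cis s \<noteq> \<zeta>^k * cis t"
proof
  assume "\<zeta>^j * cis s = \<zeta>^k * cis t"
  hence "cis (2*pi*k/g + t) / cis (2*pi*j/g + s) = 1" unfolding zeta_power cis_mult by simp
  hence "cis ((2*pi*k/g + t) - (2*pi*j/g + s)) = 1" by (simp only: cis_divide)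
  hence "cos ((2*pi*k/g + t) - (2*pi*j/g + s)) = 1" by (metis cis.sel(1) one_complex.sel(1))
  then obtain n :: int where n: "(2*pi*k/g + t) - (2*pi*j/g + s) = of_int n * 2 * pi" using cos_one_2pi_int by blast
  define y where "y = pi / real g"
  have y: "\<eta> < y" "y > 0" unfolding y_def using eta_less theta_less eta_pos by linarith+
  have y3: "3 * y \<le> pi" using g_ge unfolding y_def by (simp add: field_simps)
  define a where "a = of_int n * 2 * pi"
  have e: "2*pi*k/g = 2 * real k * y" "2*pi*j/g = 2 * real j * y" unfolding y_def by simp_all
  have a: "2 * (real k * y) + t - 2 * (real j * y) - s = a" using n unfolding a_def e by simp
  have jk: "(real j + 1) * y \<le> real k * y" "real k * y \<le> 2 * y"
    using assms(1,2) y(2) by (intro mult_right_mono; linarith)+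
  have j0: "0 \<le> real j * y" using y(2) by simp
  have jk': "real j * y + y \<le> real k * y" using jk(1) unfolding distrib_right by simp
  have "0 < a" "a < 2 * pi" using a y y3 j0 jk' jk(2) assms(3-6) by linarith+
  hence "0 < real_of_int n" "real_of_int n < 1" unfolding a_def by (simp_all add: zero_less_mult_iff)
  thus False by simp
qed

lemma no_balanced:
  assumes X: "balanced X" and d: "deg X \<le> 2"
  shows False
proof -
  define a where "a = X 1"
  have a: "a \<noteq> 0" unfolding a_def by (rule balanced_one[OF X])
  have nX: "nice X" using X unfolding balanced_def by blast
  have cp: "c \<in> poles X" using X c_Omega unfolding balanced_def by simp
  define E where "E = (\<lambda>k. X (\<zeta>^k * cis \<eta>)) ` {..<3::nat}"
  \<comment> \<open>Four candidates for the value on the image circle, of which at most three are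
    values at ends of arcs. A preimage of a remaining one is interior to its arc and so lies in the
    open domain, where distinct points are inequivalent.\<close>
  define S where "S = {1, -1, \<i>, -\<i>}"
  have cE: "card E \<le> 3" unfolding E_def using card_image_le[of "{..<3::nat}" "\<lambda>k. X (\<zeta>^k * cis \<eta>)"] by simp
  have "card S = 4" unfolding S_def by (simp add: complex_eq_iff)
  moreover have "inj_on (\<lambda>x. x * a) S" by (rule inj_onI) (use a in simp)
  ultimately have "card ((\<lambda>x. x * a) ` S) = 4" using card_image by fastforce
  moreover have "finite E" unfolding E_def by simp
  ultimately have "\<not> (\<lambda>x. x * a) ` S \<subseteq> E" using card_mono[of E "(\<lambda>x. x * a) ` S"] cE by linarith
  then obtain x where x: "x \<in> S" "x * a \<notin> E" by blast
  define v where "v = x * a"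
  have v: "v \<notin> E" unfolding v_def by (rule x(2))
  have "norm x = 1" using x(1) unfolding S_def by auto
  hence nv: "norm v = norm (X 1)" unfolding v_def a_def norm_mult by simp
  have "\<exists>t. -\<eta> \<le> t \<and> t \<le> \<eta> \<and> X (\<zeta>^k * cis t) = v" if "k < 3" for k
    using balanced_arc[OF X _ nv, of k] that g_ge by simp
  hence "\<forall>k. \<exists>t. k < 3 \<longrightarrow> -\<eta> \<le> t \<and> t \<le> \<eta> \<and> X (\<zeta>^k * cis t) = v" by blast
  from choice[OF this] obtain t where t: "\<And>k::nat. k < 3 \<Longrightarrow> -\<eta> \<le> t k \<and> t k \<le> \<eta> \<and> X (\<zeta>^k * cis (t k)) = v" by blast
  define p where "p = (\<lambda>k. \<zeta>^k * cis (t k))"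
  have p: "p k \<in> outside 1" "p k \<in> \<Omega>" "norm (p k) = 1" "X (p k) = v" if k: "k < 3" for k
  proof -
    have kg: "k < g" using k g_ge by simp
    have uO: "\<zeta>^k * cis \<eta> \<in> \<Omega>" using coutside_Omega[of 1 "cis \<eta>"] cis_coutside[of \<eta>] eta_pos s1(1) by (intro rot_power_Omega) simp
    have "X (\<zeta>^k * cis (-\<eta>)) = X (\<zeta>^k * cis \<eta>)"
      using nice_act[OF nX lmT_GG[OF kg] uO arc_endpoints(1)[OF kg]] arc_endpoints(2)[OF kg] by simp
    moreover have "X (\<zeta>^k * cis \<eta>) \<noteq> v" using v k unfolding E_def by blast
    ultimately have "t k \<noteq> \<eta>" "t k \<noteq> -\<eta>" using t[OF k] by metis+
    hence "cis (t k) \<in> outside 1" using t[OF k] by (intro cis_outside) auto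
    thus 1: "p k \<in> outside 1" unfolding p_def by (rule rot_power_outside)
    show "p k \<in> \<Omega>" using outside_Omega[of 1 "p k"] 1 s1(1) by simp
    show "norm (p k) = 1" unfolding p_def by (simp add: norm_mult)
    show "X (p k) = v" unfolding p_def using t[OF k] by blast
  qed
  have inj: "p j \<noteq> p k" if "j < k" "k < 3" for j k
    unfolding p_def using arcs_disjoint[OF that, of "t j" "t k"] t[of j] t[of k] that by simp
  define I where "I = (\<lambda>w. inverse (X w - v))"
  have "card (p ` {..<3}) \<le> deg I"
  proof (rule card_le_deg)
    show "INV I" unfolding I_def by (rule INV_inverse[OF nice_INV[OF nX]])
    have "is_pole I (p k)" if k: "k < 3" for k
      unfolding I_def using poles_inverse_iff[OF nX cp p(2)[OF k], of v] p(4)[OF k]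
        balanced_analytic(2)[OF X, of "p k"] p(2,3)[OF k] analytic_at_imp_no_pole by blast
    thus "p ` {..<3} \<subseteq> poles I" using p(2) by blast
    fix z w assume "z \<in> p ` {..<3}" "w \<in> p ` {..<3}" "z \<simeq> w"
    thus "z = w" using reps_unique[of 1 z w] p(1) s1(1) unfolding reps_def by auto
  qed simp
  moreover have "card (p ` {..<3}) = 3"
  proof -
    have "inj_on p {..<3}" using inj by (intro linorder_inj_onI) auto
    thus ?thesis using card_image by fastforce
  qed
  moreover have "deg I = deg X" unfolding I_def by (rule deg_inverse_nice[OF nX cp])
  ultimately show False using d by simp
qed

end

context schottky_curve
begin

section \<open>Exclusion of degree two\<close>

lemma INV_neg_zorder_pole:
  assumes "INV F" "z \<in> \<Omega>" "eventually (\<lambda>w. F w \<noteq> 0) (at z)" "zorder F z < 0"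
  shows "is_pole F z"
  using neg_zorder_imp_is_pole[OF _ _ assms(4)] INV_mer[OF assms(1,2)] meromorphic_at_iff
    eventually_frequently[OF _ assms(3)] by simp

text \<open>Both points are equivalent to infinity: one letter sends \<open>c\<close> to infinity,
  another sends infinity to \<open>\<zeta> * c\<close>.\<close>

lemma c_eqv_rot: "c \<simeq> \<zeta> * c"
proof -
  define M N where "M = lm (0,True)" and "N = lm (1,False)"
  have MN: "M \<in> GG" "N \<in> GG" unfolding M_def N_def using lm_GG g_ge by (simp_all del: lm.simps)
  have d: "den M c = 0" using den_lm_eq_0_iff[of "(0,True)" c] unfolding M_def by simp
  have n: "num M c \<noteq> 0" by (rule num_den_zero[OF GG_su[OF MN(1)] d])
  have N: "fst N = \<zeta> * c * cnj (snd N)" "snd N \<noteq> 0"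
    unfolding N_def using zeta_cnj[of 1] rho_pos by (auto simp: field_simps)
  have 1: "den (pmul N M) c = cnj (snd N) * num M c" "num (pmul N M) c = fst N * num M c"
    unfolding den_pmul' num_pmul' d by simp_all
  hence "den (pmul N M) c \<noteq> 0" "act (pmul N M) c = \<zeta> * c" unfolding act_def using n N by simp_all
  thus ?thesis using eq_act[OF GG_mul[OF MN(2,1)]] by metis
qed

text \<open>Subtracting a suitable multiple of the rotated function cancels the pole at \<open>0\<close>, but not the one at \<open>c\<close>:
  near \<open>c\<close>, which is equivalent to \<open>\<infinity>\<close>, the rotation acts by the inverse angle.\<close>

lemma no_two_pole_orbits:
  assumes F: "nice F" "deg F = 2" "is_pole F 0" "is_pole F c" and P: "\<And>q. q \<in> poles F \<Longrightarrow> q \<simeq> 0 \<or> q \<simeq> c"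
  shows False
proof -
  have IF: "INV F" by (rule nice_INV[OF F(1)])
  have mF: "F meromorphic_on \<Omega>" using IF INV_def by blast
  have neF: "eventually (\<lambda>w. F w \<noteq> 0) (at z)" if "z \<in> \<Omega>" for z using nonconst[OF mF c_Omega F(4) that] .
  have c0: "c \<noteq> 0" using norm_c_gt by auto
  have "(\<Sum>z\<in>{0,c}. nat (- zorder F z)) \<le> deg F"
  proof (rule orders_le[OF IF])
    show "z = w" if "z \<in> {0,c}" "w \<in> {0,c}" "z \<simeq> w" for z w using that c_neq_0 by blast
  qed (use F zero_Omega c_Omega in auto)
  hence "nat (- zorder F 0) + nat (- zorder F c) \<le> 2" using c0 F(2) by simp
  hence z: "zorder F 0 = -1" "zorder F c = -1"
    using pole_zorder[OF IF zero_Omega F(3)] pole_zorder[OF IF c_Omega F(4)] by linarith+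
  obtain a where a: "a \<noteq> 0" "((\<lambda>w. F w * (w - c)) \<longlongrightarrow> a) (at c)"
    using simple_pole_limit[OF INV_mer[OF IF c_Omega] neF[OF c_Omega] z(2)] by blast
  obtain b where b: "((\<lambda>w. F w * (w - 0)) \<longlongrightarrow> b) (at 0)"
    using simple_pole_limit[OF INV_mer[OF IF zero_Omega] neF[OF zero_Omega] z(1)] by blast
  \<comment> \<open>The coefficient is fitted to \<open>0\<close>: where \<open>F w\<close> behaves
    like \<open>b / w\<close>, the rotated function behaves like
    \<open>b / (\<zeta> * w)\<close>.\<close>
  define H where "H = (\<lambda>w. F (\<zeta> * w) - F w / \<zeta>)"
  have H_act: "H (act M w) = H w" "F (\<zeta> * act M w) = F (\<zeta> * w)" if "M \<in> GG" "w \<in> \<Omega>" "den M w \<noteq> 0" for M w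
  proof -
    have "F (act (rotm M) (\<zeta> * w)) = F (\<zeta> * w)"
      by (rule nice_act[OF F(1) rotm_GG[OF that(1)]]) (use that rot_Omega den_rotm in auto)
    thus "F (\<zeta> * act M w) = F (\<zeta> * w)" unfolding act_rotm .
    thus "H (act M w) = H w" unfolding H_def nice_act[OF F(1) that] by simp
  qed
  have IH: "INV H" unfolding INV_def
  proof (intro conjI ballI impI)
    show "H meromorphic_on \<Omega>"
    proof -
      have "(\<lambda>w. F (\<zeta> * w)) meromorphic_on \<Omega>"
        by (rule meromorphic_on_compose[OF mF]) (use rot_Omega in \<open>auto intro!: analytic_intros\<close>)
      thus ?thesis unfolding H_def by (intro meromorphic_intros mF)
    qed
    fix M z assume "M \<in> GG" "z \<in> \<Omega>" "den M z \<noteq> 0"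
    thus "\<forall>\<^sub>F w in at z. H (act M w) = H w"
      by (intro eventually_mono[OF eventually_conj[OF eventually_Omega[of z] eventually_den[of M z]]] H_act(1)) simp_all
  qed
  \<comment> \<open>The residue of \<open>H\<close> at \<open>c\<close>. There the rotated function
    contributes \<open>a * \<zeta>\<close> in place of \<open>a / \<zeta>\<close>, and the
    difference is nonzero because \<open>g\<close> does not divide \<open>2\<close>.\<close>
  define L where "L = a / (1 / \<zeta>) - a / \<zeta>"
  have L: "L \<noteq> 0"
  proof
    assume "L = 0"
    hence "a * (\<zeta> * \<zeta> - 1) = 0" unfolding L_def by (simp add: field_simps)
    hence "\<zeta>^2 = 1" using a(1) by (simp add: power2_eq_square)
    hence "g dvd 2" using zeta_power_eq_1_iff by blast
    thus False using g_ge dvd_imp_le[of g 2] by simp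
  qed
  define y where "y = (\<lambda>u. c + (u - c) * \<kappa> u)"
  have yc: "filterlim y (at c) (at c)"
  proof (rule filterlim_atI)
    have "((\<lambda>u. c + (u - c) * \<kappa> u) \<longlongrightarrow> c + (c - c) * (1 / \<zeta>)) (at c)" by (intro tendsto_intros kappa_tendsto)
    thus "(y \<longlongrightarrow> c) (at c)" unfolding y_def by simp
    show "eventually (\<lambda>u. y u \<noteq> c) (at c)" using rotation_near_c eventually_neq_at_within[of c c UNIV]
      by eventually_elim (auto simp: y_def)
  qed
  have "eventually (\<lambda>u. F (y u) * (y u - c) / \<kappa> u - F u * (u - c) / \<zeta> = H u * (u - c)) (at c)"
    using rotation_near_c
  proof eventually_elim
    case (elim u)
    define M where "M = lm (0,True)"
    define N where "N = lm (0,False)"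
    have MN: "M \<in> GG" "N \<in> GG" unfolding M_def N_def using lm_GG g_pos by (simp_all del: lm.simps)
    have e: "u \<in> \<Omega>" "den M u \<noteq> 0" "den N (\<zeta> * act M u) \<noteq> 0" "act N (\<zeta> * act M u) = y u" "den M u * den N (\<zeta> * act M u) * \<kappa> u = 1"
      using elim unfolding M_def N_def y_def by blast+
    have "\<zeta> * act M u \<in> \<Omega>" using Omega_act[OF e(1) MN(1) e(2)] rot_Omega by blast
    hence "F (y u) = F (\<zeta> * act M u)" using nice_act[OF F(1) MN(2) _ e(3)] e(4) by simp
    hence "F (y u) = F (\<zeta> * u)" using H_act(2)[OF MN(1) e(1,2)] by simp
    moreover have "\<kappa> u \<noteq> 0" using e(5) by auto
    moreover have "y u - c = (u - c) * \<kappa> u" unfolding y_def by simp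
    moreover have "A * (d * k) / k = A * d" if "k \<noteq> 0" for A d k :: complex using that by simp
    ultimately have "F (y u) * (y u - c) / \<kappa> u = F (\<zeta> * u) * (u - c)" by (simp only:)
    moreover have "(A - B / \<zeta>) * d = A * d - B * d / \<zeta>" for A B d by (simp add: left_diff_distrib)
    ultimately show ?case unfolding H_def by (simp only:)
  qed
  moreover have "((\<lambda>u. F (y u) * (y u - c) / \<kappa> u - F u * (u - c) / \<zeta>) \<longlongrightarrow> a / (1/\<zeta>) - a / \<zeta>) (at c)"
    by (intro tendsto_intros kappa_tendsto a(2) filterlim_compose[OF a(2) yc]) auto
  ultimately have Hc: "((\<lambda>u. H u * (u - c)) \<longlongrightarrow> L) (at c)" unfolding L_def by (rule Lim_transform_eventually[rotated])
  have pole_v: "zorder (\<lambda>w. H w - v) c = -1" "is_pole (\<lambda>w. H w - v) c" for v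
  proof -
    have I: "INV (\<lambda>w. H w - v)" by (rule INV_diff_const[OF IH])
    have "((\<lambda>u. H u * (u - c) - v * (u - c)) \<longlongrightarrow> L - v * (c - c)) (at c)" by (intro tendsto_intros Hc)
    hence "((\<lambda>u. (H u - v) * (u - c) ^ 1) \<longlongrightarrow> L) (at c)" by (simp add: left_diff_distrib)
    note l = zorder_limit_power[OF INV_mer[OF I c_Omega] this L]
    show "zorder (\<lambda>w. H w - v) c = -1" using l(1) by simp
    thus "is_pole (\<lambda>w. H w - v) c" using INV_neg_zorder_pole[OF I c_Omega l(2)] by simp
  qed
  have Hpc: "is_pole H c" using pole_v(2)[of 0] by simp
  have neH: "eventually (\<lambda>w. H w \<noteq> 0) (at 0)"
    using nonconst[OF _ c_Omega Hpc zero_Omega] IH unfolding INV_def by blast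
  have z0: "filterlim (\<lambda>w. \<zeta> * w) (at 0) (at 0)"
  proof (rule filterlim_atI)
    have "((\<lambda>w. \<zeta> * w) \<longlongrightarrow> \<zeta> * 0) (at 0)" by (intro tendsto_intros)
    thus "((\<lambda>w. \<zeta> * w) \<longlongrightarrow> 0) (at 0)" by simp
    show "eventually (\<lambda>w. \<zeta> * w \<noteq> 0) (at 0)" using eventually_neq_at_within[of 0 0 UNIV] by eventually_elim simp
  qed
  have "((\<lambda>w. F (\<zeta> * w) * (\<zeta> * w - 0) / \<zeta> - F w * (w - 0) / \<zeta>) \<longlongrightarrow> b / \<zeta> - b / \<zeta>) (at 0)"
    by (intro tendsto_intros b filterlim_compose[OF b z0]) auto
  moreover have "(\<lambda>w. F (\<zeta> * w) * (\<zeta> * w - 0) / \<zeta> - F w * (w - 0) / \<zeta>) = (\<lambda>w. H w * (w - 0))"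
    by (rule ext) (simp add: H_def field_simps)
  ultimately have "((\<lambda>w. H w * (w - 0)) \<longlongrightarrow> 0) (at 0)" by simp
  hence "zorder H 0 \<ge> 0" using zorder_nonneg_limit[OF INV_mer[OF IH zero_Omega] neH] by blast
  hence np0: "\<not> is_pole H 0" using pole_zorder[OF IH zero_Omega] by force
  then obtain v where v: "(H \<longlongrightarrow> v) (at 0)"
    using INV_mer[OF IH zero_Omega] meromorphic_at_iff unfolding not_essential_def by blast
  define J where "J = (\<lambda>w. H w - v)"
  have IJ: "INV J" unfolding J_def by (rule INV_diff_const[OF IH])
  define X where "X = remove_sings J"
  have X: "nice X" "INV X" unfolding X_def using nice_remove_sings[OF IJ] nice_INV by blast+
  have pX: "is_pole X p \<longleftrightarrow> is_pole H p" if "p \<in> \<Omega>" for p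
    using pole_rs(1)[OF IJ that] is_pole_plus_const_iff[of H p "-v"] by (simp add: X_def J_def)
  have poles: "is_pole X p \<longleftrightarrow> p \<simeq> c" if p: "p \<in> \<Omega>" for p
  proof
    assume "p \<simeq> c"
    thus "is_pole X p" using INV_pole_eq[OF X(2) p] pX[OF c_Omega] Hpc by blast
  next
    assume "is_pole X p"
    hence pH: "is_pole H p" using pX[OF p] by blast
    show "p \<simeq> c"
    proof (rule ccontr)
      assume npc: "\<not> p \<simeq> c"
      have np: "\<not> p \<simeq> 0" using INV_pole_eq[OF IH p] np0 pH by blast
      have zp: "\<zeta> * p \<in> \<Omega>" using p rot_Omega by blast
      have "\<not> \<zeta> * p \<simeq> 0" using eq_rot[of p 0] np by simp
      moreover have "\<not> \<zeta> * p \<simeq> c" using eq_rot[of p c] npc c_eqv_rot eq_trans by blast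
      ultimately have "\<not> is_pole F (\<zeta> * p)" using P[of "\<zeta> * p"] zp by blast
      hence "F analytic_on (\<lambda>w. \<zeta> * w) ` {p}" using nice_analytic[OF F(1) zp] by simp
      hence "(F \<circ> (\<lambda>w. \<zeta> * w)) analytic_on {p}" by (intro analytic_on_compose analytic_intros)
      moreover have "F analytic_on {p}" using nice_analytic[OF F(1) p] P[of p] np npc p by blast
      ultimately have "H analytic_on {p}" unfolding H_def o_def by (intro analytic_intros) auto
      thus False using pH analytic_at_imp_no_pole by blast
    qed
  qed
  have X0: "X 0 = 0"
    unfolding X_def
  proof (rule remove_sings_eqI)
    show "(J \<longlongrightarrow> 0) (at 0)" unfolding J_def using v by (simp add: Lim_null[symmetric])
  qed
  have np0X: "\<not> is_pole X 0" using pX[OF zero_Omega] np0 by blast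
  have cX: "c \<in> poles X" using poles[OF c_Omega] c_Omega by simp
  have "deg X = nat (- zorder X c)" by (rule deg_single[OF X(2) cX]) (use poles eq_sym in blast)
  hence d: "deg X = 1" using pole_rs(2)[OF IJ c_Omega] pole_v(1)[of v] unfolding X_def J_def by simp
  define I where "I = (\<lambda>w. inverse (X w - 0))"
  have II: "INV I" unfolding I_def by (rule INV_inverse[OF X(2)])
  have pI: "is_pole I p \<longleftrightarrow> \<not> is_pole X p \<and> X p = 0" if "p \<in> \<Omega>" for p
    unfolding I_def by (rule poles_inverse_iff[OF X(1) cX that])
  have dI: "deg I = 1" unfolding I_def d[symmetric] by (rule deg_inverse_nice[OF X(1) cX])
  have zeros: "\<not> is_pole X p \<and> X p = 0 \<longleftrightarrow> p \<simeq> 0" if p: "p \<in> \<Omega>" for p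
  proof
    assume "p \<simeq> 0"
    thus "\<not> is_pole X p \<and> X p = 0" using INV_pole_eq[OF X(2) p, of 0] nice_eq[OF X(1) p, of 0] X0 np0X by simp
  next
    assume zp: "\<not> is_pole X p \<and> X p = 0"
    show "p \<simeq> 0"
    proof (rule ccontr)
      assume np: "\<not> p \<simeq> 0"
      have "card {p,0} \<le> deg I"
      proof (rule card_le_deg[OF II])
        show "{p,0} \<subseteq> poles I" using pI[OF p] pI[OF zero_Omega] zp X0 np0X p zero_Omega by blast
        show "z = w" if "z \<in> {p,0}" "w \<in> {p,0}" "z \<simeq> w" for z w using that np eq_sym by blast
      qed simp
      moreover have "p \<noteq> 0" using np by auto
      ultimately show False using dI by simp
    qed
  qed
  have "balanced X" unfolding balanced_def using X(1) poles zeros by blast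
  from no_balanced[OF this] show False using d by simp
qed

text \<open>For \<open>X = 1 / (F - F c)\<close> infinity becomes a pole and the orbit of
  \<open>0\<close> becomes the set of zeros. \<open>deg2_poles\<close> confines the poles of
  \<open>X\<close> to these two orbits, so \<open>X\<close> is balanced.\<close>

lemma no_single_pole_orbit:
  assumes F: "nice F" "deg F = 2" "is_pole F 0" "\<not> is_pole F c" and P: "\<And>q. q \<in> poles F \<Longrightarrow> q \<simeq> 0"
  shows False
proof -
  have IF: "INV F" by (rule nice_INV[OF F(1)])
  have p0: "0 \<in> poles F" using F(3) zero_Omega by blast
  define v where "v = F c"
  define J where "J = (\<lambda>w. inverse (F w - v))"
  have IJ: "INV J" unfolding J_def by (rule INV_inverse[OF IF])
  define X where "X = remove_sings J"
  have X: "nice X" "INV X" unfolding X_def using nice_remove_sings[OF IJ] nice_INV by blast+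
  have pX: "is_pole X p \<longleftrightarrow> \<not> is_pole F p \<and> F p = v" if "p \<in> \<Omega>" for p
    unfolding X_def using pole_rs(1)[OF IJ that] poles_inverse_iff[OF F(1) p0 that, of v] unfolding J_def by blast
  have "deg J = 2" unfolding J_def using deg_inverse_nice[OF F(1) p0] F(2) by simp
  hence dX: "deg X = 2" unfolding X_def using deg_rs[OF IJ] by simp
  have cX: "is_pole X c" using pX[OF c_Omega] F(4) v_def by blast
  have poles: "is_pole X p \<longleftrightarrow> p \<simeq> c" if p: "p \<in> \<Omega>" for p
  proof
    assume "p \<simeq> c" thus "is_pole X p" using INV_pole_eq[OF X(2) p] cX by blast
  next
    assume q: "is_pole X p"
    have "\<not> p \<simeq> 0" using INV_pole_eq[OF IF p, of 0] F(3) pX[OF p] q by blast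
    thus "p \<simeq> c" using deg2_poles[OF X(2) dX _ cX p q] by blast
  qed
  have zeros: "\<not> is_pole X p \<and> X p = 0 \<longleftrightarrow> p \<simeq> 0" if p: "p \<in> \<Omega>" for p
  proof
    assume "p \<simeq> 0"
    hence pF: "is_pole F p" using INV_pole_eq[OF IF p] F(3) by blast
    hence "is_pole (\<lambda>w. F w - v) p" using is_pole_plus_const_iff[of F p "-v"] by simp
    hence "(J \<longlongrightarrow> 0) (at p)" unfolding J_def is_pole_def by (rule filterlim_compose[OF tendsto_inverse_0])
    hence "X p = 0" unfolding X_def by (rule remove_sings_eqI)
    thus "\<not> is_pole X p \<and> X p = 0" using pX[OF p] pF by blast
  next
    assume zp: "\<not> is_pole X p \<and> X p = 0"
    have "is_pole F p"
    proof (rule ccontr)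
      assume np: "\<not> is_pole F p"
      hence nv: "F p - v \<noteq> 0" using pX[OF p] zp by auto
      have "F analytic_on {p}" by (rule nice_analytic[OF F(1) p np])
      hence "J analytic_on {p}" unfolding J_def using nv by (intro analytic_intros) auto
      hence "X p = J p" unfolding X_def by (rule remove_sings_at_analytic)
      thus False using zp nv unfolding J_def by simp
    qed
    thus "p \<simeq> 0" using P[of p] p by blast
  qed
  have "balanced X" unfolding balanced_def using X(1) poles zeros by blast
  from no_balanced[OF this] show False using dX by simp
qed

text \<open>If \<open>0\<close> is not a pole, \<open>1 / (F - F 0)\<close> has a pole there and the
  same degree. \<open>deg2_poles\<close> then leaves only the two configurations already
  excluded.\<close>

lemma degree_neq_2:
  assumes F: "INV F" shows "deg F \<noteq> 2"
proof
  assume d: "deg F = 2"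
  define H where "H = remove_sings F"
  have H: "nice H" "deg H = 2" unfolding H_def using nice_remove_sings[OF F] deg_rs[OF F] d by auto
  have IH: "INV H" by (rule nice_INV[OF H(1)])
  obtain p where p: "p \<in> poles H" using no_poles_deg[OF IH] H(2) by force
  have "\<exists>F1. nice F1 \<and> deg F1 = 2 \<and> is_pole F1 0"
  proof (cases "is_pole H 0")
    case True thus ?thesis using H by blast
  next
    case False
    define J where "J = (\<lambda>w. inverse (H w - H 0))"
    have IJ: "INV J" unfolding J_def by (rule INV_inverse[OF IH])
    have "is_pole J 0" unfolding J_def using poles_inverse_iff[OF H(1) p zero_Omega] False by blast
    hence "is_pole (remove_sings J) 0" using pole_rs(1)[OF IJ zero_Omega] by blast
    moreover have "deg J = 2" unfolding J_def using deg_inverse_nice[OF H(1) p] H(2) by simp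
    hence "deg (remove_sings J) = 2" using deg_rs[OF IJ] by simp
    ultimately show ?thesis using nice_remove_sings[OF IJ] by blast
  qed
  then obtain F1 where F1: "nice F1" "deg F1 = 2" "is_pole F1 0" by blast
  have P: "q \<simeq> 0 \<or> q \<simeq> c" if "q \<in> poles F1" for q
    using deg2_poles[OF nice_INV[OF F1(1)] F1(2) _ F1(3), of q] that by blast
  show False
  proof (cases "is_pole F1 c")
    case True show ?thesis by (rule no_two_pole_orbits[OF F1 True P])
  next
    case False
    have "q \<simeq> 0" if q: "q \<in> poles F1" for q
      using P[OF q] INV_pole_eq[OF nice_INV[OF F1(1)], of q c] q False by blast
    thus ?thesis by (rule no_single_pole_orbit[OF F1 False])
  qed
qed


section \<open>The canonical map\<close>

text \<open>Near \<open>p\<close> itself only the identity can produce an equivalence, by freeness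
  of the action; other points of the orbit are reached by transport along the group.\<close>

lemma eventually_not_eqv:
  assumes "p \<in> \<Omega>" "z \<in> \<Omega>" shows "eventually (\<lambda>w. \<not> p \<simeq> w) (at z)"
proof -
  have at_p: "eventually (\<lambda>w. \<not> p \<simeq> w) (at p)"
  proof -
    have "eventually (\<lambda>x. x \<in> \<Omega> \<and> (\<forall>M\<in>GG'. D M p x \<noteq> 0)) (nhds p)"
      by (rule D_near(2)[OF _ assms(1,1)]) (use D_self[OF assms(1)] in auto)
    hence "eventually (\<lambda>x. x \<in> \<Omega> \<and> (\<forall>M\<in>GG'. D M p x \<noteq> 0)) (at p)" by (simp add: eventually_at_filter eventually_mono)
    moreover have "eventually (\<lambda>x. x \<noteq> p) (at p)" by (rule eventually_neq_at_within)
    ultimately show ?thesis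
    proof eventually_elim
      case (elim x)
      have "D M p x \<noteq> 0" if M: "M \<in> GG" for M
      proof (cases "M = (1,0)")
        case True thus ?thesis using elim(2) by (simp add: D.simps)
      next
        case False thus ?thesis using elim(1) M by blast
      qed
      thus ?case unfolding eq_iff_D by blast
    qed
  qed
  show ?thesis
  proof (cases "p \<simeq> z")
    case False
    have "eventually (\<lambda>x. x \<in> \<Omega> \<and> \<not> p \<simeq> x) (nhds z)" by (rule open_neq(2)[OF assms False])
    thus ?thesis by (simp add: eventually_at_filter eventually_mono)
  next
    case True
    then obtain N where N: "N \<in> GG" "den N z \<noteq> 0" "act N z = p" using eq_sym unfolding eqv_def by blast
    have "eventually (\<lambda>w. \<not> p \<simeq> w) (filtermap (act N) (at z))"
      unfolding filtermap_act[OF GG_su[OF N(1)] N(2)] N(3) by (rule at_p)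
    hence "eventually (\<lambda>w. \<not> p \<simeq> act N w) (at z)" unfolding eventually_filtermap .
    thus ?thesis using eventually_den[OF N(2)]
    proof eventually_elim
      case (elim w)
      thus ?case using neq_act[OF GG_inv[OF N(1)], of "act N w"] den_pinv_act[OF GG_su[OF N(1)], of w]
        act_pinv_act[OF GG_su[OF N(1)], of w] by simp
    qed
  qed
qed

text \<open>Abelian integrals with additive periods \<open>\<alpha>\<close> whose poles lie in the
  orbit of \<open>p\<close>. Meromorphy is demanded at \<open>p\<close> alone; the period relation
  carries it to the rest of the orbit.\<close>

definition quasi :: "complex \<Rightarrow> (complex \<Rightarrow> complex) \<Rightarrow> (su \<Rightarrow> complex) \<Rightarrow> bool" where
  "quasi p f \<alpha> \<longleftrightarrow> (\<forall>z\<in>\<Omega>. \<not> p \<simeq> z \<longrightarrow> f analytic_on {z}) \<and> f meromorphic_on {p} \<and>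
    (\<forall>N\<in>GG. \<forall>z\<in>\<Omega>. den N z \<noteq> 0 \<longrightarrow> \<not> p \<simeq> z \<longrightarrow> f (act N z) = f z + \<alpha> N)"

lemma quasi_meromorphic:
  assumes f: "quasi p f \<alpha>" and p: "p \<in> \<Omega>" shows "f meromorphic_on \<Omega>"
proof (rule meromorphic_Omega)
  fix z assume z: "z \<in> \<Omega>"
  show "f meromorphic_on {z}"
  proof (cases "p \<simeq> z")
    case False thus ?thesis using f z unfolding quasi_def by (intro analytic_on_imp_meromorphic_on) blast
  next
    case True
    then obtain N where N: "N \<in> GG" "den N z \<noteq> 0" "act N z = p" using eq_sym unfolding eqv_def by blast
    have fp: "f meromorphic_on {p}" using f unfolding quasi_def by blast
    have "(\<lambda>w. f (act N w)) meromorphic_on {z}"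
      by (rule meromorphic_on_compose[OF fp act_analytic[OF GG_su[OF N(1)] N(2)]]) (use N(3) in simp)
    hence "(\<lambda>w. f (act N w) - \<alpha> N) meromorphic_on {z}" by (intro meromorphic_intros)
    moreover have "eventually (\<lambda>w. f (act N w) - \<alpha> N = f w) (at z)"
      using eventually_Omega[OF z] eventually_den[OF N(2)] eventually_not_eqv[OF p z]
    proof eventually_elim
      case (elim w)
      have "f (act N w) = f w + \<alpha> N" using f N(1) elim unfolding quasi_def by blast
      thus ?case by simp
    qed
    hence "(\<lambda>w. f (act N w) - \<alpha> N) meromorphic_on {z} \<longleftrightarrow> f meromorphic_on {z}"
      by (intro meromorphic_on_cong) auto
    ultimately show ?thesis by blast
  qed
qed

lemma quasi_INV:
  assumes f: "quasi p f \<alpha>" and h: "quasi q h \<beta>" and pq: "p \<in> \<Omega>" "q \<in> \<Omega>" and e: "\<And>N. N \<in> GG \<Longrightarrow> \<alpha> N = t * \<beta> N"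
  shows "INV (\<lambda>w. f w - t * h w)"
  unfolding INV_def
proof (intro conjI ballI impI)
  show "(\<lambda>w. f w - t * h w) meromorphic_on \<Omega>"
    by (intro meromorphic_intros quasi_meromorphic[OF f pq(1)] quasi_meromorphic[OF h pq(2)])
  fix M z assume M: "M \<in> GG" "z \<in> \<Omega>" "den M z \<noteq> 0"
  show "\<forall>\<^sub>F w in at z. f (act M w) - t * h (act M w) = f w - t * h w"
    using eventually_Omega[OF M(2)] eventually_den[OF M(3)] eventually_not_eqv[OF pq(1) M(2)] eventually_not_eqv[OF pq(2) M(2)]
  proof eventually_elim
    case (elim w)
    have "f (act M w) = f w + \<alpha> M" "h (act M w) = h w + \<beta> M" using f h M(1) elim unfolding quasi_def by blast+
    thus ?case unfolding e[OF M(1)] by (simp add: algebra_simps)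
  qed
qed

lemma quasi_poles:
  assumes f: "quasi p f \<alpha>" and h: "quasi q h \<beta>" and z: "z \<in> \<Omega>" "is_pole (\<lambda>w. f w - t * h w) z"
  shows "p \<simeq> z \<or> q \<simeq> z"
proof (rule ccontr)
  assume "\<not> ?thesis"
  hence "f analytic_on {z}" "h analytic_on {z}" using f h z(1) unfolding quasi_def by blast+
  hence "(\<lambda>w. f w - t * h w) analytic_on {z}" by (intro analytic_intros)
  thus False using z(2) analytic_at_imp_no_pole by blast
qed

text \<open>Lets \<open>quasi_INV\<close> also treat a single integral whose periods vanish.\<close>

lemma quasi_zero: "quasi p (\<lambda>_. 0) (\<lambda>_. 0)"
  unfolding quasi_def by auto

lemma ev_Omega_p: "p \<in> \<Omega> \<Longrightarrow> eventually (\<lambda>z. z \<in> \<Omega> \<and> \<not> p \<simeq> z) (at p)"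
  using eventually_conj[OF eventually_Omega eventually_not_eqv] by blast

lemma quasi_K:
  assumes p: "p \<in> \<Omega>" "w \<in> \<Omega>" "\<not> p \<simeq> w"
  shows "quasi p (\<lambda>z. K p z w) (\<lambda>N. psi N p)" "((\<lambda>z. K p z w * (z - p)) \<longlongrightarrow> 1) (at p)"
proof -
  define R where "R = (\<lambda>z. KS GG' p z w)"
  have R: "R analytic_on {p}" unfolding R_def by (rule KS'_analytic[OF p])
  have split: "eventually (\<lambda>z. 1/(z - p) - 1/(w - p) + R z = K p z w) (at p)"
    using ev_Omega_p[OF p(1)] by eventually_elim (use K_split[OF p(1) _ p(2) _ p(3)] in \<open>simp add: R_def\<close>)
  have "(\<lambda>z. 1/(z - p) - 1/(w - p) + R z) meromorphic_on {p}"
    using R by (intro meromorphic_intros analytic_on_imp_meromorphic_on)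
  moreover have "(\<lambda>z. 1/(z - p) - 1/(w - p) + R z) meromorphic_on {p} \<longleftrightarrow> (\<lambda>z. K p z w) meromorphic_on {p}"
    by (intro meromorphic_on_cong) (use split in auto)
  ultimately show "quasi p (\<lambda>z. K p z w) (\<lambda>N. psi N p)"
    unfolding quasi_def using K_z[OF p(1) _ p(2) _ p(3)] K_quasi[OF _ p(1) _ p(2) _ _ p(3)] by blast
  have "(R \<longlongrightarrow> R p) (at p)" using analytic_at_imp_isCont[OF R] by (simp add: isCont_def)
  hence "((\<lambda>z. 1 + (R z - 1/(w - p)) * (z - p)) \<longlongrightarrow> 1 + (R p - 1/(w - p)) * (p - p)) (at p)" by (intro tendsto_intros)
  hence "((\<lambda>z. 1 + (R z - 1/(w - p)) * (z - p)) \<longlongrightarrow> 1) (at p)" by simp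
  moreover have "eventually (\<lambda>z. 1 + (R z - 1/(w - p)) * (z - p) = K p z w * (z - p)) (at p)"
    using split eventually_neq_at_within[of p p UNIV]
  proof eventually_elim
    case (elim z)
    have "(1/(z - p) - b + r) * (z - p) = 1 + (r - b) * (z - p)" for b r using elim(2) by (simp add: field_simps)
    thus ?case unfolding elim(1)[symmetric] by metis
  qed
  ultimately show "((\<lambda>z. K p z w * (z - p)) \<longlongrightarrow> 1) (at p)" by (rule Lim_transform_eventually)
qed

lemma quasi_dK:
  assumes p: "p \<in> \<Omega>" "w \<in> \<Omega>" "\<not> p \<simeq> w"
  shows "quasi p (\<lambda>z. dK p z w) (\<lambda>N. deriv (psi N) p)" "((\<lambda>z. dK p z w * (z - p)^2) \<longlongrightarrow> 1) (at p)"
proof -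
  define R where "R = (\<lambda>z. deriv (\<lambda>q. KS GG' q z w) p)"
  have R: "R analytic_on {p}" unfolding R_def by (rule dKS'_analytic[OF p])
  have split: "eventually (\<lambda>z. 1/(z - p)\<^sup>2 - 1/(w - p)\<^sup>2 + R z = dK p z w) (at p)"
    using ev_Omega_p[OF p(1)] by eventually_elim (use dK_split[OF p(1) _ p(2) _ p(3)] in \<open>simp add: R_def\<close>)
  have "(\<lambda>z. 1/(z - p)\<^sup>2 - 1/(w - p)\<^sup>2 + R z) meromorphic_on {p}"
    using R by (intro meromorphic_intros analytic_on_imp_meromorphic_on)
  moreover have "(\<lambda>z. 1/(z - p)\<^sup>2 - 1/(w - p)\<^sup>2 + R z) meromorphic_on {p} \<longleftrightarrow> (\<lambda>z. dK p z w) meromorphic_on {p}"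
    by (intro meromorphic_on_cong) (use split in auto)
  ultimately show "quasi p (\<lambda>z. dK p z w) (\<lambda>N. deriv (psi N) p)"
    unfolding quasi_def using dK_analytic[OF p(1) _ p(2) _ p(3)] dK_quasi[OF _ p(1) _ p(2) _ _ p(3)] by blast
  have "(R \<longlongrightarrow> R p) (at p)" using analytic_at_imp_isCont[OF R] by (simp add: isCont_def)
  hence "((\<lambda>z. 1 + (R z - 1/(w - p)\<^sup>2) * (z - p)\<^sup>2) \<longlongrightarrow> 1 + (R p - 1/(w - p)\<^sup>2) * (p - p)\<^sup>2) (at p)" by (intro tendsto_intros)
  hence "((\<lambda>z. 1 + (R z - 1/(w - p)\<^sup>2) * (z - p)\<^sup>2) \<longlongrightarrow> 1) (at p)" by simp
  moreover have "eventually (\<lambda>z. 1 + (R z - 1/(w - p)\<^sup>2) * (z - p)\<^sup>2 = dK p z w * (z - p)\<^sup>2) (at p)"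
    using split eventually_neq_at_within[of p p UNIV]
  proof eventually_elim
    case (elim z)
    have "(1/(z - p)\<^sup>2 - b + r) * (z - p)\<^sup>2 = 1 + (r - b) * (z - p)\<^sup>2" for b r using elim(2) by (simp add: field_simps)
    thus ?case unfolding elim(1)[symmetric] by metis
  qed
  ultimately show "((\<lambda>z. dK p z w * (z - p)^2) \<longlongrightarrow> 1) (at p)" by (rule Lim_transform_eventually)
qed

text \<open>\<open>0\<close>, \<open>1\<close> and \<open>cis (pi / g)\<close> are pairwise
  inequivalent, so two orbits cannot contain all three.\<close>

lemma ex_base2:
  assumes "p \<in> \<Omega>" "q \<in> \<Omega>" shows "\<exists>w\<in>\<Omega>. \<not> p \<simeq> w \<and> \<not> q \<simeq> w"
proof (rule ccontr)
  assume c: "\<not> ?thesis"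
  define a b d where "a = (0::complex)" and "b = (1::complex)" and "d = cis (pi / g)"
  have out: "a \<in> reps 1" "b \<in> reps 1" "d \<in> reps 1"
    unfolding a_def b_def d_def reps_def using zero_outside[of 1] s1(1) cis_outside[of 0] cis_outside[of "pi/g"] eta_pos by auto
  have O: "a \<in> \<Omega>" "b \<in> \<Omega>" "d \<in> \<Omega>"
    unfolding a_def b_def d_def using zero_Omega one_Omega outside_Omega[of 1 "cis (pi/g)"] cis_outside[of "pi/g"] s1(1) by auto
  have "0 < pi / g" "pi / g < pi" using g_ge by (auto simp: field_simps)
  hence "sin (pi / g) > 0" by (rule sin_gt_zero)
  hence bd: "b \<noteq> d" unfolding b_def d_def by (auto simp: complex_eq_iff)
  have ab: "a \<noteq> b" "a \<noteq> d" unfolding a_def b_def d_def by auto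
  have ne: "\<not> a \<simeq> b" "\<not> a \<simeq> d" "\<not> b \<simeq> d" using reps_unique[of 1] s1(1) out ab bd by (metis less_imp_le order_refl)+
  have "p \<simeq> a \<or> q \<simeq> a" "p \<simeq> b \<or> q \<simeq> b" "p \<simeq> d \<or> q \<simeq> d" using c O by blast+
  thus False using ne eq_sym eq_trans by metis
qed

text \<open>\<open>t \<noteq> 0\<close> gives \<open>F\<close> a simple pole at \<open>q\<close>
  besides the one at \<open>p\<close>, so that the degree is exactly two.\<close>

lemma psi_relation_distinct:
  assumes pq: "p \<in> \<Omega>" "q \<in> \<Omega>" "\<not> p \<simeq> q" and t: "t \<noteq> 0" and e: "\<And>N. N \<in> GG \<Longrightarrow> psi N p = t * psi N q"
  shows False
proof -
  obtain w where w: "w \<in> \<Omega>" "\<not> p \<simeq> w" "\<not> q \<simeq> w" using ex_base2[OF pq(1,2)] by blast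
  note Kp = quasi_K[OF pq(1) w(1,2)] and Kq = quasi_K[OF pq(2) w(1,3)]
  define F where "F = (\<lambda>z. K p z w - t * K q z w)"
  have I: "INV F" unfolding F_def by (rule quasi_INV[OF Kp(1) Kq(1) pq(1,2) e])
  have qp: "\<not> q \<simeq> p" using pq(3) eq_sym by blast
  have lim0: "(h \<longlongrightarrow> h z) (at z)" if "h analytic_on {z}" for h :: "complex \<Rightarrow> complex" and z
    using analytic_at_imp_isCont[OF that] by (simp add: isCont_def)
  have "((\<lambda>z. K p z w * (z - p) - t * K q z w * (z - p)) \<longlongrightarrow> 1 - t * K q p w * (p - p)) (at p)"
    by (intro tendsto_intros Kp(2) lim0[OF K_z[OF pq(2,1) w(1) qp w(3)]])
  hence "((\<lambda>z. F z * (z - p) ^ 1) \<longlongrightarrow> 1) (at p)" unfolding F_def by (simp add: left_diff_distrib)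
  note lp = zorder_limit_power[OF INV_mer[OF I pq(1)] this one_neq_zero]
  have "((\<lambda>z. K p z w * (z - q) - t * (K q z w * (z - q))) \<longlongrightarrow> K p q w * (q - q) - t * 1) (at q)"
    by (intro tendsto_intros Kq(2) lim0[OF K_z[OF pq(1,2) w(1) pq(3) w(2)]])
  hence "((\<lambda>z. F z * (z - q) ^ 1) \<longlongrightarrow> - t) (at q)" unfolding F_def by (simp add: left_diff_distrib mult.assoc)
  note lq = zorder_limit_power[OF INV_mer[OF I pq(2)] this]
  have nt: "- t \<noteq> 0" using t by simp
  have pp: "p \<in> poles F" "q \<in> poles F"
    using INV_neg_zorder_pole[OF I pq(1) lp(2)] lp(1) INV_neg_zorder_pole[OF I pq(2) lq(2)[OF nt]] lq(1)[OF nt] pq by auto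
  have ne: "p \<noteq> q" using pq(3) by auto
  have "deg F = (\<Sum>r\<in>{p,q}. nat (- zorder F r))"
  proof (rule merom_degree_transversal[OF I])
    show "r = r'" if "r \<in> {p,q}" "r' \<in> {p,q}" "r \<simeq> r'" for r r' using that pq(3) qp by blast
    show "\<exists>r\<in>{p,q}. r \<simeq> z" if "z \<in> poles F" for z
      using quasi_poles[OF Kp(1) Kq(1), of z t] that unfolding F_def by blast
  qed (use pp in auto)
  also have "\<dots> = 2" using ne lp(1) lq(1)[OF nt] by simp
  finally show False using degree_neq_2[OF I] by blast
qed

lemma double_pole_False:
  assumes I: "INV F" and p: "p \<in> \<Omega>" and L: "((\<lambda>z. F z * (z - p)^2) \<longlongrightarrow> 1) (at p)"
    and P: "\<And>z. z \<in> poles F \<Longrightarrow> p \<simeq> z"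
  shows False
proof -
  note l = zorder_limit_power[OF INV_mer[OF I p] L one_neq_zero]
  have "p \<in> poles F" using INV_neg_zorder_pole[OF I p l(2)] l(1) p by simp
  from deg_single[OF I this P] show False using l(1) degree_neq_2[OF I] by simp
qed

text \<open>The kernel itself would be invariant with one simple pole; squaring it raises this to
  the excluded degree.\<close>

lemma psi_all_zero:
  assumes p: "p \<in> \<Omega>" and e: "\<And>N. N \<in> GG \<Longrightarrow> psi N p = 0"
  shows False
proof -
  obtain w where w: "w \<in> \<Omega>" "\<not> p \<simeq> w" using ex_base2[OF p p] by blast
  note Kp = quasi_K[OF p w]
  have "INV (\<lambda>z. K p z w - 0 * 0)" by (rule quasi_INV[OF Kp(1) quasi_zero p p]) (use e in simp)
  hence I0: "INV (\<lambda>z. K p z w)" by simp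
  have I: "INV (\<lambda>z. (K p z w)\<^sup>2)" unfolding INV_def
  proof (intro conjI ballI impI)
    show "(\<lambda>z. (K p z w)\<^sup>2) meromorphic_on \<Omega>" using I0 unfolding INV_def by (intro meromorphic_intros) blast
    fix M z assume "M \<in> GG" "z \<in> \<Omega>" "den M z \<noteq> 0"
    from INV_D[OF I0 this] show "\<forall>\<^sub>F u in at z. (K p (act M u) w)\<^sup>2 = (K p u w)\<^sup>2"
      by eventually_elim simp
  qed
  show False
  proof (rule double_pole_False[OF I p])
    have "((\<lambda>z. (K p z w * (z - p))\<^sup>2) \<longlongrightarrow> 1\<^sup>2) (at p)" by (intro tendsto_intros Kp(2))
    thus "((\<lambda>z. (K p z w)\<^sup>2 * (z - p)\<^sup>2) \<longlongrightarrow> 1) (at p)" by (simp add: power_mult_distrib)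
    fix z assume z: "z \<in> poles (\<lambda>z. (K p z w)\<^sup>2)"
    show "p \<simeq> z"
    proof (rule ccontr)
      assume n: "\<not> p \<simeq> z"
      have zO: "z \<in> \<Omega>" using z by blast
      have "(\<lambda>z. (K p z w)\<^sup>2) analytic_on {z}" by (intro analytic_intros K_z[OF p zO w(1) n w(2)])
      thus False using z analytic_at_imp_no_pole by blast
    qed
  qed
qed

lemma psi_relation_derivative:
  assumes p: "p \<in> \<Omega>" and e: "\<And>N. N \<in> GG \<Longrightarrow> deriv (psi N) p = t * psi N p"
  shows False
proof -
  obtain w where w: "w \<in> \<Omega>" "\<not> p \<simeq> w" using ex_base2[OF p p] by blast
  note Kp = quasi_K[OF p w] and dKp = quasi_dK[OF p w]
  define F where "F = (\<lambda>z. dK p z w - t * K p z w)"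
  have I: "INV F" unfolding F_def by (rule quasi_INV[OF dKp(1) Kp(1) p p e])
  show False
  proof (rule double_pole_False[OF I p])
    have "((\<lambda>z. dK p z w * (z - p)^2 - t * (K p z w * (z - p)) * (z - p)) \<longlongrightarrow> 1 - t * 1 * (p - p)) (at p)"
      by (intro tendsto_intros dKp(2) Kp(2))
    thus "((\<lambda>z. F z * (z - p)^2) \<longlongrightarrow> 1) (at p)" unfolding F_def by (simp add: left_diff_distrib power2_eq_square mult.assoc)
    show "p \<simeq> z" if "z \<in> poles F" for z using quasi_poles[OF dKp(1) Kp(1), of z t] that unfolding F_def by blast
  qed
qed

section \<open>From periods to the canonical map\<close>

lemma additive_zero:
  fixes \<alpha> :: "su \<Rightarrow> complex"
  assumes add: "\<And>N M. N \<in> GG \<Longrightarrow> M \<in> GG \<Longrightarrow> \<alpha> (pmul N M) = \<alpha> N + \<alpha> M"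
    and gen: "\<And>k. k < g \<Longrightarrow> \<alpha> (lm (k,True)) = 0" and N: "N \<in> GG"
  shows "\<alpha> N = 0"
proof -
  have one: "\<alpha> (1,0) = 0" using add[OF GG.one GG.one] by simp
  have l: "\<alpha> (lm l) = 0" if lL: "l \<in> Ls" for l
  proof -
    obtain k b where kb: "l = (k,b)" by (cases l)
    have kb: "l = (k,b)" "k < g" using lL kb by simp_all
    define M where "M = lm (k,True)"
    have M: "M \<in> GG" unfolding M_def using lmT_GG kb(2) .
    have "\<alpha> (pmul (pinv M) M) = \<alpha> (pinv M) + \<alpha> M" by (rule add[OF GG_inv[OF M] M])
    moreover have "pinv M = lm (k,False)" unfolding M_def using lm_linv[of "(k,True)"] by (simp del: lm.simps)
    ultimately have "\<alpha> (lm (k,False)) = 0" using pinv_left[OF GG_su[OF M]] one gen[OF kb(2)] unfolding M_def[symmetric] by simp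
    thus ?thesis using gen[OF kb(2)] kb(1) by (cases b) simp_all
  qed
  show ?thesis using N
  proof (induction rule: GG.induct)
    case one thus ?case by (rule \<open>\<alpha> (1,0) = 0\<close>)
  next
    case (step M l)
    show ?case unfolding add[OF lm_GG[OF step(2)] step(1)] using l[OF step(2)] step.IH by simp
  qed
qed

lemma deriv_psi_mul:
  assumes "N \<in> GG" "M \<in> GG" "p \<in> \<Omega>"
  shows "deriv (psi (pmul N M)) p = deriv (psi N) p + deriv (psi M) p"
proof -
  have fd: "psi A field_differentiable at p" if "A \<in> GG" for A
    using analytic_on_imp_differentiable_at[OF psi_analytic[OF that assms(3)]] by simp
  have "eventually (\<lambda>x. psi (pmul N M) x = psi N x + psi M x) (nhds p)"
    using eventually_nhds_in_open[OF open_Omega assms(3)] by eventually_elim (rule psi_mul[OF assms(1,2)])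
  hence "deriv (psi (pmul N M)) p = deriv (\<lambda>x. psi N x + psi M x) p" by (rule deriv_cong_ev) simp
  also have "\<dots> = deriv (psi N) p + deriv (psi M) p" by (rule deriv_add[OF fd[OF assms(1)] fd[OF assms(2)]])
  finally show ?thesis .
qed

lemma not_hyperelliptic: "\<not> hyperelliptic_quot G"
  unfolding hyperelliptic_quot_def invariant_meromorphic_iff using degree_neq_2 by blast

lemma psi_differential:
  assumes "N \<in> GG" shows "hol_differential G (psi N)"
  unfolding hol_differential_def
proof (intro conjI ballI impI)
  show "psi N holomorphic_on \<Omega>" by (rule psi_holomorphic[OF assms])
  fix \<gamma> z assume \<gamma>: "\<gamma> \<in> G" "z \<in> \<Omega>" "mden \<gamma> z \<noteq> 0"
  obtain M where M: "M \<in> GG" "mden \<gamma> z = 0 \<longleftrightarrow> den M z = 0" "mapp \<gamma> z = act M z" "mderiv \<gamma> z = 1/(den M z)^2"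
    using schottky_imp_GG_mob[OF \<gamma>(1)] by blast
  show "psi N (mapp \<gamma> z) * mderiv \<gamma> z = psi N z"
    unfolding M(3,4) using psi_act[OF assms M(1) \<gamma>(2)] M(2) \<gamma>(3) by simp
qed

text \<open>The periods along the generators lie in the span of the given basis. A linear relation
  satisfied by all \<open>\<omega> i\<close> at given points is therefore inherited by them and, by
  additivity, by all periods; each way to fail gives a relation excluded above.\<close>

lemma canonical_embedding:
  assumes \<omega>: "hol_diff_basis G g \<omega>"
  shows "canonical_map_embedding G g \<omega>"
proof -
  have "\<exists>a::nat\<Rightarrow>complex. \<forall>z\<in>\<Omega>. psi (lm (k,True)) z = (\<Sum>i<g. a i * \<omega> i z)" if "k < g" for k
    using \<omega> psi_differential[OF lmT_GG[OF that]] unfolding hol_diff_basis_def by blast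
  hence "\<forall>k. \<exists>a::nat\<Rightarrow>complex. k < g \<longrightarrow> (\<forall>z\<in>\<Omega>. psi (lm (k,True)) z = (\<Sum>i<g. a i * \<omega> i z))" by blast
  from choice[OF this] obtain a :: "nat \<Rightarrow> nat \<Rightarrow> complex"
    where a: "\<And>k z. k < g \<Longrightarrow> z \<in> \<Omega> \<Longrightarrow> psi (lm (k,True)) z = (\<Sum>i<g. a k i * \<omega> i z)" by blast
  have base: "\<exists>i<g. \<omega> i z \<noteq> 0" if z: "z \<in> \<Omega>" for z
  proof (rule ccontr)
    assume "\<not> ?thesis"
    hence "psi (lm (k,True)) z = 0" if "k < g" for k unfolding a[OF that z] by simp
    hence "psi N z = 0" if "N \<in> GG" for N
      using additive_zero[of "\<lambda>N. psi N z", OF psi_mul[OF _ _ z] _ that] by simp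
    thus False by (rule psi_all_zero[OF z])
  qed
  moreover have "G_equiv G z w" if z: "z \<in> \<Omega>" "w \<in> \<Omega>" and t: "\<And>i. i < g \<Longrightarrow> \<omega> i w = t * \<omega> i z" for z w t
  proof (rule ccontr)
    assume "\<not> G_equiv G z w"
    hence n: "\<not> w \<simeq> z" unfolding G_equiv_iff using eq_sym by blast
    have "psi N w - t * psi N z = 0" if "N \<in> GG" for N
    proof (rule additive_zero[of "\<lambda>N. psi N w - t * psi N z", OF _ _ that])
      show "psi (pmul N M) w - t * psi (pmul N M) z = psi N w - t * psi N z + (psi M w - t * psi M z)"
        if "N \<in> GG" "M \<in> GG" for N M unfolding psi_mul[OF that z(1)] psi_mul[OF that z(2)] by (simp add: algebra_simps)
      show "psi (lm (k,True)) w - t * psi (lm (k,True)) z = 0" if "k < g" for k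
        unfolding a[OF that z(1)] a[OF that z(2)] sum_distrib_left using t by (simp add: mult_ac)
    qed
    hence r: "psi N w = t * psi N z" if "N \<in> GG" for N using that by simp
    show False
    \<comment> \<open>A factor \<open>0\<close> means that all differentials vanish at
      \<open>w\<close>, which is excluded by itself.\<close>
    proof (cases "t = 0")
      case True
      thus ?thesis using psi_all_zero[OF z(2)] r by simp
    next
      case False
      show ?thesis by (rule psi_relation_distinct[OF z(2,1) n False r])
    qed
  qed
  moreover have "\<exists>j<g. \<omega> j z \<noteq> 0 \<and> (\<exists>i<g. deriv (\<lambda>w. \<omega> i w / \<omega> j w) z \<noteq> 0)" if z: "z \<in> \<Omega>" for z
  proof -
    obtain j where j: "j < g" "\<omega> j z \<noteq> 0" using base[OF z] by blast
    have "\<exists>i<g. deriv (\<lambda>w. \<omega> i w / \<omega> j w) z \<noteq> 0"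
    proof (rule ccontr)
      assume c: "\<not> ?thesis"
      have fd: "\<omega> i field_differentiable at z" if "i < g" for i
      proof -
        have "\<omega> i holomorphic_on \<Omega>" using \<omega> that unfolding hol_diff_basis_def hol_differential_def by blast
        thus ?thesis using holomorphic_on_imp_differentiable_at[OF _ open_Omega z] by blast
      qed
      \<comment> \<open>If all quotients by \<open>\<omega> j\<close> are stationary at
        \<open>z\<close>, then the derivatives of the differentials are proportional to their values
        with this common factor.\<close>
      define t where "t = deriv (\<omega> j) z / \<omega> j z"
      have d: "deriv (\<omega> i) z = t * \<omega> i z" if i: "i < g" for i
      proof -
        have "deriv (\<lambda>w. \<omega> i w / \<omega> j w) z = (deriv (\<omega> i) z * \<omega> j z - \<omega> i z * deriv (\<omega> j) z) / (\<omega> j z)\<^sup>2"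
          by (rule deriv_divide[OF fd[OF i] fd[OF j(1)] j(2)])
        moreover have "deriv (\<lambda>w. \<omega> i w / \<omega> j w) z = 0" using c i by blast
        ultimately have "deriv (\<omega> i) z * \<omega> j z = \<omega> i z * deriv (\<omega> j) z" using j(2) by simp
        thus ?thesis unfolding t_def using j(2) by (simp add: field_simps)
      qed
      have k: "deriv (psi (lm (k,True))) z = t * psi (lm (k,True)) z" if k: "k < g" for k
      proof -
        have "eventually (\<lambda>x. psi (lm (k,True)) x = (\<Sum>i<g. a k i * \<omega> i x)) (nhds z)"
          using eventually_nhds_in_open[OF open_Omega z] by eventually_elim (rule a[OF k])
        hence "deriv (psi (lm (k,True))) z = deriv (\<lambda>x. \<Sum>i<g. a k i * \<omega> i x) z" by (rule deriv_cong_ev) simp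
        also have "\<dots> = (\<Sum>i<g. a k i * deriv (\<omega> i) z)"
        proof (rule DERIV_imp_deriv, rule DERIV_sum)
          fix i assume "i \<in> {..<g}"
          hence "(\<omega> i has_field_derivative deriv (\<omega> i) z) (at z)" using fd DERIV_deriv_iff_field_differentiable by blast
          thus "((\<lambda>x. a k i * \<omega> i x) has_field_derivative a k i * deriv (\<omega> i) z) (at z)" by (rule DERIV_cmult)
        qed
        also have "\<dots> = t * psi (lm (k,True)) z" unfolding a[OF k z] sum_distrib_left using d by (simp add: mult_ac)
        finally show ?thesis .
      qed
      have "deriv (psi N) z - t * psi N z = 0" if "N \<in> GG" for N
      proof (rule additive_zero[of "\<lambda>N. deriv (psi N) z - t * psi N z", OF _ _ that])
        show "deriv (psi (pmul N M)) z - t * psi (pmul N M) z = deriv (psi N) z - t * psi N z + (deriv (psi M) z - t * psi M z)"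
          if "N \<in> GG" "M \<in> GG" for N M unfolding psi_mul[OF that z] deriv_psi_mul[OF that z] by (simp add: algebra_simps)
        show "deriv (psi (lm (k,True))) z - t * psi (lm (k,True)) z = 0" if "k < g" for k using k[OF that] by simp
      qed
      hence "deriv (psi N) z = t * psi N z" if "N \<in> GG" for N using that by simp
      thus False by (rule psi_relation_derivative[OF z])
    qed
    thus ?thesis using j by blast
  qed
  ultimately show ?thesis unfolding canonical_map_embedding_def by blast
qed

end

theorem theorem1p4:
  fixes g :: nat and \<eta> \<theta> :: real
  assumes "g \<ge> 3" and "0 < \<eta>" and "\<eta> < \<theta>" and "\<theta> < pi / real g"
  shows "\<not> hyperelliptic_quot (schottky_group g \<eta> \<theta>) \<and>
    (\<forall>\<omega>. hol_diff_basis (schottky_group g \<eta> \<theta>) g \<omega> \<longrightarrow>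
         canonical_map_embedding (schottky_group g \<eta> \<theta>) g \<omega>)"
proof -
  interpret schottky_curve g \<eta> \<theta> using assms by unfold_locales
  show ?thesis using not_hyperelliptic canonical_embedding by blast
qed

end
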